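(* Let $m\ge 3$, $n\ge1$, and let $P_m,P_{m-1},P_{m-2}$ be homogeneous operators of order $m,m-1,m-2$ on $\mathbb{R}_t\times\mathbb{R}^n_x$, with $c_{m,0}=1$, $c_{m-1,0}>0$, $c_{m-2,0}>0$. Assume that: - $P_m(\partial_t,\partial_x)$ and $P_{m-2}(\partial_t,\partial_x)$ are hyperbolic; - $P_{m-1}(\partial_t,\partial_x)$ is strictly hyperbolic; - $P_{m-1}(\lambda,\xi')$ and $P_m(\lambda,\xi')$ interlace for any $\xi'\in S^{n-1}$; - $P_{m-2}(\lambda,\xi')$ and $P_{m-1}(\lambda,\xi')$ interlace for any $\xi'\in S^{n-1}$; - there is no $(\lambda,\xi')\in\mathbb{R}\times S^{n-1}$ such that $P_m(\lambda,\xi')=P_{m-1}(\lambda,\xi')=P_{m-2}(\lambda,\xi')=0$; and that $P_m(\partial_t,\partial_x)$ is strictly hyperbolic. Let $s_0\ge m-1$ and let $u_j\in H^{s_0-j}$ with $\hat u_j=0$ in a neighborhood of the origin, for $j=0,\ldots,m-1$. Let $Q_2=P_m+P_{m-1}+P_{m-2}$. Then the solution $u$ to the Cauchy problem $$Q_2(\partial_t,\partial_x)u=0\quad(t\ge0,\ x\in\mathbb{R}^n),\qquad \partial_t^ju(0,x)=u_j(x),\quad j=0,\ldots,m-1,$$ satisfies $$\|\partial_t^ku(t,\cdot)\|_{\dot H^s}\le C(1+t)^{-\frac\nu2}\sum_{j=0}^{m-1}\|u_j\|_{H^{k+s+\nu-j}}$$ for any $\nu\ge0$ such that $k+s+\nu\le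 s_0$. If, moreover, $P_{m-1}(\lambda,\xi')$ and $P_m(\lambda,\xi')$ strictly interlace for any $\xi'\in S^{n-1}$, then this is improved to $$\|\partial_t^ku(t,\cdot)\|_{\dot H^s}\le Ce^{-ct}\sum_{j=0}^{m-1}\|u_j\|_{H^{k+s-j}}$$ for some $c>0$ and for any $k+s\le s_0$.
   Context: A homogeneous operator of order $r$ is $P_r(\partial_t,\partial_x)=\sum_{k+|\alpha|=r}c_{k,\alpha}\partial_t^k\partial_x^\alpha$ with constant coefficients and $c_{r,0}>0$; its symbol is $P_r(\lambda,\xi)=\sum_{k+|\alpha|=r}c_{k,\alpha}\lambda^k\xi^\alpha$, $\xi\in\mathbb{R}^n$ (no factors of $i$). It is hyperbolic if, for every $\xi'\in S^{n-1}=\{\xi\in\mathbb{R}^n:|\xi|=1\}$, the polynomial $\lambda\mapsto P_r(\lambda,\xi')$ has only real roots, and strictly hyperbolic if in addition these roots are distinct for every $\xi'\in S^{n-1}$. If $p_{r-1}$, $p_r$ are polynomials of degree $r-1$, $r$ with real roots $\tilde\lambda_1\le\dots\le\tilde\lambda_{r-1}$ and $\lambda_1\le\dots\le\lambda_r$ (with multiplicity), they interlace if $\lambda_1\le\tilde\lambda_1\le\lambda_2\le\tilde\lambda_2\le\dots\le\tilde\lambda_{r-1}\le\lambda_r$, and strictly interlace if all these inequalities are strict. Here $k\ge0$ is an integer and $s\ge0$ is real. $\hat f$ is the Fourier transform in $x$, $\|f\|_{H^\sigma}=\|(1+|\xi|^2)^{\sigma/2}\hat f\|_{L^2}$ (the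 same formula is used when $\sigma<0$), $\|f\|_{\dot H^s}=\||\xi|^s\hat f\|_{L^2}$. The constants $C,c>0$ may depend on a fixed neighborhood of the origin where all $\hat u_j$ vanish, but not otherwise on the initial data or on $t$. *)

theory Defs
  imports
    "HOL-Analysis.Analysis"
    "HOL-Computational_Algebra.Computational_Algebra"
begin

subsection \<open>Homogeneous operators and their symbols\<close>

text \<open>
  A homogeneous operator of order \<open>r\<close> is given by its coefficients \<open>c k \<alpha>\<close>, where multi-indices
  are functions \<open>\<alpha> :: 'n \<Rightarrow> nat\<close>; only the values with \<open>k + |\<alpha>| = r\<close> matter.
\<close>

definition mi_size :: "('n::finite \<Rightarrow> nat) \<Rightarrow> nat" where
  "mi_size \<alpha> = (\<Sum>i\<in>UNIV. \<alpha> i)"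

definition mi_power :: "real ^ 'n::finite \<Rightarrow> ('n \<Rightarrow> nat) \<Rightarrow> real" where
  "mi_power \<xi> \<alpha> = (\<Prod>i\<in>UNIV. (\<xi> $ i) ^ \<alpha> i)"

definition op_indices :: "nat \<Rightarrow> (nat \<times> ('n::finite \<Rightarrow> nat)) set" where
  "op_indices r = {(k, \<alpha>). k + mi_size \<alpha> = r}"

lemma finite_op_indices: "finite (op_indices r :: (nat \<times> ('n::finite \<Rightarrow> nat)) set)"
proof (rule finite_subset)
  show "op_indices r \<subseteq> {..r} \<times> (PiE (UNIV :: 'n set) (\<lambda>_. {..r}))"
  proof
    fix x :: "nat \<times> ('n \<Rightarrow> nat)"
    assume "x \<in> op_indices r"
    then obtain k \<alpha> where x: "x = (k, \<alpha>)" and r: "k + mi_size \<alpha> = r"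
      by (auto simp: op_indices_def)
    have "\<alpha> i \<le> mi_size \<alpha>" for i
      unfolding mi_size_def by (rule member_le_sum) auto
    then have "\<alpha> i \<le> r" for i
      using r by (metis le_add2 le_trans)
    then show "x \<in> {..r} \<times> (PiE (UNIV :: 'n set) (\<lambda>_. {..r}))"
      using x r by auto
  qed
  show "finite ({..r} \<times> (PiE (UNIV :: 'n set) (\<lambda>_. {..r})))"
    by (intro finite_cartesian_product finite_PiE) auto
qed

text \<open>The symbol as a polynomial in \<open>\<lambda>\<close>, for fixed \<open>\<xi>\<close> (no factors of the imaginary unit).\<close>

definition op_symbol :: "nat \<Rightarrow> (nat \<Rightarrow> ('n::finite \<Rightarrow> nat) \<Rightarrow> real) \<Rightarrow> real ^ 'n \<Rightarrow> real poly" where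
  "op_symbol r c \<xi> = (\<Sum>(k, \<alpha>)\<in>op_indices r. monom (c k \<alpha> * mi_power \<xi> \<alpha>) k)"

definition real_rooted :: "real poly \<Rightarrow> bool" where
  "real_rooted p \<longleftrightarrow> p \<noteq> 0 \<and> (\<forall>z. poly (map_poly complex_of_real p) z = 0 \<longrightarrow> z \<in> \<real>)"

definition root_list :: "real poly \<Rightarrow> real list" where
  "root_list p = sorted_list_of_multiset (proots p)"

definition hyperbolic :: "nat \<Rightarrow> (nat \<Rightarrow> ('n::finite \<Rightarrow> nat) \<Rightarrow> real) \<Rightarrow> bool" where
  "hyperbolic r c \<longleftrightarrow> (\<forall>\<xi>. norm \<xi> = 1 \<longrightarrow> real_rooted (op_symbol r c \<xi>))"

definition strictly_hyperbolic :: "nat \<Rightarrow> (nat \<Rightarrow> ('n::finite \<Rightarrow> nat) \<Rightarrow> real) \<Rightarrow> bool" where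
  "strictly_hyperbolic r c \<longleftrightarrow>
     hyperbolic r c \<and> (\<forall>\<xi>. norm \<xi> = 1 \<longrightarrow> distinct (root_list (op_symbol r c \<xi>)))"

definition interlace :: "real poly \<Rightarrow> real poly \<Rightarrow> bool" where
  "interlace p q \<longleftrightarrow> real_rooted p \<and> real_rooted q \<and> degree q = Suc (degree p) \<and>
     (\<forall>i<degree p. root_list q ! i \<le> root_list p ! i \<and> root_list p ! i \<le> root_list q ! Suc i)"

definition strictly_interlace :: "real poly \<Rightarrow> real poly \<Rightarrow> bool" where
  "strictly_interlace p q \<longleftrightarrow> real_rooted p \<and> real_rooted q \<and> degree q = Suc (degree p) \<and>
     (\<forall>i<degree p. root_list q ! i < root_list p ! i \<and> root_list p ! i < root_list q ! Suc i)"


subsection \<open>Fourier transform and Sobolev norms\<close>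

definition is_L2 :: "(real ^ 'n::finite \<Rightarrow> complex) \<Rightarrow> bool" where
  "is_L2 f \<longleftrightarrow> f \<in> borel_measurable lborel \<and> integrable lborel (\<lambda>x. (cmod (f x))\<^sup>2)"

definition L2_norm :: "(real ^ 'n::finite \<Rightarrow> complex) \<Rightarrow> real" where
  "L2_norm f = sqrt (LINT x|lborel. (cmod (f x))\<^sup>2)"

definition fourier_integral :: "(real ^ 'n::finite \<Rightarrow> complex) \<Rightarrow> real ^ 'n \<Rightarrow> complex" where
  "fourier_integral f \<xi> = (LINT x|lborel. exp (- \<i> * complex_of_real (x \<bullet> \<xi>)) * f x)"

text \<open>
  The Fourier transform on \<open>L\<^sup>2\<close> is the \<open>L\<^sup>2\<close>-limit of the Fourier integrals of the truncations
  to balls (Plancherel); it is determined up to null sets. The squared \<open>L\<^sup>2\<close>-distance is a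
  nonnegative integral, so that convergence to 0 entails that it is eventually finite.
\<close>

definition has_fourier :: "(real ^ 'n::finite \<Rightarrow> complex) \<Rightarrow> (real ^ 'n \<Rightarrow> complex) \<Rightarrow> bool" where
  "has_fourier f g \<longleftrightarrow> is_L2 f \<and> is_L2 g \<and>
     ((\<lambda>R. \<integral>\<^sup>+ \<xi>. ennreal ((cmod
          (fourier_integral (\<lambda>x. indicator (cball 0 R) x * f x) \<xi> - g \<xi>))\<^sup>2) \<partial>lborel)
      \<longlongrightarrow> 0) at_top"

definition fourier :: "(real ^ 'n::finite \<Rightarrow> complex) \<Rightarrow> real ^ 'n \<Rightarrow> complex" where
  "fourier f = (SOME g. has_fourier f g)"

text \<open>
  The spaces below consist of \<open>L\<^sup>2\<close>-functions. For \<open>\<sigma> \<ge> 0\<close>, \<open>sobolev_space \<sigma>\<close> is the usual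
  \<open>H\<^sup>\<sigma>\<close>. The norms are defined by the same formula for every real \<open>\<sigma>\<close>.
\<close>

definition sobolev_weighted :: "real \<Rightarrow> (real ^ 'n::finite \<Rightarrow> complex) \<Rightarrow> real ^ 'n \<Rightarrow> complex" where
  "sobolev_weighted \<sigma> f \<xi> = complex_of_real ((1 + (norm \<xi>)\<^sup>2) powr (\<sigma> / 2)) * fourier f \<xi>"

definition sobolev_space :: "real \<Rightarrow> (real ^ 'n::finite \<Rightarrow> complex) set" where
  "sobolev_space \<sigma> = {f. has_fourier f (fourier f) \<and> is_L2 (sobolev_weighted \<sigma> f)}"

definition sobolev_norm :: "real \<Rightarrow> (real ^ 'n::finite \<Rightarrow> complex) \<Rightarrow> real" where
  "sobolev_norm \<sigma> f = L2_norm (sobolev_weighted \<sigma> f)"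

definition hom_sobolev_weighted :: "real \<Rightarrow> (real ^ 'n::finite \<Rightarrow> complex) \<Rightarrow> real ^ 'n \<Rightarrow> complex" where
  "hom_sobolev_weighted s f \<xi> = complex_of_real (norm \<xi> powr s) * fourier f \<xi>"

definition hom_sobolev_space :: "real \<Rightarrow> (real ^ 'n::finite \<Rightarrow> complex) set" where
  "hom_sobolev_space s = {f. has_fourier f (fourier f) \<and> is_L2 (hom_sobolev_weighted s f)}"

definition hom_sobolev_norm :: "real \<Rightarrow> (real ^ 'n::finite \<Rightarrow> complex) \<Rightarrow> real" where
  "hom_sobolev_norm s f = L2_norm (hom_sobolev_weighted s f)"


subsection \<open>Test functions\<close>

definition partial_deriv :: "'n::finite \<Rightarrow> (real ^ 'n \<Rightarrow> complex) \<Rightarrow> real ^ 'n \<Rightarrow> complex" where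
  "partial_deriv i f x = frechet_derivative f (at x) (axis i 1)"

definition schwartz :: "(real ^ 'n::finite \<Rightarrow> complex) \<Rightarrow> bool" where
  "schwartz \<phi> \<longleftrightarrow> (\<forall>is :: 'n list.
     (\<forall>x. foldr partial_deriv is \<phi> differentiable (at x)) \<and>
     (\<forall>N :: nat. bounded (range (\<lambda>x. (1 + norm x) ^ N *\<^sub>R foldr partial_deriv is \<phi> x))))"

text \<open>
  The partial derivative \<open>\<partial>\<^sup>\<alpha> f\<close> applies each \<open>\<partial>\<^sub>i\<close> exactly \<open>\<alpha> i\<close> times. The order of
  application is unspecified; it is irrelevant for smooth functions, the only use made of it.
\<close>

definition mi_deriv :: "('n::finite \<Rightarrow> nat) \<Rightarrow> (real ^ 'n \<Rightarrow> complex) \<Rightarrow> real ^ 'n \<Rightarrow> complex" where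
  "mi_deriv \<alpha> f = foldr partial_deriv (SOME is. \<forall>i. count_list is i = \<alpha> i) f"

definition pairing :: "(real ^ 'n::finite \<Rightarrow> complex) \<Rightarrow> (real ^ 'n \<Rightarrow> complex) \<Rightarrow> complex" where
  "pairing f \<phi> = (LINT x|lborel. f x * \<phi> x)"


subsection \<open>The Cauchy problem\<close>

text \<open>Time derivative on \<open>[0,\<infinity>)\<close>, one-sided at 0.\<close>

definition time_deriv :: "(real \<Rightarrow> complex) \<Rightarrow> real \<Rightarrow> complex" where
  "time_deriv g t = vector_derivative g (at t within {0..})"

text \<open>
  The value at \<open>\<phi>\<close> of the tempered distribution \<open>P(\<partial>\<^sub>t, \<partial>\<^sub>x) u(t, \<cdot>)\<close>: derivatives in \<open>x\<close> are
  transferred to the test function, time derivatives are taken of the resulting scalar function.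
\<close>

definition op_weak ::
  "nat \<Rightarrow> (nat \<Rightarrow> ('n::finite \<Rightarrow> nat) \<Rightarrow> real) \<Rightarrow> (real \<Rightarrow> real ^ 'n \<Rightarrow> complex) \<Rightarrow>
   (real ^ 'n \<Rightarrow> complex) \<Rightarrow> real \<Rightarrow> complex" where
  "op_weak r c u \<phi> t = (\<Sum>(k, \<alpha>)\<in>op_indices r.
     complex_of_real (c k \<alpha>) * (-1) ^ mi_size \<alpha> *
     (time_deriv ^^ k) (\<lambda>\<tau>. pairing (u \<tau>) (mi_deriv \<alpha> \<phi>)) t)"

text \<open>
  \<open>u\<close>, as a function of time with values in the tempered distributions, is \<open>m\<close> times
  differentiable on \<open>[0,\<infinity>)\<close> and satisfies \<open>(P\<^sub>m + P\<^sub>m\<^sub>-\<^sub>1 + P\<^sub>m\<^sub>-\<^sub>2) u = 0\<close> there.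
\<close>

definition solves_Q2 ::
  "nat \<Rightarrow> (nat \<Rightarrow> ('n::finite \<Rightarrow> nat) \<Rightarrow> real) \<Rightarrow> (nat \<Rightarrow> ('n \<Rightarrow> nat) \<Rightarrow> real) \<Rightarrow>
   (nat \<Rightarrow> ('n \<Rightarrow> nat) \<Rightarrow> real) \<Rightarrow> (real \<Rightarrow> real ^ 'n \<Rightarrow> complex) \<Rightarrow> bool" where
  "solves_Q2 m c c' c'' u \<longleftrightarrow> (\<forall>\<phi>. schwartz \<phi> \<longrightarrow>
     (\<forall>k<m. \<forall>t\<ge>0. (time_deriv ^^ k) (\<lambda>\<tau>. pairing (u \<tau>) \<phi>) differentiable (at t within {0..})) \<and>
     (\<forall>t\<ge>0. op_weak m c u \<phi> t + op_weak (m - 1) c' u \<phi> t + op_weak (m - 2) c'' u \<phi> t = 0))"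

text \<open>
  \<open>u\<close> belongs to \<open>C\<^sup>j([0,\<infinity>); H\<^sup>s\<^sup>0\<^sup>-\<^sup>j)\<close> for all integers \<open>0 \<le> j \<le> s0\<close>, and \<open>U j t\<close> is the
  time derivative \<open>\<partial>\<^sub>t\<^sup>j u(t, \<cdot>)\<close>. The values of \<open>U j\<close> for \<open>j > s0\<close> are irrelevant.
\<close>

definition sobolev_time_derivs ::
  "real \<Rightarrow> (real \<Rightarrow> real ^ 'n::finite \<Rightarrow> complex) \<Rightarrow> (nat \<Rightarrow> real \<Rightarrow> real ^ 'n \<Rightarrow> complex) \<Rightarrow> bool" where
  "sobolev_time_derivs s0 u U \<longleftrightarrow>
     U 0 = u \<and>
     (\<forall>j. real j \<le> s0 \<longrightarrow> (\<forall>t\<ge>0.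
        U j t \<in> sobolev_space (s0 - real j) \<and>
        ((\<lambda>\<tau>. sobolev_norm (s0 - real j) (\<lambda>x. U j \<tau> x - U j t x)) \<longlongrightarrow> 0) (at t within {0..}))) \<and>
     (\<forall>j. real (Suc j) \<le> s0 \<longrightarrow> (\<forall>t\<ge>0.
        ((\<lambda>\<tau>. sobolev_norm (s0 - real (Suc j))
            (\<lambda>x. (U j \<tau> x - U j t x) / complex_of_real (\<tau> - t) - U (Suc j) t x)) \<longlongrightarrow> 0)
          (at t within {0..})))"

definition cauchy_solution ::
  "nat \<Rightarrow> (nat \<Rightarrow> ('n::finite \<Rightarrow> nat) \<Rightarrow> real) \<Rightarrow> (nat \<Rightarrow> ('n \<Rightarrow> nat) \<Rightarrow> real) \<Rightarrow>
   (nat \<Rightarrow> ('n \<Rightarrow> nat) \<Rightarrow> real) \<Rightarrow> real \<Rightarrow> (nat \<Rightarrow> real ^ 'n \<Rightarrow> complex) \<Rightarrow>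
   (real \<Rightarrow> real ^ 'n \<Rightarrow> complex) \<Rightarrow> (nat \<Rightarrow> real \<Rightarrow> real ^ 'n \<Rightarrow> complex) \<Rightarrow> bool" where
  "cauchy_solution m c c' c'' s0 u0 u U \<longleftrightarrow>
     sobolev_time_derivs s0 u U \<and>
     solves_Q2 m c c' c'' u \<and>
     (\<forall>j<m. AE x in lborel. U j 0 x = u0 j x)"

definition admissible_data ::
  "nat \<Rightarrow> real \<Rightarrow> (real ^ 'n::finite) set \<Rightarrow> (nat \<Rightarrow> real ^ 'n \<Rightarrow> complex) \<Rightarrow> bool" where
  "admissible_data m s0 N u0 \<longleftrightarrow> (\<forall>j<m. u0 j \<in> sobolev_space (s0 - real j) \<and>
     (AE \<xi> in lborel. \<xi> \<in> N \<longrightarrow> fourier (u0 j) \<xi> = 0))"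

end

theory Submission
  imports Defs
begin

text \<open>
  On the Fourier side the equation becomes, for every frequency \<open>\<xi> = r \<xi>'\<close> with
  \<open>r = |\<xi>|\<close>, an ordinary differential equation in time. With \<open>\<epsilon> = 1 /
  r\<close> and \<open>\<lambda> = \<i> r z\<close> its characteristic polynomial is \<open>(\<i>
  r)\<^sup>m\<close> times \<open>q(z) = p(z) - \<i> \<epsilon> p1(z) - \<epsilon>\<^sup>2
  p2(z)\<close>, where \<open>p\<close>, \<open>p1\<close>, \<open>p2\<close> are the symbols of
  \<open>P\<^sub>m\<close>, \<open>P\<^sub>m\<^sub>-\<^sub>1\<close>,
  \<open>P\<^sub>m\<^sub>-\<^sub>2\<close> in the direction \<open>\<xi>'\<close>. A characteristic root
  satisfies \<open>Re \<lambda> = - r Im z\<close>, so that decay is a lower bound for \<open>Im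
  z\<close> over the roots of \<open>q\<close>, uniform over the unit sphere and over bounded
  \<open>\<epsilon>\<close>; small frequencies do not occur in the data.

  Because \<open>p1\<close> interlaces \<open>p\<close>, the rational function \<open>p / p1\<close> has
  a partial fraction expansion whose residues are all nonpositive and whose linear part is increasing;
  \<open>p2 / p1\<close> has nonnegative residues. Off the real axis the expansion shows that the roots
  of \<open>q\<close> lie in the open upper half-plane (the argument of Hermite and Biehler). On the
  real axis it shows that the Bezoutians \<open>W1 = p' p1 - p p1'\<close> and \<open>W2 = p1' p2 - p1
  p2'\<close> are nonnegative. They have no common zero since the three symbols have none, whence
  \<open>W1 + \<epsilon>\<^sup>2 W2 \<ge> c \<epsilon>\<^sup>2\<close> by compactness. At a root
  \<open>z = x + \<i> y\<close> both \<open>p1(x)\<close> and \<open>p(x) - \<epsilon>\<^sup>2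
  p2(x)\<close> are of size \<open>y / \<epsilon>\<close>, and \<open>W1 + \<epsilon>\<^sup>2 W2\<close>
  is a combination of the two with bounded coefficients. This gives \<open>y \<ge> c
  \<epsilon>\<^sup>3\<close> (\<open>spectral_gap\<close>), that is, decay like \<open>exp (- c t /
  |\<xi>|\<^sup>2)\<close>, which costs \<open>\<nu>\<close> derivatives for the rate \<open>(1 + t)
  powr (- \<nu> / 2)\<close>. When the interlacing is strict, \<open>W1 \<ge> c\<close> already, so that
  \<open>y \<ge> c \<epsilon>\<close> (\<open>strict_spectral_gap\<close>) and the decay is \<open>exp
  (- c t)\<close>.

  A bound for the roots becomes a bound for solutions with uniform constants by two different arguments
  (\<open>decay_from_gap\<close>). For small \<open>\<epsilon>\<close> the roots of \<open>q\<close> are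
  close to the simple roots of \<open>p\<close>, hence separated, and Lagrange interpolation splits a
  solution into exponentials. For \<open>\<epsilon>\<close> bounded below, where roots may collide, the
  equation is solved as a chain of first-order equations.

  It remains to see that the Fourier transform of a solution solves the ordinary differential equation
  for almost every frequency (\<open>u_hat_eq_cauchy_solution\<close>), although the equation is assumed
  only in the sense of distributions and the time derivative of order \<open>m\<close> need not be a
  function. The equation is tested with the Fourier transforms of products of explicit bump functions;
  by \<open>multiplication_formula\<close> this is a statement about integrals of the transformed
  solution against the products themselves. The equation expresses all time derivatives of such an
  integral through the first \<open>m\<close>, and they grow at most geometrically since the symbols are
  bounded on the support. Thus the integral is the sum of its Taylor series, which is the series of the
  fundamental solution integrated against the initial data (\<open>pair_cauchy_solution\<close>). The
  products approximate the indicators of all boxes, so the integrals determine the function.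
\<close>

section \<open>Roots of real-rooted polynomials\<close>

definition cpoly :: "real poly \<Rightarrow> complex \<Rightarrow> complex" where
  "cpoly p z = poly (map_poly complex_of_real p) z"

lemma cpoly_pCons [simp]: "cpoly (pCons a p) z = of_real a + z * cpoly p z"
  by (cases "a = 0 \<and> p = 0") (auto simp: cpoly_def map_poly_pCons)

lemma cpoly_0 [simp]: "cpoly 0 z = 0"
  by (simp add: cpoly_def)

lemma cpoly_add [simp]: "cpoly (p + q) z = cpoly p z + cpoly q z"
  by (induction p q rule: poly_induct2) (simp_all add: algebra_simps)

lemma cpoly_smult [simp]: "cpoly (smult c p) z = of_real c * cpoly p z"
  by (induction p) (simp_all add: algebra_simps)

lemma cpoly_uminus [simp]: "cpoly (- p) z = - cpoly p z"
  by (induction p) (simp_all add: algebra_simps)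

lemma cpoly_diff [simp]: "cpoly (p - q) z = cpoly p z - cpoly q z"
  using cpoly_add [of p "- q" z] by simp

lemma cpoly_sum [simp]: "cpoly (sum f A) z = (\<Sum>x\<in>A. cpoly (f x) z)"
  by (induction A rule: infinite_finite_induct) simp_all

lemma cpoly_of_real [simp]: "cpoly p (of_real x) = of_real (poly p x)"
  by (induction p) simp_all

lemma real_rooted_factorization:
  assumes "real_rooted p"
  shows "smult (lead_coeff p) (\<Prod>x\<in>#proots p. [:-x, 1:]) = p"
  using assms
proof (induction "degree p" arbitrary: p)
  case 0
  then obtain c where "p = [:c:]" using degree_0_id by metis
  then show ?case by simp
next
  case (Suc n)
  let ?P = "map_poly complex_of_real p"
  have "degree ?P = Suc n" using Suc.hyps(2) by (subst degree_map_poly) auto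
  then have "\<not> constant (poly ?P)" by (simp add: constant_degree)
  then obtain z where z: "poly ?P z = 0" using fundamental_theorem_of_algebra by blast
  then have "z \<in> \<real>" using Suc.prems by (auto simp: real_rooted_def)
  then obtain x where x: "z = of_real x" by (auto elim: Reals_cases)
  have "poly p x = 0" using z x cpoly_of_real [of p x] by (simp add: cpoly_def)
  \<comment> \<open>One linear factor is split off; its root is real, and the cofactor is again real-rooted.\<close>
  then obtain q where q: "p = [:-x, 1:] * q" by (auto simp: poly_eq_0_iff_dvd elim: dvdE)
  have "p \<noteq> 0" using Suc.prems by (simp add: real_rooted_def)
  then have q0: "q \<noteq> 0" using q by auto
  have Pq: "map_poly complex_of_real p = [:-of_real x, 1:] * map_poly complex_of_real q"
    unfolding q by (rule poly_eqI) (simp add: coeff_map_poly coeff_pCons split: nat.splits)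
  have "real_rooted q"
    using Suc.prems q0 unfolding real_rooted_def Pq poly_mult by auto
  moreover have "degree p = Suc (degree q)" unfolding q by (subst degree_mult_eq) (use q0 in auto)
  ultimately have IH: "smult (lead_coeff q) (\<Prod>x\<in>#proots q. [:-x, 1:]) = q"
    using Suc.hyps by simp
  have "lead_coeff p = lead_coeff q" unfolding q by (simp only: lead_coeff_mult) simp
  moreover have "proots p = {#x#} + proots q"
    unfolding q by (subst proots_mult) (use q0 in auto)
  ultimately have "smult (lead_coeff p) (\<Prod>x\<in>#proots p. [:-x, 1:])
      = [:-x, 1:] * smult (lead_coeff q) (\<Prod>x\<in>#proots q. [:-x, 1:])"
    by (simp del: mult_pCons_left)
  then show ?case using IH q by simp
qed

lemma root_list_facts:
  assumes "real_rooted p"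
  shows "sorted (root_list p)" "mset (root_list p) = proots p"
    "length (root_list p) = degree p" "set (root_list p) = {x. poly p x = 0}"
    "poly p x = lead_coeff p * (\<Prod>i<degree p. x - root_list p ! i)"
proof -
  have p0: "p \<noteq> 0" using assms by (simp add: real_rooted_def)
  show s: "sorted (root_list p)" and ms: "mset (root_list p) = proots p"
    by (simp_all add: root_list_def)
  show "set (root_list p) = {x. poly p x = 0}"
    using ms p0 by (metis set_count_proots set_mset_mset)
  have pl: "p = smult (lead_coeff p) (prod_list (map (\<lambda>x. [:-x, 1:]) (root_list p)))"
  proof -
    have "(\<Prod>x\<in>#proots p. [:-x, 1:]) = prod_list (map (\<lambda>x. [:-x, 1:]) (root_list p))"
      by (metis ms mset_map prod_mset_prod_list)
    then show ?thesis using real_rooted_factorization [OF assms] by simp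
  qed
  have "degree (prod_list (map (\<lambda>x. [:-x, 1:]) xs)) = length xs" for xs :: "real list"
    by (induction xs)
      (simp_all add: degree_mult_eq prod_list_zero_iff image_iff del: mult_pCons_left)
  then show len: "length (root_list p) = degree p"
    using pl p0 by (metis degree_smult_eq leading_coeff_0_iff)
  have "poly (prod_list (map (\<lambda>x. [:-x, 1:]) xs)) x = (\<Prod>i<length xs. x - xs ! i)"
    for xs :: "real list"
    by (induction xs)
      (simp_all add: prod.lessThan_Suc_shift algebra_simps del: prod.lessThan_Suc)
  then show "poly p x = lead_coeff p * (\<Prod>i<degree p. x - root_list p ! i)"
    using pl len by (metis poly_smult)
qed

lemma root_list_index:
  assumes "real_rooted p" "poly p x = 0"
  obtains i where "i < degree p" "x = root_list p ! i"
proof -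
  have "x \<in> set (root_list p)" using assms root_list_facts(4) by simp
  then show thesis using that root_list_facts(3) [OF assms(1)] by (auto simp: in_set_conv_nth)
qed

lemma sign_prod:
  fixes f :: "nat \<Rightarrow> real"
  assumes "i \<le> n" "\<And>k. k < i \<Longrightarrow> 0 \<le> f k" "\<And>k. i \<le> k \<Longrightarrow> k < n \<Longrightarrow> f k \<le> 0"
  shows "0 \<le> (-1) ^ (n - i) * (\<Prod>k<n. f k)"
proof -
  have "{..<n} = {..<i} \<union> {i..<n}" using assms(1) by auto
  then have "(\<Prod>k<n. f k) = (\<Prod>k<i. f k) * (\<Prod>k\<in>{i..<n}. f k)"
    by (metis finite_lessThan finite_atLeastLessThan ivl_disj_int_one(2) lessThan_atLeast0
        prod.union_disjoint)
  also have "(\<Prod>k\<in>{i..<n}. f k) = (\<Prod>k\<in>{i..<n}. (-1) * (- f k))" by simp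
  also have "\<dots> = (-1) ^ (n - i) * (\<Prod>k\<in>{i..<n}. - f k)"
    by (subst prod.distrib) simp
  finally have "(-1) ^ (n - i) * (\<Prod>k<n. f k)
      = ((-1) ^ (n - i) * (-1) ^ (n - i)) * ((\<Prod>k<i. f k) * (\<Prod>k\<in>{i..<n}. - f k))"
    by (simp add: ac_simps)
  also have "(-1) ^ (n - i) * (-1) ^ (n - i) = (1::real)"
    by (simp add: power_mult_distrib [symmetric])
  finally show ?thesis
    using assms by (auto intro!: mult_nonneg_nonneg prod_nonneg)
qed

lemma synthetic_factor:
  fixes p :: "'a::field poly"
  assumes "poly p x = 0"
  shows "p = [:-x, 1:] * (p div [:-x, 1:])"
  using assms by (simp add: poly_eq_0_iff_dvd del: mult_pCons_left)

lemma poly_pderiv_root: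
  fixes p :: "'a::field poly"
  assumes "poly p x = 0"
  shows "poly (pderiv p) x = poly (p div [:-x, 1:]) x"
proof -
  have "pderiv p = pderiv ([:-x, 1:] * (p div [:-x, 1:]))"
    using synthetic_factor [OF assms] by simp
  then show ?thesis by (simp only: pderiv_mult) (simp add: pderiv_pCons)
qed

lemma poly_quotient_other_root:
  fixes p :: "'a::field poly"
  assumes "poly p x = 0" "poly p y = 0" "x \<noteq> y"
  shows "poly (p div [:-x, 1:]) y = 0"
  using arg_cong [OF synthetic_factor [OF assms(1)], of "\<lambda>q. poly q y"] assms by simp

lemma simple_root_quotient:
  fixes p :: "'a::field poly"
  assumes "card {x. poly p x = 0} = degree p" "0 < degree p" "poly p x = 0"
  shows "poly (p div [:-x, 1:]) x \<noteq> 0" "degree (p div [:-x, 1:]) = degree p - 1"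
proof -
  let ?l = "p div [:-x, 1:]"
  have p0: "p \<noteq> 0" using assms by auto
  have fac: "p = [:-x, 1:] * ?l" by (rule synthetic_factor [OF assms(3)])
  have l0: "?l \<noteq> 0" using fac p0 by fastforce
  have "degree p = degree ([:-x, 1:] * ?l)" using fac by simp
  also have "\<dots> = Suc (degree ?l)" using l0 by (simp add: degree_mult_eq del: mult_pCons_left)
  finally show deg: "degree ?l = degree p - 1" by simp
  show "poly ?l x \<noteq> 0"
  proof
    assume l: "poly ?l x = 0"
    have "{y. poly p y = 0} \<subseteq> {y. poly ?l y = 0}"
    proof clarify
      fix y assume "poly p y = 0"
      then have "poly ([:-x, 1:] * ?l) y = 0" using fac by simp
      then show "poly ?l y = 0" using l by auto
    qed
    then have "card {y. poly p y = 0} \<le> card {y. poly ?l y = 0}"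
      by (intro card_mono poly_roots_finite l0)
    also have "\<dots> \<le> degree ?l" by (rule card_poly_roots_bound [OF l0])
    finally show False using assms deg by simp
  qed
qed

text \<open>
  Both sides agree at the roots of \<open>p\<close>, and there are more of these than the degree of the
  difference allows.
\<close>

lemma lagrange_interpolation:
  fixes p f :: "'a::field poly"
  assumes "card {x. poly p x = 0} = degree p" "degree f < degree p"
  shows "f = (\<Sum>x | poly p x = 0. smult (poly f x / poly (p div [:-x, 1:]) x) (p div [:-x, 1:]))"
    (is "f = ?g")
proof (rule ccontr)
  assume ne: "f \<noteq> ?g"
  have p0: "p \<noteq> 0" and dp: "0 < degree p" using assms by auto
  have fin: "finite {x. poly p x = 0}" by (rule poly_roots_finite [OF p0])
  have "degree ?g \<le> degree p - 1"
    by (intro degree_sum_le fin)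
      (use simple_root_quotient [OF assms(1) dp] in \<open>auto intro: order_trans [OF degree_smult_le]\<close>)
  then have d: "degree (f - ?g) < degree p"
    using assms(2) dp by (intro degree_diff_less) auto
  have "poly ?g y = poly f y" if y: "poly p y = 0" for y
  proof -
    have "poly ?g y = (\<Sum>x | poly p x = 0. if x = y then poly f y else 0)"
      unfolding poly_sum
    proof (rule sum.cong [OF refl])
      fix x assume "x \<in> {x. poly p x = 0}"
      then show "poly (smult (poly f x / poly (p div [:-x, 1:]) x) (p div [:-x, 1:])) y
        = (if x = y then poly f y else 0)"
        using simple_root_quotient(1) [OF assms(1) dp] poly_quotient_other_root y by auto
    qed
    then show ?thesis using y fin by (simp add: sum.delta)
  qed
  then have "{x. poly p x = 0} \<subseteq> {x. poly (f - ?g) x = 0}" by auto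
  moreover have "finite {x. poly (f - ?g) x = 0}" using ne by (intro poly_roots_finite) auto
  ultimately have "degree p \<le> card {x. poly (f - ?g) x = 0}"
    unfolding assms(1) [symmetric] by (intro card_mono)
  also have "\<dots> \<le> degree (f - ?g)" using ne by (intro card_poly_roots_bound) auto
  finally show False using d by simp
qed

lemma simple_roots_card:
  assumes "real_rooted p" "distinct (root_list p)"
  shows "card {x. poly p x = 0} = degree p"
  using root_list_facts [OF assms(1)] assms(2) by (metis distinct_card)

text \<open>
  In the product rule only the summand survives in which the factor vanishing at the root is
  differentiated. The smaller and the larger roots are kept apart because they contribute different
  signs.
\<close>

lemma poly_pderiv_root_list:
  assumes "real_rooted p" "i < degree p"
  shows "poly (pderiv p) (root_list p ! i)
    = lead_coeff p * ((\<Prod>k<i. root_list p ! i - root_list p ! k) *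
        (\<Prod>k\<in>{Suc i..<degree p}. root_list p ! i - root_list p ! k))"
proof -
  let ?r = "\<lambda>k. root_list p ! k"
  let ?l = "smult (lead_coeff p) (\<Prod>k\<in>{..<degree p} - {i}. [:- ?r k, 1:])"
  have fac: "p = [:- ?r i, 1:] * ?l"
  proof (rule poly_eq_poly_eq_iff [THEN iffD1], rule ext)
    fix x
    show "poly p x = poly ([:- ?r i, 1:] * ?l) x"
      using root_list_facts(5) [OF assms(1), of x] assms(2)
      by (subst (asm) prod.remove [of _ i]) (simp_all add: poly_prod algebra_simps)
  qed
  have "pderiv p = pderiv ([:- ?r i, 1:] * ?l)" using fac by simp
  then have "poly (pderiv p) (?r i) = poly ?l (?r i)"
    by (simp only: pderiv_mult) (simp add: pderiv_pCons)
  also have "\<dots> = lead_coeff p * (\<Prod>k\<in>{..<degree p} - {i}. ?r i - ?r k)"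
    by (simp add: poly_prod)
  also have "{..<degree p} - {i} = {..<i} \<union> {Suc i..<degree p}" using assms(2) by auto
  also have "(\<Prod>k\<in>{..<i} \<union> {Suc i..<degree p}. ?r i - ?r k)
    = (\<Prod>k<i. ?r i - ?r k) * (\<Prod>k\<in>{Suc i..<degree p}. ?r i - ?r k)"
    by (intro prod.union_disjoint) auto
  finally show ?thesis .
qed

lemma sign_pderiv_root_list:
  assumes "real_rooted p" "i < degree p" "0 < lead_coeff p"
  shows "0 \<le> (-1) ^ (degree p - Suc i) * poly (pderiv p) (root_list p ! i)"
proof -
  let ?r = "\<lambda>k. root_list p ! k"
  have mono: "?r k \<le> ?r l" if "k \<le> l" "l < degree p" for k l
    using root_list_facts(1,3) [OF assms(1)] that by (auto simp: sorted_iff_nth_mono)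
  have "(\<Prod>k\<in>{Suc i..<degree p}. ?r i - ?r k)
      = (-1) ^ (degree p - Suc i) * (\<Prod>k\<in>{Suc i..<degree p}. ?r k - ?r i)"
  proof -
    have "(\<Prod>k\<in>{Suc i..<degree p}. ?r i - ?r k) = (\<Prod>k\<in>{Suc i..<degree p}. (-1) * (?r k - ?r i))"
      by simp
    then show ?thesis by (simp only: prod.distrib) simp
  qed
  then have "(-1) ^ (degree p - Suc i) * poly (pderiv p) (?r i)
    = ((-1) ^ (degree p - Suc i) * (-1) ^ (degree p - Suc i)) *
      (lead_coeff p * ((\<Prod>k<i. ?r i - ?r k) * (\<Prod>k\<in>{Suc i..<degree p}. ?r k - ?r i)))"
    unfolding poly_pderiv_root_list [OF assms(1,2)] by (simp add: ac_simps)
  also have "(-1) ^ (degree p - Suc i) * (-1) ^ (degree p - Suc i) = (1::real)"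
    by (simp add: power_mult_distrib [symmetric])
  finally show ?thesis
    using assms(2,3) mono by (auto intro!: mult_nonneg_nonneg prod_nonneg)
qed

text \<open>
  Let \<open>x\<close> be root number \<open>i\<close> of \<open>p\<close>, counted from 0. To the right
  of \<open>x\<close> the polynomial \<open>q\<close> has \<open>degree p - i\<close> factors and the
  derivative of \<open>p\<close> has one less. These are the negative factors at \<open>x\<close>, so
  the signs are opposite.
\<close>

lemma interlace_sign_above:
  assumes "interlace p q" "0 < lead_coeff p" "0 < lead_coeff q" "poly p x = 0"
  shows "poly q x * poly (pderiv p) x \<le> 0"
proof -
  have rp: "real_rooted p" and rq: "real_rooted q" and dq: "degree q = Suc (degree p)"
    and il: "\<And>i. i < degree p \<Longrightarrow> root_list q ! i \<le> root_list p ! i"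
      "\<And>i. i < degree p \<Longrightarrow> root_list p ! i \<le> root_list q ! Suc i"
    using assms(1) by (auto simp: interlace_def)
  obtain i where i: "i < degree p" "x = root_list p ! i"
    using root_list_index [OF rp assms(4)] .
  have monq: "root_list q ! k \<le> root_list q ! l" if "k \<le> l" "l < degree q" for k l
    using root_list_facts(1,3) [OF rq] that by (auto simp: sorted_iff_nth_mono)
  have "0 \<le> (-1) ^ (degree q - Suc i) * (\<Prod>k<degree q. x - root_list q ! k)"
  proof (rule sign_prod)
    show "Suc i \<le> degree q" using i dq by simp
    show "0 \<le> x - root_list q ! k" if "k < Suc i" for k
      using monq [of k i] il(1) [of i] i that dq by simp
    show "x - root_list q ! k \<le> 0" if "Suc i \<le> k" "k < degree q" for k
      using monq [of "Suc i" k] il(2) [of i] i that dq by simp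
  qed
  then have A: "0 \<le> (-1) ^ (degree p - i) * poly q x"
    using mult_nonneg_nonneg [OF less_imp_le [OF assms(3)]] dq
    by (subst root_list_facts(5) [OF rq]) (simp only: mult.left_commute diff_Suc_Suc)
  have B: "0 \<le> (-1) ^ (degree p - Suc i) * poly (pderiv p) x"
    using sign_pderiv_root_list [OF rp i(1) assms(2)] i by simp
  have "(-1::real) ^ (degree p - i) = - ((-1) ^ (degree p - Suc i))"
    using i(1) by (metis Suc_diff_Suc mult_minus1 power_Suc)
  moreover have "(-1::real) ^ (degree p - Suc i) = 1 \<or> (-1::real) ^ (degree p - Suc i) = - 1"
    by (meson neg_one_even_power neg_one_odd_power)
  ultimately show ?thesis using A B by (auto simp: mult_le_0_iff)
qed

text \<open>
  To the right of root number \<open>i\<close> of \<open>q\<close> both \<open>p\<close> and the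
  derivative of \<open>q\<close> have \<open>degree p - i\<close> factors, which are the negative ones
  at that root.
\<close>

lemma interlace_sign_below:
  assumes "interlace p q" "0 < lead_coeff p" "0 < lead_coeff q" "poly q x = 0"
  shows "0 \<le> poly p x * poly (pderiv q) x"
proof -
  have rp: "real_rooted p" and rq: "real_rooted q" and dq: "degree q = Suc (degree p)"
    and il: "\<And>i. i < degree p \<Longrightarrow> root_list q ! i \<le> root_list p ! i"
      "\<And>i. i < degree p \<Longrightarrow> root_list p ! i \<le> root_list q ! Suc i"
    using assms(1) by (auto simp: interlace_def)
  obtain i where i: "i < degree q" "x = root_list q ! i"
    using root_list_index [OF rq assms(4)] .
  have monq: "root_list q ! k \<le> root_list q ! l" if "k \<le> l" "l < degree q" for k l
    using root_list_facts(1,3) [OF rq] that by (auto simp: sorted_iff_nth_mono)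
  have "0 \<le> (-1) ^ (degree p - i) * (\<Prod>k<degree p. x - root_list p ! k)"
  proof (rule sign_prod)
    show "i \<le> degree p" using i dq by simp
    show "0 \<le> x - root_list p ! k" if "k < i" for k
      using monq [of "Suc k" i] il(2) [of k] i that dq by simp
    show "x - root_list p ! k \<le> 0" if "i \<le> k" "k < degree p" for k
      using monq [of i k] il(1) [of k] i that dq by simp
  qed
  then have A: "0 \<le> (-1) ^ (degree p - i) * poly p x"
    using mult_nonneg_nonneg [OF less_imp_le [OF assms(2)]]
    by (subst root_list_facts(5) [OF rp]) (simp only: mult.left_commute)
  have B: "0 \<le> (-1) ^ (degree p - i) * poly (pderiv q) x"
    using sign_pderiv_root_list [OF rq i(1) assms(3)] i dq by simp
  have "(-1::real) ^ (degree p - i) = 1 \<or> (-1::real) ^ (degree p - i) = - 1"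
    by (meson neg_one_even_power neg_one_odd_power)
  then show ?thesis using A B by (auto simp: zero_le_mult_iff)
qed

lemma strictly_interlace_no_common_root:
  assumes "strictly_interlace p q" "poly p x = 0"
  shows "poly q x \<noteq> 0"
proof
  assume q0: "poly q x = 0"
  have rp: "real_rooted p" and rq: "real_rooted q" and dq: "degree q = Suc (degree p)"
    and il: "\<And>i. i < degree p \<Longrightarrow> root_list q ! i < root_list p ! i"
      "\<And>i. i < degree p \<Longrightarrow> root_list p ! i < root_list q ! Suc i"
    using assms(1) by (auto simp: strictly_interlace_def)
  obtain i where i: "i < degree p" "x = root_list p ! i"
    using root_list_index [OF rp assms(2)] .
  obtain k where k: "k < degree q" "x = root_list q ! k"
    using root_list_index [OF rq q0] .
  have monq: "root_list q ! k \<le> root_list q ! l" if "k \<le> l" "l < degree q" for k l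
    using root_list_facts(1,3) [OF rq] that by (auto simp: sorted_iff_nth_mono)
  show False
  proof (cases "k \<le> i")
    case True
    then show False using monq [of k i] il(1) [OF i(1)] i k dq by auto
  next
    case False
    then show False using monq [of "Suc i" k] il(2) [OF i(1)] i k dq by auto
  qed
qed

section \<open>Interlacing and the Bezoutian\<close>

lemma pderiv_sum: "pderiv (sum f A) = (\<Sum>x\<in>A. pderiv (f x))"
  by (induction A rule: infinite_finite_induct) (simp_all add: pderiv_add)

text \<open>
  The hypothesis is the partial fraction expansion \<open>G / f = a z + b - (\<Sum>\<mu>. h \<mu> / (z -
  \<mu>))\<close>, multiplied by \<open>f\<close> in order to stay within polynomials. The first
  identity is \<open>f\<^sup>2\<close> times its derivative on the real axis, the second is
  \<open>|f|\<^sup>2\<close> times its imaginary part. For \<open>a\<close> and \<open>h\<close>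
  nonnegative both right-hand sides are sums of squares.
\<close>

lemma bezoutian_identities:
  fixes G f :: "real poly" and l :: "real \<Rightarrow> real poly"
  assumes G: "G = [:b, a:] * f - (\<Sum>\<mu>\<in>M. smult (h \<mu>) (l \<mu>))"
    and l: "\<And>\<mu>. \<mu> \<in> M \<Longrightarrow> f = [:-\<mu>, 1:] * l \<mu>"
  shows "poly (pderiv G) x * poly f x - poly G x * poly (pderiv f) x
      = a * (poly f x)\<^sup>2 + (\<Sum>\<mu>\<in>M. h \<mu> * (poly (l \<mu>) x)\<^sup>2)"
    and "Im (cpoly G z * cnj (cpoly f z))
      = Im z * (a * (cmod (cpoly f z))\<^sup>2 + (\<Sum>\<mu>\<in>M. h \<mu> * (cmod (cpoly (l \<mu>) z))\<^sup>2))"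
proof -
  have one: "poly (l \<mu>) x * poly (pderiv f) x - poly (pderiv (l \<mu>)) x * poly f x = (poly (l \<mu>) x)\<^sup>2"
    if "\<mu> \<in> M" for \<mu>
  proof -
    have d: "pderiv f = pderiv ([:-\<mu>, 1:] * l \<mu>)" using l [OF that] by simp
    have A: "poly (pderiv f) x = (x - \<mu>) * poly (pderiv (l \<mu>)) x + poly (l \<mu>) x"
      unfolding d by (simp only: pderiv_mult) (simp add: pderiv_pCons algebra_simps)
    have B: "poly f x = (x - \<mu>) * poly (l \<mu>) x"
      using arg_cong [OF l [OF that], of "\<lambda>q. poly q x"] by (simp add: algebra_simps)
    show ?thesis unfolding A B by (simp add: algebra_simps power2_eq_square)
  qed
  have dG: "pderiv G = smult a f + [:b, a:] * pderiv f - (\<Sum>\<mu>\<in>M. smult (h \<mu>) (pderiv (l \<mu>)))"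
    unfolding G by (simp only: pderiv_diff pderiv_mult pderiv_sum pderiv_smult)
      (simp add: pderiv_pCons algebra_simps)
  have "poly (pderiv G) x * poly f x - poly G x * poly (pderiv f) x
      = a * (poly f x)\<^sup>2 + ((\<Sum>\<mu>\<in>M. h \<mu> * poly (l \<mu>) x) * poly (pderiv f) x
          - (\<Sum>\<mu>\<in>M. h \<mu> * poly (pderiv (l \<mu>)) x) * poly f x)"
    unfolding dG by (simp add: G poly_sum algebra_simps power2_eq_square)
  also have "(\<Sum>\<mu>\<in>M. h \<mu> * poly (l \<mu>) x) * poly (pderiv f) x
          - (\<Sum>\<mu>\<in>M. h \<mu> * poly (pderiv (l \<mu>)) x) * poly f x
      = (\<Sum>\<mu>\<in>M. h \<mu> * (poly (l \<mu>) x * poly (pderiv f) x - poly (pderiv (l \<mu>)) x * poly f x))"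
    by (simp add: sum_distrib_left sum_distrib_right sum_subtractf algebra_simps)
  also have "\<dots> = (\<Sum>\<mu>\<in>M. h \<mu> * (poly (l \<mu>) x)\<^sup>2)"
    by (rule sum.cong) (simp_all add: one)
  finally show "poly (pderiv G) x * poly f x - poly G x * poly (pderiv f) x
      = a * (poly f x)\<^sup>2 + (\<Sum>\<mu>\<in>M. h \<mu> * (poly (l \<mu>) x)\<^sup>2)" .
  have Im1: "Im (cpoly (l \<mu>) z * cnj (cpoly f z)) = - (Im z * (cmod (cpoly (l \<mu>) z))\<^sup>2)"
    if "\<mu> \<in> M" for \<mu>
  proof -
    have "cpoly f z = (z - of_real \<mu>) * cpoly (l \<mu>) z"
      using arg_cong [OF l [OF that], of "\<lambda>q. cpoly q z"]
      by (simp add: algebra_simps del: mult_pCons_left)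
    then have "cpoly (l \<mu>) z * cnj (cpoly f z)
        = of_real ((cmod (cpoly (l \<mu>) z))\<^sup>2) * cnj (z - of_real \<mu>)"
      unfolding complex_norm_square by (simp add: ac_simps)
    then show ?thesis by (simp del: of_real_power)
  qed
  have "cpoly G z * cnj (cpoly f z) = (of_real b + of_real a * z) * of_real ((cmod (cpoly f z))\<^sup>2)
      - (\<Sum>\<mu>\<in>M. of_real (h \<mu>) * (cpoly (l \<mu>) z * cnj (cpoly f z)))"
    unfolding complex_norm_square G
    by (simp add: algebra_simps sum_distrib_left sum_distrib_right del: mult_pCons_left)
  then have "Im (cpoly G z * cnj (cpoly f z))
      = Im ((of_real b + of_real a * z) * of_real ((cmod (cpoly f z))\<^sup>2))
        - (\<Sum>\<mu>\<in>M. Im (of_real (h \<mu>) * (cpoly (l \<mu>) z * cnj (cpoly f z))))"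
    by (simp only: minus_complex.simps Im_sum)
  also have "Im ((of_real b + of_real a * z) * of_real ((cmod (cpoly f z))\<^sup>2))
      = Im z * (a * (cmod (cpoly f z))\<^sup>2)"
    by (simp del: of_real_power)
  also have "(\<Sum>\<mu>\<in>M. Im (of_real (h \<mu>) * (cpoly (l \<mu>) z * cnj (cpoly f z))))
      = - (\<Sum>\<mu>\<in>M. Im z * (h \<mu> * (cmod (cpoly (l \<mu>) z))\<^sup>2))"
    unfolding sum_negf [symmetric]
  proof (rule sum.cong [OF refl])
    fix \<mu> assume "\<mu> \<in> M"
    have "Im (of_real (h \<mu>) * w) = h \<mu> * Im w" for w by simp
    then show "Im (of_real (h \<mu>) * (cpoly (l \<mu>) z * cnj (cpoly f z)))
        = - (Im z * (h \<mu> * (cmod (cpoly (l \<mu>) z))\<^sup>2))"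
      using Im1 [OF \<open>\<mu> \<in> M\<close>] by simp
  qed
  finally have "Im (cpoly G z * cnj (cpoly f z)) = Im z * (a * (cmod (cpoly f z))\<^sup>2)
      + (\<Sum>\<mu>\<in>M. Im z * (h \<mu> * (cmod (cpoly (l \<mu>) z))\<^sup>2))"
    by simp
  then show "Im (cpoly G z * cnj (cpoly f z))
      = Im z * (a * (cmod (cpoly f z))\<^sup>2 + (\<Sum>\<mu>\<in>M. h \<mu> * (cmod (cpoly (l \<mu>) z))\<^sup>2))"
    by (simp add: sum_distrib_left algebra_simps)
qed

text \<open>
  Division by \<open>f\<close> leaves a linear quotient, whose slope is the ratio of the leading
  coefficients, and a remainder that Lagrange interpolation recovers from its values at the simple roots
  of \<open>f\<close>.
\<close>

lemma interlacing_partial_fractions: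
  assumes "interlace f g" "0 < lead_coeff f" "0 < lead_coeff g" "distinct (root_list f)"
    and "0 < degree f"
  obtains a b where "0 < a"
    "g = [:b, a:] * f - (\<Sum>\<mu> | poly f \<mu> = 0.
       smult (- poly g \<mu> / poly (pderiv f) \<mu>) (f div [:-\<mu>, 1:]))"
proof -
  have card: "card {x. poly f x = 0} = degree f"
    using assms by (auto intro: simple_roots_card simp: interlace_def)
  have dg: "degree g = Suc (degree f)" using assms(1) by (simp add: interlace_def)
  have f0: "f \<noteq> 0" using assms(2) by auto
  obtain s r where eq: "g = s * f + r" and dr: "degree r < degree f"
  proof
    show "g = g div f * f + g mod f" by simp
    show "degree (g mod f) < degree f"
      using assms(5) degree_mod_less' [of f g] f0 by (cases "g mod f = 0") auto
  qed
  have s0: "s \<noteq> 0" using eq dr dg by auto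
  have dsf: "degree (s * f) = degree s + degree f" using s0 f0 by (simp add: degree_mult_eq)
  have "degree g = degree (s * f)"
    unfolding eq using dr dsf by (intro degree_add_eq_left) simp
  then have ds: "degree s = 1" using dg dsf by simp
  then have s: "s = [:coeff s 0, coeff s 1:]"
    by (intro poly_eqI) (auto simp: coeff_pCons coeff_eq_0 split: nat.splits)
  have "coeff g (Suc (degree f)) = coeff (s * f) (degree s + degree f)"
    unfolding eq using dr ds by (simp add: coeff_eq_0)
  also have "\<dots> = lead_coeff s * lead_coeff f" by (rule coeff_mult_degree_sum)
  finally have a: "0 < coeff s 1" using assms(2,3) ds dg by (simp add: zero_less_mult_iff)
  have "poly r \<mu> = poly g \<mu>" if "poly f \<mu> = 0" for \<mu>
    using that unfolding eq by simp
  then have "r = (\<Sum>\<mu> | poly f \<mu> = 0. smult (poly g \<mu> / poly (pderiv f) \<mu>) (f div [:-\<mu>, 1:]))"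
    by (subst lagrange_interpolation [OF card dr], intro sum.cong) (simp_all add: poly_pderiv_root)
  then have "g = s * f - (\<Sum>\<mu> | poly f \<mu> = 0.
       smult (- poly g \<mu> / poly (pderiv f) \<mu>) (f div [:-\<mu>, 1:]))"
    by (subst eq) (simp add: sum_negf)
  then show thesis using that [OF a, of "coeff s 0"] unfolding s [symmetric] by blast
qed

lemma interlacing_lagrange:
  assumes "interlace g f" "distinct (root_list f)"
  shows "g = (\<Sum>\<mu> | poly f \<mu> = 0. smult (poly g \<mu> / poly (pderiv f) \<mu>) (f div [:-\<mu>, 1:]))"
proof -
  have "g = (\<Sum>\<mu> | poly f \<mu> = 0. smult (poly g \<mu> / poly (f div [:-\<mu>, 1:]) \<mu>) (f div [:-\<mu>, 1:]))"
    using assms by (intro lagrange_interpolation simple_roots_card) (auto simp: interlace_def)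
  then show ?thesis by (simp add: poly_pderiv_root)
qed

lemma simple_pderiv_nonzero:
  assumes "real_rooted f" "distinct (root_list f)" "poly f x = 0"
  shows "poly (pderiv f) x \<noteq> 0"
proof -
  have "f \<noteq> 0" using assms by (simp add: real_rooted_def)
  then have "0 < degree f" using assms(3) by (metis degree_eq_zeroE gr0I poly_const_conv pCons_0_0)
  then show ?thesis
    using simple_root_quotient(1) [OF simple_roots_card] assms by (simp add: poly_pderiv_root)
qed

text \<open>
  The hypotheses on the three symbols in one fixed direction.
\<close>

locale interlacing_triple =
  fixes p p1 p2 :: "real poly"
  assumes il1: "interlace p1 p" and il2: "interlace p2 p1"
    and lc: "0 < lead_coeff p" "0 < lead_coeff p1" "0 < lead_coeff p2"
    and simple: "distinct (root_list p1)"
    and no_common_zero: "\<And>x. poly p x = 0 \<Longrightarrow> poly p1 x = 0 \<Longrightarrow> poly p2 x \<noteq> 0"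
begin

text \<open>
  The Bezoutians of the two interlacing pairs on the diagonal: \<open>W1 = p1\<^sup>2 (p / p1)'\<close>
  and \<open>W2 = - p1\<^sup>2 (p2 / p1)'\<close>.
\<close>

definition W1 :: "real \<Rightarrow> real" where
  "W1 x = poly (pderiv p) x * poly p1 x - poly p x * poly (pderiv p1) x"

definition W2 :: "real \<Rightarrow> real" where
  "W2 x = poly (pderiv p1) x * poly p2 x - poly p1 x * poly (pderiv p2) x"

text \<open>
  The negative of the residue of \<open>(p - e p2) / p1\<close> at a root of \<open>p1\<close>.
\<close>

definition weight :: "real \<Rightarrow> real \<Rightarrow> real" where
  "weight e \<mu> = (e * poly p2 \<mu> - poly p \<mu>) / poly (pderiv p1) \<mu>"

text \<open>
  The linear part does not depend on \<open>e\<close> because \<open>p2 / p1\<close> vanishes at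
  infinity.
\<close>

lemma representation:
  obtains a b where "0 < a"
    "\<And>e. p - smult e p2 = [:b, a:] * p1 - (\<Sum>\<mu> | poly p1 \<mu> = 0.
       smult (weight e \<mu>) (p1 div [:-\<mu>, 1:]))"
proof -
  have "0 < degree p1" using il2 by (simp add: interlace_def)
  then obtain a b where a: "0 < a" and
    p: "p = [:b, a:] * p1 - (\<Sum>\<mu> | poly p1 \<mu> = 0.
       smult (- poly p \<mu> / poly (pderiv p1) \<mu>) (p1 div [:-\<mu>, 1:]))"
    using interlacing_partial_fractions [OF il1 lc(2,1) simple] by blast
  note p2 = interlacing_lagrange [OF il2 simple]
  have "p - smult e p2 = [:b, a:] * p1 - (\<Sum>\<mu> | poly p1 \<mu> = 0.
       smult (weight e \<mu>) (p1 div [:-\<mu>, 1:]))" for e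
  proof -
    have s: "smult e p2 = (\<Sum>\<mu> | poly p1 \<mu> = 0.
        smult (e * (poly p2 \<mu> / poly (pderiv p1) \<mu>)) (p1 div [:-\<mu>, 1:]))"
      (is "_ = (\<Sum>\<mu> | _. smult (e * ?c \<mu>) (?l \<mu>))")
    proof -
      have "smult e (sum g M) = (\<Sum>\<mu>\<in>M. smult e (g \<mu>))" for g :: "real \<Rightarrow> real poly" and M
        by (induction M rule: infinite_finite_induct) (simp_all add: smult_add_right)
      from this [of "\<lambda>\<mu>. smult (?c \<mu>) (?l \<mu>)" "{\<mu>. poly p1 \<mu> = 0}"] show ?thesis
        unfolding p2 [symmetric] smult_smult .
    qed
    have "p - smult e p2 = [:b, a:] * p1 - (\<Sum>\<mu> | poly p1 \<mu> = 0.
       smult (- poly p \<mu> / poly (pderiv p1) \<mu>) (p1 div [:-\<mu>, 1:])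
         + smult (e * (poly p2 \<mu> / poly (pderiv p1) \<mu>)) (p1 div [:-\<mu>, 1:]))"
      unfolding sum.distrib s [symmetric] diff_diff_eq [symmetric] p [symmetric] ..
    then show ?thesis
      unfolding smult_add_left [symmetric] by (simp add: weight_def diff_divide_distrib)
  qed
  then show thesis using that a by blast
qed

lemma weight_nonneg:
  assumes "poly p1 \<mu> = 0" "0 \<le> e"
  shows "0 \<le> weight e \<mu>"
proof -
  have "poly p \<mu> * poly (pderiv p1) \<mu> \<le> 0"
    by (rule interlace_sign_above [OF il1 lc(2,1) assms(1)])
  moreover have "0 \<le> e * (poly p2 \<mu> * poly (pderiv p1) \<mu>)"
    using interlace_sign_below [OF il2 lc(3,2) assms(1)] assms(2) by simp
  ultimately have "0 \<le> (e * poly p2 \<mu> - poly p \<mu>) * poly (pderiv p1) \<mu>"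
    by (simp add: algebra_simps)
  then show ?thesis by (simp add: weight_def zero_le_divide_iff zero_le_mult_iff)
qed

lemma p1_pderiv_nonzero: "poly p1 x = 0 \<Longrightarrow> poly (pderiv p1) x \<noteq> 0"
  using il2 by (intro simple_pderiv_nonzero [OF _ simple]) (simp_all add: interlace_def)

text \<open>
  At a root of \<open>p1\<close> the numbers \<open>p\<close> and \<open>p2\<close> have opposite signs,
  so that \<open>p = e p2\<close> would make both vanish.
\<close>

lemma no_real_common_root:
  assumes "poly p1 x = 0" "0 < e"
  shows "poly p x - e * poly p2 x \<noteq> 0"
proof
  assume G: "poly p x - e * poly p2 x = 0"
  have "poly p x * poly (pderiv p1) x \<le> 0"
    by (rule interlace_sign_above [OF il1 lc(2,1) assms(1)])
  moreover have B: "0 \<le> poly p2 x * poly (pderiv p1) x"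
    by (rule interlace_sign_below [OF il2 lc(3,2) assms(1)])
  moreover have "poly p x * poly (pderiv p1) x = e * (poly p2 x * poly (pderiv p1) x)"
    using G by simp
  ultimately have "poly p2 x * poly (pderiv p1) x = 0"
    using assms(2) by (metis antisym_conv mult_le_cancel_left_pos mult_zero_right)
  then have "poly p2 x = 0" using p1_pderiv_nonzero [OF assms(1)] by simp
  then show False using G no_common_zero assms(1) by auto
qed

text \<open>
  At a root, \<open>p - e\<^sup>2 p2 = \<i> e p1\<close>. Multiplied by the conjugate of
  \<open>p1\<close> the right-hand side has imaginary part \<open>e |p1|\<^sup>2\<close>, while that of
  the left-hand side is \<open>Im z\<close> times a nonnegative number by the second Bezoutian identity.
\<close>

lemma root_upper_half_plane:
  assumes "0 < e" "cpoly p z - \<i> * of_real e * cpoly p1 z - of_real (e\<^sup>2) * cpoly p2 z = 0"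
  shows "0 < Im z"
proof -
  obtain a b where a: "0 < a" and rep: "\<And>e. p - smult e p2 = [:b, a:] * p1 -
    (\<Sum>\<mu> | poly p1 \<mu> = 0. smult (weight e \<mu>) (p1 div [:-\<mu>, 1:]))"
    using representation by blast
  let ?S = "a * (cmod (cpoly p1 z))\<^sup>2 + (\<Sum>\<mu> | poly p1 \<mu> = 0.
    weight (e\<^sup>2) \<mu> * (cmod (cpoly (p1 div [:-\<mu>, 1:]) z))\<^sup>2)"
  have G: "cpoly (p - smult (e\<^sup>2) p2) z = \<i> * of_real e * cpoly p1 z"
    using assms(2) by (simp add: algebra_simps)
  have "Im (cpoly (p - smult (e\<^sup>2) p2) z * cnj (cpoly p1 z)) = Im z * ?S"
    by (rule bezoutian_identities(2) [OF rep]) (use synthetic_factor in auto)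
  moreover have "cpoly (p - smult (e\<^sup>2) p2) z * cnj (cpoly p1 z)
      = \<i> * of_real (e * (cmod (cpoly p1 z))\<^sup>2)"
    unfolding G of_real_mult complex_norm_square by (simp add: ac_simps)
  moreover have "Im (\<i> * of_real r) = r" for r by simp
  ultimately have eq: "Im z * ?S = e * (cmod (cpoly p1 z))\<^sup>2" by metis
  have S: "0 \<le> ?S"
    using a by (intro add_nonneg_nonneg sum_nonneg mult_nonneg_nonneg weight_nonneg) auto
  have "cpoly p1 z \<noteq> 0"
  proof
    assume z: "cpoly p1 z = 0"
    then have "z \<in> \<real>" using il2 by (auto simp: interlace_def real_rooted_def cpoly_def)
    then obtain x where x: "z = of_real x" by (auto elim: Reals_cases)
    have "poly p1 x = 0" using z x by simp
    moreover have "poly p x - e\<^sup>2 * poly p2 x = 0"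
    proof -
      have "cpoly (p - smult (e\<^sup>2) p2) z = 0" using G z by (simp only: mult_zero_right)
      then show ?thesis unfolding x cpoly_of_real of_real_eq_0_iff by simp
    qed
    ultimately show False using no_real_common_root [of x "e\<^sup>2"] assms(1) by simp
  qed
  then have "0 < Im z * ?S" unfolding eq using assms(1) by simp
  then show ?thesis using S by (auto simp: zero_less_mult_iff)
qed

text \<open>
  \<open>W1 + e W2\<close> is the Bezoutian of \<open>p - e p2\<close> and \<open>p1\<close>, hence a
  sum of squares. The case \<open>e = 0\<close> is \<open>W1\<close>, and the difference of the cases
  \<open>e = 1\<close> and \<open>e = 0\<close> is \<open>W2\<close>.
\<close>

lemma W_nonneg: "0 \<le> W1 x" "0 \<le> W2 x" and W1_lower: "poly p1 x \<noteq> 0 \<Longrightarrow> 0 < W1 x"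
proof -
  obtain a b where a: "0 < a" and rep: "\<And>e. p - smult e p2 = [:b, a:] * p1 -
    (\<Sum>\<mu> | poly p1 \<mu> = 0. smult (weight e \<mu>) (p1 div [:-\<mu>, 1:]))"
    using representation by blast
  have W: "W1 x + e * W2 x = a * (poly p1 x)\<^sup>2
      + (\<Sum>\<mu> | poly p1 \<mu> = 0. weight e \<mu> * (poly (p1 div [:-\<mu>, 1:]) x)\<^sup>2)" for e
  proof -
    have "poly (pderiv (p - smult e p2)) x * poly p1 x - poly (p - smult e p2) x * poly (pderiv p1) x
      = a * (poly p1 x)\<^sup>2 + (\<Sum>\<mu> | poly p1 \<mu> = 0. weight e \<mu> * (poly (p1 div [:-\<mu>, 1:]) x)\<^sup>2)"
      by (rule bezoutian_identities(1) [OF rep]) (use synthetic_factor in auto)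
    then show ?thesis
      by (simp add: W1_def W2_def pderiv_diff pderiv_smult algebra_simps)
  qed
  have "0 \<le> (\<Sum>\<mu> | poly p1 \<mu> = 0. weight 0 \<mu> * (poly (p1 div [:-\<mu>, 1:]) x)\<^sup>2)"
    by (intro sum_nonneg mult_nonneg_nonneg weight_nonneg) auto
  then have W1: "a * (poly p1 x)\<^sup>2 \<le> W1 x" using W [of 0] by simp
  then show "0 \<le> W1 x" using a by (meson less_imp_le mult_nonneg_nonneg order_trans zero_le_power2)
  show "0 < W1 x" if "poly p1 x \<noteq> 0"
    using W1 a that by (meson less_le_trans mult_pos_pos zero_less_power2)
  have W2: "W2 x = (\<Sum>\<mu> | poly p1 \<mu> = 0.
      poly p2 \<mu> / poly (pderiv p1) \<mu> * (poly (p1 div [:-\<mu>, 1:]) x)\<^sup>2)"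
  proof -
    have "W2 x = (W1 x + 1 * W2 x) - (W1 x + 0 * W2 x)" by simp
    also have "\<dots> = (\<Sum>\<mu> | poly p1 \<mu> = 0.
        (weight 1 \<mu> - weight 0 \<mu>) * (poly (p1 div [:-\<mu>, 1:]) x)\<^sup>2)"
      unfolding W by (simp add: sum_subtractf algebra_simps)
    finally show ?thesis by (simp add: weight_def diff_divide_distrib)
  qed
  show "0 \<le> W2 x"
    unfolding W2
  proof (intro sum_nonneg mult_nonneg_nonneg)
    fix \<mu> assume "\<mu> \<in> {\<mu>. poly p1 \<mu> = 0}"
    then have "0 \<le> poly p2 \<mu> * poly (pderiv p1) \<mu>"
      using interlace_sign_below [OF il2 lc(3,2)] by simp
    then show "0 \<le> poly p2 \<mu> / poly (pderiv p1) \<mu>"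
      by (simp add: zero_le_divide_iff zero_le_mult_iff)
  qed simp
qed

text \<open>
  \<open>W1\<close> vanishes at most at the roots of \<open>p1\<close>. There \<open>W1 = - p
  p1'\<close> and \<open>W2 = p1' p2\<close>, with \<open>p1'\<close> different from 0, and
  \<open>p\<close>, \<open>p2\<close> do not both vanish.
\<close>

lemma W_sum_pos: "0 < W1 x + W2 x"
proof (cases "poly p1 x = 0")
  case False
  then show ?thesis using W1_lower W_nonneg(2) [of x] by (simp add: add_pos_nonneg)
next
  case True
  then have "poly p x \<noteq> 0 \<or> poly p2 x \<noteq> 0" using no_common_zero by auto
  then have "W1 x \<noteq> 0 \<or> W2 x \<noteq> 0"
    using True p1_pderiv_nonzero by (auto simp: W1_def W2_def)
  then show ?thesis using W_nonneg [of x] by auto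
qed

lemma W1_pos:
  assumes "strictly_interlace p1 p"
  shows "0 < W1 x"
proof (cases "poly p1 x = 0")
  case True
  then have "W1 x \<noteq> 0"
    using strictly_interlace_no_common_root [OF assms True] p1_pderiv_nonzero
    by (auto simp: W1_def)
  then show ?thesis using W_nonneg(1) [of x] by simp
qed (rule W1_lower)

end

section \<open>Bounds for polynomials depending on parameters\<close>

lemma poly_bounded_degree_sum:
  fixes p :: "'a::comm_semiring_1 poly"
  assumes "degree p \<le> n"
  shows "poly p x = (\<Sum>i\<le>n. coeff p i * x ^ i)"
proof -
  have "poly p x = (\<Sum>i\<le>degree p. coeff p i * x ^ i)" by (simp add: poly_altdef)
  also have "\<dots> = (\<Sum>i\<le>n. coeff p i * x ^ i)"
    using assms by (intro sum.mono_neutral_left) (auto simp: coeff_eq_0)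
  finally show ?thesis .
qed

lemma cpoly_bounded_degree_sum:
  assumes "degree p \<le> n"
  shows "cpoly p z = (\<Sum>i\<le>n. of_real (coeff p i) * z ^ i)"
proof -
  have "degree (map_poly complex_of_real p) \<le> n" using assms by (simp add: degree_map_poly)
  from poly_bounded_degree_sum [OF this, of z] show ?thesis
    by (simp add: cpoly_def coeff_map_poly)
qed

lemma norm_power_diff_le:
  fixes z w :: complex
  assumes "cmod z \<le> R" "cmod w \<le> R" "1 \<le> R"
  shows "cmod (z ^ k - w ^ k) \<le> real k * R ^ k * cmod (z - w)"
proof (induction k)
  case (Suc k)
  have "z ^ Suc k - w ^ Suc k = z * (z ^ k - w ^ k) + (z - w) * w ^ k" by (simp add: algebra_simps)
  then have "cmod (z ^ Suc k - w ^ Suc k) \<le> cmod z * cmod (z ^ k - w ^ k) + cmod (z - w) * cmod w ^ k"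
    by (metis norm_mult norm_power norm_triangle_ineq)
  also have "\<dots> \<le> R * (real k * R ^ k * cmod (z - w)) + cmod (z - w) * R ^ k"
    using Suc assms by (intro add_mono mult_mono power_mono) auto
  also have "\<dots> \<le> R * (real k * R ^ k * cmod (z - w)) + cmod (z - w) * R ^ Suc k"
    using assms(3) by (intro add_left_mono mult_left_mono power_increasing) auto
  finally show ?case by (simp add: algebra_simps)
qed simp

text \<open>
  The second bound makes quantitative that the values at \<open>z\<close> and at its real part differ by
  at most a multiple of the imaginary part of \<open>z\<close>.
\<close>

lemma cpoly_bounds:
  assumes "degree p \<le> n" "\<And>i. \<bar>coeff p i\<bar> \<le> B" "1 \<le> R" "cmod z \<le> R"
  shows "cmod (cpoly p z) \<le> real (Suc n) * B * R ^ n"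
    and "cmod (cpoly p z - of_real (poly p (Re z))) \<le> real (Suc n) * B * (real n * R ^ n) * \<bar>Im z\<bar>"
proof -
  have B: "0 \<le> B" using assms(2) [of 0] by linarith
  have pow: "R ^ i \<le> R ^ n" if "i \<le> n" for i using that assms(3) by (rule power_increasing)
  have "cmod (cpoly p z) \<le> (\<Sum>i\<le>n. cmod (of_real (coeff p i) * z ^ i))"
    unfolding cpoly_bounded_degree_sum [OF assms(1)] by (rule norm_sum)
  also have "\<dots> \<le> (\<Sum>i\<le>n. B * R ^ n)"
  proof (rule sum_mono)
    fix i assume i: "i \<in> {..n}"
    have "cmod z ^ i \<le> R ^ n"
      using power_mono [OF assms(4) norm_ge_zero, of i] pow [of i] i by simp
    then show "cmod (of_real (coeff p i) * z ^ i) \<le> B * R ^ n"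
      unfolding norm_mult norm_power norm_of_real
      using assms(2) [of i] B by (intro mult_mono) auto
  qed
  finally show "cmod (cpoly p z) \<le> real (Suc n) * B * R ^ n" by simp
  have Re: "cmod (of_real (Re z)) \<le> R" using assms(4) abs_Re_le_cmod [of z] by simp
  have zRe: "z - of_real (Re z) = \<i> * of_real (Im z)" by (simp add: complex_eq_iff)
  have "cpoly p z - of_real (poly p (Re z)) = (\<Sum>i\<le>n. of_real (coeff p i) * (z ^ i - of_real (Re z) ^ i))"
    unfolding cpoly_of_real [symmetric] cpoly_bounded_degree_sum [OF assms(1)]
    by (simp add: sum_subtractf right_diff_distrib)
  then have "cmod (cpoly p z - of_real (poly p (Re z)))
      \<le> (\<Sum>i\<le>n. cmod (of_real (coeff p i) * (z ^ i - of_real (Re z) ^ i)))"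
    by (metis norm_sum)
  also have "\<dots> \<le> (\<Sum>i\<le>n. B * (real n * R ^ n * \<bar>Im z\<bar>))"
  proof (rule sum_mono)
    fix i assume i: "i \<in> {..n}"
    have "cmod (z ^ i - of_real (Re z) ^ i) \<le> real i * R ^ i * \<bar>Im z\<bar>"
      using norm_power_diff_le [OF assms(4) Re assms(3), of i] unfolding zRe by (simp add: norm_mult)
    also have "\<dots> \<le> real n * R ^ n * \<bar>Im z\<bar>"
      using i pow [of i] assms(3) by (intro mult_mono mult_right_mono) auto
    finally show "cmod (of_real (coeff p i) * (z ^ i - of_real (Re z) ^ i)) \<le> B * (real n * R ^ n * \<bar>Im z\<bar>)"
      unfolding norm_mult norm_of_real
      using assms(2) [of i] B by (intro mult_mono) auto
  qed
  finally show "cmod (cpoly p z - of_real (poly p (Re z))) \<le> real (Suc n) * B * (real n * R ^ n) * \<bar>Im z\<bar>"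
    by (simp add: algebra_simps)
qed

lemma monic_root_bound:
  fixes q :: "complex poly"
  assumes "lead_coeff q = 1" "\<And>i. cmod (coeff q i) \<le> B" "poly q z = 0"
  shows "cmod z \<le> 1 + real (degree q) * B"
proof (rule ccontr)
  let ?n = "degree q"
  assume "\<not> ?thesis"
  then have big: "1 + real ?n * B < cmod z" by simp
  have B: "0 \<le> B" using assms(2) [of 0] norm_ge_zero [of "coeff q 0"] by linarith
  then have z1: "1 < cmod z" using big by (smt (verit) mult_nonneg_nonneg of_nat_0_le_iff)
  have n0: "0 < ?n"
  proof (rule ccontr)
    assume "\<not> 0 < ?n"
    then have "q = [:1:]" using assms(1) by (metis degree_0_id gr0I)
    then show False using assms(3) by simp
  qed
  have "poly q z = (\<Sum>i<?n. coeff q i * z ^ i) + z ^ ?n"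
    using assms(1) by (simp add: poly_altdef lessThan_Suc_atMost [symmetric])
  then have "z ^ ?n = - (\<Sum>i<?n. coeff q i * z ^ i)" using assms(3) by (simp add: eq_neg_iff_add_eq_0 add.commute)
  then have "cmod z ^ ?n \<le> (\<Sum>i<?n. cmod (coeff q i * z ^ i))"
    by (metis norm_minus_cancel norm_power norm_sum)
  also have "\<dots> \<le> (\<Sum>i<?n. B * cmod z ^ (?n - 1))"
    unfolding norm_mult norm_power
    using z1 B assms(2) by (intro sum_mono mult_mono power_increasing) auto
  also have "\<dots> = real ?n * B * cmod z ^ (?n - 1)" by simp
  also have "\<dots> < cmod z * cmod z ^ (?n - 1)"
    using big z1 by (intro mult_strict_right_mono zero_less_power) auto
  also have "\<dots> = cmod z ^ ?n" using n0 by (metis power_minus_mult mult.commute)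
  finally show False by simp
qed

text \<open>
  The full symbol at frequency \<open>r \<xi>'\<close> with \<open>r = 1 / e\<close>, divided by
  \<open>(\<i> r)\<^sup>m\<close> and written in the variable \<open>z = \<lambda> / (\<i> r)\<close>.
\<close>

definition qpoly :: "real \<Rightarrow> real poly \<Rightarrow> real poly \<Rightarrow> real poly \<Rightarrow> complex poly" where
  "qpoly e p p1 p2 = map_poly of_real p - smult (\<i> * of_real e) (map_poly of_real p1)
     - smult (of_real (e\<^sup>2)) (map_poly of_real p2)"

lemma poly_qpoly:
  "poly (qpoly e p p1 p2) z = cpoly p z - \<i> * of_real e * cpoly p1 z - of_real (e\<^sup>2) * cpoly p2 z"
  by (simp add: qpoly_def cpoly_def)

lemma pderiv_map_poly_of_real:
  "pderiv (map_poly complex_of_real p) = map_poly complex_of_real (pderiv p)"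
  by (rule poly_eqI) (simp add: coeff_pderiv coeff_map_poly)

lemma pderiv_qpoly: "pderiv (qpoly e p p1 p2) = qpoly e (pderiv p) (pderiv p1) (pderiv p2)"
  by (simp add: qpoly_def pderiv_diff pderiv_smult pderiv_map_poly_of_real)

lemma coeff_qpoly: "coeff (qpoly e p p1 p2) k
    = of_real (coeff p k) - \<i> * of_real e * of_real (coeff p1 k) - of_real (e\<^sup>2 * coeff p2 k)"
  by (simp add: qpoly_def coeff_map_poly)

lemma compact_pos_lower_bound:
  fixes f :: "'a::metric_space \<Rightarrow> real"
  assumes "compact K" "continuous_on K f" "\<And>x. x \<in> K \<Longrightarrow> 0 < f x"
  obtains c where "0 < c" "\<And>x. x \<in> K \<Longrightarrow> c \<le> f x"
proof (cases "K = {}")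
  case True
  then show thesis using that [of 1] by simp
next
  case False
  then obtain x where x: "x \<in> K" "\<forall>y\<in>K. f x \<le> f y"
    using continuous_attains_inf assms(1,2) by blast
  then show thesis using that [of "f x"] assms(3) by blast
qed

lemma compact_upper_bound:
  fixes f :: "'a::metric_space \<Rightarrow> real"
  assumes "compact K" "continuous_on K f"
  obtains C where "0 < C" "\<And>x. x \<in> K \<Longrightarrow> \<bar>f x\<bar> \<le> C"
proof -
  have "bounded (f ` K)" using assms by (intro compact_imp_bounded compact_continuous_image)
  then obtain C where "\<forall>y\<in>f ` K. norm y \<le> C" by (auto simp: bounded_iff)
  then have "\<bar>f x\<bar> \<le> max 1 C" if "x \<in> K" for x using that by force
  then show thesis by (intro that [of "max 1 C"]) auto
qed

text \<open>
  The common degree bound turns evaluation into a sum of fixed length, which is jointly continuous in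
  the parameter and the argument.
\<close>

definition poly_family :: "'a::metric_space set \<Rightarrow> nat \<Rightarrow> ('a \<Rightarrow> real poly) \<Rightarrow> bool" where
  "poly_family S n p \<longleftrightarrow> (\<forall>\<xi>\<in>S. degree (p \<xi>) \<le> n) \<and> (\<forall>k. continuous_on S (\<lambda>\<xi>. coeff (p \<xi>) k))"

lemma poly_family_pderiv: "poly_family S n p \<Longrightarrow> poly_family S n (\<lambda>\<xi>. pderiv (p \<xi>))"
  by (auto simp: poly_family_def coeff_pderiv degree_pderiv intro!: continuous_intros
      intro: le_trans [OF diff_le_self])

lemma poly_family_continuous:
  assumes "poly_family S n p"
  shows "continuous_on (S \<times> X) (\<lambda>(\<xi>, x). poly (p \<xi>) x)"
    and "continuous_on (S \<times> Z) (\<lambda>(\<xi>, z). cpoly (p \<xi>) z)"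
proof -
  have c: "continuous_on (S \<times> Y) (\<lambda>y. coeff (p (fst y)) k)" for k and Y :: "'c::topological_space set"
    using assms unfolding poly_family_def
    by (intro continuous_on_compose2 [of S "\<lambda>\<xi>. coeff (p \<xi>) k", OF _ continuous_on_fst]) auto
  have "continuous_on (S \<times> X) (\<lambda>y. \<Sum>i\<le>n. coeff (p (fst y)) i * snd y ^ i)"
    by (intro continuous_intros c)
  then show "continuous_on (S \<times> X) (\<lambda>(\<xi>, x). poly (p \<xi>) x)"
    by (rule continuous_on_eq)
      (use assms in \<open>auto simp: poly_family_def poly_bounded_degree_sum\<close>)
  have "continuous_on (S \<times> Z) (\<lambda>y. \<Sum>i\<le>n. of_real (coeff (p (fst y)) i) * snd y ^ i)"
    by (intro continuous_intros c)
  then show "continuous_on (S \<times> Z) (\<lambda>(\<xi>, z). cpoly (p \<xi>) z)"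
    by (rule continuous_on_eq)
      (use assms in \<open>auto simp: poly_family_def cpoly_bounded_degree_sum\<close>)
qed

lemma poly_family_coeff_bound:
  assumes "poly_family S n p" "compact S"
  obtains B where "0 < B" "\<And>\<xi> k. \<xi> \<in> S \<Longrightarrow> \<bar>coeff (p \<xi>) k\<bar> \<le> B"
proof -
  have "continuous_on S (\<lambda>\<xi>. \<Sum>k\<le>n. \<bar>coeff (p \<xi>) k\<bar>)"
    using assms by (intro continuous_intros) (auto simp: poly_family_def)
  then obtain B where B: "0 < B" "\<And>\<xi>. \<xi> \<in> S \<Longrightarrow> \<bar>\<Sum>k\<le>n. \<bar>coeff (p \<xi>) k\<bar>\<bar> \<le> B"
    using compact_upper_bound [OF assms(2)] by blast
  have "\<bar>coeff (p \<xi>) k\<bar> \<le> B" if "\<xi> \<in> S" for \<xi> k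
  proof (cases "k \<le> n")
    case True
    then have "\<bar>coeff (p \<xi>) k\<bar> \<le> (\<Sum>k\<le>n. \<bar>coeff (p \<xi>) k\<bar>)"
      by (intro member_le_sum [where f = "\<lambda>k. \<bar>coeff (p \<xi>) k\<bar>"]) auto
    then show ?thesis using B(2) [OF that] by linarith
  next
    case False
    then have "coeff (p \<xi>) k = 0"
      using assms(1) that by (intro coeff_eq_0) (auto simp: poly_family_def not_le intro: le_less_trans)
    then show ?thesis using B(1) by simp
  qed
  then show thesis using that B(1) by blast
qed

section \<open>Distance of the spectrum from the real axis\<close>

locale interlacing_family =
  fixes S :: "'a::metric_space set" and m :: nat and p p1 p2 :: "'a \<Rightarrow> real poly"
  assumes compact: "compact S"
    and family: "poly_family S m p" "poly_family S m p1" "poly_family S m p2"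
    and triple: "\<And>\<xi>. \<xi> \<in> S \<Longrightarrow> interlacing_triple (p \<xi>) (p1 \<xi>) (p2 \<xi>)"
    and degree_p: "\<And>\<xi>. \<xi> \<in> S \<Longrightarrow> degree (p \<xi>) = m"
    and monic: "\<And>\<xi>. \<xi> \<in> S \<Longrightarrow> lead_coeff (p \<xi>) = 1"
begin

abbreviation q :: "real \<Rightarrow> 'a \<Rightarrow> complex poly" where
  "q e \<xi> \<equiv> qpoly e (p \<xi>) (p1 \<xi>) (p2 \<xi>)"

lemma degrees:
  assumes "\<xi> \<in> S"
  shows "m = Suc (degree (p1 \<xi>))" "degree (p1 \<xi>) = Suc (degree (p2 \<xi>))"
  using triple [OF assms] degree_p [OF assms]
  by (auto simp: interlacing_triple_def interlace_def)

lemma q_monic: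
  assumes "\<xi> \<in> S"
  shows "degree (q e \<xi>) = m" "lead_coeff (q e \<xi>) = 1"
proof -
  have "coeff (q e \<xi>) m = 1"
    using degrees [OF assms] degree_p [OF assms] monic [OF assms]
    by (simp add: coeff_qpoly coeff_eq_0)
  moreover have "coeff (q e \<xi>) k = 0" if "m < k" for k
    using degrees [OF assms] degree_p [OF assms] that by (simp add: coeff_qpoly coeff_eq_0)
  ultimately show "degree (q e \<xi>) = m" "lead_coeff (q e \<xi>) = 1"
    by (metis degree_le le_antisym le_degree zero_neq_one)+
qed

lemma coeff_bounds:
  obtains B where "0 < B"
    "\<And>\<xi> k. \<xi> \<in> S \<Longrightarrow> \<bar>coeff (p \<xi>) k\<bar> \<le> B" "\<And>\<xi> k. \<xi> \<in> S \<Longrightarrow> \<bar>coeff (p1 \<xi>) k\<bar> \<le> B"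
    "\<And>\<xi> k. \<xi> \<in> S \<Longrightarrow> \<bar>coeff (p2 \<xi>) k\<bar> \<le> B"
    "\<And>\<xi> k. \<xi> \<in> S \<Longrightarrow> \<bar>coeff (pderiv (p \<xi>)) k\<bar> \<le> B"
    "\<And>\<xi> k. \<xi> \<in> S \<Longrightarrow> \<bar>coeff (pderiv (p1 \<xi>)) k\<bar> \<le> B"
    "\<And>\<xi> k. \<xi> \<in> S \<Longrightarrow> \<bar>coeff (pderiv (p2 \<xi>)) k\<bar> \<le> B"
proof -
  note bd = poly_family_coeff_bound [OF _ compact]
  obtain B1 where B1: "0 < B1" "\<And>\<xi> k. \<xi> \<in> S \<Longrightarrow> \<bar>coeff (p \<xi>) k\<bar> \<le> B1"
    using bd [OF family(1)] by blast
  obtain B2 where B2: "0 < B2" "\<And>\<xi> k. \<xi> \<in> S \<Longrightarrow> \<bar>coeff (p1 \<xi>) k\<bar> \<le> B2"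
    using bd [OF family(2)] by blast
  obtain B3 where B3: "0 < B3" "\<And>\<xi> k. \<xi> \<in> S \<Longrightarrow> \<bar>coeff (p2 \<xi>) k\<bar> \<le> B3"
    using bd [OF family(3)] by blast
  obtain B4 where B4: "0 < B4" "\<And>\<xi> k. \<xi> \<in> S \<Longrightarrow> \<bar>coeff (pderiv (p \<xi>)) k\<bar> \<le> B4"
    using bd [OF poly_family_pderiv [OF family(1)]] by blast
  obtain B5 where B5: "0 < B5" "\<And>\<xi> k. \<xi> \<in> S \<Longrightarrow> \<bar>coeff (pderiv (p1 \<xi>)) k\<bar> \<le> B5"
    using bd [OF poly_family_pderiv [OF family(2)]] by blast
  obtain B6 where B6: "0 < B6" "\<And>\<xi> k. \<xi> \<in> S \<Longrightarrow> \<bar>coeff (pderiv (p2 \<xi>)) k\<bar> \<le> B6"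
    using bd [OF poly_family_pderiv [OF family(3)]] by blast
  show thesis
  proof (rule that [of "B1 + B2 + B3 + B4 + B5 + B6"])
    show "0 < B1 + B2 + B3 + B4 + B5 + B6"
      using B1(1) B2(1) B3(1) B4(1) B5(1) B6(1) by linarith
    fix \<xi> k assume "\<xi> \<in> S"
    note b = B1(2) [OF this, of k] B2(2) [OF this, of k] B3(2) [OF this, of k] B4(2) [OF this, of k]
      B5(2) [OF this, of k] B6(2) [OF this, of k] B1(1) B2(1) B3(1) B4(1) B5(1) B6(1)
    show "\<bar>coeff (p \<xi>) k\<bar> \<le> B1 + B2 + B3 + B4 + B5 + B6" using b by linarith
    show "\<bar>coeff (p1 \<xi>) k\<bar> \<le> B1 + B2 + B3 + B4 + B5 + B6" using b by linarith
    show "\<bar>coeff (p2 \<xi>) k\<bar> \<le> B1 + B2 + B3 + B4 + B5 + B6" using b by linarith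
    show "\<bar>coeff (pderiv (p \<xi>)) k\<bar> \<le> B1 + B2 + B3 + B4 + B5 + B6" using b by linarith
    show "\<bar>coeff (pderiv (p1 \<xi>)) k\<bar> \<le> B1 + B2 + B3 + B4 + B5 + B6" using b by linarith
    show "\<bar>coeff (pderiv (p2 \<xi>)) k\<bar> \<le> B1 + B2 + B3 + B4 + B5 + B6" using b by linarith
  qed
qed

lemma q_bounds:
  obtains B R where "0 < B" "1 \<le> R"
    "\<And>\<xi> e k. \<xi> \<in> S \<Longrightarrow> 0 \<le> e \<Longrightarrow> e \<le> K \<Longrightarrow> cmod (coeff (q e \<xi>) k) \<le> B"
    "\<And>\<xi> e z. \<xi> \<in> S \<Longrightarrow> 0 \<le> e \<Longrightarrow> e \<le> K \<Longrightarrow> poly (q e \<xi>) z = 0 \<Longrightarrow> cmod z \<le> R"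
proof -
  obtain B0 where B0: "0 < B0"
    "\<And>\<xi> k. \<xi> \<in> S \<Longrightarrow> \<bar>coeff (p \<xi>) k\<bar> \<le> B0" "\<And>\<xi> k. \<xi> \<in> S \<Longrightarrow> \<bar>coeff (p1 \<xi>) k\<bar> \<le> B0"
    "\<And>\<xi> k. \<xi> \<in> S \<Longrightarrow> \<bar>coeff (p2 \<xi>) k\<bar> \<le> B0"
    using coeff_bounds by metis
  let ?B = "B0 + \<bar>K\<bar> * B0 + K\<^sup>2 * B0"
  have Bpos: "0 < ?B" using B0(1) by (intro add_pos_nonneg) auto
  have c: "cmod (coeff (q e \<xi>) k) \<le> ?B" if "\<xi> \<in> S" "0 \<le> e" "e \<le> K" for \<xi> e k
  proof -
    have "cmod (coeff (q e \<xi>) k) \<le> cmod (of_real (coeff (p \<xi>) k))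
        + cmod (\<i> * of_real e * of_real (coeff (p1 \<xi>) k)) + cmod (of_real (e\<^sup>2 * coeff (p2 \<xi>) k))"
      unfolding coeff_qpoly by (intro norm_triangle_le_diff add_right_mono norm_triangle_ineq4)
    also have "\<dots> = \<bar>coeff (p \<xi>) k\<bar> + e * \<bar>coeff (p1 \<xi>) k\<bar> + e\<^sup>2 * \<bar>coeff (p2 \<xi>) k\<bar>"
      unfolding norm_mult norm_of_real using that by (simp add: abs_mult)
    also have "\<dots> \<le> ?B"
      using that B0 by (intro add_mono mult_mono power_mono) auto
    finally show ?thesis .
  qed
  show thesis
  proof (rule that [OF Bpos _ c])
    show "1 \<le> 1 + real m * ?B" using Bpos by simp
    show "cmod z \<le> 1 + real m * ?B" if "\<xi> \<in> S" "0 \<le> e" "e \<le> K" "poly (q e \<xi>) z = 0" for \<xi> e z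
      using monic_root_bound [of "q e \<xi>" ?B z] q_monic [OF that(1)] c [OF that(1-3)] that(4) by simp
  qed
qed

text \<open>
  Write a root as \<open>z = x + \<i> y\<close> and \<open>G = p - e\<^sup>2 p2\<close>. The imaginary
  and the real part of the equation \<open>q(z) = 0\<close> show that \<open>e p1(x)\<close> and
  \<open>e G(x)\<close> are bounded by a multiple of \<open>y\<close>. Since \<open>W1 + e\<^sup>2 W2 =
  G' p1 - G p1'\<close>, a lower bound for this expression on the real axis is a lower bound for
  \<open>y / e\<close>.
\<close>

lemma spectral_gap_from_bezoutian:
  assumes "0 < K" and \<phi>: "\<And>e. 0 < e \<Longrightarrow> 0 < \<phi> e"
    and W: "\<And>R. \<exists>c>0. \<forall>\<xi>\<in>S. \<forall>e. 0 < e \<and> e \<le> K \<longrightarrow> (\<forall>x. \<bar>x\<bar> \<le> R \<longrightarrow>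
      c * \<phi> e \<le> interlacing_triple.W1 (p \<xi>) (p1 \<xi>) x + e\<^sup>2 * interlacing_triple.W2 (p1 \<xi>) (p2 \<xi>) x)"
  shows "\<exists>c>0. \<forall>\<xi>\<in>S. \<forall>e. 0 < e \<and> e \<le> K \<longrightarrow> (\<forall>z. poly (q e \<xi>) z = 0 \<longrightarrow> c * (e * \<phi> e) \<le> Im z)"
proof -
  obtain B where B: "0 < B"
    "\<And>\<xi> k. \<xi> \<in> S \<Longrightarrow> \<bar>coeff (p \<xi>) k\<bar> \<le> B" "\<And>\<xi> k. \<xi> \<in> S \<Longrightarrow> \<bar>coeff (p1 \<xi>) k\<bar> \<le> B"
    "\<And>\<xi> k. \<xi> \<in> S \<Longrightarrow> \<bar>coeff (p2 \<xi>) k\<bar> \<le> B"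
    "\<And>\<xi> k. \<xi> \<in> S \<Longrightarrow> \<bar>coeff (pderiv (p \<xi>)) k\<bar> \<le> B"
    "\<And>\<xi> k. \<xi> \<in> S \<Longrightarrow> \<bar>coeff (pderiv (p1 \<xi>)) k\<bar> \<le> B"
    "\<And>\<xi> k. \<xi> \<in> S \<Longrightarrow> \<bar>coeff (pderiv (p2 \<xi>)) k\<bar> \<le> B"
    by (rule coeff_bounds) blast
  obtain B' R where R: "1 \<le> R"
    "\<And>\<xi> e z. \<xi> \<in> S \<Longrightarrow> 0 \<le> e \<Longrightarrow> e \<le> K \<Longrightarrow> poly (q e \<xi>) z = 0 \<Longrightarrow> cmod z \<le> R"
    using q_bounds [of K] by metis
  obtain c0 where c0: "0 < c0" "\<And>\<xi> e x. \<xi> \<in> S \<Longrightarrow> 0 < e \<Longrightarrow> e \<le> K \<Longrightarrow> \<bar>x\<bar> \<le> R \<Longrightarrow>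
      c0 * \<phi> e \<le> interlacing_triple.W1 (p \<xi>) (p1 \<xi>) x + e\<^sup>2 * interlacing_triple.W2 (p1 \<xi>) (p2 \<xi>) x"
    using W [of R] by metis
  \<comment> \<open>\<open>V\<close> bounds the values on the disc of radius \<open>R\<close>, \<open>L y\<close> the change from \<open>x\<close> to \<open>z\<close>;
    \<open>C\<close> collects the constants of the final estimate.\<close>
  define V where "V = real (Suc m) * B * R ^ m"
  define L where "L = real (Suc m) * B * (real m * R ^ m)"
  have V: "0 < V" using B(1) R(1) by (simp add: V_def)
  have L: "0 \<le> L" using B(1) R(1) by (simp add: L_def)
  define C where "C = V * (1 + K\<^sup>2) * (L * (1 + K\<^sup>2 + K)) + V * (L * (K\<^sup>2 + K * (1 + K\<^sup>2))) + 1"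
  have C: "0 < C" using V L assms(1) by (simp add: C_def add_nonneg_pos)
  have "c0 / C * (e * \<phi> e) \<le> Im z"
    if \<xi>: "\<xi> \<in> S" and e: "0 < e" "e \<le> K" and z: "poly (q e \<xi>) z = 0" for \<xi> e z
  proof -
    interpret interlacing_triple "p \<xi>" "p1 \<xi>" "p2 \<xi>" by (rule triple [OF \<xi>])
    define x where "x = Re z"
    define y where "y = Im z"
    have root: "cpoly (p \<xi>) z - \<i> * of_real e * cpoly (p1 \<xi>) z - of_real (e\<^sup>2) * cpoly (p2 \<xi>) z = 0"
      using z by (simp add: poly_qpoly)
    have y: "0 < y" unfolding y_def by (rule root_upper_half_plane [OF e(1) root])
    have zR: "cmod z \<le> R" using R(2) [OF \<xi> _ e(2) z] e by simp
    have xR: "\<bar>x\<bar> \<le> R" using zR abs_Re_le_cmod [of z] by (simp add: x_def)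
    have xz: "cmod (of_real x) \<le> R" using xR by simp
    have lip: "\<bar>Im (cpoly f z)\<bar> \<le> L * y" "\<bar>Re (cpoly f z) - poly f x\<bar> \<le> L * y"
      if "degree f \<le> m" "\<And>i. \<bar>coeff f i\<bar> \<le> B" for f
    proof -
      have "cmod (cpoly f z - of_real (poly f x)) \<le> L * y"
        using cpoly_bounds(2) [OF that R(1) zR] y by (simp add: L_def x_def y_def)
      then show "\<bar>Im (cpoly f z)\<bar> \<le> L * y" "\<bar>Re (cpoly f z) - poly f x\<bar> \<le> L * y"
        using abs_Im_le_cmod [of "cpoly f z - of_real (poly f x)"]
          abs_Re_le_cmod [of "cpoly f z - of_real (poly f x)"] by simp_all
    qed
    have val: "\<bar>poly f x\<bar> \<le> V" if "degree f \<le> m" "\<And>i. \<bar>coeff f i\<bar> \<le> B" for f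
      using cpoly_bounds(1) [OF that R(1) xz] by (simp add: V_def)
    have dg: "degree (p \<xi>) \<le> m" "degree (p1 \<xi>) \<le> m" "degree (p2 \<xi>) \<le> m"
      "degree (pderiv (p \<xi>)) \<le> m" "degree (pderiv (p1 \<xi>)) \<le> m" "degree (pderiv (p2 \<xi>)) \<le> m"
      using degrees [OF \<xi>] degree_p [OF \<xi>] by (simp_all add: degree_pderiv)
    note b = B(2-) [OF \<xi>]
    define G where "G = poly (p \<xi>) x - e\<^sup>2 * poly (p2 \<xi>) x"
    have Ly: "0 \<le> L * y" using L y by simp
    have e2: "e\<^sup>2 \<le> K\<^sup>2" using e by (intro power_mono) auto
    have re: "Re (cpoly (p \<xi>) z) - e\<^sup>2 * Re (cpoly (p2 \<xi>) z) = - (e * Im (cpoly (p1 \<xi>) z))"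
      using arg_cong [OF root, of Re] by simp
    have im: "Im (cpoly (p \<xi>) z) - e\<^sup>2 * Im (cpoly (p2 \<xi>) z) = e * Re (cpoly (p1 \<xi>) z)"
      using arg_cong [OF root, of Im] by simp
    \<comment> \<open>The imaginary part of the equation controls the value of \<open>p1\<close>.\<close>
    have A1: "e * \<bar>poly (p1 \<xi>) x\<bar> \<le> L * (1 + K\<^sup>2 + K) * y"
    proof -
      have "e * \<bar>poly (p1 \<xi>) x\<bar> = \<bar>e * poly (p1 \<xi>) x\<bar>" using e by (simp add: abs_mult)
      also have "e * poly (p1 \<xi>) x = Im (cpoly (p \<xi>) z) - e\<^sup>2 * Im (cpoly (p2 \<xi>) z)
          - e * (Re (cpoly (p1 \<xi>) z) - poly (p1 \<xi>) x)"
        unfolding im by (simp add: algebra_simps)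
      also have "\<bar>\<dots>\<bar> \<le> \<bar>Im (cpoly (p \<xi>) z)\<bar> + \<bar>e\<^sup>2 * Im (cpoly (p2 \<xi>) z)\<bar>
          + \<bar>e * (Re (cpoly (p1 \<xi>) z) - poly (p1 \<xi>) x)\<bar>"
        by linarith
      also have "\<dots> = \<bar>Im (cpoly (p \<xi>) z)\<bar> + e\<^sup>2 * \<bar>Im (cpoly (p2 \<xi>) z)\<bar>
          + e * \<bar>Re (cpoly (p1 \<xi>) z) - poly (p1 \<xi>) x\<bar>"
        using e by (simp add: abs_mult)
      also have "\<dots> \<le> L * y + K\<^sup>2 * (L * y) + K * (L * y)"
        using lip(1) [OF dg(1) b(1)] lip(1) [OF dg(3) b(3)] lip(2) [OF dg(2) b(2)] e e2 Ly
        by (intro add_mono mult_mono) auto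
      finally show ?thesis by (simp add: algebra_simps)
    qed
    \<comment> \<open>The real part controls \<open>G\<close>.\<close>
    have A2: "e * \<bar>G\<bar> \<le> L * (K\<^sup>2 + K * (1 + K\<^sup>2)) * y"
    proof -
      have "G = - (e * Im (cpoly (p1 \<xi>) z)) - (Re (cpoly (p \<xi>) z) - poly (p \<xi>) x)
          + e\<^sup>2 * (Re (cpoly (p2 \<xi>) z) - poly (p2 \<xi>) x)"
        unfolding G_def re [symmetric] by (simp add: algebra_simps)
      then have "\<bar>G\<bar> \<le> \<bar>e * Im (cpoly (p1 \<xi>) z)\<bar> + \<bar>Re (cpoly (p \<xi>) z) - poly (p \<xi>) x\<bar>
          + \<bar>e\<^sup>2 * (Re (cpoly (p2 \<xi>) z) - poly (p2 \<xi>) x)\<bar>"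
        by linarith
      also have "\<dots> = e * \<bar>Im (cpoly (p1 \<xi>) z)\<bar> + \<bar>Re (cpoly (p \<xi>) z) - poly (p \<xi>) x\<bar>
          + e\<^sup>2 * \<bar>Re (cpoly (p2 \<xi>) z) - poly (p2 \<xi>) x\<bar>"
        using e by (simp add: abs_mult)
      also have "\<dots> \<le> K * (L * y) + L * y + K\<^sup>2 * (L * y)"
        using lip(1) [OF dg(2) b(2)] lip(2) [OF dg(3) b(3)] lip(2) [OF dg(1) b(1)] e e2 Ly
        by (intro add_mono mult_mono) auto
      finally have "e * \<bar>G\<bar> \<le> K * (K * (L * y) + L * y + K\<^sup>2 * (L * y))"
        using e Ly by (intro mult_mono) auto
      then show ?thesis by (simp add: algebra_simps power2_eq_square)
    qed
    have "W1 x + e\<^sup>2 * W2 x = (poly (pderiv (p \<xi>)) x - e\<^sup>2 * poly (pderiv (p2 \<xi>)) x) * poly (p1 \<xi>) x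
        - G * poly (pderiv (p1 \<xi>)) x"
      by (simp add: W1_def W2_def G_def algebra_simps)
    also have "\<dots> \<le> \<bar>poly (pderiv (p \<xi>)) x - e\<^sup>2 * poly (pderiv (p2 \<xi>)) x\<bar> * \<bar>poly (p1 \<xi>) x\<bar>
        + \<bar>G\<bar> * \<bar>poly (pderiv (p1 \<xi>)) x\<bar>"
      unfolding abs_mult [symmetric] by linarith
    also have "\<dots> \<le> V * (1 + K\<^sup>2) * \<bar>poly (p1 \<xi>) x\<bar> + \<bar>G\<bar> * V"
    proof (intro add_mono mult_right_mono mult_left_mono)
      have "\<bar>e\<^sup>2 * poly (pderiv (p2 \<xi>)) x\<bar> \<le> K\<^sup>2 * V"
        unfolding abs_mult using val [OF dg(6) b(6)] e2 V by (intro mult_mono) auto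
      then show "\<bar>poly (pderiv (p \<xi>)) x - e\<^sup>2 * poly (pderiv (p2 \<xi>)) x\<bar> \<le> V * (1 + K\<^sup>2)"
        using val [OF dg(4) b(4)] by (simp add: algebra_simps)
      show "\<bar>poly (pderiv (p1 \<xi>)) x\<bar> \<le> V" by (rule val [OF dg(5) b(5)])
    qed auto
    finally have "e * (W1 x + e\<^sup>2 * W2 x) \<le> e * (V * (1 + K\<^sup>2) * \<bar>poly (p1 \<xi>) x\<bar> + \<bar>G\<bar> * V)"
      using e by (intro mult_left_mono) auto
    also have "\<dots> = V * (1 + K\<^sup>2) * (e * \<bar>poly (p1 \<xi>) x\<bar>) + V * (e * \<bar>G\<bar>)"
      by (simp add: algebra_simps)
    also have "\<dots> \<le> V * (1 + K\<^sup>2) * (L * (1 + K\<^sup>2 + K) * y) + V * (L * (K\<^sup>2 + K * (1 + K\<^sup>2)) * y)"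
      using A1 A2 V by (intro add_mono mult_left_mono mult_nonneg_nonneg) auto
    also have "\<dots> \<le> C * y" using y by (simp add: C_def algebra_simps)
    finally have "e * (c0 * \<phi> e) \<le> C * y"
      using c0(2) [OF \<xi> e xR] e by (meson mult_left_mono less_imp_le order_trans)
    then show ?thesis using C by (simp add: y_def field_simps)
  qed
  moreover have "0 < c0 / C" using c0 C by simp
  ultimately show ?thesis by blast
qed

lemma W_continuous:
  "continuous_on (S \<times> X) (\<lambda>(\<xi>, x). interlacing_triple.W1 (p \<xi>) (p1 \<xi>) x)"
  "continuous_on (S \<times> X) (\<lambda>(\<xi>, x). interlacing_triple.W2 (p1 \<xi>) (p2 \<xi>) x)"
proof -
  have c: "continuous_on (S \<times> X) (\<lambda>y. poly (f (fst y)) (snd y))" if "poly_family S m f" for f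
    using poly_family_continuous(1) [OF that, of X] by (simp add: case_prod_beta)
  note cs = c [OF family(1)] c [OF family(2)] c [OF family(3)] c [OF poly_family_pderiv [OF family(1)]]
    c [OF poly_family_pderiv [OF family(2)]] c [OF poly_family_pderiv [OF family(3)]]
  have "continuous_on (S \<times> X) (\<lambda>y. poly (pderiv (p (fst y))) (snd y) * poly (p1 (fst y)) (snd y)
      - poly (p (fst y)) (snd y) * poly (pderiv (p1 (fst y))) (snd y))"
    by (intro continuous_intros cs)
  then show "continuous_on (S \<times> X) (\<lambda>(\<xi>, x). interlacing_triple.W1 (p \<xi>) (p1 \<xi>) x)"
    by (rule continuous_on_eq) (auto simp: interlacing_triple.W1_def [OF triple])
  have "continuous_on (S \<times> X) (\<lambda>y. poly (pderiv (p1 (fst y))) (snd y) * poly (p2 (fst y)) (snd y)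
      - poly (p1 (fst y)) (snd y) * poly (pderiv (p2 (fst y))) (snd y))"
    by (intro continuous_intros cs)
  then show "continuous_on (S \<times> X) (\<lambda>(\<xi>, x). interlacing_triple.W2 (p1 \<xi>) (p2 \<xi>) x)"
    by (rule continuous_on_eq) (auto simp: interlacing_triple.W2_def [OF triple])
qed

text \<open>
  \<open>W1 + W2\<close> is positive and therefore bounded below on compact sets; replacing it by
  \<open>W1 + e\<^sup>2 W2\<close> costs a factor \<open>e\<^sup>2\<close>.
\<close>

lemma spectral_gap:
  assumes "0 < K"
  shows "\<exists>c>0. \<forall>\<xi>\<in>S. \<forall>e. 0 < e \<and> e \<le> K \<longrightarrow> (\<forall>z. poly (q e \<xi>) z = 0 \<longrightarrow> c * e ^ 3 \<le> Im z)"
proof -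
  have "\<exists>c>0. \<forall>\<xi>\<in>S. \<forall>e. 0 < e \<and> e \<le> K \<longrightarrow> (\<forall>z. poly (q e \<xi>) z = 0 \<longrightarrow> c * (e * e\<^sup>2) \<le> Im z)"
  proof (rule spectral_gap_from_bezoutian [OF assms])
    fix R :: real
    have "compact (S \<times> {-R..R})" using compact by (intro compact_Times) auto
    moreover have "continuous_on (S \<times> {-R..R}) (\<lambda>y. (\<lambda>(\<xi>, x). interlacing_triple.W1 (p \<xi>) (p1 \<xi>) x) y
        + (\<lambda>(\<xi>, x). interlacing_triple.W2 (p1 \<xi>) (p2 \<xi>) x) y)"
      by (intro continuous_on_add W_continuous)
    ultimately obtain c where c: "0 < c" "\<And>y. y \<in> S \<times> {-R..R} \<Longrightarrow>
      c \<le> (\<lambda>(\<xi>, x). interlacing_triple.W1 (p \<xi>) (p1 \<xi>) x) y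
        + (\<lambda>(\<xi>, x). interlacing_triple.W2 (p1 \<xi>) (p2 \<xi>) x) y"
      by (rule compact_pos_lower_bound) (use interlacing_triple.W_sum_pos triple in fastforce)+
    let ?k = "max 1 (K\<^sup>2)"
    have "c / ?k * e\<^sup>2 \<le> interlacing_triple.W1 (p \<xi>) (p1 \<xi>) x + e\<^sup>2 * interlacing_triple.W2 (p1 \<xi>) (p2 \<xi>) x"
      if "\<xi> \<in> S" "0 < e" "e \<le> K" "\<bar>x\<bar> \<le> R" for \<xi> e x
    proof -
      interpret interlacing_triple "p \<xi>" "p1 \<xi>" "p2 \<xi>" by (rule triple [OF that(1)])
      have e2: "e\<^sup>2 \<le> ?k" using that by (simp add: le_max_iff_disj power_mono)
      have "c \<le> W1 x + W2 x" using c(2) [of "(\<xi>, x)"] that by (auto simp: abs_le_iff)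
      then have "c * e\<^sup>2 \<le> (W1 x + W2 x) * e\<^sup>2" by (intro mult_right_mono) auto
      also have "\<dots> = W1 x * e\<^sup>2 + e\<^sup>2 * W2 x" by (simp add: algebra_simps)
      also have "\<dots> \<le> W1 x * ?k + ?k * (e\<^sup>2 * W2 x)"
      proof (rule add_mono)
        show "W1 x * e\<^sup>2 \<le> W1 x * ?k" using e2 W_nonneg(1) by (intro mult_left_mono)
        have "1 * (e\<^sup>2 * W2 x) \<le> ?k * (e\<^sup>2 * W2 x)"
          using W_nonneg(2) by (intro mult_right_mono) auto
        then show "e\<^sup>2 * W2 x \<le> ?k * (e\<^sup>2 * W2 x)" by simp
      qed
      also have "\<dots> = ?k * (W1 x + e\<^sup>2 * W2 x)" by (simp only: distrib_left mult.commute)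
      finally have "c * e\<^sup>2 / ?k \<le> W1 x + e\<^sup>2 * W2 x"
        by (subst pos_divide_le_eq) (simp_all add: mult.commute)
      then show ?thesis by simp
    qed
    moreover have "0 < c / ?k" using c(1) by simp
    ultimately show "\<exists>c>0. \<forall>\<xi>\<in>S. \<forall>e. 0 < e \<and> e \<le> K \<longrightarrow> (\<forall>x. \<bar>x\<bar> \<le> R \<longrightarrow> c * e\<^sup>2
      \<le> interlacing_triple.W1 (p \<xi>) (p1 \<xi>) x + e\<^sup>2 * interlacing_triple.W2 (p1 \<xi>) (p2 \<xi>) x)"
      by blast
  qed simp
  then show ?thesis by (simp add: power3_eq_cube power2_eq_square mult.assoc)
qed

text \<open>
  Here \<open>W1\<close> alone is positive everywhere.
\<close>

lemma strict_spectral_gap: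
  assumes "0 < K" and strict: "\<And>\<xi>. \<xi> \<in> S \<Longrightarrow> strictly_interlace (p1 \<xi>) (p \<xi>)"
  shows "\<exists>c>0. \<forall>\<xi>\<in>S. \<forall>e. 0 < e \<and> e \<le> K \<longrightarrow> (\<forall>z. poly (q e \<xi>) z = 0 \<longrightarrow> c * e \<le> Im z)"
proof -
  have "\<exists>c>0. \<forall>\<xi>\<in>S. \<forall>e. 0 < e \<and> e \<le> K \<longrightarrow> (\<forall>z. poly (q e \<xi>) z = 0 \<longrightarrow> c * (e * 1) \<le> Im z)"
  proof (rule spectral_gap_from_bezoutian [OF assms(1)])
    fix R :: real
    have "compact (S \<times> {-R..R})" using compact by (intro compact_Times) auto
    then obtain c where c: "0 < c" "\<And>y. y \<in> S \<times> {-R..R} \<Longrightarrow>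
      c \<le> (\<lambda>(\<xi>, x). interlacing_triple.W1 (p \<xi>) (p1 \<xi>) x) y"
      by (rule compact_pos_lower_bound [OF _ W_continuous(1)])
        (use interlacing_triple.W1_pos [OF triple strict] in auto)
    have "c * 1 \<le> interlacing_triple.W1 (p \<xi>) (p1 \<xi>) x + e\<^sup>2 * interlacing_triple.W2 (p1 \<xi>) (p2 \<xi>) x"
      if "\<xi> \<in> S" "0 < e" "e \<le> K" "\<bar>x\<bar> \<le> R" for \<xi> e x
    proof -
      interpret interlacing_triple "p \<xi>" "p1 \<xi>" "p2 \<xi>" by (rule triple [OF that(1)])
      have "c \<le> W1 x" using c(2) [of "(\<xi>, x)"] that by (auto simp: abs_le_iff)
      moreover have "0 \<le> e\<^sup>2 * W2 x" using W_nonneg(2) by simp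
      ultimately show ?thesis by simp
    qed
    then show "\<exists>c>0. \<forall>\<xi>\<in>S. \<forall>e. 0 < e \<and> e \<le> K \<longrightarrow> (\<forall>x. \<bar>x\<bar> \<le> R \<longrightarrow> c * 1
      \<le> interlacing_triple.W1 (p \<xi>) (p1 \<xi>) x + e\<^sup>2 * interlacing_triple.W2 (p1 \<xi>) (p2 \<xi>) x)"
      using c(1) by blast
  qed simp
  then show ?thesis by simp
qed

text \<open>
  \<open>|p| + |p'|\<close> has a positive lower bound, since \<open>p\<close> has only simple roots.
  For small \<open>e\<close> the polynomial \<open>q\<close> and its derivative are close to
  \<open>p\<close> and \<open>p'\<close>, and \<open>q\<close> vanishes at the point in question.
\<close>

lemma simple_spectrum:
  assumes "\<And>\<xi>. \<xi> \<in> S \<Longrightarrow> distinct (root_list (p \<xi>))"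
  shows "\<exists>e0>0. \<exists>c>0. \<forall>\<xi>\<in>S. \<forall>e. 0 < e \<and> e \<le> e0 \<longrightarrow> (\<forall>z. poly (q e \<xi>) z = 0 \<longrightarrow>
    c \<le> cmod (poly (pderiv (q e \<xi>)) z))"
proof -
  obtain B where B: "0 < B" "\<And>\<xi> k. \<xi> \<in> S \<Longrightarrow> \<bar>coeff (p1 \<xi>) k\<bar> \<le> B"
    "\<And>\<xi> k. \<xi> \<in> S \<Longrightarrow> \<bar>coeff (p2 \<xi>) k\<bar> \<le> B"
    "\<And>\<xi> k. \<xi> \<in> S \<Longrightarrow> \<bar>coeff (pderiv (p1 \<xi>)) k\<bar> \<le> B"
    "\<And>\<xi> k. \<xi> \<in> S \<Longrightarrow> \<bar>coeff (pderiv (p2 \<xi>)) k\<bar> \<le> B"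
    using coeff_bounds by metis
  obtain R where R: "1 \<le> R"
    "\<And>\<xi> e z. \<xi> \<in> S \<Longrightarrow> 0 \<le> e \<Longrightarrow> e \<le> 1 \<Longrightarrow> poly (q e \<xi>) z = 0 \<Longrightarrow> cmod z \<le> R"
    using q_bounds [of 1] by metis
  define V where "V = real (Suc m) * B * R ^ m"
  have V: "0 < V" using B(1) R(1) by (simp add: V_def)
  have comp: "compact (S \<times> cball (0::complex) R)" using compact by (intro compact_Times) auto
  have cont: "continuous_on (S \<times> cball (0::complex) R) (\<lambda>y. cmod ((\<lambda>(\<xi>, z). cpoly (p \<xi>) z) y)
      + cmod ((\<lambda>(\<xi>, z). cpoly (pderiv (p \<xi>)) z) y))"
    by (intro continuous_on_add continuous_on_norm poly_family_continuous(2) [OF family(1)]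
        poly_family_continuous(2) [OF poly_family_pderiv [OF family(1)]])
  have pos: "0 < cmod (cpoly (p \<xi>) z) + cmod (cpoly (pderiv (p \<xi>)) z)" if "\<xi> \<in> S" for \<xi> z
  proof (cases "cpoly (p \<xi>) z = 0")
    case True
    have rr: "real_rooted (p \<xi>)" using triple [OF that] by (auto simp: interlacing_triple_def interlace_def)
    then have "z \<in> \<real>" using True by (auto simp: real_rooted_def cpoly_def)
    then obtain x where x: "z = of_real x" by (auto elim: Reals_cases)
    then have "poly (p \<xi>) x = 0" using True by simp
    then have "poly (pderiv (p \<xi>)) x \<noteq> 0"
      using simple_pderiv_nonzero rr assms that by blast
    then show ?thesis using x by (simp add: add_nonneg_pos)
  qed (simp add: add_pos_nonneg)
  obtain c where c: "0 < c" "\<And>\<xi> z. \<xi> \<in> S \<Longrightarrow> cmod z \<le> R \<Longrightarrow>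
      c \<le> cmod (cpoly (p \<xi>) z) + cmod (cpoly (pderiv (p \<xi>)) z)"
    by (rule compact_pos_lower_bound [OF comp cont]) (use pos in auto)
  \<comment> \<open>Passing from \<open>p\<close> to \<open>q\<close>, and from \<open>p'\<close> to \<open>q'\<close>, costs \<open>2 e V\<close> each; this choice keeps the sum
    below half of \<open>c\<close>.\<close>
  define e0 where "e0 = min 1 (c / (8 * V))"
  have e0: "0 < e0" using c(1) V by (simp add: e0_def)
  have "c / 2 \<le> cmod (poly (pderiv (q e \<xi>)) z)"
    if \<xi>: "\<xi> \<in> S" and e: "0 < e" "e \<le> e0" and z: "poly (q e \<xi>) z = 0" for \<xi> e z
  proof -
    have e1: "e \<le> 1" and eV: "4 * e * V \<le> c / 2"
      using e V by (simp_all add: e0_def field_simps)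
    have zR: "cmod z \<le> R" using R(2) [OF \<xi> _ e1 z] e by simp
    have near: "cmod (cpoly f z) \<le> cmod (poly (qpoly e f f1 f2) z) + 2 * e * V"
      if "degree f1 \<le> m" "degree f2 \<le> m" "\<And>k. \<bar>coeff f1 k\<bar> \<le> B" "\<And>k. \<bar>coeff f2 k\<bar> \<le> B" for f f1 f2
    proof -
      have "cpoly f z = poly (qpoly e f f1 f2) z + \<i> * of_real e * cpoly f1 z + of_real (e\<^sup>2) * cpoly f2 z"
        by (simp add: poly_qpoly)
      then have "cmod (cpoly f z) \<le> cmod (poly (qpoly e f f1 f2) z) + cmod (\<i> * of_real e * cpoly f1 z)
          + cmod (of_real (e\<^sup>2) * cpoly f2 z)"
        by (metis norm_triangle_ineq norm_triangle_mono order_refl)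
      also have "\<dots> = cmod (poly (qpoly e f f1 f2) z) + e * cmod (cpoly f1 z) + e\<^sup>2 * cmod (cpoly f2 z)"
        unfolding norm_mult norm_of_real using e by simp
      also have "\<dots> \<le> cmod (poly (qpoly e f f1 f2) z) + e * V + e * V"
        using cpoly_bounds(1) [OF that(1,3) R(1) zR] cpoly_bounds(1) [OF that(2,4) R(1) zR] e e1
        by (intro add_mono mult_mono) (auto simp: V_def power2_eq_square mult_left_le)
      finally show ?thesis by (simp add: algebra_simps)
    qed
    have dg: "degree (p1 \<xi>) \<le> m" "degree (p2 \<xi>) \<le> m" "degree (pderiv (p1 \<xi>)) \<le> m" "degree (pderiv (p2 \<xi>)) \<le> m"
      using degrees [OF \<xi>] by (simp_all add: degree_pderiv)
    have "cmod (cpoly (p \<xi>) z) \<le> 2 * e * V"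
      using near [OF dg(1,2) B(2) [OF \<xi>] B(3) [OF \<xi>], of "p \<xi>"] z by simp
    moreover have "cmod (cpoly (pderiv (p \<xi>)) z) \<le> cmod (poly (pderiv (q e \<xi>)) z) + 2 * e * V"
      unfolding pderiv_qpoly by (rule near [OF dg(3,4) B(4) [OF \<xi>] B(5) [OF \<xi>]])
    ultimately show ?thesis using c(2) [OF \<xi> zR] eV by linarith
  qed
  moreover have "0 < c / 2" using c(1) by simp
  ultimately show ?thesis using e0 by blast
qed

end

section \<open>Decay for scalar linear differential equations\<close>

text \<open>
  A chain stands for the function \<open>W 0\<close> and its images under the powers of \<open>D = -
  \<i> d/dt\<close>. The factor \<open>\<i>\<close> makes \<open>exp (\<i> z t)\<close> an eigenfunction
  of \<open>D\<close> with eigenvalue \<open>z\<close>. Carrying the whole sequence allows differential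
  operators to be applied and factored as polynomials.
\<close>

definition derivative_chain :: "(nat \<Rightarrow> real \<Rightarrow> complex) \<Rightarrow> bool" where
  "derivative_chain W \<longleftrightarrow>
     (\<forall>n. \<forall>t\<ge>0. (W n has_vector_derivative \<i> * W (Suc n) t) (at t within {0..}))"

text \<open>
  The operator \<open>D\<^sup>n q(D)\<close> applied to \<open>W 0\<close>.
\<close>

definition apply_poly :: "complex poly \<Rightarrow> (nat \<Rightarrow> real \<Rightarrow> complex) \<Rightarrow> nat \<Rightarrow> real \<Rightarrow> complex" where
  "apply_poly q W n t = (\<Sum>k\<le>degree q. coeff q k * W (n + k) t)"

lemma apply_poly_0 [simp]: "apply_poly 0 W n t = 0"
  by (simp add: apply_poly_def)

lemma apply_poly_pCons [simp]:
  "apply_poly (pCons a q) W n t = a * W n t + apply_poly q W (Suc n) t"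
proof (cases "q = 0")
  case False
  then show ?thesis
    by (simp add: apply_poly_def sum.atMost_Suc_shift del: sum.atMost_Suc)
qed (simp add: apply_poly_def)

lemma apply_poly_add [simp]: "apply_poly (p + q) W n t = apply_poly p W n t + apply_poly q W n t"
  by (induction p q arbitrary: n rule: poly_induct2) (simp_all add: algebra_simps)

lemma apply_poly_smult [simp]: "apply_poly (smult c q) W n t = c * apply_poly q W n t"
  by (induction q arbitrary: n) (simp_all add: algebra_simps)

lemma apply_poly_sum [simp]: "apply_poly (sum f A) W n t = (\<Sum>x\<in>A. apply_poly (f x) W n t)"
  by (induction A rule: infinite_finite_induct) simp_all

lemma apply_poly_linear_factor:
  "apply_poly ([:-z, 1:] * q) W n t = apply_poly q W (Suc n) t - z * apply_poly q W n t"
proof -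
  have "[:-z, 1:] * q = smult (-z) q + pCons 0 q" by simp
  then show ?thesis by (simp only: apply_poly_add apply_poly_smult apply_poly_pCons) simp
qed

lemma apply_poly_first_order:
  "apply_poly q (\<lambda>n t. W (Suc n) t - z * W n t) n t = apply_poly ([:-z, 1:] * q) W n t"
  unfolding apply_poly_linear_factor
  by (induction q arbitrary: n) (simp_all add: algebra_simps)

lemma apply_poly_norm_le:
  assumes "degree q < m" "\<And>k. cmod (coeff q k) \<le> B"
  shows "cmod (apply_poly q W 0 t) \<le> B * (\<Sum>k<m. cmod (W k t))"
proof -
  have B: "0 \<le> B" using assms(2) [of 0] norm_ge_zero [of "coeff q 0"] by linarith
  have "cmod (apply_poly q W 0 t) \<le> (\<Sum>k\<le>degree q. cmod (coeff q k * W k t))"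
    by (simp add: apply_poly_def norm_sum)
  also have "\<dots> \<le> (\<Sum>k\<le>degree q. B * cmod (W k t))"
    unfolding norm_mult using assms(2) by (intro sum_mono mult_right_mono) auto
  also have "\<dots> \<le> (\<Sum>k<m. B * cmod (W k t))"
    using assms(1) B by (intro sum_mono2) auto
  finally show ?thesis by (simp add: sum_distrib_left)
qed

lemma apply_poly_derivative:
  assumes "derivative_chain W" "0 \<le> t"
  shows "((\<lambda>t. apply_poly q W n t) has_vector_derivative \<i> * apply_poly q W (Suc n) t) (at t within {0..})"
proof -
  have "((\<lambda>t. \<Sum>k\<le>degree q. coeff q k * W (n + k) t) has_vector_derivative
      (\<Sum>k\<le>degree q. coeff q k * (\<i> * W (Suc (n + k)) t))) (at t within {0..})"
    using assms unfolding derivative_chain_def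
    by (intro has_vector_derivative_sum has_vector_derivative_mult_right) auto
  then show ?thesis
    by (simp add: apply_poly_def sum_distrib_left algebra_simps)
qed

lemma exp_scaleR_has_vector_derivative:
  fixes A :: complex
  shows "((\<lambda>s. exp (s *\<^sub>R A)) has_vector_derivative exp (s *\<^sub>R A) * A) (at s within T)"
  by (rule exp_scaleR_has_vector_derivative_right)

text \<open>
  The product with \<open>exp (- \<i> z t)\<close> is constant.
\<close>

lemma exponential_solution:
  fixes v :: "real \<Rightarrow> complex"
  assumes "\<And>t. 0 \<le> t \<Longrightarrow> (v has_vector_derivative \<i> * z * v t) (at t within {0..})" "0 \<le> t"
  shows "cmod (v t) = exp (- Im z * t) * cmod (v 0)"
proof -
  have d: "((\<lambda>s. exp (s *\<^sub>R (- \<i> * z)) * v s) has_vector_derivative 0) (at s within {0..})"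
    if "s \<in> {0..}" for s :: real
    using has_vector_derivative_mult [OF exp_scaleR_has_vector_derivative [of "- \<i> * z"] assms(1) [of s]]
      that by (simp add: algebra_simps)
  from has_vector_derivative_zero_constant [OF convex_real_interval(1) d]
  obtain c where c: "\<And>s. s \<in> {0..} \<Longrightarrow> exp (s *\<^sub>R (- \<i> * z)) * v s = c" by blast
  have "exp (t *\<^sub>R (- \<i> * z)) * v t = v 0"
    using c [of t] c [of 0] assms(2) by simp
  then have "cmod (exp (t *\<^sub>R (- \<i> * z))) * cmod (v t) = cmod (v 0)"
    by (metis norm_mult)
  then have "exp (Im z * t) * cmod (v t) = cmod (v 0)"
    by (simp add: norm_exp_eq_Re mult.commute)
  then show ?thesis by (auto simp: exp_minus field_simps)
qed

text \<open>
  Variation of constants. The rate is halved so that the forcing term decays strictly more slowly than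
  the homogeneous solutions, which excludes resonance and yields a constant independent of
  \<open>z\<close>.
\<close>

lemma first_order_decay:
  fixes w v :: "real \<Rightarrow> complex"
  assumes w: "\<And>t. 0 \<le> t \<Longrightarrow> (w has_vector_derivative \<i> * (v t + z * w t)) (at t within {0..})"
    and v: "\<And>t. 0 \<le> t \<Longrightarrow> cmod (v t) \<le> K * exp (- (\<gamma> / 2) * t)"
    and \<gamma>: "0 < \<gamma>" "\<gamma> \<le> Im z" and t: "0 \<le> t"
  shows "cmod (w t) \<le> exp (- (\<gamma> / 2) * t) * (cmod (w 0) + 2 * K / \<gamma>)"
proof (cases "t = 0")
  have "0 \<le> K * exp (- (\<gamma> / 2) * 0)" using v [of 0] norm_ge_zero [of "v 0"] by linarith
  then have K: "0 \<le> K" by simp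
  {
    case True
    then show ?thesis using K \<gamma> by simp
  next
    case False
    then have t0: "0 < t" using t by simp
    define \<sigma> where "\<sigma> = Im z"
    define \<rho> where "\<rho> = \<sigma> - \<gamma> / 2"
    have \<rho>: "\<gamma> / 2 \<le> \<rho>" "0 < \<rho>" using \<gamma> by (auto simp: \<rho>_def \<sigma>_def)
    \<comment> \<open>The product with the integrating factor grows at most at the rate \<open>\<rho>\<close>.\<close>
    define f where "f s = exp (s *\<^sub>R (- \<i> * z)) * w s" for s
    have df: "(f has_vector_derivative exp (s *\<^sub>R (- \<i> * z)) * (\<i> * v s)) (at s within {0..})"
      if "0 \<le> s" for s
      using has_vector_derivative_mult [OF exp_scaleR_has_vector_derivative [of "- \<i> * z"] w [OF that]]
      unfolding f_def by (simp add: algebra_simps)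
    have "norm (f t - f 0) \<le> K / \<rho> * exp (\<rho> * t) - K / \<rho> * exp (\<rho> * 0)"
    proof (rule differentiable_bound_general [OF t0])
      show "continuous_on {0..t} f"
      proof (rule continuous_on_vector_derivative)
        fix s assume "s \<in> {0..t}"
        then show "(f has_vector_derivative exp (s *\<^sub>R (- \<i> * z)) * (\<i> * v s)) (at s within {0..t})"
          by (intro has_vector_derivative_within_subset [OF df]) auto
      qed
      show "continuous_on {0..t} (\<lambda>s. K / \<rho> * exp (\<rho> * s))" by (intro continuous_intros)
      fix s assume s: "0 < s" "s < t"
      have "at s within {0..} = at s" using s by (intro at_within_interior) auto
      then show "(f has_vector_derivative exp (s *\<^sub>R (- \<i> * z)) * (\<i> * v s)) (at s)"
        using df [of s] s by simp
      show "((\<lambda>s. K / \<rho> * exp (\<rho> * s)) has_vector_derivative K * exp (\<rho> * s)) (at s)"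
        using \<rho> by (auto intro!: derivative_eq_intros simp: has_real_derivative_iff_has_vector_derivative [symmetric])
      have "cmod (exp (s *\<^sub>R (- \<i> * z)) * (\<i> * v s)) = exp (\<sigma> * s) * cmod (v s)"
        by (simp add: norm_mult norm_exp_eq_Re \<sigma>_def mult.commute)
      also have "\<dots> \<le> exp (\<sigma> * s) * (K * exp (- (\<gamma> / 2) * s))"
        using v [of s] s by (intro mult_left_mono) auto
      also have "\<dots> = K * exp (\<rho> * s)"
        by (simp add: \<rho>_def exp_add [symmetric] algebra_simps)
      finally show "cmod (exp (s *\<^sub>R (- \<i> * z)) * (\<i> * v s)) \<le> K * exp (\<rho> * s)" .
    qed
    also have "\<dots> \<le> K / \<rho> * exp (\<rho> * t)" using K \<rho> by simp
    also have "\<dots> \<le> 2 * K / \<gamma> * exp (\<rho> * t)"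
    proof (rule mult_right_mono)
      have "K / \<rho> \<le> K / (\<gamma> / 2)" using K \<rho> \<gamma> by (intro divide_left_mono) auto
      then show "K / \<rho> \<le> 2 * K / \<gamma>" by (simp add: mult.commute)
    qed simp
    finally have "cmod (f t) \<le> cmod (f 0) + 2 * K / \<gamma> * exp (\<rho> * t)"
      using norm_triangle_sub [of "f t" "f 0"] by linarith
    then have "exp (\<sigma> * t) * cmod (w t) \<le> cmod (w 0) + 2 * K / \<gamma> * exp (\<rho> * t)"
      by (simp add: f_def norm_mult norm_exp_eq_Re \<sigma>_def mult.commute)
    also have "\<dots> \<le> cmod (w 0) * exp (\<rho> * t) + 2 * K / \<gamma> * exp (\<rho> * t)"
      using \<rho> t by (intro add_right_mono) (simp add: mult_left_le_one_le mult_le_cancel_left1)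
    also have "\<dots> = exp (\<sigma> * t) * (exp (- (\<gamma> / 2) * t) * (cmod (w 0) + 2 * K / \<gamma>))"
    proof -
      have "exp (\<rho> * t) = exp (\<sigma> * t) * exp (- (\<gamma> / 2) * t)"
        by (simp add: \<rho>_def exp_add [symmetric] algebra_simps)
      then show ?thesis by (simp add: algebra_simps)
    qed
    finally show ?thesis by simp
  }
qed

text \<open>
  Splitting off one linear factor at a time replaces \<open>W\<close> by \<open>(D - z) W\<close>, which
  solves an equation of order one less and serves as forcing term for \<open>W\<close>. The distances
  between the roots do not enter.
\<close>

lemma chain_decay:
  assumes "0 < \<gamma>" "0 \<le> R"
  shows "\<exists>C\<ge>0. \<forall>zs W. length zs = n \<and> (\<forall>z\<in>set zs. \<gamma> \<le> Im z \<and> cmod z \<le> R) \<and> derivative_chain W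
      \<and> (\<forall>n. \<forall>t\<ge>0. apply_poly (\<Prod>z\<leftarrow>zs. [:-z, 1:]) W n t = 0) \<longrightarrow>
      (\<forall>t\<ge>0. cmod (W 0 t) \<le> C * exp (- (\<gamma> / 2) * t) * (\<Sum>k<n. cmod (W k 0)))"
proof (induction n)
  case 0
  then show ?case by (intro exI [of _ 0]) (auto simp: one_pCons)
next
  case (Suc n)
  then obtain C where C: "0 \<le> C" and IH: "\<And>zs W t. length zs = n \<Longrightarrow>
      (\<And>z. z \<in> set zs \<Longrightarrow> \<gamma> \<le> Im z \<and> cmod z \<le> R) \<Longrightarrow> derivative_chain W \<Longrightarrow>
      (\<And>n t. 0 \<le> t \<Longrightarrow> apply_poly (\<Prod>z\<leftarrow>zs. [:-z, 1:]) W n t = 0) \<Longrightarrow> 0 \<le> t \<Longrightarrow>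
      cmod (W 0 t) \<le> C * exp (- (\<gamma> / 2) * t) * (\<Sum>k<n. cmod (W k 0))"
    by metis
  define C' where "C' = 1 + 2 / \<gamma> * (C * (1 + R))"
  have C': "0 \<le> C'" using C assms by (simp add: C'_def)
  have "cmod (W 0 t) \<le> C' * exp (- (\<gamma> / 2) * t) * (\<Sum>k<Suc n. cmod (W k 0))"
    if zs: "length zs = Suc n" "\<And>z. z \<in> set zs \<Longrightarrow> \<gamma> \<le> Im z \<and> cmod z \<le> R"
      and W: "derivative_chain W"
      and sol: "\<And>n t. 0 \<le> t \<Longrightarrow> apply_poly (\<Prod>z\<leftarrow>zs. [:-z, 1:]) W n t = 0" and t: "0 \<le> t"
    for zs W t
  proof -
    obtain z zs' where zs': "zs = z # zs'" using zs(1) by (cases zs) auto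
    have z: "\<gamma> \<le> Im z" "cmod z \<le> R" using zs(2) zs' by auto
    define V where "V n t = W (Suc n) t - z * W n t" for n t
    define M where "M = (\<Sum>k<Suc n. cmod (W k 0))"
    have "derivative_chain V"
      unfolding derivative_chain_def V_def
    proof (intro allI impI)
      fix n :: nat and t :: real assume "0 \<le> t"
      then show "((\<lambda>t. W (Suc n) t - z * W n t) has_vector_derivative
          \<i> * (W (Suc (Suc n)) t - z * W (Suc n) t)) (at t within {0..})"
        using W unfolding derivative_chain_def
        by (auto intro!: derivative_eq_intros simp: algebra_simps)
    qed
    moreover have "apply_poly (\<Prod>z\<leftarrow>zs'. [:-z, 1:]) V n t = 0" if "0 \<le> t" for n t
      using sol [OF that, of n] unfolding V_def apply_poly_first_order zs' by simp
    ultimately have V: "cmod (V 0 t) \<le> C * exp (- (\<gamma> / 2) * t) * (\<Sum>k<n. cmod (V k 0))" if "0 \<le> t" for t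
      using IH [of zs' V t] zs zs' that by auto
    have "(\<Sum>k<n. cmod (V k 0)) \<le> (\<Sum>k<n. cmod (W (Suc k) 0) + R * cmod (W k 0))"
      unfolding V_def
      using z(2) by (intro sum_mono norm_triangle_le_diff) (auto simp: norm_mult intro: mult_right_mono)
    also have "\<dots> = (\<Sum>k<n. cmod (W (Suc k) 0)) + R * (\<Sum>k<n. cmod (W k 0))"
      by (simp add: sum.distrib sum_distrib_left)
    also have "\<dots> \<le> M + R * M"
    proof (intro add_mono mult_left_mono assms)
      show "(\<Sum>k<n. cmod (W (Suc k) 0)) \<le> M"
        unfolding M_def by (simp add: sum.lessThan_Suc_shift del: sum.lessThan_Suc)
    qed (simp add: M_def)
    finally have VM: "(\<Sum>k<n. cmod (V k 0)) \<le> (1 + R) * M" by (simp add: algebra_simps)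
    have "cmod (V 0 t) \<le> C * (1 + R) * M * exp (- (\<gamma> / 2) * t)" if "0 \<le> t" for t
      using V [OF that] mult_left_mono [OF VM, of "C * exp (- (\<gamma> / 2) * t)"] C by (simp add: algebra_simps)
    moreover have "(W 0 has_vector_derivative \<i> * (V 0 t + z * W 0 t)) (at t within {0..})" if "0 \<le> t" for t
      using W that by (simp add: derivative_chain_def V_def)
    ultimately have "cmod (W 0 t) \<le> exp (- (\<gamma> / 2) * t) * (cmod (W 0 0) + 2 * (C * (1 + R) * M) / \<gamma>)"
      using first_order_decay [where w = "W 0" and v = "V 0" and z = z] assms(1) z(1) t by blast
    also have "\<dots> \<le> exp (- (\<gamma> / 2) * t) * (M + 2 * (C * (1 + R) * M) / \<gamma>)"
      unfolding M_def by (intro mult_left_mono add_right_mono member_le_sum) auto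
    also have "\<dots> = C' * exp (- (\<gamma> / 2) * t) * M" by (simp add: C'_def algebra_simps)
    finally show ?thesis by (simp only: M_def)
  qed
  then show ?case using C' by (intro exI [of _ C']) blast
qed

text \<open>
  Synthetic division gives the coefficients of the quotient by a downward recursion, each step of which
  multiplies by \<open>z\<close> and adds a coefficient of \<open>q\<close>.
\<close>

lemma coeff_synthetic_bound:
  fixes q :: "complex poly"
  assumes "poly q z = 0" "\<And>k. cmod (coeff q k) \<le> B" "cmod z \<le> R"
  shows "cmod (coeff (q div [:-z, 1:]) k) \<le> B * (1 + R) ^ degree q"
proof -
  let ?l = "q div [:-z, 1:]"
  have R: "0 \<le> R" using assms(3) norm_ge_zero order_trans by blast
  have B: "0 \<le> B" using assms(2) [of 0] norm_ge_zero order_trans by blast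
  have dl: "degree ?l \<le> degree q"
  proof (cases "?l = 0")
    case False
    have "degree q = degree ([:-z, 1:] * ?l)" using synthetic_factor [OF assms(1)] by simp
    also have "\<dots> = Suc (degree ?l)" using False by (subst degree_mult_eq) auto
    finally show ?thesis by simp
  qed simp
  have step: "coeff ?l k = coeff q (Suc k) + z * coeff ?l (Suc k)" for k
  proof -
    have "coeff q (Suc k) = coeff ([:-z, 1:] * ?l) (Suc k)"
      using synthetic_factor [OF assms(1)] by simp
    then show ?thesis by simp
  qed
  have "cmod (coeff ?l (Suc (degree q) - j)) \<le> B * (1 + R) ^ (j - 1)" if "j \<le> Suc (degree q)" for j
    using that
  proof (induction j)
    case 0
    then show ?case using dl B by (simp add: coeff_eq_0)
  next
    case (Suc j)
    let ?k = "degree q - j"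
    have k: "Suc ?k = Suc (degree q) - j" using Suc.prems by simp
    show ?case
    proof (cases "j = 0")
      case True
      then show ?thesis using step [of "degree q"] dl B assms(2) by (simp add: coeff_eq_0)
    next
      case False
      have "cmod (coeff ?l ?k) \<le> cmod (coeff q (Suc ?k)) + cmod z * cmod (coeff ?l (Suc ?k))"
        unfolding step [of ?k] by (metis norm_mult norm_triangle_ineq)
      also have "\<dots> \<le> B * (1 + R) ^ (j - 1) + R * (B * (1 + R) ^ (j - 1))"
      proof (intro add_mono mult_mono)
        have "B * 1 \<le> B * (1 + R) ^ (j - 1)" using B R by (intro mult_left_mono one_le_power) auto
        then show "cmod (coeff q (Suc ?k)) \<le> B * (1 + R) ^ (j - 1)" using assms(2) [of "Suc ?k"] by linarith
        show "cmod (coeff ?l (Suc ?k)) \<le> B * (1 + R) ^ (j - 1)" unfolding k using Suc by simp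
      qed (use assms(3) R in auto)
      also have "\<dots> = B * (1 + R) ^ j" using False by (cases j) (simp_all add: algebra_simps)
      finally show ?thesis by simp
    qed
  qed
  note bd = this
  show ?thesis
  proof (cases "k \<le> degree q")
    case True
    have "cmod (coeff ?l k) \<le> B * (1 + R) ^ (degree q - k)"
      using bd [of "Suc (degree q) - k"] True by (simp add: Suc_diff_le)
    also have "\<dots> \<le> B * (1 + R) ^ degree q"
      using B R by (intro mult_left_mono power_increasing) auto
    finally show ?thesis .
  next
    case False
    then have "coeff ?l k = 0" using dl by (intro coeff_eq_0) simp
    then show ?thesis using B R by simp
  qed
qed

text \<open>
  Let \<open>l\<^sub>z\<close> be the quotient of \<open>q\<close> by the factor of its root
  \<open>z\<close>. By Lagrange interpolation the constant 1 is the sum of the \<open>l\<^sub>z /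
  q'(z)\<close>, and \<open>l\<^sub>z(D) W\<close> is a multiple of \<open>exp (\<i> z t)\<close>. Thus
  no part of the rate \<open>\<gamma>\<close> is lost, and the constant does not depend on
  \<open>\<gamma>\<close>.
\<close>

lemma simple_spectrum_decay:
  fixes q :: "complex poly"
  assumes deg: "0 < degree q" and monic: "lead_coeff q = 1"
    and c: "0 < c" "\<And>z. poly q z = 0 \<Longrightarrow> c \<le> cmod (poly (pderiv q) z)"
    and B: "\<And>k. cmod (coeff q k) \<le> B" and R: "\<And>z. poly q z = 0 \<Longrightarrow> cmod z \<le> R"
    and \<gamma>: "\<And>z. poly q z = 0 \<Longrightarrow> \<gamma> \<le> Im z"
    and W: "derivative_chain W" "\<And>n t. 0 \<le> t \<Longrightarrow> apply_poly q W n t = 0" and t: "0 \<le> t"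
  shows "cmod (W 0 t) \<le> real (degree q) * (B * (1 + R) ^ degree q / c) * exp (- \<gamma> * t)
    * (\<Sum>k<degree q. cmod (W k 0))"
proof -
  let ?l = "\<lambda>z. q div [:-z, 1:]"
  let ?M = "\<Sum>k<degree q. cmod (W k 0)"
  have q0: "q \<noteq> 0" using deg by auto
  have rsf: "rsquarefree q"
    using c by (intro rsquarefree_roots [THEN iffD2]) force
  have "degree q = degree (\<Prod>z | poly q z = 0. [:-z, 1:])"
    using complex_poly_decompose_rsquarefree [OF rsf] monic by simp
  then have card: "card {z. poly q z = 0} = degree q"
    by (simp add: degree_prod_sum_eq)
  have one: "1 = (\<Sum>z | poly q z = 0. smult (poly 1 z / poly (?l z) z) (?l z))"
    by (rule lagrange_interpolation [OF card]) (use deg in simp)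
  have "W 0 t = apply_poly 1 W 0 t" by (simp add: one_pCons)
  also have "\<dots> = (\<Sum>z | poly q z = 0. apply_poly (?l z) W 0 t / poly (pderiv q) z)"
    by (subst one) (simp add: poly_pderiv_root)
  finally have "cmod (W 0 t) \<le> (\<Sum>z | poly q z = 0. cmod (apply_poly (?l z) W 0 t / poly (pderiv q) z))"
    by (simp only: norm_sum)
  also have "\<dots> \<le> (\<Sum>z | poly q z = 0. B * (1 + R) ^ degree q / c * exp (- \<gamma> * t) * ?M)"
  proof (rule sum_mono)
    fix z assume "z \<in> {z. poly q z = 0}"
    then have z: "poly q z = 0" by simp
    have eq: "apply_poly (?l z) W (Suc n) s = z * apply_poly (?l z) W n s" if "0 \<le> s" for n s
      using W(2) [OF that, of n] synthetic_factor [OF z] apply_poly_linear_factor [of z "?l z" W n s] by simp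
    have "cmod (apply_poly (?l z) W 0 t) = exp (- Im z * t) * cmod (apply_poly (?l z) W 0 0)"
    proof (rule exponential_solution [OF _ t])
      fix s :: real assume "0 \<le> s"
      then show "((\<lambda>t. apply_poly (?l z) W 0 t) has_vector_derivative
          \<i> * z * apply_poly (?l z) W 0 s) (at s within {0..})"
        using apply_poly_derivative [OF W(1), of s "?l z" 0] eq by (simp add: mult.assoc)
    qed
    also have "\<dots> \<le> exp (- \<gamma> * t) * (B * (1 + R) ^ degree q * ?M)"
    proof (intro mult_mono apply_poly_norm_le)
      show "exp (- Im z * t) \<le> exp (- \<gamma> * t)" using \<gamma> [OF z] t by (simp add: mult_right_mono)
      show "degree (?l z) < degree q" using simple_root_quotient(2) [OF card deg z] deg by simp
      show "cmod (coeff (?l z) k) \<le> B * (1 + R) ^ degree q" for k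
        by (rule coeff_synthetic_bound [OF z B R [OF z]])
    qed auto
    finally have "cmod (apply_poly (?l z) W 0 t) / cmod (poly (pderiv q) z)
        \<le> exp (- \<gamma> * t) * (B * (1 + R) ^ degree q * ?M) / c"
      using c(1) c(2) [OF z] by (intro frac_le) (auto intro: order_trans [OF norm_ge_zero])
    then show "cmod (apply_poly (?l z) W 0 t / poly (pderiv q) z)
        \<le> B * (1 + R) ^ degree q / c * exp (- \<gamma> * t) * ?M"
      by (simp add: norm_divide algebra_simps)
  qed
  also have "\<dots> = real (degree q) * (B * (1 + R) ^ degree q / c) * exp (- \<gamma> * t) * ?M"
    by (simp add: card)
  finally show ?thesis .
qed

context interlacing_family
begin

text \<open>
  The rate \<open>c e^d\<close> degenerates as \<open>e\<close> tends to 0, so that constants depending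
  on it are harmful there; but for small \<open>e\<close> the spectrum is simple with uniform bounds.
  For larger \<open>e\<close> the rate is bounded below and the roots may coincide.
\<close>

lemma decay_from_gap:
  assumes K: "0 < K" and m: "0 < m" and simple: "\<And>\<xi>. \<xi> \<in> S \<Longrightarrow> distinct (root_list (p \<xi>))"
    and gap: "\<exists>c>0. \<forall>\<xi>\<in>S. \<forall>e. 0 < e \<and> e \<le> K \<longrightarrow> (\<forall>z. poly (q e \<xi>) z = 0 \<longrightarrow> c * e ^ d \<le> Im z)"
  shows "\<exists>C>0. \<exists>c>0. \<forall>\<xi>\<in>S. \<forall>e W t. 0 < e \<and> e \<le> K \<and> derivative_chain W \<and>
      (\<forall>n. \<forall>t\<ge>0. apply_poly (q e \<xi>) W n t = 0) \<and> 0 \<le> t \<longrightarrow>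
      cmod (W 0 t) \<le> C * exp (- (c * e ^ d) * t) * (\<Sum>k<m. cmod (W k 0))"
proof -
  obtain c where c: "0 < c" "\<And>\<xi> e z. \<xi> \<in> S \<Longrightarrow> 0 < e \<Longrightarrow> e \<le> K \<Longrightarrow> poly (q e \<xi>) z = 0 \<Longrightarrow> c * e ^ d \<le> Im z"
    using gap by blast
  obtain e0 c1 where e0: "0 < e0" and c1: "0 < c1"
    "\<And>\<xi> e z. \<xi> \<in> S \<Longrightarrow> 0 < e \<Longrightarrow> e \<le> e0 \<Longrightarrow> poly (q e \<xi>) z = 0 \<Longrightarrow> c1 \<le> cmod (poly (pderiv (q e \<xi>)) z)"
    using simple_spectrum [OF simple] by blast
  obtain B R where B: "0 < B" and R: "1 \<le> R"
    and bB: "\<And>\<xi> e k. \<xi> \<in> S \<Longrightarrow> 0 \<le> e \<Longrightarrow> e \<le> K \<Longrightarrow> cmod (coeff (q e \<xi>) k) \<le> B"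
    and bR: "\<And>\<xi> e z. \<xi> \<in> S \<Longrightarrow> 0 \<le> e \<Longrightarrow> e \<le> K \<Longrightarrow> poly (q e \<xi>) z = 0 \<Longrightarrow> cmod z \<le> R"
    by (rule q_bounds [of K]) blast
  define \<gamma> where "\<gamma> = c * e0 ^ d"
  have \<gamma>: "0 < \<gamma>" using c(1) e0 by (simp add: \<gamma>_def)
  obtain C2 where C2ge: "0 \<le> C2" and C2all: "\<forall>zs W. length zs = m \<and>
      (\<forall>z\<in>set zs. \<gamma> \<le> Im z \<and> cmod z \<le> R) \<and> derivative_chain W
      \<and> (\<forall>n. \<forall>t\<ge>0. apply_poly (\<Prod>z\<leftarrow>zs. [:-z, 1:]) W n t = 0) \<longrightarrow>
      (\<forall>t\<ge>0. cmod (W 0 t) \<le> C2 * exp (- (\<gamma> / 2) * t) * (\<Sum>k<m. cmod (W k 0)))"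
    using chain_decay [OF \<gamma> order_trans [OF zero_le_one R], of m] by blast
  have C2: "0 \<le> C2" "\<And>zs W t. length zs = m \<Longrightarrow>
      (\<And>z. z \<in> set zs \<Longrightarrow> \<gamma> \<le> Im z \<and> cmod z \<le> R) \<Longrightarrow> derivative_chain W \<Longrightarrow>
      (\<And>n t. 0 \<le> t \<Longrightarrow> apply_poly (\<Prod>z\<leftarrow>zs. [:-z, 1:]) W n t = 0) \<Longrightarrow> 0 \<le> t \<Longrightarrow>
      cmod (W 0 t) \<le> C2 * exp (- (\<gamma> / 2) * t) * (\<Sum>k<m. cmod (W k 0))"
    by (rule C2ge, rule C2all [rule_format]) auto
  define C1 where "C1 = real m * (B * (1 + R) ^ m / c1)"
  have C1: "0 < C1" using m B R c1(1) by (simp add: C1_def)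
  \<comment> \<open>The second entry makes \<open>c' e^d \<le> \<gamma> / 2\<close> for all \<open>e \<le> K\<close>, the rate available when \<open>e > e0\<close>.\<close>
  define c' where "c' = min c (\<gamma> / (2 * K ^ d))"
  have c': "0 < c'" using c(1) \<gamma> K by (simp add: c'_def)
  have main: "cmod (W 0 t) \<le> (C1 + C2) * exp (- (c' * e ^ d) * t) * (\<Sum>k<m. cmod (W k 0))"
    if \<xi>: "\<xi> \<in> S" and e: "0 < e" "e \<le> K" and W: "derivative_chain W"
      and sol: "\<And>n t. 0 \<le> t \<Longrightarrow> apply_poly (q e \<xi>) W n t = 0" and t: "0 \<le> t" for \<xi> e W t
  proof (cases "e \<le> e0")
    case True
    have "cmod (W 0 t) \<le> real (degree (q e \<xi>)) * (B * (1 + R) ^ degree (q e \<xi>) / c1)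
        * exp (- (c * e ^ d) * t) * (\<Sum>k<degree (q e \<xi>). cmod (W k 0))"
      using q_monic [OF \<xi>] m
      by (intro simple_spectrum_decay [OF _ _ c1(1) c1(2) [OF \<xi> e(1) True] bB [OF \<xi> less_imp_le [OF e(1)] e(2)]
            bR [OF \<xi> less_imp_le [OF e(1)] e(2)] c(2) [OF \<xi> e] W sol t]) auto
    then have "cmod (W 0 t) \<le> C1 * exp (- (c * e ^ d) * t) * (\<Sum>k<m. cmod (W k 0))"
      unfolding q_monic(1) [OF \<xi>] C1_def .
    also have "\<dots> \<le> (C1 + C2) * exp (- (c' * e ^ d) * t) * (\<Sum>k<m. cmod (W k 0))"
      using C1 C2(1) e t by (intro mult_right_mono mult_mono sum_nonneg) (auto simp: c'_def intro!: mult_right_mono)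
    finally show ?thesis .
  next
    case False
    obtain r where "smult (lead_coeff (q e \<xi>)) (\<Prod>i<degree (q e \<xi>). [:- r i, 1:]) = q e \<xi>"
      by (rule complex_poly_decompose')
    then have r: "(\<Prod>i<m. [:- r i, 1:]) = q e \<xi>"
      unfolding q_monic(2) [OF \<xi>] unfolding q_monic(1) [OF \<xi>] smult_1_left .
    define zs where "zs = map r [0..<m]"
    have qzs: "(\<Prod>z\<leftarrow>zs. [:-z, 1:]) = q e \<xi>"
      unfolding r [symmetric] zs_def
      by (simp add: prod.list_conv_set_nth atLeast0LessThan)
    have zroot: "poly (q e \<xi>) z = 0" if "z \<in> set zs" for z
      using that unfolding r [symmetric] zs_def by (auto simp: poly_prod)
    have "e0 ^ d \<le> e ^ d" using False e0 by (intro power_mono) auto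
    then have \<gamma>e: "\<gamma> \<le> c * e ^ d" using c(1) by (simp add: \<gamma>_def)
    have "cmod (W 0 t) \<le> C2 * exp (- (\<gamma> / 2) * t) * (\<Sum>k<m. cmod (W k 0))"
    proof (rule C2(2) [of zs])
      show "length zs = m" by (simp add: zs_def)
      show "\<gamma> \<le> Im z \<and> cmod z \<le> R" if "z \<in> set zs" for z
        using c(2) [OF \<xi> e zroot [OF that]] bR [OF \<xi> _ e(2) zroot [OF that]] e \<gamma>e by simp
    qed (use W sol t qzs in auto)
    also have "\<dots> \<le> (C1 + C2) * exp (- (c' * e ^ d) * t) * (\<Sum>k<m. cmod (W k 0))"
    proof (intro mult_right_mono mult_mono sum_nonneg)
      have "c' * e ^ d \<le> \<gamma> / (2 * K ^ d) * K ^ d"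
        using e K \<gamma> by (intro mult_mono power_mono) (auto simp: c'_def)
      also have "\<dots> = \<gamma> / 2" using K by simp
      finally have "c' * e ^ d * t \<le> \<gamma> / 2 * t" using t by (rule mult_right_mono)
      then show "exp (- (\<gamma> / 2) * t) \<le> exp (- (c' * e ^ d) * t)" by simp
    qed (use C1 C2(1) in auto)
    finally show ?thesis .
  qed
  have "0 < C1 + C2" using C1 C2(1) by linarith
  then show ?thesis using c' main by blast
qed

end

lemma monic_recurrence_bound:
  fixes W :: "nat \<Rightarrow> complex"
  assumes rec: "\<And>n. W (n + m) = - (\<Sum>k<m. a k * W (n + k))"
    and a: "\<And>k. k < m \<Longrightarrow> cmod (a k) \<le> B" "0 \<le> B"
  shows "cmod (W n) \<le> (1 + real m * B) ^ n * (\<Sum>j<m. cmod (W j))"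
proof (induction n rule: less_induct)
  case (less n)
  let ?M = "1 + real m * B" and ?s = "\<Sum>j<m. cmod (W j)"
  have M: "1 \<le> ?M" using a(2) by simp
  have s: "0 \<le> ?s" by (intro sum_nonneg) auto
  show ?case
  proof (cases "n < m")
    case True
    then have "cmod (W n) \<le> ?s" by (intro member_le_sum) auto
    also have "\<dots> \<le> ?M ^ n * ?s" using M s by (simp add: mult_le_cancel_right1 one_le_power)
    finally show ?thesis .
  next
    case False
    then obtain n' where n: "n = n' + m" by (metis le_add_diff_inverse2 not_less)
    show ?thesis
    proof (cases "m = 0")
      case True
      then show ?thesis using rec [of n'] n by simp
    next
      case m: False
      have "cmod (W n) \<le> (\<Sum>k<m. cmod (a k * W (n' + k)))"
        unfolding n rec norm_minus_cancel by (rule norm_sum)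
      also have "\<dots> \<le> (\<Sum>k<m. B * (?M ^ (n - 1) * ?s))"
        unfolding norm_mult
      proof (intro sum_mono mult_mono a)
        fix k assume "k \<in> {..<m}"
        then have k: "k < m" by simp
        have "cmod (W (n' + k)) \<le> ?M ^ (n' + k) * ?s" using k n by (intro less) simp
        also have "\<dots> \<le> ?M ^ (n - 1) * ?s"
          using M s k n by (intro mult_right_mono power_increasing) auto
        finally show "cmod (W (n' + k)) \<le> ?M ^ (n - 1) * ?s" .
      qed auto
      also have "\<dots> = real m * B * (?M ^ (n - 1) * ?s)" by simp
      also have "\<dots> \<le> ?M * (?M ^ (n - 1) * ?s)"
        using M s by (intro mult_right_mono) auto
      also have "\<dots> = ?M ^ Suc (n - 1) * ?s" by (simp only: power_Suc mult.assoc)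
      also have "Suc (n - 1) = n" using m n by simp
      finally show ?thesis .
    qed
  qed
qed

lemma derivative_chain_shift: "derivative_chain W \<Longrightarrow> derivative_chain (\<lambda>n. W (k + n))"
  by (simp add: derivative_chain_def)

lemma apply_poly_shift: "apply_poly q (\<lambda>n. W (k + n)) n t = apply_poly q W (k + n) t"
  by (simp add: apply_poly_def add.assoc)

context interlacing_family
begin

text \<open>
  The derivatives solve the same equation, and the recurrence bounds their initial values by the first
  \<open>m\<close> of them.
\<close>

lemma derivative_decay_from_gap:
  assumes K: "0 < K" and m: "0 < m" and simple: "\<And>\<xi>. \<xi> \<in> S \<Longrightarrow> distinct (root_list (p \<xi>))"
    and gap: "\<exists>c>0. \<forall>\<xi>\<in>S. \<forall>e. 0 < e \<and> e \<le> K \<longrightarrow> (\<forall>z. poly (q e \<xi>) z = 0 \<longrightarrow> c * e ^ d \<le> Im z)"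
  shows "\<exists>c>0. \<forall>k. \<exists>C>0. \<forall>\<xi>\<in>S. \<forall>e W t. 0 < e \<and> e \<le> K \<and> derivative_chain W \<and>
      (\<forall>n. \<forall>t\<ge>0. apply_poly (q e \<xi>) W n t = 0) \<and> 0 \<le> t \<longrightarrow>
      cmod (W k t) \<le> C * exp (- (c * e ^ d) * t) * (\<Sum>j<m. cmod (W j 0))"
proof -
  obtain C c where C: "0 < C" and c: "0 < c" and dec: "\<forall>\<xi>\<in>S. \<forall>e W t. 0 < e \<and> e \<le> K \<and> derivative_chain W \<and>
      (\<forall>n. \<forall>t\<ge>0. apply_poly (q e \<xi>) W n t = 0) \<and> 0 \<le> t \<longrightarrow>
      cmod (W 0 t) \<le> C * exp (- (c * e ^ d) * t) * (\<Sum>k<m. cmod (W k 0))"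
    using decay_from_gap [OF assms] by blast
  obtain B where B: "0 < B" and bB: "\<And>\<xi> e k. \<xi> \<in> S \<Longrightarrow> 0 \<le> e \<Longrightarrow> e \<le> K \<Longrightarrow> cmod (coeff (q e \<xi>) k) \<le> B"
    by (rule q_bounds [of K]) blast
  define M where "M = 1 + real m * B"
  have M: "1 \<le> M" using B by (simp add: M_def)
  have "cmod (W k t) \<le> C * (\<Sum>j<m. M ^ (k + j)) * exp (- (c * e ^ d) * t) * (\<Sum>j<m. cmod (W j 0))"
    if \<xi>: "\<xi> \<in> S" and e: "0 < e" "e \<le> K" and W: "derivative_chain W"
      and sol: "\<And>n t. 0 \<le> t \<Longrightarrow> apply_poly (q e \<xi>) W n t = 0" and t: "0 \<le> t" for \<xi> e W t k
  proof -
    let ?s = "\<Sum>j<m. cmod (W j 0)"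
    have rec: "W (n + m) 0 = - (\<Sum>k<m. coeff (q e \<xi>) k * W (n + k) 0)" for n
    proof -
      have "(\<Sum>k<Suc m. coeff (q e \<xi>) k * W (n + k) 0) = 0"
        using sol [of 0 n] q_monic(1) [OF \<xi>] by (simp add: apply_poly_def lessThan_Suc_atMost)
      then show ?thesis
        using q_monic [OF \<xi>, of e] by (simp add: eq_neg_iff_add_eq_0 add.commute)
    qed
    have bd: "cmod (W n 0) \<le> M ^ n * ?s" for n
      unfolding M_def
      using monic_recurrence_bound [of "\<lambda>n. W n 0" m "coeff (q e \<xi>)" B n] rec bB [OF \<xi> _ e(2)] e B by simp
    have "cmod (W k t) \<le> C * exp (- (c * e ^ d) * t) * (\<Sum>j<m. cmod (W (k + j) 0))"
      using dec [rule_format, of \<xi> e "\<lambda>n. W (k + n)" t] \<xi> e derivative_chain_shift [OF W] sol t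
      by (simp add: apply_poly_shift)
    also have "\<dots> \<le> C * exp (- (c * e ^ d) * t) * (\<Sum>j<m. M ^ (k + j) * ?s)"
      using C bd by (intro mult_left_mono sum_mono) auto
    finally show ?thesis by (simp add: sum_distrib_right [symmetric] algebra_simps)
  qed
  moreover have "0 < C * (\<Sum>j<m. M ^ (k + j))" for k
    using C M m by (intro mult_pos_pos sum_pos) auto
  ultimately show ?thesis using c by blast
qed

end

section \<open>The initial value problem at a fixed frequency\<close>

text \<open>
  The coefficient of the derivative of order \<open>j\<close> when the derivative of order
  \<open>n\<close> of a solution of \<open>(d/dt)^m y + (\<Sum>k<m. A k (d/dt)^k y) = 0\<close> is
  expressed through those of order below \<open>m\<close>; these are entries of the powers of the
  companion matrix.
\<close>

primrec companion :: "(nat \<Rightarrow> complex) \<Rightarrow> nat \<Rightarrow> nat \<Rightarrow> nat \<Rightarrow> complex" where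
  "companion A m 0 j = (if j = 0 then 1 else 0)"
| "companion A m (Suc n) j = (if j = 0 then 0 else companion A m n (j - 1)) - A j * companion A m n (m - 1)"

lemma companion_initial:
  "n < m \<Longrightarrow> j < m \<Longrightarrow> companion A m n j = (if n = j then 1 else 0)"
proof (induction n arbitrary: j)
  case (Suc n)
  then show ?case by (cases j) auto
qed simp

lemma companion_recurrence:
  assumes "j < m"
  shows "companion A m (n + m) j + (\<Sum>k<m. A k * companion A m (n + k) j) = 0"
  using assms
proof (induction n arbitrary: j)
  case 0
  obtain m' where m: "m = Suc m'" using 0 by (cases m) auto
  have "companion A m m j = - A j"
    using 0 companion_initial [of m' m "j - 1" A] companion_initial [of m' m m' A]
    unfolding m by auto
  moreover have "(\<Sum>k<m. A k * companion A m k j) = (\<Sum>k<m. if k = j then A k else 0)"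
    using 0 by (intro sum.cong) (auto simp: companion_initial)
  ultimately show ?case using 0 by simp
next
  case (Suc n)
  have last: "companion A m (n + m) (m - 1) + (\<Sum>k<m. A k * companion A m (n + k) (m - 1)) = 0"
    using Suc by (intro Suc.IH) auto
  have prev: "companion A m (n + m) (j - 1) + (\<Sum>k<m. A k * companion A m (n + k) (j - 1)) = 0"
    using Suc by (intro Suc.IH) auto
  have "companion A m (Suc n + m) j + (\<Sum>k<m. A k * companion A m (Suc n + k) j)
    = (if j = 0 then 0 else companion A m (n + m) (j - 1) + (\<Sum>k<m. A k * companion A m (n + k) (j - 1)))
      - A j * (companion A m (n + m) (m - 1) + (\<Sum>k<m. A k * companion A m (n + k) (m - 1)))"
    by (simp add: sum_distrib_left sum_subtractf algebra_simps)
  then show ?case using last prev by simp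
qed

lemma companion_bound:
  assumes "j < m"
  shows "cmod (companion A m n j) \<le> (1 + (\<Sum>k<m. cmod (A k))) ^ n"
  using assms
proof (induction n arbitrary: j)
  case (Suc n)
  let ?M = "1 + (\<Sum>k<m. cmod (A k))"
  have "0 \<le> (\<Sum>k<m. cmod (A k))" by (intro sum_nonneg) auto
  then have M: "0 \<le> ?M ^ n" by simp
  have "cmod (companion A m (Suc n) j)
      \<le> cmod (if j = 0 then 0 else companion A m n (j - 1)) + cmod (A j) * cmod (companion A m n (m - 1))"
    unfolding companion.simps norm_mult [symmetric] by (rule norm_triangle_ineq4)
  also have "\<dots> \<le> ?M ^ n + (\<Sum>k<m. cmod (A k)) * ?M ^ n"
  proof (intro add_mono mult_mono)
    show "cmod (if j = 0 then 0 else companion A m n (j - 1)) \<le> ?M ^ n"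
      using Suc M by auto
    show "cmod (A j) \<le> (\<Sum>k<m. cmod (A k))" using Suc.prems by (intro member_le_sum) auto
    show "cmod (companion A m n (m - 1)) \<le> ?M ^ n" using Suc by auto
  qed (auto intro: sum_nonneg)
  also have "\<dots> = ?M ^ Suc n" by (simp add: algebra_simps)
  finally show ?case .
qed simp

text \<open>
  The derivative of order \<open>k\<close> of the solution all of whose first \<open>m\<close> initial
  values are 0, except for the value 1 of the derivative of order \<open>j\<close>.
\<close>

definition fundamental_solution :: "(nat \<Rightarrow> complex) \<Rightarrow> nat \<Rightarrow> nat \<Rightarrow> nat \<Rightarrow> real \<Rightarrow> complex" where
  "fundamental_solution A m k j t = (\<Sum>n. companion A m (n + k) j / fact n * of_real t ^ n)"

lemma fundamental_solution_sums:
  assumes "j < m"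
  shows "(\<lambda>n. companion A m (n + k) j / fact n * z ^ n) sums (\<Sum>n. companion A m (n + k) j / fact n * z ^ n)"
proof -
  let ?M = "1 + (\<Sum>k<m. cmod (A k))"
  have M: "0 \<le> ?M" by (simp add: sum_nonneg add_nonneg_nonneg)
  have "summable (\<lambda>n. ?M ^ k * ((?M * cmod z) ^ n /\<^sub>R fact n))"
    by (intro summable_mult summable_exp_generic)
  then have "summable (\<lambda>n. companion A m (n + k) j / fact n * z ^ n)"
  proof (rule summable_comparison_test' [of _ 0])
    fix n :: nat
    have "norm (companion A m (n + k) j / fact n * z ^ n) = cmod (companion A m (n + k) j) / fact n * cmod z ^ n"
      by (simp add: norm_mult norm_divide norm_power)
    also have "\<dots> \<le> ?M ^ (n + k) / fact n * cmod z ^ n"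
      using companion_bound [OF assms] by (intro mult_right_mono divide_right_mono) auto
    also have "\<dots> = ?M ^ k * ((?M * cmod z) ^ n /\<^sub>R fact n)"
      by (simp only: power_add power_mult_distrib divide_inverse real_scaleR_def mult_ac)
    finally show "norm (companion A m (n + k) j / fact n * z ^ n) \<le> ?M ^ k * ((?M * cmod z) ^ n /\<^sub>R fact n)" .
  qed
  then show ?thesis by (rule summable_sums)
qed

lemma fundamental_solution_derivative:
  assumes "j < m"
  shows "(fundamental_solution A m k j has_vector_derivative fundamental_solution A m (Suc k) j t) (at t within T)"
proof -
  let ?c = "\<lambda>n. companion A m (n + k) j / fact n"
  have d: "diffs ?c = (\<lambda>n. companion A m (n + Suc k) j / fact n)"
    by (rule ext) (simp add: diffs_def del: companion.simps of_nat_Suc)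
  have "((\<lambda>z. \<Sum>n. ?c n * z ^ n) has_field_derivative (\<Sum>n. diffs ?c n * (of_real t) ^ n)) (at (of_real t))"
    by (rule termdiffs_strong_converges_everywhere)
      (use fundamental_solution_sums [OF assms] in \<open>simp add: sums_iff\<close>)
  from has_vector_derivative_real_field [OF this]
  have "((\<lambda>t. \<Sum>n. ?c n * of_real t ^ n) has_vector_derivative (\<Sum>n. diffs ?c n * (of_real t) ^ n)) (at t within T)" .
  then show ?thesis unfolding d fundamental_solution_def .
qed

lemma fundamental_solution_0: "fundamental_solution A m k j 0 = companion A m k j"
  unfolding fundamental_solution_def
  using powser_zero [of "\<lambda>n. companion A m (n + k) j / fact n"] by simp

lemma fundamental_solution_equation:
  assumes "j < m"
  shows "fundamental_solution A m (n + m) j t + (\<Sum>k<m. A k * fundamental_solution A m (n + k) j t) = 0"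
proof -
  let ?f = "\<lambda>k i. companion A m (i + k) j / fact i * of_real t ^ i"
  note s = fundamental_solution_sums [OF assms, of A _ "of_real t"]
  have "(\<lambda>i. ?f (n + m) i + (\<Sum>k<m. A k * ?f (n + k) i)) sums
     (fundamental_solution A m (n + m) j t + (\<Sum>k<m. A k * fundamental_solution A m (n + k) j t))"
    unfolding fundamental_solution_def by (intro sums_add sums_sum sums_mult s)
  moreover have "?f (n + m) i + (\<Sum>k<m. A k * ?f (n + k) i) = 0" for i
  proof -
    have "?f (n + m) i + (\<Sum>k<m. A k * ?f (n + k) i)
      = (companion A m ((i + n) + m) j + (\<Sum>k<m. A k * companion A m ((i + n) + k) j)) / fact i * of_real t ^ i"
      by (simp add: sum_divide_distrib sum_distrib_left sum_distrib_right algebra_simps add_divide_distrib)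
    then show ?thesis by (simp add: companion_recurrence [OF assms])
  qed
  ultimately show ?thesis by (simp add: sums_iff)
qed

text \<open>
  The derivative of order \<open>k\<close> at time \<open>t\<close> of the solution with initial values
  \<open>d\<close>.
\<close>

definition cauchy_solution_at :: "(nat \<Rightarrow> complex) \<Rightarrow> nat \<Rightarrow> (nat \<Rightarrow> complex) \<Rightarrow> nat \<Rightarrow> real \<Rightarrow> complex" where
  "cauchy_solution_at A m d k t = (\<Sum>j<m. fundamental_solution A m k j t * d j)"

text \<open>
  In the time \<open>r t\<close>, and with derivatives divided by powers of \<open>\<i> r\<close>, the
  equation is the one with characteristic polynomial \<open>q (1 / r) \<xi>\<close>.
\<close>

lemma (in interlacing_family) cauchy_solution_decay:
  assumes K: "0 < K" and m: "0 < m" and simple: "\<And>\<xi>. \<xi> \<in> S \<Longrightarrow> distinct (root_list (p \<xi>))"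
    and gap: "\<exists>c>0. \<forall>\<xi>\<in>S. \<forall>e. 0 < e \<and> e \<le> K \<longrightarrow> (\<forall>z. poly (q e \<xi>) z = 0 \<longrightarrow> c * e ^ \<kappa> \<le> Im z)"
  shows "\<exists>c>0. \<forall>k. \<exists>C>0. \<forall>\<xi>\<in>S. \<forall>r A d t. 0 < r \<and> 1 / r \<le> K \<and> 0 \<le> t \<and>
      (\<forall>j<m. A j = (\<i> * of_real r) ^ (m - j) * coeff (q (1 / r) \<xi>) j) \<longrightarrow>
      cmod (cauchy_solution_at A m d k t)
        \<le> C * exp (- (c * (1 / r) ^ \<kappa>) * (r * t)) * (\<Sum>j<m. r ^ k / r ^ j * cmod (d j))"
proof -
  obtain c where c: "0 < c" and C: "\<forall>k. \<exists>C>0. \<forall>\<xi>\<in>S. \<forall>e W t. 0 < e \<and> e \<le> K \<and> derivative_chain W \<and>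
      (\<forall>n. \<forall>t\<ge>0. apply_poly (q e \<xi>) W n t = 0) \<and> 0 \<le> t \<longrightarrow>
      cmod (W k t) \<le> C * exp (- (c * e ^ \<kappa>) * t) * (\<Sum>j<m. cmod (W j 0))"
    using derivative_decay_from_gap [OF assms] by blast
  show ?thesis
  proof (rule exI [of _ c], intro conjI allI c)
    fix k
    obtain C where C: "0 < C" and dec: "\<forall>\<xi>\<in>S. \<forall>e W t. 0 < e \<and> e \<le> K \<and> derivative_chain W \<and>
      (\<forall>n. \<forall>t\<ge>0. apply_poly (q e \<xi>) W n t = 0) \<and> 0 \<le> t \<longrightarrow>
      cmod (W k t) \<le> C * exp (- (c * e ^ \<kappa>) * t) * (\<Sum>j<m. cmod (W j 0))"
      using C by blast
    have "cmod (cauchy_solution_at A m d k t)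
        \<le> C * exp (- (c * (1 / r) ^ \<kappa>) * (r * t)) * (\<Sum>j<m. r ^ k / r ^ j * cmod (d j))"
      if \<xi>: "\<xi> \<in> S" and r: "0 < r" "1 / r \<le> K" and t: "0 \<le> t"
        and A: "\<And>j. j < m \<Longrightarrow> A j = (\<i> * of_real r) ^ (m - j) * coeff (q (1 / r) \<xi>) j" for \<xi> r A d t
    proof -
      \<comment> \<open>\<open>?b\<close> is the reciprocal of \<open>\<i> r\<close>.\<close>
      let ?b = "- \<i> / of_real r"
      define Y where "Y = cauchy_solution_at A m d"
      define W where "W n s = ?b ^ n * Y n (s / r)" for n s
      have dY: "(Y n has_vector_derivative Y (Suc n) s) (at s)" for n s
        unfolding Y_def cauchy_solution_at_def
        by (intro has_vector_derivative_sum has_vector_derivative_mult_left fundamental_solution_derivative) auto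
      have Y0: "Y j 0 = d j" if "j < m" for j
      proof -
        have "Y j 0 = (\<Sum>i<m. if i = j then d i else 0)"
          unfolding Y_def cauchy_solution_at_def fundamental_solution_0
          using that by (intro sum.cong) (auto simp: companion_initial)
        then show ?thesis using that by simp
      qed
      have eqY: "Y (n + m) s + (\<Sum>k<m. A k * Y (n + k) s) = 0" for n s
      proof -
        have "Y (n + m) s + (\<Sum>k<m. A k * Y (n + k) s)
          = (\<Sum>j<m. (fundamental_solution A m (n + m) j s + (\<Sum>k<m. A k * fundamental_solution A m (n + k) j s)) * d j)"
          unfolding Y_def cauchy_solution_at_def
          by (simp add: sum_distrib_left sum_distrib_right sum.distrib algebra_simps)
            (rule sum.swap)
        then show ?thesis by (simp add: fundamental_solution_equation)
      qed
      have "derivative_chain W"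
        unfolding derivative_chain_def
      proof (intro allI impI)
        fix n and s :: real assume "0 \<le> s"
        have "((Y n \<circ> (\<lambda>s. s / r)) has_vector_derivative (1 / r) *\<^sub>R Y (Suc n) (s / r)) (at s)"
          by (rule vector_diff_chain_at)
            (use r in \<open>auto intro!: derivative_eq_intros dY simp: has_real_derivative_iff_has_vector_derivative [symmetric]\<close>)
        then have "((\<lambda>s. ?b ^ n * (Y n \<circ> (\<lambda>s. s / r)) s) has_vector_derivative
            ?b ^ n * ((1 / r) *\<^sub>R Y (Suc n) (s / r))) (at s within {0..})"
          by (rule has_vector_derivative_at_within [OF has_vector_derivative_mult_right])
        moreover have "?b ^ n * ((1 / r) *\<^sub>R Y (Suc n) (s / r)) = \<i> * W (Suc n) s"
        proof -
          have "\<i> * ?b = of_real (1 / r)" by (simp add: divide_simps)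
          moreover have "\<i> * (?b ^ Suc n * y) = (\<i> * ?b) * (?b ^ n * y)" for y
            by (simp only: power_Suc mult_ac)
          ultimately show ?thesis by (simp only: W_def scaleR_conv_of_real mult.left_commute)
        qed
        moreover have "(\<lambda>s. ?b ^ n * (Y n \<circ> (\<lambda>s. s / r)) s) = W n"
          by (rule ext) (simp add: W_def)
        ultimately show "(W n has_vector_derivative \<i> * W (Suc n) s) (at s within {0..})" by simp
      qed
      moreover have "apply_poly (q (1 / r) \<xi>) W n s = 0" for n s
      proof -
        have tk: "coeff (q (1 / r) \<xi>) k * W (n + k) s = ?b ^ (n + m) * (A k * Y (n + k) (s / r))" if "k < m" for k
        proof -
          have "?b * (\<i> * of_real r) = 1" using r by simp
          then have "?b ^ (m - k) * (\<i> * of_real r) ^ (m - k) = 1"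
            unfolding power_mult_distrib [symmetric] by simp
          moreover have "?b ^ (n + m) = ?b ^ (n + k) * ?b ^ (m - k)"
            using that by (simp add: power_add [symmetric])
          ultimately show ?thesis unfolding W_def A [OF that] by (simp add: algebra_simps)
        qed
        have "apply_poly (q (1 / r) \<xi>) W n s = (\<Sum>k<Suc m. coeff (q (1 / r) \<xi>) k * W (n + k) s)"
          by (simp add: apply_poly_def q_monic(1) [OF \<xi>] lessThan_Suc_atMost)
        also have "\<dots> = (\<Sum>k<m. ?b ^ (n + m) * (A k * Y (n + k) (s / r))) + W (n + m) s"
          using q_monic [OF \<xi>, of "1 / r"] by (simp add: tk)
        also have "\<dots> = ?b ^ (n + m) * (Y (n + m) (s / r) + (\<Sum>k<m. A k * Y (n + k) (s / r)))"
          by (simp add: W_def sum_distrib_left algebra_simps)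
        finally show ?thesis by (simp add: eqY)
      qed
      ultimately have "cmod (W k (r * t)) \<le> C * exp (- (c * (1 / r) ^ \<kappa>) * (r * t)) * (\<Sum>j<m. cmod (W j 0))"
        using dec [rule_format, of \<xi> "1 / r" W "r * t"] \<xi> r t by simp
      also have "(\<Sum>j<m. cmod (W j 0)) = (\<Sum>j<m. cmod (d j) / r ^ j)"
        using r by (intro sum.cong) (auto simp: W_def Y0 norm_mult norm_divide norm_power power_divide)
      finally have "r ^ k * cmod (W k (r * t))
          \<le> r ^ k * (C * exp (- (c * (1 / r) ^ \<kappa>) * (r * t)) * (\<Sum>j<m. cmod (d j) / r ^ j))"
        using r by (intro mult_left_mono) auto
      moreover have "r ^ k * cmod (W k (r * t)) = cmod (Y k t)"
        using r by (simp add: W_def norm_mult norm_power norm_divide power_divide)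
      moreover have "(\<Sum>j<m. r ^ k / r ^ j * cmod (d j)) = r ^ k * (\<Sum>j<m. cmod (d j) / r ^ j)"
        by (simp add: sum_distrib_left)
      ultimately show ?thesis by (simp only: Y_def mult_ac)
    qed
    then show "\<exists>C>0. \<forall>\<xi>\<in>S. \<forall>r A d t. 0 < r \<and> 1 / r \<le> K \<and> 0 \<le> t \<and>
      (\<forall>j<m. A j = (\<i> * of_real r) ^ (m - j) * coeff (q (1 / r) \<xi>) j) \<longrightarrow>
      cmod (cauchy_solution_at A m d k t)
        \<le> C * exp (- (c * (1 / r) ^ \<kappa>) * (r * t)) * (\<Sum>j<m. r ^ k / r ^ j * cmod (d j))"
      using C by blast
  qed
qed

section \<open>Explicit bump functions on the line\<close>

text \<open>
  Positive inside the interval, and vanishing to first order at its end points.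
\<close>

definition edge :: "real \<Rightarrow> real \<Rightarrow> real \<Rightarrow> real" where
  "edge a b x = (x - a) * (b - x)"

text \<open>
  The powers of \<open>edge\<close> in the denominator come from differentiating the exponential. With
  them the class is closed under differentiation as well as under multiplication by polynomials, and the
  derivatives remain explicit.
\<close>

definition bump :: "real \<Rightarrow> real \<Rightarrow> real \<Rightarrow> complex poly \<Rightarrow> nat \<Rightarrow> real \<Rightarrow> complex" where
  "bump \<epsilon> a b P N x = (if a < x \<and> x < b
     then poly P (of_real x) * of_real (exp (- \<epsilon> / edge a b x) / edge a b x ^ N) else 0)"

definition bumps :: "real \<Rightarrow> real \<Rightarrow> real \<Rightarrow> (real \<Rightarrow> complex) set" where
  "bumps \<epsilon> a b = {bump \<epsilon> a b P N | P N. True}"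

lemma bump_in_bumps: "bump \<epsilon> a b P N \<in> bumps \<epsilon> a b"
  by (auto simp: bumps_def)

lemma bumps_outside: "h \<in> bumps \<epsilon> a b \<Longrightarrow> \<not> (a < x \<and> x < b) \<Longrightarrow> h x = 0"
  unfolding bumps_def bump_def by force

lemma bumps_mult: "h \<in> bumps \<epsilon> a b \<Longrightarrow> (\<lambda>x. c * of_real x * h x) \<in> bumps \<epsilon> a b"
proof -
  assume "h \<in> bumps \<epsilon> a b"
  then obtain P N where h: "h = bump \<epsilon> a b P N" by (auto simp: bumps_def)
  have "(\<lambda>x. c * of_real x * h x) = bump \<epsilon> a b ([:0, c:] * P) N"
    by (rule ext) (simp add: h bump_def algebra_simps)
  then show ?thesis by (simp only: bump_in_bumps)
qed

lemma power_le_fact_exp: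
  fixes x :: real
  assumes "0 \<le> x"
  shows "x ^ n / fact n \<le> exp x"
proof -
  have s: "(\<lambda>n. x ^ n /\<^sub>R fact n) sums exp x" by (rule exp_converges)
  have "(\<Sum>k\<in>{n}. x ^ k /\<^sub>R fact k) \<le> suminf (\<lambda>n. x ^ n /\<^sub>R fact n)"
    using s assms by (intro sum_le_suminf) (auto simp: sums_iff)
  then show ?thesis using s by (simp add: sums_iff divide_inverse mult.commute)
qed

lemma exp_edge_bound:
  fixes y \<epsilon> :: real
  assumes "0 < y" "0 < \<epsilon>"
  shows "exp (- \<epsilon> / y) / y ^ N \<le> fact (N + 2) / \<epsilon> ^ (N + 2) * y\<^sup>2"
proof -
  have "(\<epsilon> / y) ^ (N + 2) / fact (N + 2) \<le> exp (\<epsilon> / y)"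
    using assms by (intro power_le_fact_exp) simp
  then have "\<epsilon> ^ (N + 2) \<le> fact (N + 2) * y ^ (N + 2) * exp (\<epsilon> / y)"
    using assms by (simp add: power_divide divide_le_eq mult.commute mult.left_commute)
  then have "\<epsilon> ^ (N + 2) * exp (- \<epsilon> / y) \<le> fact (N + 2) * y ^ (N + 2)"
    using assms by (simp add: exp_minus field_simps)
  then show ?thesis
    using assms by (simp add: field_simps power_add power2_eq_square)
qed

lemma quadratic_bound_derivative_zero:
  fixes f :: "real \<Rightarrow> 'a::real_normed_vector"
  assumes "\<And>x. norm (f x) \<le> C * (x - a)\<^sup>2"
  shows "(f has_vector_derivative 0) (at a)"
proof -
  have fa: "f a = 0" using assms [of a] by simp
  have "((\<lambda>x. C * \<bar>x - a\<bar>) \<longlongrightarrow> C * \<bar>a - a\<bar>) (at a)" by (intro tendsto_intros)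
  then have lim: "((\<lambda>x. C * \<bar>x - a\<bar>) \<longlongrightarrow> 0) (at a)" by simp
  have "((\<lambda>x. (f x - f a - (x - a) *\<^sub>R 0) /\<^sub>R norm (x - a)) \<longlongrightarrow> 0) (at a)"
  proof (rule Lim_null_comparison [OF always_eventually lim], rule allI)
    fix x
    have "norm ((f x - f a - (x - a) *\<^sub>R 0) /\<^sub>R norm (x - a)) = norm (f x) / \<bar>x - a\<bar>"
      using fa by (simp add: divide_inverse mult.commute)
    also have "\<dots> \<le> C * (x - a)\<^sup>2 / \<bar>x - a\<bar>" by (intro divide_right_mono assms) auto
    also have "\<dots> = C * \<bar>x - a\<bar>"
      by (cases "x = a") (simp_all add: field_simps power2_eq_square abs_mult [symmetric])
    finally show "norm ((f x - f a - (x - a) *\<^sub>R 0) /\<^sub>R norm (x - a)) \<le> C * \<bar>x - a\<bar>" .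
  qed
  then show ?thesis
    by (simp add: has_vector_derivative_def has_derivative_at_within bounded_linear_scaleR_left)
qed

text \<open>
  The exponential beats every power of \<open>edge\<close>. Vanishing to second order makes the bump
  differentiable at the end points, with derivative 0.
\<close>

lemma bump_quadratic_bound:
  assumes "a < b" "0 < \<epsilon>"
  obtains C where "\<And>x. cmod (bump \<epsilon> a b P N x) \<le> C * (x - a)\<^sup>2" "\<And>x. cmod (bump \<epsilon> a b P N x) \<le> C * (x - b)\<^sup>2"
proof -
  have "continuous_on {a..b} (\<lambda>x. cmod (poly P (of_real x)))" by (intro continuous_intros)
  then obtain M where M: "0 < M" "\<And>x. x \<in> {a..b} \<Longrightarrow> \<bar>cmod (poly P (of_real x))\<bar> \<le> M"
    using compact_upper_bound [OF compact_Icc] by blast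
  let ?K = "fact (N + 2) / \<epsilon> ^ (N + 2) :: real"
  let ?C = "M * (?K * (b - a)\<^sup>2)"
  have K: "0 \<le> ?K" using assms by simp
  have key: "cmod (bump \<epsilon> a b P N x) \<le> M * (?K * (edge a b x)\<^sup>2)" if x: "a < x" "x < b" for x
  proof -
    have e: "0 < edge a b x" using x by (simp add: edge_def)
    have "cmod (bump \<epsilon> a b P N x) = cmod (poly P (of_real x)) * (exp (- \<epsilon> / edge a b x) / edge a b x ^ N)"
      using x e unfolding bump_def by (simp add: norm_mult norm_divide norm_power)
    also have "\<dots> \<le> M * (?K * (edge a b x)\<^sup>2)"
      using M(1) M(2) [of x] x exp_edge_bound [OF e assms(2), of N] e by (intro mult_mono) auto
    finally show ?thesis .
  qed
  show thesis
  proof (rule that [of ?C])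
    fix x
    show "cmod (bump \<epsilon> a b P N x) \<le> ?C * (x - a)\<^sup>2"
    proof (cases "a < x \<and> x < b")
      case True
      have "(edge a b x)\<^sup>2 \<le> (b - a)\<^sup>2 * (x - a)\<^sup>2"
        unfolding edge_def power_mult_distrib
        using True by (subst mult.commute) (intro mult_right_mono power_mono, auto)
      then have "M * (?K * (edge a b x)\<^sup>2) \<le> M * (?K * ((b - a)\<^sup>2 * (x - a)\<^sup>2))"
        using M K by (intro mult_left_mono) auto
      then show ?thesis using key [of x] True by (simp add: mult.assoc)
    next
      case False
      then have z: "bump \<epsilon> a b P N x = 0" by (auto simp: bump_def)
      show ?thesis unfolding z norm_zero
        using M(1) by (intro mult_nonneg_nonneg K) auto
    qed
    show "cmod (bump \<epsilon> a b P N x) \<le> ?C * (x - b)\<^sup>2"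
    proof (cases "a < x \<and> x < b")
      case True
      have "(edge a b x)\<^sup>2 \<le> (b - a)\<^sup>2 * (x - b)\<^sup>2"
        unfolding edge_def power_mult_distrib power2_commute [of x b]
        using True by (intro mult_right_mono power_mono, auto)
      then have "M * (?K * (edge a b x)\<^sup>2) \<le> M * (?K * ((b - a)\<^sup>2 * (x - b)\<^sup>2))"
        using M K by (intro mult_left_mono) auto
      then show ?thesis using key [of x] True by (simp add: mult.assoc)
    next
      case False
      then have z: "bump \<epsilon> a b P N x = 0" by (auto simp: bump_def)
      show ?thesis unfolding z norm_zero
        using M(1) by (intro mult_nonneg_nonneg K) auto
    qed
  qed
qed

text \<open>
  \<open>Q\<close> is \<open>edge\<close> as a polynomial and \<open>D\<close> is its derivative; the
  three summands stem from \<open>P\<close>, from the power of \<open>edge\<close> and from the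
  exponential.
\<close>

lemma bump_derivative:
  assumes "a < b" "0 < \<epsilon>"
  defines "Q \<equiv> [:- of_real a, 1:] * [:of_real b, -1:]"
  defines "D \<equiv> [:of_real (a + b), -2:]"
  shows "(bump \<epsilon> a b P N has_vector_derivative
    bump \<epsilon> a b (pderiv P * Q\<^sup>2 - smult (of_nat N) (P * D * Q) + smult (of_real \<epsilon>) (P * D)) (N + 2) x) (at x)"
    (is "(_ has_vector_derivative bump \<epsilon> a b ?P' _ x) _")
proof (cases "a < x \<and> x < b")
  case True
  define e where "e = edge a b x"
  have e: "0 < e" using True by (simp add: e_def edge_def)
  have Q: "poly Q (of_real x) = of_real e" by (simp add: Q_def e_def edge_def algebra_simps)
  have D: "poly D (of_real x) = of_real (a + b - 2 * x)" by (simp add: D_def)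
  have dedge: "(edge a b has_real_derivative (a + b - 2 * x)) (at x)"
    unfolding edge_def [abs_def] by (auto intro!: derivative_eq_intros)
  have dr: "((\<lambda>x. exp (- \<epsilon> / edge a b x) / edge a b x ^ N) has_real_derivative
      exp (- \<epsilon> / e) / e ^ (N + 2) * (\<epsilon> * (a + b - 2 * x) - real N * (a + b - 2 * x) * e)) (at x)"
    using e unfolding e_def
    by (auto intro!: derivative_eq_intros dedge simp: field_simps power2_eq_square power_add)
      (cases N; simp add: field_simps)
  have dp: "((\<lambda>x. poly P (of_real x)) has_vector_derivative poly (pderiv P) (of_real x)) (at x)"
    by (intro has_vector_derivative_real_field poly_DERIV)
  have "((\<lambda>x. poly P (of_real x) * of_real (exp (- \<epsilon> / edge a b x) / edge a b x ^ N)) has_vector_derivative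
      bump \<epsilon> a b ?P' (N + 2) x) (at x)"
  proof (rule has_vector_derivative_eq_rhs)
    show "((\<lambda>x. poly P (of_real x) * of_real (exp (- \<epsilon> / edge a b x) / edge a b x ^ N)) has_vector_derivative
      poly P (of_real x) * of_real (exp (- \<epsilon> / e) / e ^ (N + 2) * (\<epsilon> * (a + b - 2 * x) - real N * (a + b - 2 * x) * e))
      + poly (pderiv P) (of_real x) * of_real (exp (- \<epsilon> / edge a b x) / edge a b x ^ N)) (at x)"
      by (intro has_vector_derivative_mult dp has_vector_derivative_of_real)
        (use dr in \<open>simp add: has_real_derivative_iff_has_vector_derivative\<close>)
    show "poly P (of_real x) * of_real (exp (- \<epsilon> / e) / e ^ (N + 2) * (\<epsilon> * (a + b - 2 * x) - real N * (a + b - 2 * x) * e))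
      + poly (pderiv P) (of_real x) * of_real (exp (- \<epsilon> / edge a b x) / edge a b x ^ N)
      = bump \<epsilon> a b ?P' (N + 2) x"
    proof -
      define u where "u = exp (- \<epsilon> / e) / e ^ (N + 2)"
      have u: "exp (- \<epsilon> / e) / e ^ N = u * e\<^sup>2"
        using e by (simp add: u_def power_add power2_eq_square)
      have "bump \<epsilon> a b ?P' (N + 2) x = poly ?P' (of_real x) * of_real u"
        using True by (simp only: bump_def u_def e_def simp_thms if_True)
      also have "poly ?P' (of_real x) = poly (pderiv P) (of_real x) * (of_real e)\<^sup>2
          - of_nat N * (poly P (of_real x) * of_real (a + b - 2 * x) * of_real e)
          + of_real \<epsilon> * (poly P (of_real x) * of_real (a + b - 2 * x))"
        by (simp only: poly_add poly_diff poly_smult poly_mult poly_power Q D)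
      finally show ?thesis
        unfolding e_def [symmetric] u u_def [symmetric] by (simp add: algebra_simps)
    qed
  qed
  moreover have "open {a<..<b}" "x \<in> {a<..<b}" using True by auto
  ultimately show ?thesis
    by (rule has_vector_derivative_transform_within_open) (auto simp: bump_def)
next
  case False
  obtain C where C: "\<And>x. cmod (bump \<epsilon> a b P N x) \<le> C * (x - a)\<^sup>2" "\<And>x. cmod (bump \<epsilon> a b P N x) \<le> C * (x - b)\<^sup>2"
    using bump_quadratic_bound [OF assms(1,2)] by metis
  have zero: "bump \<epsilon> a b R M x = 0" for R M using False by (auto simp: bump_def)
  consider "x < a" | "x = a" | "x = b" | "b < x" using False by linarith
  then have "(bump \<epsilon> a b P N has_vector_derivative 0) (at x)"
  proof cases
    case 1
    show ?thesis
      by (rule has_vector_derivative_transform_within_open [OF has_vector_derivative_const, of "{..<a}" _ 0])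
        (use 1 in \<open>auto simp: bump_def\<close>)
  next
    case 2
    then show ?thesis using quadratic_bound_derivative_zero C(1) by blast
  next
    case 3
    then show ?thesis using quadratic_bound_derivative_zero C(2) by blast
  next
    case 4
    show ?thesis
      by (rule has_vector_derivative_transform_within_open [OF has_vector_derivative_const, of "{b<..}" _ 0])
        (use 4 in \<open>auto simp: bump_def\<close>)
  qed
  then show ?thesis by (simp add: zero)
qed

lemma bumps_derivative:
  assumes "a < b" "0 < \<epsilon>" "h \<in> bumps \<epsilon> a b"
  obtains h' where "h' \<in> bumps \<epsilon> a b" "\<And>x. (h has_vector_derivative h' x) (at x)"
  using assms bump_derivative [OF assms(1,2)] unfolding bumps_def by blast

lemma bumps_continuous:
  assumes "a < b" "0 < \<epsilon>" "h \<in> bumps \<epsilon> a b"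
  shows "continuous_on X h"
proof -
  obtain h' where "\<And>x. (h has_vector_derivative h' x) (at x)"
    using bumps_derivative [OF assms] by metis
  then show ?thesis
    by (meson continuous_at_imp_continuous_on has_vector_derivative_continuous)
qed

section \<open>Products of bump functions and their Fourier transforms\<close>

lemma continuous_compact_support_integral:
  fixes f :: "real \<Rightarrow> complex"
  assumes "continuous_on {a..b} f" "\<And>x. x \<notin> {a..b} \<Longrightarrow> f x = 0"
  shows "integrable lborel f" "(LINT x|lborel. f x) = integral {a..b} f"
proof -
  have s: "set_integrable lborel {a..b} f"
    by (rule borel_integrable_atLeastAtMost' [OF assms(1)])
  have eq: "(\<lambda>x. indicator {a..b} x *\<^sub>R f x) = f"
    using assms(2) by (auto simp: fun_eq_iff indicator_def)
  show "integrable lborel f" using s unfolding set_integrable_def eq .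
  have "(LINT x:{a..b}|lborel. f x) = integral {a..b} f"
    by (rule set_borel_integral_eq_integral(2) [OF s])
  then show "(LINT x|lborel. f x) = integral {a..b} f"
    unfolding set_lebesgue_integral_def eq .
qed

definition fourier1 :: "(real \<Rightarrow> complex) \<Rightarrow> real \<Rightarrow> complex" where
  "fourier1 h x = (LINT \<xi>|lborel. exp (- \<i> * of_real (x * \<xi>)) * h \<xi>)"

context
  fixes \<epsilon> a b :: real
  assumes ab: "a < b" and eps: "0 < \<epsilon>"
begin

lemma bumps_integrable:
  assumes "h \<in> bumps \<epsilon> a b"
  shows "integrable lborel h" "integrable lborel (\<lambda>\<xi>. exp (- \<i> * of_real (x * \<xi>)) * h \<xi>)"
    "fourier1 h x = integral {a..b} (\<lambda>\<xi>. exp (- \<i> * of_real (x * \<xi>)) * h \<xi>)"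
proof -
  have c: "continuous_on {a..b} h" by (rule bumps_continuous [OF ab eps assms])
  have z: "h y = 0" if "y \<notin> {a..b}" for y using bumps_outside [OF assms, of y] that by auto
  show "integrable lborel h" using continuous_compact_support_integral(1) [OF c z] .
  have c': "continuous_on {a..b} (\<lambda>\<xi>. exp (- \<i> * of_real (x * \<xi>)) * h \<xi>)"
    by (intro continuous_intros c)
  show "integrable lborel (\<lambda>\<xi>. exp (- \<i> * of_real (x * \<xi>)) * h \<xi>)"
    by (rule continuous_compact_support_integral(1) [OF c']) (simp add: z)
  show "fourier1 h x = integral {a..b} (\<lambda>\<xi>. exp (- \<i> * of_real (x * \<xi>)) * h \<xi>)"
    unfolding fourier1_def by (rule continuous_compact_support_integral(2) [OF c']) (simp add: z)
qed

lemma fourier1_derivative: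
  assumes h: "h \<in> bumps \<epsilon> a b"
  shows "(fourier1 h has_vector_derivative fourier1 (\<lambda>\<xi>. - \<i> * of_real \<xi> * h \<xi>) x) (at x)"
proof -
  have c: "continuous_on X h" for X by (rule bumps_continuous [OF ab eps h])
  have "((\<lambda>x. integral (cbox a b) (\<lambda>\<xi>. exp (- \<i> * of_real (x * \<xi>)) * h \<xi>)) has_vector_derivative
      integral (cbox a b) (\<lambda>\<xi>. exp (- \<i> * of_real (x * \<xi>)) * (- \<i> * of_real \<xi> * h \<xi>))) (at x within UNIV)"
  proof (rule leibniz_rule_vector_derivative)
    fix x t :: real
    have "((\<lambda>x. exp (x *\<^sub>R (- \<i> * of_real t)) * h t) has_vector_derivative
        exp (x *\<^sub>R (- \<i> * of_real t)) * (- \<i> * of_real t) * h t) (at x)"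
      by (intro has_vector_derivative_mult_left exp_scaleR_has_vector_derivative)
    then show "((\<lambda>x. exp (- \<i> * of_real (x * t)) * h t) has_vector_derivative
        exp (- \<i> * of_real (x * t)) * (- \<i> * of_real t * h t)) (at x)"
      by (simp add: scaleR_conv_of_real algebra_simps)
    show "(\<lambda>\<xi>. exp (- \<i> * of_real (x * \<xi>)) * h \<xi>) integrable_on cbox a b"
      by (intro integrable_continuous continuous_intros c)
  next
    have "continuous_on (UNIV \<times> cbox a b) (\<lambda>y. h (snd y))"
      by (rule continuous_on_compose2 [OF c [of UNIV] continuous_on_snd]) auto
    then show "continuous_on (UNIV \<times> cbox a b) (\<lambda>(x, t). exp (- \<i> * of_real (x * t)) * (- \<i> * of_real t * h t))"
      unfolding case_prod_beta by (intro continuous_intros)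
  qed auto
  moreover have "fourier1 h = (\<lambda>x. integral (cbox a b) (\<lambda>\<xi>. exp (- \<i> * of_real (x * \<xi>)) * h \<xi>))"
    unfolding cbox_interval by (rule ext) (rule bumps_integrable(3) [OF h])
  moreover have "fourier1 (\<lambda>\<xi>. - \<i> * of_real \<xi> * h \<xi>) x
      = integral (cbox a b) (\<lambda>\<xi>. exp (- \<i> * of_real (x * \<xi>)) * (- \<i> * of_real \<xi> * h \<xi>))"
    unfolding cbox_interval by (rule bumps_integrable(3) [OF bumps_mult [OF h]])
  ultimately show ?thesis by simp
qed

text \<open>
  There are no boundary terms, since \<open>h\<close> vanishes at the end points.
\<close>

lemma fourier1_by_parts:
  assumes h: "h \<in> bumps \<epsilon> a b"
  obtains h' where "h' \<in> bumps \<epsilon> a b" "\<And>x. \<i> * of_real x * fourier1 h x = fourier1 h' x"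
proof -
  obtain h' where h': "h' \<in> bumps \<epsilon> a b" and d: "\<And>\<xi>. (h has_vector_derivative h' \<xi>) (at \<xi>)"
    using bumps_derivative [OF ab eps h] by metis
  have "\<i> * of_real x * fourier1 h x = fourier1 h' x" for x
  proof -
    let ?e = "\<lambda>\<xi>. exp (- \<i> * of_real (x * \<xi>))"
    have de: "(?e has_vector_derivative ?e \<xi> * (- \<i> * of_real x)) (at \<xi> within X)" for \<xi> X
      using exp_scaleR_has_vector_derivative [of "- \<i> * of_real x" \<xi> X]
      by (simp add: scaleR_conv_of_real algebra_simps)
    have "((\<lambda>\<xi>. ?e \<xi> * h' \<xi> + ?e \<xi> * (- \<i> * of_real x) * h \<xi>) has_integral ?e b * h b - ?e a * h a) {a..b}"
      using ab by (intro fundamental_theorem_of_calculus has_vector_derivative_mult de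
          has_vector_derivative_at_within [OF d]) auto
    moreover have "h a = 0" "h b = 0" using bumps_outside [OF h] by auto
    ultimately have 1: "integral {a..b} (\<lambda>\<xi>. ?e \<xi> * h' \<xi> - \<i> * of_real x * (?e \<xi> * h \<xi>)) = 0"
      by (intro integral_unique) (simp add: algebra_simps)
    have i: "(\<lambda>\<xi>. ?e \<xi> * k \<xi>) integrable_on {a..b}" if "k \<in> bumps \<epsilon> a b" for k
      by (intro integrable_continuous_real continuous_intros bumps_continuous [OF ab eps that])
    have "integral {a..b} (\<lambda>\<xi>. ?e \<xi> * h' \<xi>) - \<i> * of_real x * integral {a..b} (\<lambda>\<xi>. ?e \<xi> * h \<xi>) = 0"
      using 1 i [OF h] i [OF h'] by (simp add: integral_diff integrable_on_mult_right)
    then show ?thesis by (simp add: bumps_integrable(3) [OF h] bumps_integrable(3) [OF h'])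
  qed
  then show thesis using that h' by blast
qed

text \<open>
  Each integration by parts gains one power of \<open>x\<close>.
\<close>

lemma fourier1_decay:
  assumes "h \<in> bumps \<epsilon> a b"
  shows "\<exists>C. \<forall>x. (1 + \<bar>x\<bar>) ^ N * cmod (fourier1 h x) \<le> C"
  using assms
proof (induction N arbitrary: h)
  case 0
  have "cmod (fourier1 h x) \<le> (LINT \<xi>|lborel. cmod (h \<xi>))" for x
  proof -
    have "cmod (fourier1 h x) \<le> (LINT \<xi>|lborel. cmod (exp (- \<i> * of_real (x * \<xi>)) * h \<xi>))"
      unfolding fourier1_def by (rule integral_norm_bound)
    then show ?thesis by (simp add: norm_mult norm_exp_eq_Re)
  qed
  then show ?case by auto
next
  case (Suc N)
  obtain h' where h': "h' \<in> bumps \<epsilon> a b" "\<And>x. \<i> * of_real x * fourier1 h x = fourier1 h' x"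
    using fourier1_by_parts [OF Suc.prems] by metis
  obtain C1 C2 where C: "\<And>x. (1 + \<bar>x\<bar>) ^ N * cmod (fourier1 h x) \<le> C1"
    "\<And>x. (1 + \<bar>x\<bar>) ^ N * cmod (fourier1 h' x) \<le> C2"
    using Suc.IH [OF Suc.prems] Suc.IH [OF h'(1)] by metis
  have "(1 + \<bar>x\<bar>) ^ Suc N * cmod (fourier1 h x) \<le> C1 + C2" for x
  proof -
    have "\<bar>x\<bar> * cmod (fourier1 h x) = cmod (fourier1 h' x)"
      unfolding h'(2) [symmetric] by (simp add: norm_mult)
    then have "(1 + \<bar>x\<bar>) ^ Suc N * cmod (fourier1 h x)
        = (1 + \<bar>x\<bar>) ^ N * cmod (fourier1 h x) + (1 + \<bar>x\<bar>) ^ N * cmod (fourier1 h' x)"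
      by (simp add: algebra_simps)
    then show ?thesis using C [of x] by linarith
  qed
  then show ?case by blast
qed

end

text \<open>
  Lebesgue measure on vectors is the image of the product measure on coordinate functions, for which the
  integral of a product of functions of separate coordinates factors.
\<close>

lemma integral_lborel_vec_prod:
  fixes f :: "'n::finite \<Rightarrow> real \<Rightarrow> complex"
  assumes f: "\<And>i. integrable lborel (f i)"
  shows "integrable lborel (\<lambda>x :: real ^ 'n. \<Prod>i\<in>UNIV. f i (x $ i))"
    and "(LINT x|lborel. (\<Prod>i\<in>UNIV. f i ((x :: real ^ 'n) $ i))) = (\<Prod>i\<in>UNIV. LINT y|lborel. f i y)"
proof -
  let ?ax = "\<lambda>i :: 'n. axis i (1::real)"
  have inj: "inj ?ax" by (auto simp: inj_on_def axis_eq_axis)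
  have Basis: "(Basis :: (real ^ 'n) set) = range ?ax" by (auto simp: Basis_vec_def)
  define g where "g b = f (inv ?ax b)" for b
  have g: "g (?ax i) = f i" for i by (simp add: g_def inv_f_f [OF inj])
  have prodB: "(\<Prod>b\<in>Basis. F b) = (\<Prod>i\<in>UNIV. F (?ax i))" for F :: "real ^ 'n \<Rightarrow> complex"
    unfolding Basis by (simp add: prod.reindex [OF inj])
  define T where "T y = (\<Sum>b\<in>Basis. y b *\<^sub>R (b :: real ^ 'n))" for y
  have Tm: "T \<in> measurable (\<Pi>\<^sub>M b\<in>Basis. lborel) borel"
    unfolding T_def by measurable
  have lb: "(lborel :: (real ^ 'n) measure) = distr (\<Pi>\<^sub>M b\<in>Basis. lborel) borel T"
    unfolding T_def by (rule lborel_eq)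
  have Ti: "T y $ i = y (?ax i)" for y i
  proof -
    have "T y $ i = T y \<bullet> ?ax i" by (simp add: inner_axis)
    also have "\<dots> = y (?ax i)" unfolding T_def using Basis by (intro inner_sum_left_Basis) auto
    finally show ?thesis .
  qed
  have fm [measurable]: "f i \<in> borel_measurable borel" for i using f [of i] by simp
  have m: "(\<lambda>x :: real ^ 'n. \<Prod>i\<in>UNIV. f i (x $ i)) \<in> borel_measurable borel"
    by measurable
  have comp: "(\<Prod>i\<in>UNIV. f i (T y $ i)) = (\<Prod>b\<in>Basis. g b (y b))" for y
    by (simp add: prodB g Ti)
  interpret product_sigma_finite "\<lambda>_ :: real ^ 'n. lborel :: real measure" ..
  have gi: "integrable lborel (g b)" for b by (simp add: g_def f)
  show "integrable lborel (\<lambda>x :: real ^ 'n. \<Prod>i\<in>UNIV. f i (x $ i))"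
    unfolding lb using product_integrable_prod [of Basis g] gi
    by (subst integrable_distr_eq [OF Tm m]) (simp add: comp)
  have "(LINT x|lborel. (\<Prod>i\<in>UNIV. f i ((x :: real ^ 'n) $ i)))
      = (LINT y|(\<Pi>\<^sub>M b\<in>Basis. lborel). (\<Prod>b\<in>Basis. g b (y b)))"
    unfolding lb by (subst integral_distr [OF Tm m]) (simp add: comp)
  also have "\<dots> = (\<Prod>b\<in>Basis. LINT y|lborel. g b y)"
    by (rule product_integral_prod) (auto simp: gi)
  also have "\<dots> = (\<Prod>i\<in>UNIV. LINT y|lborel. f i y)" by (simp add: prodB g)
  finally show "(LINT x|lborel. (\<Prod>i\<in>UNIV. f i ((x :: real ^ 'n) $ i))) = (\<Prod>i\<in>UNIV. LINT y|lborel. f i y)" .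
qed

definition tensor :: "('n::finite \<Rightarrow> real \<Rightarrow> complex) \<Rightarrow> real ^ 'n \<Rightarrow> complex" where
  "tensor h \<xi> = (\<Prod>i\<in>UNIV. h i (\<xi> $ i))"

text \<open>
  The effect on \<open>h\<close> of differentiating its Fourier transform, one variable at a time.
\<close>

definition moment :: "('n \<Rightarrow> nat) \<Rightarrow> ('n \<Rightarrow> real \<Rightarrow> complex) \<Rightarrow> 'n \<Rightarrow> real \<Rightarrow> complex" where
  "moment \<alpha> h i y = (- \<i> * of_real y) ^ \<alpha> i * h i y"

lemma tensor_moment:
  "tensor (moment \<alpha> h) \<xi> = (- \<i>) ^ mi_size \<alpha> * of_real (mi_power \<xi> \<alpha>) * tensor h \<xi>"
  by (simp only: tensor_def moment_def mi_size_def mi_power_def prod.distrib power_mult_distrib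
      power_sum of_real_prod of_real_power)

locale box_bumps =
  fixes \<epsilon> :: real and a b :: "'n::finite \<Rightarrow> real"
  assumes ab: "\<And>i. a i < b i" and eps: "0 < \<epsilon>"
begin

definition bump_family :: "('n \<Rightarrow> real \<Rightarrow> complex) \<Rightarrow> bool" where
  "bump_family h \<longleftrightarrow> (\<forall>i. h i \<in> bumps \<epsilon> (a i) (b i))"

lemma bump_family_moment:
  assumes "bump_family h"
  shows "bump_family (moment \<alpha> h)"
proof -
  have "(\<lambda>y. (- \<i> * of_real y) ^ n * k y) \<in> bumps \<epsilon> c d" if "k \<in> bumps \<epsilon> c d" for n k c d
  proof (induction n)
    case (Suc n)
    from bumps_mult [OF this, of "- \<i>"] show ?case by (simp add: algebra_simps)
  qed (use that in simp)
  then show ?thesis using assms by (simp add: bump_family_def moment_def [abs_def])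
qed

lemma tensor_integrable:
  assumes "bump_family h"
  shows "integrable lborel (tensor h)"
  unfolding tensor_def [abs_def]
proof (rule integral_lborel_vec_prod(1))
  fix i
  show "integrable lborel (h i)"
    using bumps_integrable(1) [OF ab [of i] eps] assms by (simp add: bump_family_def)
qed

lemma tensor_continuous: "bump_family h \<Longrightarrow> continuous_on UNIV (tensor h)"
  unfolding tensor_def [abs_def] bump_family_def
  by (intro continuous_on_prod continuous_on_compose2 [OF bumps_continuous [OF ab eps], of _ _ UNIV]
      continuous_intros) auto

lemma tensor_outside:
  assumes "bump_family h" "\<xi> \<notin> cbox (\<chi> i. a i) (\<chi> i. b i)"
  shows "tensor h \<xi> = 0"
proof -
  obtain i where "\<not> (a i \<le> \<xi> $ i \<and> \<xi> $ i \<le> b i)" using assms(2) by (auto simp: mem_box_cart)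
  then have "h i (\<xi> $ i) = 0" using assms(1) by (intro bumps_outside [of _ \<epsilon> "a i" "b i"]) (auto simp: bump_family_def)
  then show ?thesis by (auto simp: tensor_def)
qed

definition tensor_hat :: "('n \<Rightarrow> real \<Rightarrow> complex) \<Rightarrow> real ^ 'n \<Rightarrow> complex" where
  "tensor_hat h x = (\<Prod>i\<in>UNIV. fourier1 (h i) (x $ i))"

lemma fourier_integral_tensor:
  assumes "bump_family h"
  shows "fourier_integral (tensor h) x = tensor_hat h x"
proof -
  have eq: "exp (- \<i> * of_real (\<xi> \<bullet> x)) * tensor h \<xi>
      = (\<Prod>i\<in>UNIV. exp (- \<i> * of_real (x $ i * \<xi> $ i)) * h i (\<xi> $ i))" for \<xi>
    by (simp add: tensor_def prod.distrib inner_vec_def exp_sum [symmetric] sum_distrib_left sum_negf mult.commute)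
  have "integrable lborel (\<lambda>y. exp (- \<i> * of_real (x $ i * y)) * h i y)" for i
    using assms by (intro bumps_integrable(2) [OF ab eps]) (auto simp: bump_family_def)
  then show ?thesis
    unfolding fourier_integral_def eq tensor_hat_def fourier1_def
    by (rule integral_lborel_vec_prod(2))
qed

lemma tensor_hat_derivative:
  assumes "bump_family h"
  shows "(tensor_hat h has_derivative (\<lambda>v. \<Sum>i\<in>UNIV. (v $ i) *\<^sub>R
      tensor_hat (\<lambda>j. if j = i then (\<lambda>y. - \<i> * of_real y * h i y) else h j) x)) (at x)"
proof -
  have d: "((\<lambda>x. fourier1 (h i) (x $ i)) has_derivative
      (\<lambda>v. (v $ i) *\<^sub>R fourier1 (\<lambda>y. - \<i> * of_real y * h i y) (x $ i))) (at x)" for i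
  proof -
    have "(fourier1 (h i) has_derivative (\<lambda>s. s *\<^sub>R fourier1 (\<lambda>y. - \<i> * of_real y * h i y) (x $ i))) (at (x $ i))"
      using fourier1_derivative [OF ab eps, of "h i" i "x $ i"] assms
      by (simp add: bump_family_def has_vector_derivative_def)
    from has_derivative_compose [OF bounded_linear.has_derivative [OF bounded_linear_vec_nth has_derivative_ident] this]
    show ?thesis .
  qed
  have "(tensor_hat h has_derivative (\<lambda>v. \<Sum>i\<in>UNIV. (v $ i) *\<^sub>R fourier1 (\<lambda>y. - \<i> * of_real y * h i y) (x $ i)
      * (\<Prod>j\<in>UNIV - {i}. fourier1 (h j) (x $ j)))) (at x)"
    unfolding tensor_hat_def [abs_def] by (intro has_derivative_prod d)
  moreover have "tensor_hat (\<lambda>j. if j = i then (\<lambda>y. - \<i> * of_real y * h i y) else h j) x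
      = fourier1 (\<lambda>y. - \<i> * of_real y * h i y) (x $ i) * (\<Prod>j\<in>UNIV - {i}. fourier1 (h j) (x $ j))" for i
    unfolding tensor_hat_def by (subst prod.remove [of _ i]) (auto intro!: prod.cong)
  ultimately show ?thesis by (simp add: mult.assoc)
qed

lemma partial_deriv_tensor_hat:
  assumes "bump_family h"
  shows "partial_deriv i (tensor_hat h) = tensor_hat (\<lambda>j. if j = i then (\<lambda>y. - \<i> * of_real y * h i y) else h j)"
proof
  fix x
  have "partial_deriv i (tensor_hat h) x = (\<Sum>k\<in>UNIV. (axis i 1 $ k) *\<^sub>R
      tensor_hat (\<lambda>j. if j = k then (\<lambda>y. - \<i> * of_real y * h k y) else h j) x)"
    unfolding partial_deriv_def frechet_derivative_at [OF tensor_hat_derivative [OF assms], symmetric] ..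
  also have "\<dots> = (\<Sum>k\<in>UNIV. if k = i then
      tensor_hat (\<lambda>j. if j = i then (\<lambda>y. - \<i> * of_real y * h i y) else h j) x else 0)"
    by (intro sum.cong) (auto simp: axis_def)
  finally show "partial_deriv i (tensor_hat h) x
      = tensor_hat (\<lambda>j. if j = i then (\<lambda>y. - \<i> * of_real y * h i y) else h j) x" by simp
qed

lemma foldr_partial_deriv_tensor_hat:
  assumes "bump_family h"
  shows "foldr partial_deriv is (tensor_hat h) = tensor_hat (moment (count_list is) h)"
proof (induction "is")
  case Nil
  then show ?case by (simp add: moment_def [abs_def])
next
  case (Cons i "is")
  have "(\<lambda>j. if j = i then (\<lambda>y. - \<i> * of_real y * moment (count_list is) h i y) else moment (count_list is) h j)
      = moment (count_list (i # is)) h"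
    by (auto simp: fun_eq_iff moment_def)
  then show ?case
    using partial_deriv_tensor_hat [OF bump_family_moment [OF assms]] Cons by (simp del: count_list.simps)
qed

text \<open>
  Decay in each variable suffices, as \<open>1 + |x|\<close> is at most the product of the factors
  \<open>1 + |x\<^sub>i|\<close>.
\<close>

lemma tensor_hat_decay:
  assumes "bump_family h"
  shows "\<exists>C. \<forall>x. (1 + norm x) ^ N * cmod (tensor_hat h x) \<le> C"
proof -
  have "\<forall>i. \<exists>C. \<forall>y. (1 + \<bar>y\<bar>) ^ N * cmod (fourier1 (h i) y) \<le> C"
  proof
    fix i
    show "\<exists>C. \<forall>y. (1 + \<bar>y\<bar>) ^ N * cmod (fourier1 (h i) y) \<le> C"
      using fourier1_decay [OF ab [of i] eps] assms by (simp add: bump_family_def)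
  qed
  then obtain C where C: "\<And>i y. (1 + \<bar>y\<bar>) ^ N * cmod (fourier1 (h i) y) \<le> C i" by metis
  have le: "1 + norm x \<le> (\<Prod>i\<in>UNIV. 1 + \<bar>x $ i\<bar>)" for x :: "real ^ 'n"
  proof -
    have "1 + (\<Sum>i\<in>A. \<bar>x $ i\<bar>) \<le> (\<Prod>i\<in>A. 1 + \<bar>x $ i\<bar>)" if "finite A" for A
      using that
    proof (induction A rule: finite_induct)
      case (insert i A)
      have "1 + (\<bar>x $ i\<bar> + (\<Sum>i\<in>A. \<bar>x $ i\<bar>)) \<le> (1 + \<bar>x $ i\<bar>) * (1 + (\<Sum>i\<in>A. \<bar>x $ i\<bar>))"
        by (simp add: algebra_simps sum_nonneg)
      also have "\<dots> \<le> (1 + \<bar>x $ i\<bar>) * (\<Prod>i\<in>A. 1 + \<bar>x $ i\<bar>)"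
        using insert by (intro mult_left_mono) auto
      finally show ?case using insert by simp
    qed simp
    from this [of UNIV] show ?thesis using norm_le_l1_cart [of x] by simp
  qed
  have "(1 + norm x) ^ N * cmod (tensor_hat h x) \<le> (\<Prod>i\<in>UNIV. C i)" for x
  proof -
    have "(1 + norm x) ^ N * cmod (tensor_hat h x) \<le> (\<Prod>i\<in>UNIV. 1 + \<bar>x $ i\<bar>) ^ N * cmod (tensor_hat h x)"
      by (intro mult_right_mono power_mono le) auto
    also have "\<dots> = (\<Prod>i\<in>UNIV. (1 + \<bar>x $ i\<bar>) ^ N * cmod (fourier1 (h i) (x $ i)))"
      by (simp add: tensor_hat_def prod_norm [symmetric] prod.distrib prod_power_distrib)
    also have "\<dots> \<le> (\<Prod>i\<in>UNIV. C i)" by (intro prod_mono) (auto intro: C)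
    finally show ?thesis .
  qed
  then show ?thesis by blast
qed

lemma schwartz_tensor_hat:
  assumes "bump_family h"
  shows "schwartz (tensor_hat h)"
  unfolding schwartz_def foldr_partial_deriv_tensor_hat [OF assms]
proof (intro allI conjI)
  fix "is" :: "'n list" and x N
  have bf: "bump_family (moment (count_list is) h)" by (rule bump_family_moment [OF assms])
  show "tensor_hat (moment (count_list is) h) differentiable at x"
    using tensor_hat_derivative [OF bf] by (auto simp: differentiable_def)
  obtain C where "\<And>x. (1 + norm x) ^ N * cmod (tensor_hat (moment (count_list is) h) x) \<le> C"
    using tensor_hat_decay [OF bf] by blast
  then have "norm ((1 + norm x) ^ N *\<^sub>R tensor_hat (moment (count_list is) h) x) \<le> C" for x
    by (simp add: abs_mult)
  then show "bounded (range (\<lambda>x. (1 + norm x) ^ N *\<^sub>R tensor_hat (moment (count_list is) h) x))"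
    by (intro boundedI) auto
qed

text \<open>
  Every list of directions with the prescribed multiplicities gives the same derivative. Such a list
  exists, so the unspecified choice in \<open>mi_deriv\<close> is one.
\<close>

lemma mi_deriv_tensor_hat:
  assumes "bump_family h"
  shows "mi_deriv \<alpha> (tensor_hat h) = tensor_hat (moment \<alpha> h)"
proof -
  obtain xs :: "'n list" where xs: "set xs = UNIV" "distinct xs"
    using finite_distinct_list [OF finite [of "UNIV :: 'n set"]] by blast
  have cr: "count_list (replicate n x) y = (if x = y then n else 0)" for n and x y :: 'n
    by (induction n) auto
  have "count_list (concat (map (\<lambda>i. replicate (\<alpha> i) i) ys)) j = (if j \<in> set ys then \<alpha> j else 0)"
    if "distinct ys" for ys j
    using that by (induction ys) (auto simp: cr count_list_append)
  then have "\<exists>is. \<forall>i. count_list is i = \<alpha> i" using xs by (metis UNIV_I)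
  then have "\<forall>i. count_list (SOME is. \<forall>i. count_list is i = \<alpha> i) i = \<alpha> i" by (rule someI_ex)
  then have "count_list (SOME is. \<forall>i. count_list is i = \<alpha> i) = \<alpha>" by (auto simp: fun_eq_iff)
  then show ?thesis
    unfolding mi_deriv_def foldr_partial_deriv_tensor_hat [OF assms] by simp
qed

end

section \<open>The Fourier transform of square-integrable functions\<close>

lemma is_L2_dominated:
  assumes g: "is_L2 g" and f: "f \<in> borel_measurable lborel" and le: "AE x in lborel. cmod (f x) \<le> K * cmod (g x)"
  shows "is_L2 f"
proof -
  have int: "integrable lborel (\<lambda>x. K\<^sup>2 * (cmod (g x))\<^sup>2)" using g by (simp add: is_L2_def)
  have le2: "AE x in lborel. norm ((cmod (f x))\<^sup>2) \<le> norm (K\<^sup>2 * (cmod (g x))\<^sup>2)"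
    using le
  proof eventually_elim
    case (elim x)
    then have "(cmod (f x))\<^sup>2 \<le> (K * cmod (g x))\<^sup>2" by (intro power_mono) auto
    then show ?case by (simp add: power_mult_distrib)
  qed
  have "integrable lborel (\<lambda>x. (cmod (f x))\<^sup>2)"
    by (rule Bochner_Integration.integrable_bound [OF int _ le2]) (use f in measurable)
  then show ?thesis using f by (simp add: is_L2_def)
qed

lemma L2_norm_dominated:
  assumes g: "is_L2 g" and f: "f \<in> borel_measurable lborel" and K: "0 \<le> K"
    and le: "AE x in lborel. cmod (f x) \<le> K * cmod (g x)"
  shows "L2_norm f \<le> K * L2_norm g"
proof -
  have "(LINT x|lborel. (cmod (f x))\<^sup>2) \<le> (LINT x|lborel. K\<^sup>2 * (cmod (g x))\<^sup>2)"
  proof (rule integral_mono_AE)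
    show "integrable lborel (\<lambda>x. (cmod (f x))\<^sup>2)" using is_L2_dominated [OF g f le] by (simp add: is_L2_def)
    show "integrable lborel (\<lambda>x. K\<^sup>2 * (cmod (g x))\<^sup>2)" using g by (simp add: is_L2_def)
    show "AE x in lborel. (cmod (f x))\<^sup>2 \<le> K\<^sup>2 * (cmod (g x))\<^sup>2"
      using le
    proof eventually_elim
      case (elim x)
      then show ?case unfolding power_mult_distrib [symmetric] by (intro power_mono) auto
    qed
  qed
  then have "L2_norm f \<le> sqrt (K\<^sup>2 * (LINT x|lborel. (cmod (g x))\<^sup>2))"
    unfolding L2_norm_def by simp
  then show ?thesis using K by (simp add: L2_norm_def real_sqrt_mult)
qed

lemma L2_norm_AE_cong:
  assumes "is_L2 f" "is_L2 g" "AE x in lborel. f x = g x"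
  shows "L2_norm f = L2_norm g"
  unfolding L2_norm_def
  by (intro arg_cong [of _ _ sqrt] integral_cong_AE) (use assms in \<open>auto simp: is_L2_def\<close>)

lemma L2_norm_nonneg [simp]: "0 \<le> L2_norm f"
  by (simp add: L2_norm_def)

lemma sum_power2_bound: "(a + b)\<^sup>2 \<le> 2 * a\<^sup>2 + 2 * (b::real)\<^sup>2"
  using zero_le_power2 [of "a - b"] by (simp add: power2_eq_square algebra_simps)

lemma norm_add_power2_bound: "(cmod (a + b))\<^sup>2 \<le> 2 * (cmod a)\<^sup>2 + 2 * (cmod b)\<^sup>2"
  by (rule order_trans [OF power_mono [OF norm_triangle_ineq norm_ge_zero] sum_power2_bound])

lemma is_L2_add:
  assumes "is_L2 f" "is_L2 g"
  shows "is_L2 (\<lambda>x. f x + g x)"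
proof -
  have [measurable]: "f \<in> borel_measurable lborel" "g \<in> borel_measurable lborel"
    using assms by (auto simp: is_L2_def)
  have "integrable lborel (\<lambda>x. 2 * (cmod (f x))\<^sup>2 + 2 * (cmod (g x))\<^sup>2)"
    using assms by (auto simp: is_L2_def)
  then have "integrable lborel (\<lambda>x. (cmod (f x + g x))\<^sup>2)"
    by (rule Bochner_Integration.integrable_bound) (auto simp: norm_add_power2_bound)
  then show ?thesis by (simp add: is_L2_def)
qed

lemma is_L2_cmult:
  assumes "is_L2 f"
  shows "is_L2 (\<lambda>x. c * f x)"
proof (rule is_L2_dominated [OF assms])
  have [measurable]: "f \<in> borel_measurable lborel" using assms by (simp add: is_L2_def)
  show "(\<lambda>x. c * f x) \<in> borel_measurable lborel" by measurable
  show "AE x in lborel. cmod (c * f x) \<le> cmod c * cmod (f x)" by (simp add: norm_mult)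
qed

lemma is_L2_lincomb:
  "is_L2 f \<Longrightarrow> is_L2 g \<Longrightarrow> is_L2 (\<lambda>x. c * f x + d * g x)"
  by (intro is_L2_add is_L2_cmult)

lemma is_L2_mult:
  assumes "is_L2 f" "is_L2 g"
  shows "integrable lborel (\<lambda>x. f x * g x)"
    and "cmod (LINT x|lborel. f x * g x) \<le> L2_norm f * L2_norm g"
proof -
  have fm [measurable]: "f \<in> borel_measurable lborel" and gm [measurable]: "g \<in> borel_measurable lborel"
    using assms by (auto simp: is_L2_def)
  let ?A = "LINT x|lborel. (cmod (f x))\<^sup>2" and ?B = "LINT x|lborel. (cmod (g x))\<^sup>2"
  have "integrable lborel (\<lambda>x. (cmod (f x))\<^sup>2 + (cmod (g x))\<^sup>2)"
    using assms by (auto simp: is_L2_def)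
  then show i: "integrable lborel (\<lambda>x. f x * g x)"
  proof (rule Bochner_Integration.integrable_bound)
    have "norm (f x * g x) \<le> norm ((cmod (f x))\<^sup>2 + (cmod (g x))\<^sup>2)" for x
    proof -
      have "2 * (cmod (f x) * cmod (g x)) \<le> (cmod (f x))\<^sup>2 + (cmod (g x))\<^sup>2"
        using sum_squares_bound [of "cmod (f x)" "cmod (g x)"] by (simp add: mult.assoc)
      then show ?thesis
        by (simp add: norm_mult) (smt (verit) mult_nonneg_nonneg norm_ge_zero zero_le_power2)
    qed
    then show "AE x in lborel. norm (f x * g x) \<le> norm ((cmod (f x))\<^sup>2 + (cmod (g x))\<^sup>2)" by simp
  qed measurable
  have "(\<integral>\<^sup>+x. ennreal (cmod (f x)) * ennreal (cmod (g x)) \<partial>lborel)\<^sup>2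
      \<le> (\<integral>\<^sup>+x. (ennreal (cmod (f x)))\<^sup>2 \<partial>lborel) * (\<integral>\<^sup>+x. (ennreal (cmod (g x)))\<^sup>2 \<partial>lborel)"
    by (rule Cauchy_Schwarz_nn_integral) measurable
  moreover have "(\<integral>\<^sup>+x. ennreal (cmod (f x)) * ennreal (cmod (g x)) \<partial>lborel) = ennreal (LINT x|lborel. cmod (f x * g x))"
    using i by (simp add: ennreal_mult [symmetric] norm_mult [symmetric] nn_integral_eq_integral)
  moreover have "(\<integral>\<^sup>+x. (ennreal (cmod (f x)))\<^sup>2 \<partial>lborel) = ennreal ?A"
    using assms(1) by (simp add: ennreal_power is_L2_def nn_integral_eq_integral)
  moreover have "(\<integral>\<^sup>+x. (ennreal (cmod (g x)))\<^sup>2 \<partial>lborel) = ennreal ?B"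
    using assms(2) by (simp add: ennreal_power is_L2_def nn_integral_eq_integral)
  ultimately have "ennreal ((LINT x|lborel. cmod (f x * g x))\<^sup>2) \<le> ennreal (?A * ?B)"
    by (simp add: ennreal_power ennreal_mult)
  then have "(LINT x|lborel. cmod (f x * g x))\<^sup>2 \<le> ?A * ?B"
    by (subst (asm) ennreal_le_iff) (auto intro!: mult_nonneg_nonneg)
  then have "(LINT x|lborel. cmod (f x * g x)) \<le> sqrt (?A * ?B)" by (rule real_le_rsqrt)
  from order_trans [OF integral_norm_bound this]
  show "cmod (LINT x|lborel. f x * g x) \<le> L2_norm f * L2_norm g"
    by (simp add: L2_norm_def real_sqrt_mult)
qed

text \<open>
  \<open>|f| \<le> 1 + |f|\<^sup>2\<close>, and balls have finite measure.
\<close>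

lemma truncation_integrable:
  fixes f :: "real ^ 'n::finite \<Rightarrow> complex"
  assumes "is_L2 f"
  shows "integrable lborel (\<lambda>x. indicator (cball 0 R) x * f x)"
proof -
  have fm [measurable]: "f \<in> borel_measurable lborel" using assms by (simp add: is_L2_def)
  have [measurable]: "cball (0 :: real ^ 'n) R \<in> sets lborel" by simp
  have "emeasure lborel (cball (0 :: real ^ 'n) R) < \<infinity>" by (rule emeasure_lborel_cball_finite)
  then have "integrable lborel (\<lambda>x :: real ^ 'n. indicator (cball 0 R) x + (cmod (f x))\<^sup>2)"
    using assms by (intro Bochner_Integration.integrable_add integrable_real_indicator) (auto simp: is_L2_def)
  then show ?thesis
  proof (rule Bochner_Integration.integrable_bound)
    have "norm (indicator (cball 0 R) x * f x) \<le> norm (indicator (cball 0 R) x + (cmod (f x))\<^sup>2)" for x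
    proof -
      have "2 * cmod (f x) \<le> (cmod (f x))\<^sup>2 + 1"
        using sum_squares_bound [of "cmod (f x)" 1] by simp
      then have "cmod (f x) \<le> 1 + (cmod (f x))\<^sup>2" using norm_ge_zero [of "f x"] by linarith
      then show ?thesis by (auto simp: indicator_def norm_mult)
    qed
    then show "AE x in lborel. norm (indicator (cball 0 R) x * f x) \<le> norm (indicator (cball 0 R) x + (cmod (f x))\<^sup>2)"
      by simp
  qed measurable
qed

lemma fourier_kernel_integrable:
  assumes "integrable lborel f"
  shows "integrable lborel (\<lambda>x. exp (- \<i> * complex_of_real (x \<bullet> \<xi>)) * f x)"
proof (rule Bochner_Integration.integrable_bound [OF assms])
  have [measurable]: "f \<in> borel_measurable lborel" using assms by simp
  show "(\<lambda>x. exp (- \<i> * complex_of_real (x \<bullet> \<xi>)) * f x) \<in> borel_measurable lborel" by measurable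
  show "AE x in lborel. norm (exp (- \<i> * complex_of_real (x \<bullet> \<xi>)) * f x) \<le> norm (f x)"
    by (simp add: norm_mult norm_exp_eq_Re)
qed

lemma fourier_integral_lincomb:
  assumes "integrable lborel f" "integrable lborel g"
  shows "fourier_integral (\<lambda>x. c * f x + d * g x) \<xi> = c * fourier_integral f \<xi> + d * fourier_integral g \<xi>"
proof -
  have "fourier_integral (\<lambda>x. c * f x + d * g x) \<xi>
    = (LINT x|lborel. c * (exp (- \<i> * complex_of_real (x \<bullet> \<xi>)) * f x) + d * (exp (- \<i> * complex_of_real (x \<bullet> \<xi>)) * g x))"
    unfolding fourier_integral_def by (simp add: algebra_simps)
  also have "\<dots> = c * fourier_integral f \<xi> + d * fourier_integral g \<xi>"
    unfolding fourier_integral_def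
    by (subst Bochner_Integration.integral_add [OF integrable_mult_right [OF fourier_kernel_integrable [OF assms(1)]]
            integrable_mult_right [OF fourier_kernel_integrable [OF assms(2)]]]) simp
  finally show ?thesis .
qed

lemma fourier_integral_measurable:
  fixes f :: "real ^ 'n::finite \<Rightarrow> complex"
  assumes [measurable]: "f \<in> borel_measurable lborel"
  shows "fourier_integral f \<in> borel_measurable lborel"
proof -
  have "(\<lambda>\<xi>. LINT x|lborel. (\<lambda>\<xi> x. exp (- \<i> * complex_of_real (x \<bullet> \<xi>)) * f x) \<xi> x) \<in> borel_measurable lborel"
    by (rule lborel.borel_measurable_lebesgue_integral) measurable
  then show ?thesis by (simp add: fourier_integral_def [abs_def])
qed

lemma has_fourier_lincomb:
  fixes f f' :: "real ^ 'n::finite \<Rightarrow> complex"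
  assumes f: "has_fourier f g" and f': "has_fourier f' g'"
  shows "has_fourier (\<lambda>x. c * f x + d * f' x) (\<lambda>\<xi>. c * g \<xi> + d * g' \<xi>)"
proof -
  note L2 = f [unfolded has_fourier_def, THEN conjunct1] f [unfolded has_fourier_def, THEN conjunct2, THEN conjunct1]
    f' [unfolded has_fourier_def, THEN conjunct1] f' [unfolded has_fourier_def, THEN conjunct2, THEN conjunct1]
  have [measurable]: "f \<in> borel_measurable lborel" "g \<in> borel_measurable lborel"
    "f' \<in> borel_measurable lborel" "g' \<in> borel_measurable lborel"
    using L2 by (auto simp: is_L2_def)
  let ?F = "\<lambda>f R \<xi>. fourier_integral (\<lambda>x. indicator (cball 0 R) x * f x) \<xi>"
  let ?N = "\<lambda>f g R. \<integral>\<^sup>+ \<xi>. ennreal ((cmod (?F f R \<xi> - g \<xi>))\<^sup>2) \<partial>lborel"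
  have [measurable]: "?F f R \<in> borel_measurable lborel" "?F f' R \<in> borel_measurable lborel" for R
    using truncation_integrable [OF L2(1), of R] truncation_integrable [OF L2(3), of R]
    by (intro fourier_integral_measurable; simp only: borel_measurable_integrable)+
  have lim: "(?N f g \<longlongrightarrow> 0) at_top" "(?N f' g' \<longlongrightarrow> 0) at_top"
    using f f' by (auto simp: has_fourier_def)
  have up: "((\<lambda>R. ennreal (2 * (cmod c)\<^sup>2) * ?N f g R + ennreal (2 * (cmod d)\<^sup>2) * ?N f' g' R) \<longlongrightarrow>
      ennreal (2 * (cmod c)\<^sup>2) * 0 + ennreal (2 * (cmod d)\<^sup>2) * 0) at_top"
    by (intro tendsto_add tendsto_mult_ennreal lim tendsto_const) auto
  have le: "?N (\<lambda>x. c * f x + d * f' x) (\<lambda>\<xi>. c * g \<xi> + d * g' \<xi>) R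
      \<le> ennreal (2 * (cmod c)\<^sup>2) * ?N f g R + ennreal (2 * (cmod d)\<^sup>2) * ?N f' g' R" for R
  proof -
    have Flin: "?F (\<lambda>x. c * f x + d * f' x) R \<xi> = c * ?F f R \<xi> + d * ?F f' R \<xi>" for \<xi>
      using fourier_integral_lincomb [OF truncation_integrable [OF L2(1)] truncation_integrable [OF L2(3)], of c R d R \<xi>]
      by (simp add: algebra_simps)
    have "?N (\<lambda>x. c * f x + d * f' x) (\<lambda>\<xi>. c * g \<xi> + d * g' \<xi>) R
      \<le> (\<integral>\<^sup>+ \<xi>. ennreal (2 * (cmod c)\<^sup>2) * ennreal ((cmod (?F f R \<xi> - g \<xi>))\<^sup>2)
          + ennreal (2 * (cmod d)\<^sup>2) * ennreal ((cmod (?F f' R \<xi> - g' \<xi>))\<^sup>2) \<partial>lborel)"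
    proof (rule nn_integral_mono)
      fix \<xi> :: "real ^ 'n"
      have "?F (\<lambda>x. c * f x + d * f' x) R \<xi> - (c * g \<xi> + d * g' \<xi>)
        = c * (?F f R \<xi> - g \<xi>) + d * (?F f' R \<xi> - g' \<xi>)"
        unfolding Flin by (simp add: algebra_simps)
      then have "(cmod (?F (\<lambda>x. c * f x + d * f' x) R \<xi> - (c * g \<xi> + d * g' \<xi>)))\<^sup>2
        \<le> 2 * (cmod c)\<^sup>2 * (cmod (?F f R \<xi> - g \<xi>))\<^sup>2 + 2 * (cmod d)\<^sup>2 * (cmod (?F f' R \<xi> - g' \<xi>))\<^sup>2"
        using norm_add_power2_bound [of "c * (?F f R \<xi> - g \<xi>)" "d * (?F f' R \<xi> - g' \<xi>)"]
        by (simp add: norm_mult power_mult_distrib mult.assoc)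
      then show "ennreal ((cmod (?F (\<lambda>x. c * f x + d * f' x) R \<xi> - (c * g \<xi> + d * g' \<xi>)))\<^sup>2)
        \<le> ennreal (2 * (cmod c)\<^sup>2) * ennreal ((cmod (?F f R \<xi> - g \<xi>))\<^sup>2)
          + ennreal (2 * (cmod d)\<^sup>2) * ennreal ((cmod (?F f' R \<xi> - g' \<xi>))\<^sup>2)"
        by (simp add: ennreal_mult [symmetric] ennreal_plus [symmetric] ennreal_leI del: ennreal_plus)
    qed
    also have "\<dots> = ennreal (2 * (cmod c)\<^sup>2) * ?N f g R + ennreal (2 * (cmod d)\<^sup>2) * ?N f' g' R"
      by (subst nn_integral_add, measurable) (simp add: nn_integral_cmult)
    finally show ?thesis .
  qed
  have "(?N (\<lambda>x. c * f x + d * f' x) (\<lambda>\<xi>. c * g \<xi> + d * g' \<xi>) \<longlongrightarrow> 0) at_top"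
    by (rule tendsto_sandwich [OF _ _ tendsto_const up [unfolded mult_zero_right add_0_right]])
      (intro always_eventually allI zero_le le)+
  then show ?thesis
    unfolding has_fourier_def using L2 by (auto intro: is_L2_lincomb)
qed

text \<open>
  By linearity the difference of two transforms is a transform of 0.
\<close>

lemma has_fourier_unique:
  fixes f :: "real ^ 'n::finite \<Rightarrow> complex"
  assumes "has_fourier f g" "has_fourier f g'"
  shows "AE \<xi> in lborel. g \<xi> = g' \<xi>"
proof -
  have [measurable]: "g \<in> borel_measurable lborel" "g' \<in> borel_measurable lborel"
    using assms by (auto simp: has_fourier_def is_L2_def)
  have "has_fourier (\<lambda>x. 1 * f x + (- 1) * f x) (\<lambda>\<xi>. 1 * g \<xi> + (- 1) * g' \<xi>)"
    by (rule has_fourier_lincomb [OF assms])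
  then have "((\<lambda>R :: real. \<integral>\<^sup>+ \<xi>. ennreal ((cmod (g \<xi> - g' \<xi>))\<^sup>2) \<partial>lborel) \<longlongrightarrow> 0) at_top"
    by (simp add: has_fourier_def fourier_integral_def norm_minus_commute)
  then have "(\<integral>\<^sup>+ \<xi>. ennreal ((cmod (g \<xi> - g' \<xi>))\<^sup>2) \<partial>lborel) = 0"
    by (simp add: tendsto_const_iff)
  then have "AE \<xi> in lborel. ennreal ((cmod (g \<xi> - g' \<xi>))\<^sup>2) = 0"
    by (subst (asm) nn_integral_0_iff_AE) auto
  then show ?thesis by eventually_elim simp
qed

lemma has_fourier_fourier:
  assumes "has_fourier f g"
  shows "has_fourier f (fourier f)" "AE \<xi> in lborel. fourier f \<xi> = g \<xi>"
proof -
  show "has_fourier f (fourier f)" unfolding fourier_def by (rule someI [of "has_fourier f", OF assms])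
  then show "AE \<xi> in lborel. fourier f \<xi> = g \<xi>" using assms by (rule has_fourier_unique)
qed

text \<open>
  The truncations of \<open>f\<close> are integrable, so that Fubini's theorem applies to them. On the
  left the limit is dominated, on the right it is an \<open>L\<^sup>2\<close>-limit tested against
  \<open>\<psi>\<close>.
\<close>

lemma multiplication_formula:
  fixes f :: "real ^ 'n::finite \<Rightarrow> complex"
  assumes f: "has_fourier f g" and \<psi>: "integrable lborel \<psi>" "is_L2 \<psi>" and \<phi>: "is_L2 (fourier_integral \<psi>)"
  shows "(LINT x|lborel. f x * fourier_integral \<psi> x) = (LINT \<xi>|lborel. g \<xi> * \<psi> \<xi>)"
proof -
  have fL2: "is_L2 f" and gL2: "is_L2 g" using f by (auto simp: has_fourier_def)
  have [measurable]: "f \<in> borel_measurable lborel" "g \<in> borel_measurable lborel" "\<psi> \<in> borel_measurable lborel"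
    using fL2 gL2 \<psi> by (auto simp: is_L2_def)
  define T where "T n x = indicator (cball 0 (real n)) x * f x" for n :: nat and x
  define F where "F n = fourier_integral (T n)" for n
  have Ti: "integrable lborel (T n)" for n
    unfolding T_def [abs_def] by (rule truncation_integrable [OF fL2])
  have [measurable]: "T n \<in> borel_measurable lborel" for n using Ti [of n] by simp
  have [measurable]: "F n \<in> borel_measurable lborel" for n
    unfolding F_def by (rule fourier_integral_measurable) measurable
  have swap: "integrable lborel (\<lambda>\<xi>. F n \<xi> * \<psi> \<xi>)"
    "(LINT \<xi>|lborel. F n \<xi> * \<psi> \<xi>) = (LINT x|lborel. T n x * fourier_integral \<psi> x)" for n
  proof -
    let ?k = "\<lambda>x \<xi>. exp (- \<i> * complex_of_real (x \<bullet> \<xi>)) * T n x * \<psi> \<xi>"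
    have "integrable (lborel \<Otimes>\<^sub>M lborel) (\<lambda>(x, \<xi>). T n x * \<psi> \<xi>)"
    proof (rule lborel_pair.Fubini_integrable)
      show "integrable lborel (\<lambda>x. LINT \<xi>|lborel. norm (case (x, \<xi>) of (x, \<xi>) \<Rightarrow> T n x * \<psi> \<xi>))"
        using integrable_norm [OF Ti [of n]] by (simp add: norm_mult)
      show "AE x in lborel. integrable lborel (\<lambda>\<xi>. case (x, \<xi>) of (x, \<xi>) \<Rightarrow> T n x * \<psi> \<xi>)"
        using \<psi>(1) by simp
    qed measurable
    then have int: "integrable (lborel \<Otimes>\<^sub>M lborel) (\<lambda>(x, \<xi>). ?k x \<xi>)"
      by (rule Bochner_Integration.integrable_bound) (auto simp: norm_mult norm_exp_eq_Re)
    have e1: "(LINT x|lborel. ?k x \<xi>) = F n \<xi> * \<psi> \<xi>" for \<xi>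
      unfolding F_def fourier_integral_def by simp
    have e2: "(LINT \<xi>|lborel. ?k x \<xi>) = T n x * fourier_integral \<psi> x" for x
    proof -
      have "(LINT \<xi>|lborel. ?k x \<xi>) = (LINT \<xi>|lborel. T n x * (exp (- \<i> * complex_of_real (\<xi> \<bullet> x)) * \<psi> \<xi>))"
        by (simp add: inner_commute mult.commute mult.left_commute)
      then show ?thesis unfolding fourier_integral_def by simp
    qed
    show "integrable lborel (\<lambda>\<xi>. F n \<xi> * \<psi> \<xi>)"
      using lborel_pair.integrable_snd [OF int] by (simp only: e1)
    show "(LINT \<xi>|lborel. F n \<xi> * \<psi> \<xi>) = (LINT x|lborel. T n x * fourier_integral \<psi> x)"
      using lborel_pair.Fubini_integral [OF int] by (simp only: e1 e2)
  qed
  have lim1: "(\<lambda>n. LINT x|lborel. T n x * fourier_integral \<psi> x) \<longlonglongrightarrow> (LINT x|lborel. f x * fourier_integral \<psi> x)"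
  proof (rule integral_dominated_convergence)
    have [measurable]: "fourier_integral \<psi> \<in> borel_measurable lborel" using \<phi> by (simp add: is_L2_def)
    show "(\<lambda>x. f x * fourier_integral \<psi> x) \<in> borel_measurable lborel"
      "\<And>n. (\<lambda>x. T n x * fourier_integral \<psi> x) \<in> borel_measurable lborel" by measurable
    show "integrable lborel (\<lambda>x. cmod (f x * fourier_integral \<psi> x))"
      by (intro integrable_norm is_L2_mult(1) fL2 \<phi>)
    show "AE x in lborel. (\<lambda>n. T n x * fourier_integral \<psi> x) \<longlonglongrightarrow> f x * fourier_integral \<psi> x"
    proof (rule AE_I2)
      fix x :: "real ^ 'n"
      have "eventually (\<lambda>n. T n x * fourier_integral \<psi> x = f x * fourier_integral \<psi> x) sequentially"
        using eventually_ge_at_top [of "nat \<lceil>norm x\<rceil>"]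
      proof eventually_elim
        case (elim n)
        then have "norm x \<le> real n" by linarith
        then show ?case by (simp add: T_def)
      qed
      then show "(\<lambda>n. T n x * fourier_integral \<psi> x) \<longlonglongrightarrow> f x * fourier_integral \<psi> x"
        by (rule tendsto_eventually)
    qed
    show "\<And>n. AE x in lborel. norm (T n x * fourier_integral \<psi> x) \<le> cmod (f x * fourier_integral \<psi> x)"
      by (auto simp: T_def norm_mult indicator_def intro!: AE_I2)
  qed
  \<comment> \<open>\<open>E n\<close> is an extended real and may be infinite for small \<open>n\<close>; it is eventually finite because it
    tends to 0.\<close>
  define E where "E n = (\<integral>\<^sup>+ \<xi>. ennreal ((cmod (F n \<xi> - g \<xi>))\<^sup>2) \<partial>lborel)" for n
  have E: "E \<longlonglongrightarrow> 0"
  proof -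
    have "((\<lambda>R. \<integral>\<^sup>+ \<xi>. ennreal ((cmod (fourier_integral (\<lambda>x. indicator (cball 0 R) x * f x) \<xi> - g \<xi>))\<^sup>2) \<partial>lborel)
      \<longlongrightarrow> 0) at_top" using f by (simp add: has_fourier_def)
    from filterlim_compose [OF this filterlim_real_sequentially]
    show ?thesis by (simp add: E_def [abs_def] F_def T_def [abs_def])
  qed
  have bound: "cmod ((LINT \<xi>|lborel. F n \<xi> * \<psi> \<xi>) - (LINT \<xi>|lborel. g \<xi> * \<psi> \<xi>)) \<le> sqrt (enn2real (E n)) * L2_norm \<psi>"
    if "E n < \<infinity>" for n
  proof -
    have "integrable lborel (\<lambda>\<xi>. (cmod (F n \<xi> - g \<xi>))\<^sup>2)"
      by (rule integrableI_nonneg) (use that in \<open>auto simp: E_def\<close>)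
    then have L2: "is_L2 (\<lambda>\<xi>. F n \<xi> - g \<xi>)" by (simp add: is_L2_def)
    have "L2_norm (\<lambda>\<xi>. F n \<xi> - g \<xi>) = sqrt (enn2real (E n))"
      unfolding L2_norm_def E_def by (subst integral_eq_nn_integral) auto
    moreover have "(LINT \<xi>|lborel. F n \<xi> * \<psi> \<xi>) - (LINT \<xi>|lborel. g \<xi> * \<psi> \<xi>) = (LINT \<xi>|lborel. (F n \<xi> - g \<xi>) * \<psi> \<xi>)"
      using swap(1) [of n] is_L2_mult(1) [OF gL2 \<psi>(2)]
      by (simp add: left_diff_distrib)
    ultimately show ?thesis using is_L2_mult(2) [OF L2 \<psi>(2)] by simp
  qed
  have "eventually (\<lambda>n. E n < 1) sequentially" using E by (rule order_tendstoD) simp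
  then have fin: "eventually (\<lambda>n. E n < \<infinity>) sequentially"
  proof (rule eventually_mono)
    show "E n < \<infinity>" if "E n < 1" for n
      using that ennreal_one_less_top unfolding infinity_ennreal_def by (rule less_trans)
  qed
  have "(\<lambda>n. enn2real (E n)) \<longlonglongrightarrow> 0" by (rule tendsto_enn2real) (use E in simp_all)
  then have "(\<lambda>n. sqrt (enn2real (E n)) * L2_norm \<psi>) \<longlonglongrightarrow> sqrt 0 * L2_norm \<psi>"
    by (intro tendsto_mult tendsto_real_sqrt tendsto_const)
  then have up: "(\<lambda>n. sqrt (enn2real (E n)) * L2_norm \<psi>) \<longlonglongrightarrow> 0" by simp
  have "(\<lambda>n. (LINT \<xi>|lborel. F n \<xi> * \<psi> \<xi>) - (LINT \<xi>|lborel. g \<xi> * \<psi> \<xi>)) \<longlonglongrightarrow> 0"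
    by (rule Lim_null_comparison [OF _ up]) (use fin bound in \<open>auto elim: eventually_mono\<close>)
  then have "(\<lambda>n. LINT x|lborel. T n x * fourier_integral \<psi> x) \<longlonglongrightarrow> (LINT \<xi>|lborel. g \<xi> * \<psi> \<xi>)"
    unfolding swap(2) by (simp add: LIM_zero_iff)
  then show ?thesis using lim1 LIMSEQ_unique by blast
qed

lemma integrable_inverse_square: "integrable lborel (\<lambda>x :: real. 1 / (1 + x\<^sup>2))"
proof -
  have pos: "0 < 1 + x\<^sup>2" for x :: real by (simp add: add_pos_nonneg)
  have "set_integrable lborel (einterval (-\<infinity>) \<infinity>) (\<lambda>x :: real. 1 / (1 + x\<^sup>2))"
  proof (rule interval_integral_FTC_nonneg [where F = arctan and A = "- (pi / 2)" and B = "pi / 2"])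
    show "DERIV arctan x :> 1 / (1 + x\<^sup>2)" for x :: real
      using DERIV_arctan [of x] by (simp add: divide_inverse)
    show "isCont (\<lambda>x. 1 / (1 + x\<^sup>2)) x" for x :: real
      using pos [of x] by (intro continuous_intros) auto
    show "((arctan \<circ> real_of_ereal) \<longlongrightarrow> - (pi / 2)) (at_right (- \<infinity>))"
      using tendsto_arctan_at_bot by (simp add: ereal_tendsto_simps1)
    show "((arctan \<circ> real_of_ereal) \<longlongrightarrow> pi / 2) (at_left \<infinity>)"
      using tendsto_arctan_at_top by (simp add: ereal_tendsto_simps1)
  qed (use pos in \<open>auto intro!: AE_I2 simp: less_imp_le\<close>)
  moreover have "einterval (-\<infinity>) \<infinity> = (UNIV :: real set)" by (auto simp: einterval_def)
  ultimately show ?thesis by (simp add: set_integrable_def)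
qed

text \<open>
  One factor \<open>1 / (1 + |y|)\<close> in each variable is enough.
\<close>

lemma (in box_bumps) tensor_hat_L2:
  assumes "bump_family h"
  shows "is_L2 (tensor_hat h)"
proof -
  have hb: "h i \<in> bumps \<epsilon> (a i) (b i)" for i using assms by (simp add: bump_family_def)
  have c: "continuous_on UNIV (fourier1 (h i))" for i
    using fourier1_derivative [OF ab eps hb]
    by (meson continuous_at_imp_continuous_on has_vector_derivative_continuous)
  have m1 [measurable]: "fourier1 (h i) \<in> borel_measurable borel" for i
    by (rule borel_measurable_continuous_onI [OF c])
  have "integrable lborel (\<lambda>y. complex_of_real ((cmod (fourier1 (h i) y))\<^sup>2))" for i
  proof -
    obtain C where C: "\<And>y. (1 + \<bar>y\<bar>) ^ 1 * cmod (fourier1 (h i) y) \<le> C"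
      using fourier1_decay [OF ab [of i] eps hb, of 1] by blast
    have "integrable lborel (\<lambda>y. C\<^sup>2 * (1 / (1 + y\<^sup>2)))"
      by (intro integrable_mult_right integrable_inverse_square)
    then have "integrable lborel (\<lambda>y. (cmod (fourier1 (h i) y))\<^sup>2)"
    proof (rule Bochner_Integration.integrable_bound)
      have "(cmod (fourier1 (h i) y))\<^sup>2 \<le> C\<^sup>2 * (1 / (1 + y\<^sup>2))" for y
      proof -
        have "((1 + \<bar>y\<bar>) * cmod (fourier1 (h i) y))\<^sup>2 \<le> C\<^sup>2"
          using C [of y] by (intro power_mono) auto
        moreover have "(1 + y\<^sup>2) * (cmod (fourier1 (h i) y))\<^sup>2 \<le> (1 + \<bar>y\<bar>)\<^sup>2 * (cmod (fourier1 (h i) y))\<^sup>2"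
          by (intro mult_right_mono) (auto simp: power2_eq_square algebra_simps)
        moreover have "0 < 1 + y\<^sup>2" by (simp add: add_pos_nonneg)
        ultimately show ?thesis
          by (simp add: power_mult_distrib pos_le_divide_eq mult.commute)
      qed
      then show "AE y in lborel. norm ((cmod (fourier1 (h i) y))\<^sup>2) \<le> norm (C\<^sup>2 * (1 / (1 + y\<^sup>2)))"
        by (intro AE_I2) (simp add: abs_of_nonneg)
    qed measurable
    then show ?thesis by (rule integrable_of_real)
  qed
  from integral_lborel_vec_prod(1) [OF this]
  have "integrable lborel (\<lambda>x :: real ^ 'n. Re (\<Prod>i\<in>UNIV. complex_of_real ((cmod (fourier1 (h i) (x $ i)))\<^sup>2)))"
    by (rule integrable_Re)
  moreover have "Re (\<Prod>i\<in>UNIV. complex_of_real ((cmod (fourier1 (h i) (x $ i)))\<^sup>2)) = (cmod (tensor_hat h x))\<^sup>2" for x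
    by (simp add: tensor_hat_def prod_norm [symmetric] prod_power_distrib of_real_prod [symmetric] del: of_real_power of_real_prod)
  moreover have "tensor_hat h \<in> borel_measurable lborel"
    unfolding tensor_hat_def [abs_def] by measurable
  ultimately show ?thesis by (simp add: is_L2_def)
qed

section \<open>Separation of functions by products of bumps\<close>

lemma bump_one_limit:
  "(\<lambda>k. bump (1 / real (Suc k)) a b 1 0 x) \<longlonglongrightarrow> indicator {a<..<b} x"
proof (cases "a < x \<and> x < b")
  case True
  have "(\<lambda>k. - (1 / real (Suc k)) / edge a b x) \<longlonglongrightarrow> - 0 / edge a b x"
    by (rule tendsto_divide [OF tendsto_minus [OF LIMSEQ_Suc [OF lim_1_over_n]] tendsto_const])
      (use True in \<open>simp add: edge_def\<close>)
  then have "(\<lambda>k. complex_of_real (exp (- (1 / real (Suc k)) / edge a b x))) \<longlonglongrightarrow> complex_of_real (exp (- 0 / edge a b x))"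
    by (intro tendsto_of_real tendsto_exp)
  then show ?thesis using True by (simp add: bump_def)
next
  case False
  then show ?thesis by (auto simp: bump_def indicator_def)
qed

lemma bump_one_le:
  assumes "0 < \<epsilon>"
  shows "cmod (bump \<epsilon> a b 1 0 x) \<le> indicator {a<..<b} x"
  using assms by (auto simp: bump_def edge_def)

text \<open>
  Boxes generate the Borel sets and are closed under intersection, so that the integral of
  \<open>F\<close> vanishes over all Borel sets. As \<open>F\<close> is only locally integrable, this is
  done inside each box of an exhaustion.
\<close>

lemma zero_on_boxes_imp_AE_zero:
  fixes F :: "'a::euclidean_space \<Rightarrow> complex"
  assumes F: "\<And>a b. integrable lborel (\<lambda>x. indicator (box a b) x *\<^sub>R F x)"
    and zero: "\<And>a b. (LINT x:box a b|lborel. F x) = 0"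
  shows "AE x in lborel. F x = 0"
proof -
  \<comment> \<open>An exhaustion by bounded boxes, on each of which \<open>F\<close> is integrable.\<close>
  define B where "B k = box (- real k *\<^sub>R One) (real k *\<^sub>R (One :: 'a))" for k :: nat
  have "AE x in lborel. indicator (B k) x *\<^sub>R F x = 0" for k
  proof (rule sigma_finite_measure.density_zero [OF sigma_finite_lborel])
    define f where "f x = indicator (B k) x *\<^sub>R F x" for x
    have f: "integrable lborel f" unfolding f_def B_def by (rule F)
    show "integrable lborel (\<lambda>x. indicator (B k) x *\<^sub>R F x)" using f by (simp add: f_def [abs_def])
    have fs: "set_integrable lborel A f" if "A \<in> sets borel" for A
      using that f unfolding set_integrable_def by (intro integrable_mult_indicator) auto
    have fbox: "(LINT x:box a b|lborel. f x) = 0" for a b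
    proof -
      have "(LINT x:box a b|lborel. f x) = (LINT x:box a b \<inter> B k|lborel. F x)"
        unfolding set_lebesgue_integral_def f_def
        by (intro Bochner_Integration.integral_cong) (auto simp: indicator_def)
      also have "\<dots> = 0" unfolding B_def box_Int_box by (rule zero)
      finally show ?thesis .
    qed
    have total: "(LINT x|lborel. f x) = 0"
    proof -
      have "(LINT x|lborel. f x) = (LINT x:B k|lborel. f x)"
        unfolding set_lebesgue_integral_def f_def
        by (intro Bochner_Integration.integral_cong) (auto simp: indicator_def)
      then show ?thesis unfolding B_def by (simp add: fbox)
    qed
    have main: "(LINT x:A|lborel. f x) = 0" if "A \<in> sigma_sets UNIV (range (\<lambda>(a, b). box a b :: 'a set))" for A
    proof -
      have sb: "sets borel = sigma_sets UNIV (range (\<lambda>(a, b). box a b :: 'a set))"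
        by (subst borel_eq_box) (simp add: sets_measure_of)
      have stable: "Int_stable (range (\<lambda>(a, b). box a b :: 'a set))"
        by (auto simp: Int_stable_def box_Int_box)
      have "range (\<lambda>(a, b). box a b :: 'a set) \<subseteq> Pow UNIV" by simp
      from stable this that show ?thesis
      proof (induction rule: sigma_sets_induct_disjoint)
        case (basic A)
        then show ?case using fbox by auto
      next
        case empty
        then show ?case by (simp add: set_lebesgue_integral_def)
      next
        case (compl A)
        have A: "A \<in> sets borel" unfolding sb by (rule compl(1))
        then have A': "UNIV - A \<in> sets borel" using sets.compl_sets [of A borel] by simp
        have "(LINT x:A \<union> (UNIV - A)|lborel. f x) = (LINT x:A|lborel. f x) + (LINT x:UNIV - A|lborel. f x)"
          by (intro set_integral_Un fs A A') auto
        then show ?case using compl total by (simp add: set_lebesgue_integral_def)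
      next
        case (union A)
        have A: "A i \<in> sets lborel" for i
          unfolding sets_lborel sb using union(2) by (rule subsetD) simp
        have "(LINT x:(\<Union>i. A i)|lborel. f x) = (\<Sum>i. (LINT x:(A i)|lborel. f x))"
        proof (intro lebesgue_integral_countable_add fs A)
          show "A i \<inter> A j = {}" if "i \<noteq> j" for i j
            using union(1) that by (simp add: disjoint_family_on_def)
          show "(\<Union>i. A i) \<in> sets borel" using A by auto
        qed
        then show ?case using union by simp
      qed
    qed
    show "(LINT x:A|lborel. indicator (B k) x *\<^sub>R F x) = 0" if "A \<in> sets lborel" for A
    proof -
      have "A \<in> sigma_sets UNIV (range (\<lambda>(a, b). box a b :: 'a set))"
        using that by (simp, subst (asm) borel_eq_box) (simp add: sets_measure_of)
      then show ?thesis using main by (simp add: f_def [abs_def])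
    qed
  qed
  then have "AE x in lborel. \<forall>k. indicator (B k) x *\<^sub>R F x = 0"
    by (intro AE_all_countable [THEN iffD2] allI)
  then show ?thesis
  proof eventually_elim
    case (elim x)
    obtain k :: nat where k: "norm x < real k" using reals_Archimedean2 by blast
    have "x \<in> B k"
    proof -
      have "- real k < x \<bullet> i \<and> x \<bullet> i < real k" if "i \<in> Basis" for i
        using Basis_le_norm [OF that, of x] k by linarith
      then show ?thesis by (simp add: B_def mem_box)
    qed
    then show ?case using elim [rule_format, of k] by simp
  qed
qed

text \<open>
  As \<open>\<epsilon>\<close> tends to 0, the bumps with \<open>P = 1\<close> and \<open>N = 0\<close>
  converge to the indicator of their interval and stay below it.
\<close>

lemma tensor_bumps_separate:
  fixes F :: "real ^ 'n::finite \<Rightarrow> complex"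
  assumes F: "\<And>a b. integrable lborel (\<lambda>x. indicator (box a b) x *\<^sub>R F x)"
    and zero: "\<And>\<epsilon> a b. 0 < \<epsilon> \<Longrightarrow> (\<And>i. a i < b i) \<Longrightarrow>
      (LINT x|lborel. F x * tensor (\<lambda>i :: 'n. bump \<epsilon> (a i) (b i) 1 0) x) = 0"
  shows "AE x in lborel. F x = 0"
proof (rule zero_on_boxes_imp_AE_zero [OF F])
  fix a b :: "real ^ 'n"
  show "(LINT x:box a b|lborel. F x) = 0"
  proof (cases "\<forall>i. a $ i < b $ i")
    case False
    then obtain i where "b $ i \<le> a $ i" by (auto simp: not_less)
    then have "x \<notin> box a b" for x
      using less_trans [of "a $ i" "x $ i" "b $ i"] by (auto simp: mem_box_cart intro!: exI [of _ i])
    then have "box a b = {}" by auto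
    then show ?thesis by (simp add: set_lebesgue_integral_def)
  next
    case True
    define \<psi> where "\<psi> k = tensor (\<lambda>i. bump (1 / real (Suc k)) (a $ i) (b $ i) 1 0)" for k
    have ind: "(\<Prod>i\<in>UNIV. indicator {a $ i <..< b $ i} (x $ i)) = (indicator (box a b) x :: 'c::comm_semiring_1)" for x
    proof (cases "x \<in> box a b")
      case False
      then obtain i where "x $ i \<notin> {a $ i <..< b $ i}" by (auto simp: mem_box_cart)
      then show ?thesis using False by (auto simp: indicator_def intro!: prod_zero exI [of _ i])
    qed (auto simp: mem_box_cart indicator_def)
    have lim: "(\<lambda>k. \<psi> k x) \<longlonglongrightarrow> indicator (box a b) x" for x
      unfolding \<psi>_def tensor_def ind [symmetric] by (intro tendsto_prod bump_one_limit)
    have le: "cmod (\<psi> k x) \<le> indicator (box a b) x" for k x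
      unfolding \<psi>_def tensor_def ind [symmetric] prod_norm [symmetric]
      by (intro prod_mono conjI norm_ge_zero bump_one_le) simp
    have FB: "(\<lambda>x. indicator (box a b) x *\<^sub>R F x) \<in> borel_measurable lborel" for a b
      using F by (rule borel_measurable_integrable)
    have \<psi>m [measurable]: "\<psi> k \<in> borel_measurable lborel" for k
    proof -
      have e: "0 < 1 / real (Suc k)" by simp
      have c: "continuous_on UNIV (bump (1 / real (Suc k)) (a $ i) (b $ i) 1 0)" for i
        by (rule bumps_continuous [OF True [rule_format] e bump_in_bumps])
      have "continuous_on UNIV (\<psi> k)"
        unfolding \<psi>_def tensor_def
        by (intro continuous_on_prod continuous_on_compose2 [OF c] continuous_intros) auto
      then show ?thesis by (simp add: borel_measurable_continuous_onI)
    qed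
    have eqF: "F x * \<psi> k x = (indicator (box a b) x *\<^sub>R F x) * \<psi> k x" for k x
      using le [of k x] by (auto simp: indicator_def)
    have "(\<lambda>k. LINT x|lborel. F x * \<psi> k x) \<longlonglongrightarrow> (LINT x|lborel. indicator (box a b) x *\<^sub>R F x)"
    proof (rule integral_dominated_convergence)
      show "(\<lambda>x. indicator (box a b) x *\<^sub>R F x) \<in> borel_measurable lborel" by (rule FB)
      show "(\<lambda>x. F x * \<psi> k x) \<in> borel_measurable lborel" for k
        unfolding eqF by (intro borel_measurable_times FB \<psi>m)
      show "integrable lborel (\<lambda>x. norm (indicator (box a b) x *\<^sub>R F x))" by (intro integrable_norm F)
      show "AE x in lborel. (\<lambda>k. F x * \<psi> k x) \<longlonglongrightarrow> indicator (box a b) x *\<^sub>R F x"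
      proof (rule AE_I2)
        fix x
        have "(\<lambda>k. F x * \<psi> k x) \<longlonglongrightarrow> F x * indicator (box a b) x" by (intro tendsto_intros lim)
        then show "(\<lambda>k. F x * \<psi> k x) \<longlonglongrightarrow> indicator (box a b) x *\<^sub>R F x"
          by (cases "x \<in> box a b") simp_all
      qed
      show "AE x in lborel. norm (F x * \<psi> k x) \<le> norm (indicator (box a b) x *\<^sub>R F x)" for k
      proof (rule AE_I2)
        fix x
        have "cmod (F x) * cmod (\<psi> k x) \<le> cmod (F x) * indicator (box a b) x"
          by (intro mult_left_mono le) simp
        then show "norm (F x * \<psi> k x) \<le> norm (indicator (box a b) x *\<^sub>R F x)"
          by (simp add: norm_mult mult.commute)
      qed
    qed
    moreover have "(LINT x|lborel. F x * \<psi> k x) = 0" for k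
      unfolding \<psi>_def by (rule zero) (use True in auto)
    ultimately have "(LINT x|lborel. indicator (box a b) x *\<^sub>R F x) = 0"
      using LIMSEQ_unique [OF _ tendsto_const] by simp
    then show ?thesis by (simp add: set_lebesgue_integral_def)
  qed
qed

section \<open>The Fourier transform of a solution\<close>

lemma is_L2_diff: "is_L2 f \<Longrightarrow> is_L2 g \<Longrightarrow> is_L2 (\<lambda>x. f x - g x)"
  using is_L2_lincomb [of f g 1 "-1"] by simp

lemma L2_norm_triangle:
  assumes f: "is_L2 f" and g: "is_L2 g"
  shows "L2_norm (\<lambda>x. f x + g x) \<le> L2_norm f + L2_norm g"
proof -
  have [measurable]: "f \<in> borel_measurable lborel" "g \<in> borel_measurable lborel"
    using f g by (auto simp: is_L2_def)
  let ?f = "\<lambda>x. complex_of_real (cmod (f x))" and ?g = "\<lambda>x. complex_of_real (cmod (g x))"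
  have L2: "is_L2 ?f" "is_L2 ?g" using f g by (auto simp: is_L2_def)
  have n: "L2_norm ?f = L2_norm f" "L2_norm ?g = L2_norm g" by (simp_all add: L2_norm_def)
  have fg: "integrable lborel (\<lambda>x. cmod (f x) * cmod (g x))"
    using integrable_Re [OF is_L2_mult(1) [OF L2]] by simp
  have "cmod (LINT x|lborel. complex_of_real (cmod (f x) * cmod (g x))) \<le> L2_norm f * L2_norm g"
    using is_L2_mult(2) [OF L2] unfolding n by simp
  then have CS: "(LINT x|lborel. cmod (f x) * cmod (g x)) \<le> L2_norm f * L2_norm g"
    unfolding integral_complex_of_real norm_of_real by linarith
  have sq: "(LINT x|lborel. (cmod (h x))\<^sup>2) = (L2_norm h)\<^sup>2" for h by (simp add: L2_norm_def)
  have "(LINT x|lborel. (cmod (f x + g x))\<^sup>2)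
      \<le> (LINT x|lborel. (cmod (f x))\<^sup>2 + 2 * (cmod (f x) * cmod (g x)) + (cmod (g x))\<^sup>2)"
  proof (rule integral_mono)
    show "integrable lborel (\<lambda>x. (cmod (f x + g x))\<^sup>2)" using is_L2_add [OF f g] by (simp add: is_L2_def)
    show "integrable lborel (\<lambda>x. (cmod (f x))\<^sup>2 + 2 * (cmod (f x) * cmod (g x)) + (cmod (g x))\<^sup>2)"
      using f g fg by (auto simp: is_L2_def)
    fix x
    have "(cmod (f x + g x))\<^sup>2 \<le> (cmod (f x) + cmod (g x))\<^sup>2"
      by (intro power_mono norm_triangle_ineq) auto
    then show "(cmod (f x + g x))\<^sup>2 \<le> (cmod (f x))\<^sup>2 + 2 * (cmod (f x) * cmod (g x)) + (cmod (g x))\<^sup>2"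
      by (simp add: power2_sum algebra_simps)
  qed
  also have "\<dots> = (L2_norm f)\<^sup>2 + 2 * (LINT x|lborel. cmod (f x) * cmod (g x)) + (L2_norm g)\<^sup>2"
    using f g fg by (simp add: is_L2_def sq)
  also have "\<dots> \<le> (L2_norm f + L2_norm g)\<^sup>2" using CS by (simp add: power2_sum)
  finally have "L2_norm (\<lambda>x. f x + g x) \<le> sqrt ((L2_norm f + L2_norm g)\<^sup>2)"
    unfolding L2_norm_def [of "\<lambda>x. f x + g x"] by (rule real_sqrt_le_mono)
  then show ?thesis by simp
qed

lemma L2_norm_le_add_diff:
  assumes "is_L2 f" "is_L2 g"
  shows "\<bar>L2_norm f - L2_norm g\<bar> \<le> L2_norm (\<lambda>x. f x - g x)"
proof -
  have "L2_norm f \<le> L2_norm (\<lambda>x. f x - g x) + L2_norm g"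
    using L2_norm_triangle [OF is_L2_diff [OF assms] assms(2)] by simp
  moreover have "L2_norm g \<le> L2_norm (\<lambda>x. g x - f x) + L2_norm f"
    using L2_norm_triangle [OF is_L2_diff [OF assms(2,1)] assms(1)] by simp
  moreover have "L2_norm (\<lambda>x. g x - f x) = L2_norm (\<lambda>x. f x - g x)"
    by (simp add: L2_norm_def norm_minus_commute)
  ultimately show ?thesis by linarith
qed

definition bessel_weight :: "real \<Rightarrow> real ^ 'n::finite \<Rightarrow> real" where
  "bessel_weight \<sigma> \<xi> = (1 + (norm \<xi>)\<^sup>2) powr (\<sigma> / 2)"

lemma bessel_weight_pos: "0 < bessel_weight \<sigma> \<xi>"
proof -
  have "0 < 1 + (norm \<xi>)\<^sup>2" by (simp add: add_pos_nonneg)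
  then show ?thesis by (simp add: bessel_weight_def)
qed

lemma abs_bessel_weight [simp]: "\<bar>bessel_weight \<sigma> \<xi>\<bar> = bessel_weight \<sigma> \<xi>"
  using bessel_weight_pos [of \<sigma> \<xi>] by simp

lemma bessel_weight_mono: "\<sigma> \<le> \<sigma>' \<Longrightarrow> bessel_weight \<sigma> \<xi> \<le> bessel_weight \<sigma>' \<xi>"
  unfolding bessel_weight_def by (intro powr_mono) auto

lemma bessel_weight_0: "bessel_weight 0 \<xi> = 1"
proof -
  have "0 < 1 + (norm \<xi>)\<^sup>2" by (simp add: add_pos_nonneg)
  then show ?thesis by (simp add: bessel_weight_def)
qed

lemma bessel_weight_measurable [measurable]: "bessel_weight \<sigma> \<in> borel_measurable borel"
  unfolding bessel_weight_def [abs_def] by measurable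

lemma weighted_L2_mono:
  assumes "is_L2 (\<lambda>\<xi>. complex_of_real (bessel_weight \<sigma>' \<xi>) * g \<xi>)" "g \<in> borel_measurable lborel" "\<sigma> \<le> \<sigma>'"
  shows "is_L2 (\<lambda>\<xi>. complex_of_real (bessel_weight \<sigma> \<xi>) * g \<xi>)"
proof (rule is_L2_dominated [OF assms(1), of _ 1])
  have [measurable]: "g \<in> borel_measurable borel" using assms(2) by simp
  show "(\<lambda>\<xi>. complex_of_real (bessel_weight \<sigma> \<xi>) * g \<xi>) \<in> borel_measurable lborel" by measurable
  have "bessel_weight \<sigma> \<xi> * cmod (g \<xi>) \<le> bessel_weight \<sigma>' \<xi> * cmod (g \<xi>)" for \<xi>
    by (intro mult_right_mono bessel_weight_mono assms) simp
  then show "AE \<xi> in lborel. cmod (complex_of_real (bessel_weight \<sigma> \<xi>) * g \<xi>)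
      \<le> 1 * cmod (complex_of_real (bessel_weight \<sigma>' \<xi>) * g \<xi>)"
    by (intro AE_I2) (simp add: norm_mult)
qed

lemma sobolev_norm_eq:
  assumes f: "has_fourier f g" and g: "is_L2 (\<lambda>\<xi>. complex_of_real (bessel_weight \<sigma> \<xi>) * g \<xi>)"
  shows "sobolev_norm \<sigma> f = L2_norm (\<lambda>\<xi>. complex_of_real (bessel_weight \<sigma> \<xi>) * g \<xi>)"
proof -
  have [measurable]: "fourier f \<in> borel_measurable borel"
    using has_fourier_fourier(1) [OF f] by (simp add: has_fourier_def is_L2_def)
  have ae: "AE \<xi> in lborel. sobolev_weighted \<sigma> f \<xi> = complex_of_real (bessel_weight \<sigma> \<xi>) * g \<xi>"
    using has_fourier_fourier(2) [OF f] by eventually_elim (simp add: sobolev_weighted_def bessel_weight_def)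
  have "is_L2 (sobolev_weighted \<sigma> f)"
  proof (rule is_L2_dominated [OF g, of _ 1])
    show "sobolev_weighted \<sigma> f \<in> borel_measurable lborel"
      unfolding sobolev_weighted_def [abs_def] by measurable
    show "AE \<xi> in lborel. cmod (sobolev_weighted \<sigma> f \<xi>) \<le> 1 * cmod (complex_of_real (bessel_weight \<sigma> \<xi>) * g \<xi>)"
      using ae by eventually_elim simp
  qed
  then show ?thesis unfolding sobolev_norm_def using g ae by (rule L2_norm_AE_cong)
qed

lemma L2_norm_le_sobolev_norm:
  assumes f: "has_fourier f g" and g: "is_L2 (\<lambda>\<xi>. complex_of_real (bessel_weight \<sigma> \<xi>) * g \<xi>)" and \<sigma>: "0 \<le> \<sigma>"
  shows "L2_norm g \<le> sobolev_norm \<sigma> f"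
proof -
  have gm: "g \<in> borel_measurable lborel" using f by (simp add: has_fourier_def is_L2_def)
  have "cmod (g \<xi>) \<le> bessel_weight \<sigma> \<xi> * cmod (g \<xi>)" for \<xi>
    using mult_right_mono [OF bessel_weight_mono [OF \<sigma>, of \<xi>], of "cmod (g \<xi>)"] by (simp add: bessel_weight_0)
  then have "L2_norm g \<le> 1 * L2_norm (\<lambda>\<xi>. complex_of_real (bessel_weight \<sigma> \<xi>) * g \<xi>)"
    by (intro L2_norm_dominated [OF g gm] AE_I2) (auto simp: norm_mult)
  then show ?thesis by (simp add: sobolev_norm_eq [OF f g])
qed

lemma sobolev_spaceD:
  assumes "f \<in> sobolev_space \<sigma>"
  shows "has_fourier f (fourier f)" "is_L2 (fourier f)" "fourier f \<in> borel_measurable borel"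
    "\<sigma>' \<le> \<sigma> \<Longrightarrow> is_L2 (\<lambda>\<xi>. complex_of_real (bessel_weight \<sigma>' \<xi>) * fourier f \<xi>)"
proof -
  show "has_fourier f (fourier f)" using assms by (simp add: sobolev_space_def)
  then show "is_L2 (fourier f)" by (simp add: has_fourier_def)
  then show m: "fourier f \<in> borel_measurable borel" by (simp add: is_L2_def)
  show "is_L2 (\<lambda>\<xi>. complex_of_real (bessel_weight \<sigma>' \<xi>) * fourier f \<xi>)" if "\<sigma>' \<le> \<sigma>"
    using assms m that weighted_L2_mono [of \<sigma> "fourier f" \<sigma>']
    by (simp add: sobolev_space_def sobolev_weighted_def [abs_def] bessel_weight_def)
qed

locale cauchy_problem =
  fixes m :: nat and Pm Pm1 Pm2 :: "nat \<Rightarrow> ('n::finite \<Rightarrow> nat) \<Rightarrow> real" and s0 :: real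
    and u0 :: "nat \<Rightarrow> real ^ 'n \<Rightarrow> complex" and u :: "real \<Rightarrow> real ^ 'n \<Rightarrow> complex"
    and U :: "nat \<Rightarrow> real \<Rightarrow> real ^ 'n \<Rightarrow> complex"
  assumes m: "3 \<le> m" and lead: "Pm m (\<lambda>_. 0) = 1" and s0: "real m - 1 \<le> s0"
    and sol: "cauchy_solution m Pm Pm1 Pm2 s0 u0 u U"
begin

definition u_hat :: "nat \<Rightarrow> real \<Rightarrow> real ^ 'n \<Rightarrow> complex" where
  "u_hat j t = fourier (U j t)"

lemma U_sobolev: "real j \<le> s0 \<Longrightarrow> 0 \<le> t \<Longrightarrow> U j t \<in> sobolev_space (s0 - real j)"
  using sol by (simp add: cauchy_solution_def sobolev_time_derivs_def)

lemma u_hat_facts: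
  assumes "real j \<le> s0" "0 \<le> t"
  shows "has_fourier (U j t) (u_hat j t)" "is_L2 (u_hat j t)" "u_hat j t \<in> borel_measurable borel"
    "\<sigma> \<le> s0 - real j \<Longrightarrow> is_L2 (\<lambda>\<xi>. complex_of_real (bessel_weight \<sigma> \<xi>) * u_hat j t \<xi>)"
  unfolding u_hat_def using sobolev_spaceD [OF U_sobolev [OF assms]] by auto

lemma u_hat_continuous:
  assumes j: "real j \<le> s0" and t: "0 \<le> t"
  shows "((\<lambda>\<tau>. L2_norm (\<lambda>\<xi>. u_hat j \<tau> \<xi> - u_hat j t \<xi>)) \<longlongrightarrow> 0) (at t within {0..})"
proof -
  let ?\<sigma> = "s0 - real j"
  have lim: "((\<lambda>\<tau>. sobolev_norm ?\<sigma> (\<lambda>x. U j \<tau> x - U j t x)) \<longlongrightarrow> 0) (at t within {0..})"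
    using sol j t by (simp add: cauchy_solution_def sobolev_time_derivs_def)
  show ?thesis
  proof (rule Lim_null_comparison [OF _ lim])
    have "norm (L2_norm (\<lambda>\<xi>. u_hat j \<tau> \<xi> - u_hat j t \<xi>)) \<le> sobolev_norm ?\<sigma> (\<lambda>x. U j \<tau> x - U j t x)"
      if "0 \<le> \<tau>" for \<tau>
    proof -
      have "has_fourier (\<lambda>x. U j \<tau> x - U j t x) (\<lambda>\<xi>. u_hat j \<tau> \<xi> - u_hat j t \<xi>)"
        using has_fourier_lincomb [OF u_hat_facts(1) [OF j that] u_hat_facts(1) [OF j t], of 1 "-1"] by simp
      moreover have "is_L2 (\<lambda>\<xi>. complex_of_real (bessel_weight ?\<sigma> \<xi>) * (u_hat j \<tau> \<xi> - u_hat j t \<xi>))"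
        using is_L2_diff [OF u_hat_facts(4) [OF j that, of ?\<sigma>] u_hat_facts(4) [OF j t, of ?\<sigma>]]
        by (simp add: algebra_simps)
      ultimately have "L2_norm (\<lambda>\<xi>. u_hat j \<tau> \<xi> - u_hat j t \<xi>) \<le> sobolev_norm ?\<sigma> (\<lambda>x. U j \<tau> x - U j t x)"
        using j by (intro L2_norm_le_sobolev_norm) auto
      then show ?thesis by simp
    qed
    then show "\<forall>\<^sub>F \<tau> in at t within {0..}. norm (L2_norm (\<lambda>\<xi>. u_hat j \<tau> \<xi> - u_hat j t \<xi>))
        \<le> sobolev_norm ?\<sigma> (\<lambda>x. U j \<tau> x - U j t x)"
      by (auto simp: eventually_at_filter)
  qed
qed

text \<open>
  The Fourier transform is linear, and a Sobolev norm of nonnegative order dominates the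
  \<open>L\<^sup>2\<close>-norm of the transform. Hence difference quotients converge in
  \<open>L\<^sup>2\<close> on the Fourier side.
\<close>

lemma u_hat_derivative:
  assumes j: "real (Suc j) \<le> s0" and t: "0 \<le> t"
  shows "((\<lambda>\<tau>. L2_norm (\<lambda>\<xi>. (u_hat j \<tau> \<xi> - u_hat j t \<xi>) / complex_of_real (\<tau> - t) - u_hat (Suc j) t \<xi>)) \<longlongrightarrow> 0)
    (at t within {0..})"
proof -
  let ?\<sigma> = "s0 - real (Suc j)"
  have j': "real j \<le> s0" using j by simp
  have lim: "((\<lambda>\<tau>. sobolev_norm ?\<sigma> (\<lambda>x. (U j \<tau> x - U j t x) / complex_of_real (\<tau> - t) - U (Suc j) t x)) \<longlongrightarrow> 0)
      (at t within {0..})"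
    using sol j t unfolding cauchy_solution_def sobolev_time_derivs_def by blast
  show ?thesis
  proof (rule Lim_null_comparison [OF _ lim])
    have "norm (L2_norm (\<lambda>\<xi>. (u_hat j \<tau> \<xi> - u_hat j t \<xi>) / complex_of_real (\<tau> - t) - u_hat (Suc j) t \<xi>))
        \<le> sobolev_norm ?\<sigma> (\<lambda>x. (U j \<tau> x - U j t x) / complex_of_real (\<tau> - t) - U (Suc j) t x)"
      if \<tau>: "0 \<le> \<tau>" for \<tau>
    proof -
      let ?c = "1 / complex_of_real (\<tau> - t)"
      have "has_fourier (\<lambda>x. ?c * (1 * U j \<tau> x + (-1) * U j t x) + (-1) * U (Suc j) t x)
          (\<lambda>\<xi>. ?c * (1 * u_hat j \<tau> \<xi> + (-1) * u_hat j t \<xi>) + (-1) * u_hat (Suc j) t \<xi>)"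
        by (intro has_fourier_lincomb u_hat_facts(1) j j' t \<tau>)
      then have "has_fourier (\<lambda>x. (U j \<tau> x - U j t x) / complex_of_real (\<tau> - t) - U (Suc j) t x)
          (\<lambda>\<xi>. (u_hat j \<tau> \<xi> - u_hat j t \<xi>) / complex_of_real (\<tau> - t) - u_hat (Suc j) t \<xi>)"
        by simp
      moreover have "is_L2 (\<lambda>\<xi>. complex_of_real (bessel_weight ?\<sigma> \<xi>) *
          ((u_hat j \<tau> \<xi> - u_hat j t \<xi>) / complex_of_real (\<tau> - t) - u_hat (Suc j) t \<xi>))"
      proof -
        let ?w = "\<lambda>\<xi>. complex_of_real (bessel_weight ?\<sigma> \<xi>)"
        have "is_L2 (\<lambda>\<xi>. ?c * (1 * (?w \<xi> * u_hat j \<tau> \<xi>) + (-1) * (?w \<xi> * u_hat j t \<xi>)) + (-1) * (?w \<xi> * u_hat (Suc j) t \<xi>))"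
          by (intro is_L2_lincomb u_hat_facts(4) j j' t \<tau>) auto
        then show ?thesis by (simp add: algebra_simps diff_divide_distrib)
      qed
      ultimately have "L2_norm (\<lambda>\<xi>. (u_hat j \<tau> \<xi> - u_hat j t \<xi>) / complex_of_real (\<tau> - t) - u_hat (Suc j) t \<xi>)
        \<le> sobolev_norm ?\<sigma> (\<lambda>x. (U j \<tau> x - U j t x) / complex_of_real (\<tau> - t) - U (Suc j) t x)"
        using j by (intro L2_norm_le_sobolev_norm) auto
      then show ?thesis by simp
    qed
    then show "\<forall>\<^sub>F \<tau> in at t within {0..}.
        norm (L2_norm (\<lambda>\<xi>. (u_hat j \<tau> \<xi> - u_hat j t \<xi>) / complex_of_real (\<tau> - t) - u_hat (Suc j) t \<xi>))
        \<le> sobolev_norm ?\<sigma> (\<lambda>x. (U j \<tau> x - U j t x) / complex_of_real (\<tau> - t) - U (Suc j) t x)"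
      by (auto simp: eventually_at_filter)
  qed
qed

definition pair :: "nat \<Rightarrow> (real ^ 'n \<Rightarrow> complex) \<Rightarrow> real \<Rightarrow> complex" where
  "pair j \<psi> t = (LINT \<xi>|lborel. u_hat j t \<xi> * \<psi> \<xi>)"

lemma pair_derivative:
  assumes j: "real (Suc j) \<le> s0" and t: "0 \<le> t" and \<psi>: "is_L2 \<psi>"
  shows "(pair j \<psi> has_vector_derivative pair (Suc j) \<psi> t) (at t within {0..})"
proof -
  have j': "real j \<le> s0" using j by simp
  let ?d = "\<lambda>\<tau> \<xi>. (u_hat j \<tau> \<xi> - u_hat j t \<xi>) / complex_of_real (\<tau> - t) - u_hat (Suc j) t \<xi>"
  have up: "((\<lambda>\<tau>. L2_norm (?d \<tau>) * L2_norm \<psi>) \<longlongrightarrow> 0 * L2_norm \<psi>) (at t within {0..})"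
    by (intro tendsto_mult u_hat_derivative j t tendsto_const)
  have "((\<lambda>\<tau>. (1 / norm (\<tau> - t)) *\<^sub>R (pair j \<psi> \<tau> - (pair j \<psi> t + (\<tau> - t) *\<^sub>R pair (Suc j) \<psi> t))) \<longlongrightarrow> 0)
      (at t within {0..})"
  proof (rule Lim_null_comparison [OF _ up [unfolded mult_zero_left]])
    have "norm ((1 / norm (\<tau> - t)) *\<^sub>R (pair j \<psi> \<tau> - (pair j \<psi> t + (\<tau> - t) *\<^sub>R pair (Suc j) \<psi> t)))
        \<le> L2_norm (?d \<tau>) * L2_norm \<psi>" if \<tau>: "0 \<le> \<tau>" "\<tau> \<noteq> t" for \<tau>
    proof -
      let ?c = "1 / complex_of_real (\<tau> - t)"
      have "is_L2 (\<lambda>\<xi>. ?c * (1 * u_hat j \<tau> \<xi> + (-1) * u_hat j t \<xi>) + (-1) * u_hat (Suc j) t \<xi>)"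
        by (intro is_L2_lincomb u_hat_facts(2) j j' t \<tau>)
      then have dL2: "is_L2 (?d \<tau>)" by simp
      note i = is_L2_mult(1) [OF u_hat_facts(2) [OF j' \<tau>(1)] \<psi>] is_L2_mult(1) [OF u_hat_facts(2) [OF j' t] \<psi>]
        is_L2_mult(1) [OF u_hat_facts(2) [OF j t] \<psi>]
      have "(LINT \<xi>|lborel. ?d \<tau> \<xi> * \<psi> \<xi>)
        = (LINT \<xi>|lborel. ?c * (u_hat j \<tau> \<xi> * \<psi> \<xi>) - ?c * (u_hat j t \<xi> * \<psi> \<xi>) - u_hat (Suc j) t \<xi> * \<psi> \<xi>)"
        by (intro Bochner_Integration.integral_cong) (simp_all add: algebra_simps diff_divide_distrib)
      also have "\<dots> = ?c * pair j \<psi> \<tau> - ?c * pair j \<psi> t - pair (Suc j) \<psi> t"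
        unfolding pair_def using i by simp
      finally have eq: "?c * pair j \<psi> \<tau> - ?c * pair j \<psi> t - pair (Suc j) \<psi> t = (LINT \<xi>|lborel. ?d \<tau> \<xi> * \<psi> \<xi>)" ..
      have "pair j \<psi> \<tau> - (pair j \<psi> t + (\<tau> - t) *\<^sub>R pair (Suc j) \<psi> t)
        = complex_of_real (\<tau> - t) * (?c * pair j \<psi> \<tau> - ?c * pair j \<psi> t - pair (Suc j) \<psi> t)"
      proof -
        have "x - (y + d * z) = d * (1 / d * x - 1 / d * y - z)" if "d \<noteq> 0" for x y z d :: complex
          using that by (simp add: field_simps)
        then show ?thesis using \<tau>(2) unfolding scaleR_conv_of_real by simp
      qed
      then have "norm ((1 / norm (\<tau> - t)) *\<^sub>R (pair j \<psi> \<tau> - (pair j \<psi> t + (\<tau> - t) *\<^sub>R pair (Suc j) \<psi> t)))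
          = cmod (LINT \<xi>|lborel. ?d \<tau> \<xi> * \<psi> \<xi>)"
        unfolding eq using \<tau>(2) by (simp only: norm_scaleR norm_mult norm_of_real) simp
      then show ?thesis using is_L2_mult(2) [OF dL2 \<psi>] by simp
    qed
    then show "\<forall>\<^sub>F \<tau> in at t within {0..}.
      norm ((1 / norm (\<tau> - t)) *\<^sub>R (pair j \<psi> \<tau> - (pair j \<psi> t + (\<tau> - t) *\<^sub>R pair (Suc j) \<psi> t)))
        \<le> L2_norm (?d \<tau>) * L2_norm \<psi>"
      by (auto simp: eventually_at_filter)
  qed
  then show ?thesis
    by (simp add: has_vector_derivative_def has_derivative_within bounded_linear_scaleR_left divide_inverse)
qed

end

section \<open>The equation on the Fourier side\<close>

lemma at_within_Ici_neq_bot: "0 \<le> t \<Longrightarrow> at t within {0::real..} \<noteq> bot"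
proof
  assume t: "0 \<le> t" and bot: "at t within {0..} = bot"
  have "at_right t \<le> at t within {0..}" using t by (intro at_le) auto
  then show False using bot by (simp add: bot_unique)
qed

lemma time_deriv_eq:
  "(f has_vector_derivative D) (at t within {0..}) \<Longrightarrow> 0 \<le> t \<Longrightarrow> time_deriv f t = D"
  unfolding time_deriv_def by (intro vector_derivative_within at_within_Ici_neq_bot)

lemma time_deriv_works:
  "f differentiable (at t within {0..}) \<Longrightarrow> (f has_vector_derivative time_deriv f t) (at t within {0..})"
  unfolding time_deriv_def by (rule vector_derivative_works [THEN iffD1])

lemma has_vector_derivative_cong_Ici:
  assumes "\<And>s. 0 \<le> s \<Longrightarrow> f s = g s" "0 \<le> t"
  shows "(f has_vector_derivative D) (at t within {0..}) \<longleftrightarrow> (g has_vector_derivative D) (at t within {0..})"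
proof
  assume "(f has_vector_derivative D) (at t within {0..})"
  then show "(g has_vector_derivative D) (at t within {0..})"
    by (rule has_vector_derivative_transform [rotated 2]) (use assms in simp_all)
next
  assume "(g has_vector_derivative D) (at t within {0..})"
  then show "(f has_vector_derivative D) (at t within {0..})"
    by (rule has_vector_derivative_transform [rotated 2]) (use assms in simp_all)
qed

lemma time_deriv_cong:
  assumes "\<And>s. 0 \<le> s \<Longrightarrow> f s = g s" "0 \<le> t"
  shows "time_deriv f t = time_deriv g t"
  unfolding time_deriv_def vector_derivative_def
  by (simp only: has_vector_derivative_cong_Ici [of f g, OF assms])

text \<open>
  The coefficient of \<open>\<lambda>\<^sup>k\<close> in the symbol evaluated at the imaginary covector
  \<open>\<i> \<xi>\<close>.
\<close>

definition symbol_coeff :: "nat \<Rightarrow> (nat \<Rightarrow> ('n::finite \<Rightarrow> nat) \<Rightarrow> real) \<Rightarrow> nat \<Rightarrow> real ^ 'n \<Rightarrow> complex" where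
  "symbol_coeff r c k \<xi> = (\<Sum>x\<in>op_indices r. if fst x = k
     then complex_of_real (c (fst x) (snd x) * mi_power \<xi> (snd x)) * \<i> ^ mi_size (snd x) else 0)"

text \<open>
  The coefficients of order \<open>k < m\<close> of the ordinary differential equation at frequency
  \<open>\<xi>\<close>; that of order \<open>m\<close> is 1.
\<close>

definition (in cauchy_problem) A :: "nat \<Rightarrow> real ^ 'n \<Rightarrow> complex" where
  "A k \<xi> = symbol_coeff m Pm k \<xi> + symbol_coeff (m - 1) Pm1 k \<xi> + symbol_coeff (m - 2) Pm2 k \<xi>"

context box_bumps
begin

definition test_box :: "(real ^ 'n) set" where
  "test_box = cbox (\<chi> i. a i) (\<chi> i. b i)"

text \<open>
  Linear combinations of products of bumps. Their transforms are Schwartz functions, and multiplication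
  by polynomials, in particular by the coefficients \<open>A k\<close>, does not lead out of this space.
\<close>

inductive_set tests :: "(real ^ 'n \<Rightarrow> complex) set" where
  tensor: "bump_family h \<Longrightarrow> tensor h \<in> tests"
| add: "\<psi> \<in> tests \<Longrightarrow> \<phi> \<in> tests \<Longrightarrow> (\<lambda>\<xi>. \<psi> \<xi> + \<phi> \<xi>) \<in> tests"
| scale: "\<psi> \<in> tests \<Longrightarrow> (\<lambda>\<xi>. c * \<psi> \<xi>) \<in> tests"

lemma tests_continuous: "\<psi> \<in> tests \<Longrightarrow> continuous_on UNIV \<psi>"
  by (induction rule: tests.induct) (auto intro!: continuous_intros tensor_continuous)

lemma tests_outside: "\<psi> \<in> tests \<Longrightarrow> \<xi> \<notin> test_box \<Longrightarrow> \<psi> \<xi> = 0"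
  by (induction rule: tests.induct) (auto simp: test_box_def tensor_outside)

lemma tests_bounded:
  assumes "\<psi> \<in> tests"
  obtains C where "\<And>\<xi>. cmod (\<psi> \<xi>) \<le> C * indicator test_box \<xi>"
proof -
  have "compact test_box" by (simp add: test_box_def)
  moreover have "continuous_on test_box (\<lambda>\<xi>. cmod (\<psi> \<xi>))"
    by (rule continuous_on_norm [OF continuous_on_subset [OF tests_continuous [OF assms]]]) simp
  ultimately obtain C where "\<And>\<xi>. \<xi> \<in> test_box \<Longrightarrow> \<bar>cmod (\<psi> \<xi>)\<bar> \<le> C" using compact_upper_bound by blast
  then have "cmod (\<psi> \<xi>) \<le> C * indicator test_box \<xi>" for \<xi>
    using tests_outside [OF assms, of \<xi>] by (auto simp: indicator_def)
  then show thesis by (rule that)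
qed

lemma tests_L2:
  assumes "\<psi> \<in> tests"
  shows "is_L2 \<psi>"
proof -
  obtain C where C: "\<And>\<xi>. cmod (\<psi> \<xi>) \<le> C * indicator test_box \<xi>" using tests_bounded [OF assms] by blast
  have m: "\<psi> \<in> borel_measurable borel"
    by (rule borel_measurable_continuous_onI [OF tests_continuous [OF assms]])
  have "emeasure lborel test_box < \<infinity>" unfolding test_box_def by (rule emeasure_lborel_cbox_finite)
  moreover have "test_box \<in> sets lborel" by (simp add: test_box_def)
  ultimately have ind: "is_L2 (\<lambda>\<xi>. complex_of_real (indicator test_box \<xi>))"
  proof -
    assume fin: "emeasure lborel test_box < \<infinity>" and meas: "test_box \<in> sets lborel"
    have "(\<lambda>\<xi>. (cmod (complex_of_real (indicator test_box \<xi>)))\<^sup>2) = indicator test_box"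
      by (auto simp: indicator_def)
    then show "is_L2 (\<lambda>\<xi>. complex_of_real (indicator test_box \<xi>))"
      unfolding is_L2_def using integrable_real_indicator [OF meas fin] meas by simp
  qed
  show ?thesis
    by (rule is_L2_dominated [OF ind, of _ C]) (use m C in simp_all)
qed

lemma tests_zero: "(\<lambda>\<xi>. 0) \<in> tests"
proof -
  have "bump_family (\<lambda>i. bump \<epsilon> (a i) (b i) 1 0)" by (simp add: bump_family_def bump_in_bumps)
  from tests.scale [OF tests.tensor [OF this], of 0] show ?thesis by simp
qed

lemma tests_sum: "(\<And>x. x \<in> X \<Longrightarrow> \<psi> x \<in> tests) \<Longrightarrow> (\<lambda>\<xi>. \<Sum>x\<in>X. \<psi> x \<xi>) \<in> tests"
  by (induction X rule: infinite_finite_induct) (auto intro: tests_zero tests.add)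

lemma tests_mi_power: "\<psi> \<in> tests \<Longrightarrow> (\<lambda>\<xi>. complex_of_real (mi_power \<xi> \<alpha>) * \<psi> \<xi>) \<in> tests"
proof (induction rule: tests.induct)
  case (tensor h)
  have one: "\<i> ^ n * (- \<i>) ^ n = 1" for n by (simp add: power_mult_distrib [symmetric])
  have "(\<lambda>\<xi>. complex_of_real (mi_power \<xi> \<alpha>) * tensor h \<xi>) = (\<lambda>\<xi>. \<i> ^ mi_size \<alpha> * tensor (moment \<alpha> h) \<xi>)"
    unfolding tensor_moment by (simp add: one mult.assoc [symmetric])
  then show ?case using tests.scale [OF tests.tensor [OF bump_family_moment [OF tensor]]] by simp
next
  case (add \<psi> \<phi>)
  then show ?case using tests.add by (fastforce simp: algebra_simps)
next
  case (scale \<psi> c)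
  from tests.scale [OF scale.IH, of c] show ?case by (simp add: mult.left_commute)
qed

lemma tests_symbol_coeff:
  assumes "\<psi> \<in> tests"
  shows "(\<lambda>\<xi>. symbol_coeff r c k \<xi> * \<psi> \<xi>) \<in> tests"
proof -
  have t: "(\<lambda>\<xi>. if fst x = k then complex_of_real (c (fst x) (snd x) * mi_power \<xi> (snd x)) * \<i> ^ mi_size (snd x) * \<psi> \<xi> else 0)
      \<in> tests" for x
  proof (cases "fst x = k")
    case True
    from tests.scale [OF tests_mi_power [OF assms, of "snd x"], of "complex_of_real (c k (snd x)) * \<i> ^ mi_size (snd x)"]
    show ?thesis using True by (simp add: algebra_simps)
  qed (simp add: tests_zero)
  have "(\<lambda>\<xi>. symbol_coeff r c k \<xi> * \<psi> \<xi>) = (\<lambda>\<xi>. \<Sum>x\<in>op_indices r.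
      if fst x = k then complex_of_real (c (fst x) (snd x) * mi_power \<xi> (snd x)) * \<i> ^ mi_size (snd x) * \<psi> \<xi> else 0)"
    by (rule ext) (simp add: symbol_coeff_def sum_distrib_right if_distrib [of "\<lambda>y. y * _"] cong: if_cong)
  then show ?thesis by (simp only: tests_sum t)
qed

end

locale cauchy_problem_tests = cauchy_problem m Pm Pm1 Pm2 s0 u0 u U + box_bumps \<epsilon> a b
  for m :: nat and Pm Pm1 Pm2 :: "nat \<Rightarrow> ('n::finite \<Rightarrow> nat) \<Rightarrow> real" and s0 :: real
    and u0 :: "nat \<Rightarrow> real ^ 'n \<Rightarrow> complex" and u :: "real \<Rightarrow> real ^ 'n \<Rightarrow> complex"
    and U :: "nat \<Rightarrow> real \<Rightarrow> real ^ 'n \<Rightarrow> complex" and \<epsilon> :: real and a b :: "'n \<Rightarrow> real"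
begin

lemma pair_add:
  assumes "real j \<le> s0" "0 \<le> t" "is_L2 \<psi>" "is_L2 \<phi>"
  shows "pair j (\<lambda>\<xi>. \<psi> \<xi> + \<phi> \<xi>) t = pair j \<psi> t + pair j \<phi> t"
  using is_L2_mult(1) [OF u_hat_facts(2) [OF assms(1,2)]] assms(3,4)
  by (simp add: pair_def distrib_left)

lemma pair_scale: "pair j (\<lambda>\<xi>. c * \<psi> \<xi>) t = c * pair j \<psi> t"
proof -
  have "pair j (\<lambda>\<xi>. c * \<psi> \<xi>) t = (LINT \<xi>|lborel. c * (u_hat j t \<xi> * \<psi> \<xi>))"
    by (simp add: pair_def mult.left_commute)
  then show ?thesis by (simp add: pair_def)
qed

lemma pair_zero: "pair j (\<lambda>\<xi>. 0) t = 0"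
  by (simp add: pair_def)

lemma pair_sum:
  assumes "real j \<le> s0" "0 \<le> t" "\<And>x. x \<in> X \<Longrightarrow> \<psi> x \<in> tests"
  shows "pair j (\<lambda>\<xi>. \<Sum>x\<in>X. \<psi> x \<xi>) t = (\<Sum>x\<in>X. pair j (\<psi> x) t)"
  using assms(3)
proof (induction X rule: infinite_finite_induct)
  case (insert x X)
  then have "(\<lambda>\<xi>. \<Sum>x\<in>X. \<psi> x \<xi>) \<in> tests" by (intro tests_sum) auto
  then show ?case using insert by (simp add: pair_add [OF assms(1,2)] tests_L2)
qed (simp_all add: pair_zero)

lemma pairing_tensor_hat:
  assumes h: "bump_family h" and j: "real j \<le> s0" and t: "0 \<le> t"
  shows "pairing (U j t) (tensor_hat h) = pair j (tensor h) t"
proof -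
  have F: "fourier_integral (tensor h) = tensor_hat h"
    by (rule ext) (rule fourier_integral_tensor [OF h])
  have "is_L2 (fourier_integral (tensor h))" unfolding F by (rule tensor_hat_L2 [OF h])
  from multiplication_formula [OF u_hat_facts(1) [OF j t] tensor_integrable [OF h] tests_L2 [OF tests.tensor [OF h]] this]
  show ?thesis by (simp add: F pairing_def pair_def)
qed

lemma iterated_time_deriv:
  assumes "bump_family h" "k < m" "0 \<le> t"
  shows "(time_deriv ^^ k) (\<lambda>\<tau>. pairing (u \<tau>) (tensor_hat h)) t = pair k (tensor h) t"
  using assms(2,3)
proof (induction k arbitrary: t)
  case 0
  have "U 0 = u" using sol by (simp add: cauchy_solution_def sobolev_time_derivs_def)
  then show ?case using pairing_tensor_hat [OF assms(1), of 0 t] 0 s0 m by simp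
next
  case (Suc k)
  have "(time_deriv ^^ Suc k) (\<lambda>\<tau>. pairing (u \<tau>) (tensor_hat h)) t = time_deriv (pair k (tensor h)) t"
    using Suc by (simp del: funpow.simps add: funpow.simps(2) o_def) (intro time_deriv_cong, auto)
  also have "\<dots> = pair (Suc k) (tensor h) t"
    using Suc.prems s0 by (intro time_deriv_eq pair_derivative tests_L2 tests.tensor assms(1)) auto
  finally show ?case .
qed

text \<open>
  Differentiating the transform of \<open>\<psi>\<close> by \<open>\<partial>\<^sup>\<alpha>\<close>
  multiplies \<open>\<psi>\<close> by \<open>(- \<i> \<xi>)\<^sup>\<alpha>\<close>; together with the
  sign from the definition of weak derivatives this is \<open>(\<i> \<xi>)\<^sup>\<alpha>\<close>. Only
  time derivatives of order below \<open>m\<close> are considered, as the one of order \<open>m\<close>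
  may fail to be a function when \<open>s0 < m\<close>.
\<close>

lemma weak_operator_terms:
  assumes h: "bump_family h" and t: "0 \<le> t"
  shows "(\<Sum>x\<in>{x \<in> op_indices r. fst x < m}. complex_of_real (c (fst x) (snd x)) * (-1) ^ mi_size (snd x) *
      (time_deriv ^^ fst x) (\<lambda>\<tau>. pairing (u \<tau>) (mi_deriv (snd x) (tensor_hat h))) t)
    = (\<Sum>k<m. pair k (\<lambda>\<xi>. symbol_coeff r c k \<xi> * tensor h \<xi>) t)"
proof -
  let ?\<psi> = "tensor h"
  let ?g = "\<lambda>x \<xi>. complex_of_real (c (fst x) (snd x) * mi_power \<xi> (snd x)) * \<i> ^ mi_size (snd x) * ?\<psi> \<xi>"
  have gt: "?g x \<in> tests" for x
    using tests.scale [OF tests_mi_power [OF tests.tensor [OF h], of "snd x"],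
        of "complex_of_real (c (fst x) (snd x)) * \<i> ^ mi_size (snd x)"]
    by (simp add: algebra_simps)
  have one: "complex_of_real (c (fst x) (snd x)) * (-1) ^ mi_size (snd x) *
      (time_deriv ^^ fst x) (\<lambda>\<tau>. pairing (u \<tau>) (mi_deriv (snd x) (tensor_hat h))) t = pair (fst x) (?g x) t"
    if "fst x < m" for x
  proof -
    have im: "(-1) ^ n * (- \<i>) ^ n = \<i> ^ n" for n by (simp add: power_mult_distrib [symmetric])
    have "(time_deriv ^^ fst x) (\<lambda>\<tau>. pairing (u \<tau>) (mi_deriv (snd x) (tensor_hat h))) t
      = pair (fst x) (tensor (moment (snd x) h)) t"
      unfolding mi_deriv_tensor_hat [OF h]
      by (rule iterated_time_deriv [OF bump_family_moment [OF h] that t])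
    then have "complex_of_real (c (fst x) (snd x)) * (-1) ^ mi_size (snd x) *
      (time_deriv ^^ fst x) (\<lambda>\<tau>. pairing (u \<tau>) (mi_deriv (snd x) (tensor_hat h))) t
      = pair (fst x) (\<lambda>\<xi>. complex_of_real (c (fst x) (snd x)) * (-1) ^ mi_size (snd x) * tensor (moment (snd x) h) \<xi>) t"
      by (simp add: pair_scale)
    also have "(\<lambda>\<xi>. complex_of_real (c (fst x) (snd x)) * (-1) ^ mi_size (snd x) * tensor (moment (snd x) h) \<xi>) = ?g x"
      by (rule ext) (simp add: tensor_moment im [symmetric] mult_ac)
    finally show ?thesis .
  qed
  have fin: "finite (op_indices r :: (nat \<times> ('n \<Rightarrow> nat)) set)" by (rule finite_op_indices)
  have "(\<Sum>k<m. pair k (\<lambda>\<xi>. symbol_coeff r c k \<xi> * ?\<psi> \<xi>) t)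
      = (\<Sum>k<m. \<Sum>x\<in>op_indices r. if fst x = k then pair k (?g x) t else 0)"
  proof (rule sum.cong [OF refl])
    fix k assume "k \<in> {..<m}"
    then have k: "real k \<le> s0" using s0 by auto
    have eq: "(\<lambda>\<xi>. symbol_coeff r c k \<xi> * ?\<psi> \<xi>) = (\<lambda>\<xi>. \<Sum>x\<in>op_indices r. if fst x = k then ?g x \<xi> else 0)"
      by (rule ext) (simp add: symbol_coeff_def sum_distrib_right if_distrib [of "\<lambda>y. y * _"] cong: if_cong)
    have "pair k (\<lambda>\<xi>. symbol_coeff r c k \<xi> * ?\<psi> \<xi>) t = (\<Sum>x\<in>op_indices r. pair k (\<lambda>\<xi>. if fst x = k then ?g x \<xi> else 0) t)"
      unfolding eq
    proof (rule pair_sum [OF k t])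
      show "(\<lambda>\<xi>. if fst x = k then ?g x \<xi> else 0) \<in> tests" for x
        using gt [of x] tests_zero by (cases "fst x = k") auto
    qed
    also have "\<dots> = (\<Sum>x\<in>op_indices r. if fst x = k then pair k (?g x) t else 0)"
      by (intro sum.cong) (auto simp: pair_zero)
    finally show "pair k (\<lambda>\<xi>. symbol_coeff r c k \<xi> * ?\<psi> \<xi>) t
      = (\<Sum>x\<in>op_indices r. if fst x = k then pair k (?g x) t else 0)" .
  qed
  also have "\<dots> = (\<Sum>x\<in>op_indices r. \<Sum>k<m. if fst x = k then pair k (?g x) t else 0)"
    by (rule sum.swap)
  also have "\<dots> = (\<Sum>x\<in>op_indices r. if fst x < m then pair (fst x) (?g x) t else 0)"
    by (intro sum.cong) auto
  also have "\<dots> = (\<Sum>x\<in>{x \<in> op_indices r. fst x < m}. pair (fst x) (?g x) t)"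
    using fin by (simp add: sum.If_cases Int_def)
  also have "\<dots> = (\<Sum>x\<in>{x \<in> op_indices r. fst x < m}. complex_of_real (c (fst x) (snd x)) * (-1) ^ mi_size (snd x) *
      (time_deriv ^^ fst x) (\<lambda>\<tau>. pairing (u \<tau>) (mi_deriv (snd x) (tensor_hat h))) t)"
    by (rule sum.cong [OF refl], rule one [symmetric]) simp
  finally show ?thesis ..
qed

text \<open>
  The term of order \<open>m\<close> in time has coefficient 1 and is the derivative of the pairing of
  order \<open>m - 1\<close>.
\<close>

lemma weak_equation_tensor:
  assumes h: "bump_family h" and t: "0 \<le> t"
  shows "(pair (m - 1) (tensor h) has_vector_derivative
    - (\<Sum>k<m. pair k (\<lambda>\<xi>. A k \<xi> * tensor h \<xi>) t)) (at t within {0..})"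
proof -
  let ?\<phi> = "tensor_hat h" and ?\<psi> = "tensor h"
  let ?term = "\<lambda>c x. complex_of_real (c (fst x) (snd x)) * (-1) ^ mi_size (snd x) *
      (time_deriv ^^ fst x) (\<lambda>\<tau>. pairing (u \<tau>) (mi_deriv (snd x) ?\<phi>)) t"
  have m1: "Suc (m - 1) = m" using m by simp
  have solves: "solves_Q2 m Pm Pm1 Pm2 u" using sol by (simp add: cauchy_solution_def)
  have eq: "op_weak m Pm u ?\<phi> t + op_weak (m - 1) Pm1 u ?\<phi> t + op_weak (m - 2) Pm2 u ?\<phi> t = 0"
    and diff: "(time_deriv ^^ (m - 1)) (\<lambda>\<tau>. pairing (u \<tau>) ?\<phi>) differentiable (at t within {0..})"
    using solves schwartz_tensor_hat [OF h] t m unfolding solves_Q2_def by auto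
  have ow: "op_weak r c u ?\<phi> t = (\<Sum>x\<in>op_indices r. ?term c x)" for r c
    by (simp add: op_weak_def case_prod_beta)
  have low: "op_weak r c u ?\<phi> t = (\<Sum>k<m. pair k (\<lambda>\<xi>. symbol_coeff r c k \<xi> * ?\<psi> \<xi>) t)" if "r < m" for r c
  proof -
    have "{x \<in> op_indices r. fst x < m} = (op_indices r :: (nat \<times> ('n \<Rightarrow> nat)) set)"
      using that by (auto simp: op_indices_def)
    then show ?thesis using weak_operator_terms [OF h t, where r = r and c = c] by (simp add: ow)
  qed
  define D where "D = time_deriv ((time_deriv ^^ (m - 1)) (\<lambda>\<tau>. pairing (u \<tau>) ?\<phi>)) t"
  have top: "op_weak m Pm u ?\<phi> t = D + (\<Sum>k<m. pair k (\<lambda>\<xi>. symbol_coeff m Pm k \<xi> * ?\<psi> \<xi>) t)"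
  proof -
    \<comment> \<open>The only index of order \<open>m\<close> in time is the one without space derivatives.\<close>
    have ind: "(op_indices m :: (nat \<times> ('n \<Rightarrow> nat)) set) = insert (m, \<lambda>_. 0) {x \<in> op_indices m. fst x < m}"
    proof (intro set_eqI iffI)
      fix x :: "nat \<times> ('n \<Rightarrow> nat)" assume x: "x \<in> op_indices m"
      then have s: "fst x + mi_size (snd x) = m" by (auto simp: op_indices_def)
      show "x \<in> insert (m, \<lambda>_. 0) {x \<in> op_indices m. fst x < m}"
      proof (cases "fst x < m")
        case False
        then have "mi_size (snd x) = 0" "fst x = m" using s by auto
        then have "x = (m, \<lambda>_. 0)" by (auto simp: mi_size_def prod_eq_iff)
        then show ?thesis by simp
      qed (use x in simp)
    qed (auto simp: op_indices_def mi_size_def)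
    have "moment (\<lambda>_. 0) h = h" by (simp add: fun_eq_iff moment_def)
    then have "?term Pm (m, \<lambda>_. 0) = (time_deriv ^^ Suc (m - 1)) (\<lambda>\<tau>. pairing (u \<tau>) ?\<phi>) t"
      unfolding mi_deriv_tensor_hat [OF h] m1 by (simp add: lead mi_size_def)
    then have T: "?term Pm (m, \<lambda>_. 0) = D" by (simp add: D_def)
    have "finite {x \<in> op_indices m :: (nat \<times> ('n \<Rightarrow> nat)) set. fst x < m}"
      using finite_op_indices by (rule finite_subset [rotated]) auto
    then have "op_weak m Pm u ?\<phi> t = ?term Pm (m, \<lambda>_. 0) + (\<Sum>x\<in>{x \<in> op_indices m. fst x < m}. ?term Pm x)"
      unfolding ow by (subst ind) (subst sum.insert, auto)
    then show ?thesis unfolding T weak_operator_terms [OF h t] .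
  qed
  have "(\<Sum>k<m. pair k (\<lambda>\<xi>. A k \<xi> * ?\<psi> \<xi>) t)
      = (\<Sum>k<m. pair k (\<lambda>\<xi>. symbol_coeff m Pm k \<xi> * ?\<psi> \<xi>) t + pair k (\<lambda>\<xi>. symbol_coeff (m - 1) Pm1 k \<xi> * ?\<psi> \<xi>) t
          + pair k (\<lambda>\<xi>. symbol_coeff (m - 2) Pm2 k \<xi> * ?\<psi> \<xi>) t)"
  proof (rule sum.cong [OF refl])
    fix k assume "k \<in> {..<m}"
    then have k: "real k \<le> s0" using s0 by auto
    have L: "is_L2 (\<lambda>\<xi>. symbol_coeff r c k \<xi> * ?\<psi> \<xi>)" for r c
      by (intro tests_L2 tests_symbol_coeff tests.tensor h)
    show "pair k (\<lambda>\<xi>. A k \<xi> * ?\<psi> \<xi>) t = pair k (\<lambda>\<xi>. symbol_coeff m Pm k \<xi> * ?\<psi> \<xi>) t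
        + pair k (\<lambda>\<xi>. symbol_coeff (m - 1) Pm1 k \<xi> * ?\<psi> \<xi>) t + pair k (\<lambda>\<xi>. symbol_coeff (m - 2) Pm2 k \<xi> * ?\<psi> \<xi>) t"
      unfolding A_def distrib_right by (simp add: pair_add [OF k t] L is_L2_add)
  qed
  then have "D + (\<Sum>k<m. pair k (\<lambda>\<xi>. A k \<xi> * ?\<psi> \<xi>) t) = 0"
    using eq top low [of "m - 1" Pm1] low [of "m - 2" Pm2] m by (simp add: sum.distrib add.assoc)
  then have D: "D = - (\<Sum>k<m. pair k (\<lambda>\<xi>. A k \<xi> * ?\<psi> \<xi>) t)" by (simp add: eq_neg_iff_add_eq_0)
  have "((time_deriv ^^ (m - 1)) (\<lambda>\<tau>. pairing (u \<tau>) ?\<phi>) has_vector_derivative D) (at t within {0..})"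
    unfolding D_def by (rule time_deriv_works [OF diff])
  then have "(pair (m - 1) ?\<psi> has_vector_derivative D) (at t within {0..})"
    using iterated_time_deriv [OF h, of "m - 1"] m t
    by (subst (asm) has_vector_derivative_cong_Ici [of _ "pair (m - 1) ?\<psi>"]) auto
  then show ?thesis unfolding D .
qed

lemma weak_equation:
  assumes "\<psi> \<in> tests" and t: "0 \<le> t"
  shows "(pair (m - 1) \<psi> has_vector_derivative - (\<Sum>k<m. pair k (\<lambda>\<xi>. A k \<xi> * \<psi> \<xi>) t)) (at t within {0..})"
  using assms(1)
proof (induction rule: tests.induct)
  case (tensor h)
  then show ?case using weak_equation_tensor t by blast
next
  case (add \<psi> \<phi>)
  have m1: "real (m - 1) \<le> s0" using s0 m by simp
  have AL: "is_L2 (\<lambda>\<xi>. A k \<xi> * \<omega> \<xi>)" if "\<omega> \<in> tests" for k \<omega>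
    unfolding A_def distrib_right by (intro is_L2_add tests_L2 tests_symbol_coeff that)
  have "((\<lambda>s. pair (m - 1) \<psi> s + pair (m - 1) \<phi> s) has_vector_derivative
      - (\<Sum>k<m. pair k (\<lambda>\<xi>. A k \<xi> * \<psi> \<xi>) t) + - (\<Sum>k<m. pair k (\<lambda>\<xi>. A k \<xi> * \<phi> \<xi>) t)) (at t within {0..})"
    by (intro has_vector_derivative_add add.IH)
  moreover have "(\<Sum>k<m. pair k (\<lambda>\<xi>. A k \<xi> * (\<psi> \<xi> + \<phi> \<xi>)) t)
      = (\<Sum>k<m. pair k (\<lambda>\<xi>. A k \<xi> * \<psi> \<xi>) t) + (\<Sum>k<m. pair k (\<lambda>\<xi>. A k \<xi> * \<phi> \<xi>) t)"
    unfolding sum.distrib [symmetric] distrib_left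
    by (intro sum.cong refl pair_add t AL add.hyps) (use s0 in auto)
  ultimately show ?case
    using tests_L2 [OF add.hyps(1)] tests_L2 [OF add.hyps(2)] t
    by (subst has_vector_derivative_cong_Ici [of _ "\<lambda>s. pair (m - 1) \<psi> s + pair (m - 1) \<phi> s"])
      (simp_all add: pair_add [OF m1] del: One_nat_def)
next
  case (scale \<psi> c)
  have "((\<lambda>s. c * pair (m - 1) \<psi> s) has_vector_derivative c * - (\<Sum>k<m. pair k (\<lambda>\<xi>. A k \<xi> * \<psi> \<xi>) t)) (at t within {0..})"
    by (intro has_vector_derivative_mult_right scale.IH)
  moreover have "pair k (\<lambda>\<xi>. A k \<xi> * (c * \<psi> \<xi>)) t = c * pair k (\<lambda>\<xi>. A k \<xi> * \<psi> \<xi>) t" for k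
    using pair_scale [of k c "\<lambda>\<xi>. A k \<xi> * \<psi> \<xi>" t] by (simp add: mult.left_commute)
  ultimately show ?case by (simp add: pair_scale [abs_def] sum_distrib_left)
qed

end

section \<open>Taylor expansion in time\<close>

lemma companion_partial_sum_bound:
  assumes j: "j < m" and t: "0 \<le> t" and M: "1 + (\<Sum>i<m. cmod (A i)) \<le> M"
  shows "cmod (\<Sum>n<N. companion A m (n + k) j / fact n * of_real t ^ n) \<le> M ^ k * exp (M * t)"
proof -
  have M0: "0 \<le> M" using M sum_nonneg [of "{..<m}" "\<lambda>i. cmod (A i)"] by simp
  have "cmod (companion A m n j) \<le> M ^ n" for n
    using companion_bound [OF j, of A n] power_mono [OF M, of n] sum_nonneg [of "{..<m}" "\<lambda>i. cmod (A i)"]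
    by (simp add: add_nonneg_nonneg)
  then have le: "cmod (companion A m (n + k) j / fact n * of_real t ^ n) \<le> M ^ k * ((M * t) ^ n /\<^sub>R fact n)" for n
  proof -
    have "cmod (companion A m (n + k) j / fact n * of_real t ^ n) = cmod (companion A m (n + k) j) * (t ^ n / fact n)"
      using t by (simp add: norm_mult norm_divide norm_power)
    also have "\<dots> \<le> M ^ (n + k) * (t ^ n / fact n)"
      using t \<open>\<And>n. cmod (companion A m n j) \<le> M ^ n\<close> by (intro mult_right_mono) auto
    also have "\<dots> = M ^ k * ((M * t) ^ n /\<^sub>R fact n)"
      by (simp only: power_add power_mult_distrib divide_inverse real_scaleR_def mult_ac)
    finally show ?thesis .
  qed
  have s: "(\<lambda>n. (M * t) ^ n /\<^sub>R fact n) sums exp (M * t)" by (rule exp_converges)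
  have "cmod (\<Sum>n<N. companion A m (n + k) j / fact n * of_real t ^ n)
      \<le> (\<Sum>n<N. M ^ k * ((M * t) ^ n /\<^sub>R fact n))"
    by (rule order_trans [OF norm_sum sum_mono [OF le]])
  also have "\<dots> = M ^ k * (\<Sum>n<N. (M * t) ^ n /\<^sub>R fact n)" by (simp add: sum_distrib_left)
  also have "\<dots> \<le> M ^ k * (\<Sum>n. (M * t) ^ n /\<^sub>R fact n)"
    using s M0 t by (intro mult_left_mono sum_le_suminf) (auto simp: sums_iff)
  finally show ?thesis using s by (simp add: sums_iff)
qed

lemma fundamental_solution_LIMSEQ:
  "j < m \<Longrightarrow> (\<lambda>N. \<Sum>n<N. companion A m (n + k) j / fact n * of_real t ^ n) \<longlonglongrightarrow> fundamental_solution A m k j t"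
  using fundamental_solution_sums [of j m A k "of_real t"] by (simp add: sums_def fundamental_solution_def)

text \<open>
  The exponential series, with companion coefficients bounded by powers of \<open>M\<close>.
\<close>

lemma fundamental_solution_bound:
  assumes "j < m" "0 \<le> t" "1 + (\<Sum>i<m. cmod (A i)) \<le> M"
  shows "cmod (fundamental_solution A m k j t) \<le> M ^ k * exp (M * t)"
  by (rule Lim_bounded [OF tendsto_norm [OF fundamental_solution_LIMSEQ [OF assms(1)]], of 0])
    (use companion_partial_sum_bound [OF assms] in simp)

lemma symbol_coeff_continuous: "continuous_on X (symbol_coeff r c k)"
  unfolding symbol_coeff_def
proof (intro continuous_on_sum)
  fix x
  show "continuous_on X (\<lambda>\<xi>. if fst x = k
    then complex_of_real (c (fst x) (snd x) * mi_power \<xi> (snd x)) * \<i> ^ mi_size (snd x) else 0)"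
    by (cases "fst x = k") (auto simp: mi_power_def intro!: continuous_intros)
qed

context cauchy_problem
begin

lemma A_continuous: "continuous_on X (A k)"
  unfolding A_def by (intro continuous_on_add symbol_coeff_continuous)

lemma companion_A_continuous: "continuous_on X (\<lambda>\<xi>. companion (\<lambda>k. A k \<xi>) m n j)"
proof (induction n arbitrary: j)
  case (Suc n)
  show ?case
    by (cases "j = 0") (auto intro!: continuous_intros Suc A_continuous)
qed simp

lemma fundamental_solution_A_measurable [measurable]:
  "(\<lambda>\<xi>. fundamental_solution (\<lambda>i. A i \<xi>) m k j t) \<in> borel_measurable borel"
proof -
  have [measurable]: "(\<lambda>\<xi>. companion (\<lambda>k. A k \<xi>) m n j) \<in> borel_measurable borel" for n
    by (rule borel_measurable_continuous_onI [OF companion_A_continuous])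
  show ?thesis unfolding fundamental_solution_def by measurable
qed

lemma A_bound_on_compact:
  assumes "compact K"
  obtains M where "0 < M" "\<And>\<xi>. \<xi> \<in> K \<Longrightarrow> 1 + (\<Sum>i<m. cmod (A i \<xi>)) \<le> M"
proof -
  have "continuous_on K (\<lambda>\<xi>. 1 + (\<Sum>i<m. cmod (A i \<xi>)))"
    by (intro continuous_intros A_continuous)
  then obtain M where M: "0 < M" "\<And>\<xi>. \<xi> \<in> K \<Longrightarrow> \<bar>1 + (\<Sum>i<m. cmod (A i \<xi>))\<bar> \<le> M"
    using compact_upper_bound [OF assms] by blast
  then show thesis using that [of M] by (meson abs_le_D1)
qed

lemma L2_norm_u_hat_bounded:
  assumes j: "real j \<le> s0"
  obtains V where "0 < V" "\<And>s. 0 \<le> s \<Longrightarrow> s \<le> t \<Longrightarrow> L2_norm (u_hat j s) \<le> V"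
proof -
  have "continuous_on {0..t} (\<lambda>s. L2_norm (u_hat j s))"
    unfolding continuous_on_def
  proof
    fix s assume s: "s \<in> {0..t}"
    have "((\<lambda>\<tau>. L2_norm (u_hat j \<tau>) - L2_norm (u_hat j s)) \<longlongrightarrow> 0) (at s within {0..})"
    proof (rule Lim_null_comparison [OF _ u_hat_continuous [OF j, of s]])
      show "\<forall>\<^sub>F \<tau> in at s within {0..}. norm (L2_norm (u_hat j \<tau>) - L2_norm (u_hat j s))
          \<le> L2_norm (\<lambda>\<xi>. u_hat j \<tau> \<xi> - u_hat j s \<xi>)"
        using s L2_norm_le_add_diff [OF u_hat_facts(2) [OF j] u_hat_facts(2) [OF j]]
        by (auto simp: eventually_at_filter)
    qed (use s in auto)
    then have "((\<lambda>\<tau>. L2_norm (u_hat j \<tau>)) \<longlongrightarrow> L2_norm (u_hat j s)) (at s within {0..})"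
      by (simp add: LIM_zero_iff)
    then show "((\<lambda>\<tau>. L2_norm (u_hat j \<tau>)) \<longlongrightarrow> L2_norm (u_hat j s)) (at s within {0..t})"
      by (rule tendsto_within_subset) auto
  qed
  then obtain V where "0 < V" "\<And>s. s \<in> {0..t} \<Longrightarrow> \<bar>L2_norm (u_hat j s)\<bar> \<le> V"
    using compact_upper_bound [OF compact_Icc] by blast
  then show thesis using that [of V] by auto
qed

end

context cauchy_problem_tests
begin

lemma tests_diff: "\<psi> \<in> tests \<Longrightarrow> \<phi> \<in> tests \<Longrightarrow> (\<lambda>\<xi>. \<psi> \<xi> - \<phi> \<xi>) \<in> tests"
  using tests.add [OF _ tests.scale [of \<phi> "-1"], of \<psi>] by simp

lemma tests_A: "\<psi> \<in> tests \<Longrightarrow> (\<lambda>\<xi>. A k \<xi> * \<psi> \<xi>) \<in> tests"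
  unfolding A_def distrib_right by (intro tests.add tests_symbol_coeff)

lemma tests_companion:
  assumes "\<psi> \<in> tests"
  shows "(\<lambda>\<xi>. companion (\<lambda>k. A k \<xi>) m n j * \<psi> \<xi>) \<in> tests"
proof (induction n arbitrary: j)
  case 0
  then show ?case using assms tests_zero by (cases "j = 0") auto
next
  case (Suc n)
  have "(\<lambda>\<xi>. A j \<xi> * (companion (\<lambda>k. A k \<xi>) m n (m - 1) * \<psi> \<xi>)) \<in> tests"
    by (intro tests_A Suc)
  moreover have "(\<lambda>\<xi>. (if j = 0 then 0 else companion (\<lambda>k. A k \<xi>) m n (j - 1)) * \<psi> \<xi>) \<in> tests"
    using Suc tests_zero by (cases "j = 0") auto
  ultimately have "(\<lambda>\<xi>. (if j = 0 then 0 else companion (\<lambda>k. A k \<xi>) m n (j - 1)) * \<psi> \<xi>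
      - A j \<xi> * (companion (\<lambda>k. A k \<xi>) m n (m - 1) * \<psi> \<xi>)) \<in> tests"
    by (rule tests_diff [rotated])
  then show ?case unfolding companion.simps left_diff_distrib mult.assoc .
qed

text \<open>
  What the pairing of \<open>\<psi>\<close> with the time derivative of order \<open>n\<close> becomes
  when the equation is used to reduce the order below \<open>m\<close>. It makes sense for every
  \<open>n\<close>, also beyond the regularity \<open>s0\<close>.
\<close>

definition H :: "nat \<Rightarrow> (real ^ 'n \<Rightarrow> complex) \<Rightarrow> real \<Rightarrow> complex" where
  "H n \<psi> t = (\<Sum>j<m. pair j (\<lambda>\<xi>. companion (\<lambda>k. A k \<xi>) m n j * \<psi> \<xi>) t)"

text \<open>
  The recursion of \<open>companion\<close> mirrors differentiation: the orders \<open>j < m - 1\<close>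
  move up by one, and the order \<open>m - 1\<close> is differentiated with the equation.
\<close>

lemma H_derivative:
  assumes \<psi>: "\<psi> \<in> tests" and t: "0 \<le> t"
  shows "(H n \<psi> has_vector_derivative H (Suc n) \<psi> t) (at t within {0..})"
proof -
  let ?L = "\<lambda>n j \<xi>. companion (\<lambda>k. A k \<xi>) m n j * \<psi> \<xi>"
  define m' where "m' = m - 1"
  have m': "Suc m' = m" using m by (simp add: m'_def)
  have split: "(\<Sum>j<m. f j) = (\<Sum>j<m'. f j) + f m'" for f :: "nat \<Rightarrow> complex"
    by (subst m' [symmetric]) simp
  have shift: "(\<Sum>j<m. f j) = f 0 + (\<Sum>j<m'. f (Suc j))" for f :: "nat \<Rightarrow> complex"
    by (subst m' [symmetric]) (rule sum.lessThan_Suc_shift)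
  have js: "real j \<le> s0" if "j < m" for j using s0 that by auto
  have Lt: "?L n j \<in> tests" for n j by (rule tests_companion [OF \<psi>])
  have "((\<lambda>t. (\<Sum>j<m'. pair j (?L n j) t) + pair m' (?L n m') t) has_vector_derivative
      (\<Sum>j<m'. pair (Suc j) (?L n j) t) + - (\<Sum>k<m. pair k (\<lambda>\<xi>. A k \<xi> * ?L n m' \<xi>) t)) (at t within {0..})"
  proof (intro has_vector_derivative_add has_vector_derivative_sum)
    show "(pair j (?L n j) has_vector_derivative pair (Suc j) (?L n j) t) (at t within {0..})" if "j \<in> {..<m'}" for j
      using that m' by (intro pair_derivative t tests_L2 Lt js) auto
    show "(pair m' (?L n m') has_vector_derivative - (\<Sum>k<m. pair k (\<lambda>\<xi>. A k \<xi> * ?L n m' \<xi>) t)) (at t within {0..})"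
      using weak_equation [OF Lt t, of n m'] by (simp add: m'_def)
  qed
  moreover have "(\<lambda>t. (\<Sum>j<m'. pair j (?L n j) t) + pair m' (?L n m') t) = H n \<psi>"
    by (rule ext) (simp add: H_def split)
  moreover have "(\<Sum>j<m'. pair (Suc j) (?L n j) t) + - (\<Sum>k<m. pair k (\<lambda>\<xi>. A k \<xi> * ?L n m' \<xi>) t) = H (Suc n) \<psi> t"
  proof -
    let ?P = "\<lambda>k \<xi>. (if k = 0 then 0 else ?L n (k - 1) \<xi>)"
    have Pt: "?P k \<in> tests" for k using Lt tests_zero by (cases "k = 0") auto
    have "pair k (?L (Suc n) k) t = pair k (?P k) t - pair k (\<lambda>\<xi>. A k \<xi> * ?L n m' \<xi>) t" if "k < m" for k
    proof -
      have "?L (Suc n) k = (\<lambda>\<xi>. ?P k \<xi> + (-1) * (A k \<xi> * ?L n m' \<xi>))"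
        by (rule ext) (simp add: m'_def algebra_simps)
      then have "pair k (?L (Suc n) k) t = pair k (?P k) t + pair k (\<lambda>\<xi>. (-1) * (A k \<xi> * ?L n m' \<xi>)) t"
        using pair_add [OF js [OF that] t tests_L2 [OF Pt [of k]] tests_L2 [OF tests.scale [OF tests_A [OF Lt]]], of "-1" k n m']
        by simp
      then show ?thesis by (subst (asm) pair_scale) simp
    qed
    then have "H (Suc n) \<psi> t = (\<Sum>k<m. pair k (?P k) t) - (\<Sum>k<m. pair k (\<lambda>\<xi>. A k \<xi> * ?L n m' \<xi>) t)"
      unfolding H_def by (simp add: sum_subtractf [symmetric] del: companion.simps)
    moreover have "(\<Sum>k<m. pair k (?P k) t) = (\<Sum>j<m'. pair (Suc j) (?L n j) t)"
      unfolding shift by (simp add: pair_zero)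
    ultimately show ?thesis by simp
  qed
  ultimately show ?thesis by simp
qed

lemma pair_eq_H:
  assumes "\<psi> \<in> tests" "real k \<le> s0" "0 \<le> t"
  shows "pair k \<psi> t = H k \<psi> t"
proof -
  have low: "pair k \<psi> t = H k \<psi> t" if "k < m" for k t
  proof -
    have "H k \<psi> t = (\<Sum>j<m. if j = k then pair k \<psi> t else 0)"
      unfolding H_def using that by (intro sum.cong) (auto simp: companion_initial pair_zero)
    then show ?thesis using that by simp
  qed
  show ?thesis
    using assms(2,3)
  proof (induction k arbitrary: t)
    case 0
    then show ?case using low m by simp
  next
    case (Suc k)
    show ?case
    proof (cases "Suc k < m")
      case True
      then show ?thesis by (rule low)
    next
      \<comment> \<open>From order \<open>m\<close> on, the two sides are derivatives of functions that agree by induction.\<close>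
      case False
      have "(pair k \<psi> has_vector_derivative pair (Suc k) \<psi> t) (at t within {0..})"
        using Suc.prems by (intro pair_derivative tests_L2 assms(1))
      moreover have "(H k \<psi> has_vector_derivative H (Suc k) \<psi> t) (at t within {0..})"
        using Suc.prems by (intro H_derivative assms(1))
      then have "(pair k \<psi> has_vector_derivative H (Suc k) \<psi> t) (at t within {0..})"
        using Suc by (subst has_vector_derivative_cong_Ici [of _ "H k \<psi>"]) auto
      ultimately show ?thesis
        using Suc.prems by (intro vector_derivative_unique_within [OF at_within_Ici_neq_bot]) auto
    qed
  qed
qed

lemma test_box_bound:
  obtains M where "0 < M" "\<And>\<xi>. \<xi> \<in> test_box \<Longrightarrow> 1 + (\<Sum>i<m. cmod (A i \<xi>)) \<le> M"
proof -
  have c: "compact test_box" unfolding test_box_def by (rule compact_cbox)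
  show thesis by (rule A_bound_on_compact [OF c]) (rule that)
qed

text \<open>
  On the support of \<open>\<psi>\<close> the coefficients \<open>A k\<close> are bounded, and the
  companion coefficients grow geometrically.
\<close>

lemma H_bound:
  assumes \<psi>: "\<psi> \<in> tests"
  obtains V M where "0 \<le> V" "0 < M" "\<And>n s. 0 \<le> s \<Longrightarrow> s \<le> t \<Longrightarrow> cmod (H n \<psi> s) \<le> V * M ^ n"
proof -
  obtain M where M: "0 < M" "\<And>\<xi>. \<xi> \<in> test_box \<Longrightarrow> 1 + (\<Sum>i<m. cmod (A i \<xi>)) \<le> M"
    by (rule test_box_bound) (rule that)
  have "\<exists>V>0. \<forall>s. 0 \<le> s \<and> s \<le> t \<longrightarrow> L2_norm (u_hat j s) \<le> V" if "j < m" for j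
  proof -
    have "real j \<le> s0" using s0 that by auto
    then obtain V where "0 < V" "\<And>s. 0 \<le> s \<Longrightarrow> s \<le> t \<Longrightarrow> L2_norm (u_hat j s) \<le> V"
      by (rule L2_norm_u_hat_bounded) (rule that)
    then show ?thesis by (intro exI [of _ V]) simp
  qed
  then obtain V where V: "\<And>j. j < m \<Longrightarrow> 0 < V j" "\<And>j s. j < m \<Longrightarrow> 0 \<le> s \<Longrightarrow> s \<le> t \<Longrightarrow> L2_norm (u_hat j s) \<le> V j"
    by metis
  have L: "L2_norm (\<lambda>\<xi>. companion (\<lambda>k. A k \<xi>) m n j * \<psi> \<xi>) \<le> M ^ n * L2_norm \<psi>" if "j < m" for n j
  proof (rule L2_norm_dominated [OF tests_L2 [OF \<psi>]])
    show "(\<lambda>\<xi>. companion (\<lambda>k. A k \<xi>) m n j * \<psi> \<xi>) \<in> borel_measurable lborel"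
      using tests_L2 [OF tests_companion [OF \<psi>]] by (simp add: is_L2_def)
    show "AE \<xi> in lborel. cmod (companion (\<lambda>k. A k \<xi>) m n j * \<psi> \<xi>) \<le> M ^ n * cmod (\<psi> \<xi>)"
    proof (rule AE_I2)
      fix \<xi>
      show "cmod (companion (\<lambda>k. A k \<xi>) m n j * \<psi> \<xi>) \<le> M ^ n * cmod (\<psi> \<xi>)"
      proof (cases "\<xi> \<in> test_box")
        case True
        have "cmod (companion (\<lambda>k. A k \<xi>) m n j) \<le> (1 + (\<Sum>i<m. cmod (A i \<xi>))) ^ n"
          by (rule companion_bound [OF that])
        also have "\<dots> \<le> M ^ n"
          by (intro power_mono M(2) True add_nonneg_nonneg sum_nonneg) auto
        finally show ?thesis unfolding norm_mult by (intro mult_right_mono) auto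
      qed (simp add: tests_outside [OF \<psi>])
    qed
  qed (use M in simp)
  have "cmod (H n \<psi> s) \<le> (\<Sum>j<m. V j * L2_norm \<psi>) * M ^ n" if s: "0 \<le> s" "s \<le> t" for n s
  proof -
    have "cmod (H n \<psi> s) \<le> (\<Sum>j<m. V j * (M ^ n * L2_norm \<psi>))"
      unfolding H_def
    proof (rule order_trans [OF norm_sum sum_mono])
      fix j assume "j \<in> {..<m}"
      then have j: "j < m" by simp
      then have js: "real j \<le> s0" using s0 by auto
      have "cmod (pair j (\<lambda>\<xi>. companion (\<lambda>k. A k \<xi>) m n j * \<psi> \<xi>) s)
          \<le> L2_norm (u_hat j s) * L2_norm (\<lambda>\<xi>. companion (\<lambda>k. A k \<xi>) m n j * \<psi> \<xi>)"
        unfolding pair_def by (intro is_L2_mult(2) u_hat_facts(2) js s tests_L2 tests_companion \<psi>)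
      also have "\<dots> \<le> V j * (M ^ n * L2_norm \<psi>)"
        using V(1) [OF j] by (intro mult_mono V(2) j s L) auto
      finally show "cmod (pair j (\<lambda>\<xi>. companion (\<lambda>k. A k \<xi>) m n j * \<psi> \<xi>) s) \<le> V j * (M ^ n * L2_norm \<psi>)" .
    qed
    then show ?thesis unfolding sum_distrib_right by (simp only: mult_ac)
  qed
  moreover have "0 \<le> (\<Sum>j<m. V j * L2_norm \<psi>)" using V(1) by (intro sum_nonneg mult_nonneg_nonneg) (auto simp: less_imp_le)
  ultimately show thesis using that M(1) by blast
qed

text \<open>
  Geometric growth of the derivatives makes the integral remainder of order \<open>(t M)\<^sup>N /
  N!\<close>.
\<close>

lemma H_taylor:
  assumes \<psi>: "\<psi> \<in> tests" and t: "0 \<le> t"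
  shows "(\<lambda>N. \<Sum>i<Suc N. (t ^ i / fact i) *\<^sub>R H (k + i) \<psi> 0) \<longlonglongrightarrow> H k \<psi> t"
proof -
  obtain V M where V: "0 \<le> V" and M: "0 < M" and bd: "\<And>n s. 0 \<le> s \<Longrightarrow> s \<le> t \<Longrightarrow> cmod (H n \<psi> s) \<le> V * M ^ n"
    using H_bound [OF \<psi>] by blast
  have d: "(H n \<psi> has_vector_derivative H (Suc n) \<psi> s) (at s within {0..t})" if "0 \<le> s" for n s
    by (rule has_vector_derivative_within_subset [OF H_derivative [OF \<psi> that]]) auto
  have cont: "continuous_on {0..t} (H n \<psi>)" for n
    by (rule continuous_on_vector_derivative) (use d in auto)
  define R where "R N = integral {0..t} (\<lambda>x. ((t - x) ^ (Suc N - 1) / fact (Suc N - 1)) *\<^sub>R H (k + Suc N) \<psi> x)" for N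
  have taylor: "H k \<psi> t = (\<Sum>i<Suc N. ((t - 0) ^ i / fact i) *\<^sub>R H (k + i) \<psi> 0) + R N" for N
    unfolding R_def
    by (rule Taylor_integral [of "Suc N" "\<lambda>n. H (k + n) \<psi>"]) (use t d in auto)
  have "cmod (R N) \<le> V * M ^ (k + 1) * t * ((t * M) ^ N /\<^sub>R fact N)" for N
  proof -
    have "cmod (R N) \<le> (t ^ N / fact N * (V * M ^ (k + Suc N))) * (t - 0)"
      unfolding R_def
    proof (rule integral_bound [OF t])
      show "continuous_on {0..t} (\<lambda>x. ((t - x) ^ (Suc N - 1) / fact (Suc N - 1)) *\<^sub>R H (k + Suc N) \<psi> x)"
        by (intro continuous_intros cont) auto
      fix x assume x: "x \<in> {0..t}"
      have "(t - x) ^ N / fact N \<le> t ^ N / fact N" using x by (intro divide_right_mono power_mono) auto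
      then show "norm (((t - x) ^ (Suc N - 1) / fact (Suc N - 1)) *\<^sub>R H (k + Suc N) \<psi> x)
          \<le> t ^ N / fact N * (V * M ^ (k + Suc N))"
        using x bd [of x "k + Suc N"] t unfolding norm_scaleR by (intro mult_mono) auto
    qed
    also have "\<dots> = V * M ^ (k + 1) * t * ((t * M) ^ N /\<^sub>R fact N)"
      by (simp add: power_add power_mult_distrib divide_inverse)
    finally show ?thesis .
  qed
  moreover have "(\<lambda>N. V * M ^ (k + 1) * t * ((t * M) ^ N /\<^sub>R fact N)) \<longlonglongrightarrow> V * M ^ (k + 1) * t * 0"
    by (intro tendsto_mult tendsto_const summable_LIMSEQ_zero summable_exp_generic)
  ultimately have "R \<longlonglongrightarrow> 0"
    by (intro Lim_null_comparison [of R "\<lambda>N. V * M ^ (k + 1) * t * ((t * M) ^ N /\<^sub>R fact N)"]) (auto intro: always_eventually)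
  then have "(\<lambda>N. H k \<psi> t - R N) \<longlonglongrightarrow> H k \<psi> t - 0" by (intro tendsto_intros)
  moreover have "H k \<psi> t - R N = (\<Sum>i<Suc N. (t ^ i / fact i) *\<^sub>R H (k + i) \<psi> 0)" for N
    using taylor [of N] by simp
  ultimately show ?thesis by simp
qed

text \<open>
  At time 0 the Taylor series of the pairing is the series of the fundamental solution, paired with the
  initial values; dominated convergence moves the sum into the integral.
\<close>

lemma pair_cauchy_solution:
  assumes \<psi>: "\<psi> \<in> tests" and k: "real k \<le> s0" and t: "0 \<le> t"
  shows "pair k \<psi> t = (LINT \<xi>|lborel. cauchy_solution_at (\<lambda>j. A j \<xi>) m (\<lambda>j. u_hat j 0 \<xi>) k t * \<psi> \<xi>)"
proof -
  obtain M where M: "0 < M" "\<And>\<xi>. \<xi> \<in> test_box \<Longrightarrow> 1 + (\<Sum>i<m. cmod (A i \<xi>)) \<le> M"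
    by (rule test_box_bound) (rule that)
  let ?S = "\<lambda>N j \<xi>. \<Sum>n<N. companion (\<lambda>i. A i \<xi>) m (n + k) j / fact n * complex_of_real t ^ n"
  let ?E = "\<lambda>j \<xi>. fundamental_solution (\<lambda>i. A i \<xi>) m k j t"
  let ?C = "M ^ k * exp (M * t)"
  have js: "real j \<le> s0" if "j < m" for j using s0 that by auto
  have [measurable]: "u_hat j 0 \<in> borel_measurable borel" if "j < m" for j by (rule u_hat_facts(3) [OF js [OF that]]) simp
  have [measurable]: "\<psi> \<in> borel_measurable borel" using tests_L2 [OF \<psi>] by (simp add: is_L2_def)
  have [measurable]: "(\<lambda>\<xi>. companion (\<lambda>k. A k \<xi>) m n j) \<in> borel_measurable borel" for n j
    by (rule borel_measurable_continuous_onI [OF companion_A_continuous])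
  have dom: "integrable lborel (\<lambda>\<xi>. ?C * cmod (u_hat j 0 \<xi> * \<psi> \<xi>))" if "j < m" for j
    by (intro integrable_mult_right integrable_norm is_L2_mult(1) u_hat_facts(2) js that tests_L2 \<psi>) simp
  have dominated: "cmod (u_hat j 0 \<xi> * (X * \<psi> \<xi>)) \<le> ?C * cmod (u_hat j 0 \<xi> * \<psi> \<xi>)"
    if "\<xi> \<in> test_box \<Longrightarrow> cmod X \<le> ?C" for X j \<xi>
  proof (cases "\<xi> \<in> test_box")
    case True
    then have "cmod X * cmod (u_hat j 0 \<xi> * \<psi> \<xi>) \<le> ?C * cmod (u_hat j 0 \<xi> * \<psi> \<xi>)"
      using that by (intro mult_right_mono) auto
    then show ?thesis by (simp add: norm_mult mult_ac)
  qed (simp add: tests_outside [OF \<psi>])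
  have intE: "integrable lborel (\<lambda>\<xi>. u_hat j 0 \<xi> * (?E j \<xi> * \<psi> \<xi>))" if j: "j < m" for j
  proof (rule Bochner_Integration.integrable_bound [OF dom [OF j]])
    show "(\<lambda>\<xi>. u_hat j 0 \<xi> * (?E j \<xi> * \<psi> \<xi>)) \<in> borel_measurable lborel" using j by measurable
    show "AE \<xi> in lborel. norm (u_hat j 0 \<xi> * (?E j \<xi> * \<psi> \<xi>)) \<le> norm (?C * cmod (u_hat j 0 \<xi> * \<psi> \<xi>))"
    proof (rule AE_I2)
      fix \<xi>
      have "norm (u_hat j 0 \<xi> * (?E j \<xi> * \<psi> \<xi>)) \<le> ?C * cmod (u_hat j 0 \<xi> * \<psi> \<xi>)"
        by (rule dominated) (rule fundamental_solution_bound [OF j t M(2)])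
      then show "norm (u_hat j 0 \<xi> * (?E j \<xi> * \<psi> \<xi>)) \<le> norm (?C * cmod (u_hat j 0 \<xi> * \<psi> \<xi>))" by simp
    qed
  qed
  have lim: "(\<lambda>N. pair j (\<lambda>\<xi>. ?S N j \<xi> * \<psi> \<xi>) 0) \<longlonglongrightarrow> (LINT \<xi>|lborel. u_hat j 0 \<xi> * (?E j \<xi> * \<psi> \<xi>))" if j: "j < m" for j
    unfolding pair_def
  proof (rule integral_dominated_convergence [OF _ _ dom [OF j]])
    show "(\<lambda>\<xi>. u_hat j 0 \<xi> * (?E j \<xi> * \<psi> \<xi>)) \<in> borel_measurable lborel" using j by measurable
    show "(\<lambda>\<xi>. u_hat j 0 \<xi> * (?S N j \<xi> * \<psi> \<xi>)) \<in> borel_measurable lborel" for N using j by measurable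
    show "AE \<xi> in lborel. (\<lambda>N. u_hat j 0 \<xi> * (?S N j \<xi> * \<psi> \<xi>)) \<longlonglongrightarrow> u_hat j 0 \<xi> * (?E j \<xi> * \<psi> \<xi>)"
      by (intro AE_I2 tendsto_mult tendsto_const fundamental_solution_LIMSEQ j)
    show "AE \<xi> in lborel. norm (u_hat j 0 \<xi> * (?S N j \<xi> * \<psi> \<xi>)) \<le> ?C * cmod (u_hat j 0 \<xi> * \<psi> \<xi>)" for N
    proof (rule AE_I2)
      fix \<xi>
      show "norm (u_hat j 0 \<xi> * (?S N j \<xi> * \<psi> \<xi>)) \<le> ?C * cmod (u_hat j 0 \<xi> * \<psi> \<xi>)"
        by (rule dominated) (rule companion_partial_sum_bound [OF j t M(2)])
    qed
  qed
  have partial: "(\<Sum>j<m. pair j (\<lambda>\<xi>. ?S N j \<xi> * \<psi> \<xi>) 0) = (\<Sum>i<N. (t ^ i / fact i) *\<^sub>R H (k + i) \<psi> 0)" for N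
  proof -
    have "pair j (\<lambda>\<xi>. ?S N j \<xi> * \<psi> \<xi>) 0
      = (\<Sum>i<N. (t ^ i / fact i) *\<^sub>R pair j (\<lambda>\<xi>. companion (\<lambda>i. A i \<xi>) m (k + i) j * \<psi> \<xi>) 0)" if j: "j < m" for j
    proof -
      have "(\<lambda>\<xi>. ?S N j \<xi> * \<psi> \<xi>)
        = (\<lambda>\<xi>. \<Sum>i<N. complex_of_real (t ^ i / fact i) * (companion (\<lambda>i. A i \<xi>) m (k + i) j * \<psi> \<xi>))"
        unfolding sum_distrib_right by (intro ext sum.cong refl) (simp add: add.commute)
      then have "pair j (\<lambda>\<xi>. ?S N j \<xi> * \<psi> \<xi>) 0
        = (\<Sum>i<N. pair j (\<lambda>\<xi>. complex_of_real (t ^ i / fact i) * (companion (\<lambda>i. A i \<xi>) m (k + i) j * \<psi> \<xi>)) 0)"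
        using pair_sum [OF js [OF j] order_refl, of "{..<N}"
            "\<lambda>i \<xi>. complex_of_real (t ^ i / fact i) * (companion (\<lambda>i. A i \<xi>) m (k + i) j * \<psi> \<xi>)"]
        by (simp only: tests.scale tests_companion [OF \<psi>])
      then show ?thesis by (simp only: pair_scale scaleR_conv_of_real)
    qed
    then have "(\<Sum>j<m. pair j (\<lambda>\<xi>. ?S N j \<xi> * \<psi> \<xi>) 0)
      = (\<Sum>j<m. \<Sum>i<N. (t ^ i / fact i) *\<^sub>R pair j (\<lambda>\<xi>. companion (\<lambda>i. A i \<xi>) m (k + i) j * \<psi> \<xi>) 0)"
      by (intro sum.cong) auto
    also have "\<dots> = (\<Sum>i<N. \<Sum>j<m. (t ^ i / fact i) *\<^sub>R pair j (\<lambda>\<xi>. companion (\<lambda>i. A i \<xi>) m (k + i) j * \<psi> \<xi>) 0)"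
      by (rule sum.swap)
    finally show ?thesis by (simp add: H_def scaleR_sum_right)
  qed
  have "(\<lambda>N. \<Sum>j<m. pair j (\<lambda>\<xi>. ?S (Suc N) j \<xi> * \<psi> \<xi>) 0) \<longlonglongrightarrow> (\<Sum>j<m. (LINT \<xi>|lborel. u_hat j 0 \<xi> * (?E j \<xi> * \<psi> \<xi>)))"
    by (intro tendsto_sum LIMSEQ_Suc [OF lim]) simp
  then have "(\<lambda>N. \<Sum>i<Suc N. (t ^ i / fact i) *\<^sub>R H (k + i) \<psi> 0) \<longlonglongrightarrow> (\<Sum>j<m. (LINT \<xi>|lborel. u_hat j 0 \<xi> * (?E j \<xi> * \<psi> \<xi>)))"
    unfolding partial .
  then have "H k \<psi> t = (\<Sum>j<m. (LINT \<xi>|lborel. u_hat j 0 \<xi> * (?E j \<xi> * \<psi> \<xi>)))"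
    using H_taylor [OF \<psi> t] LIMSEQ_unique by blast
  also have "\<dots> = (LINT \<xi>|lborel. (\<Sum>j<m. u_hat j 0 \<xi> * (?E j \<xi> * \<psi> \<xi>)))"
    using intE by (intro Bochner_Integration.integral_sum [symmetric]) auto
  also have "\<dots> = (LINT \<xi>|lborel. cauchy_solution_at (\<lambda>j. A j \<xi>) m (\<lambda>j. u_hat j 0 \<xi>) k t * \<psi> \<xi>)"
    unfolding cauchy_solution_at_def sum_distrib_right by (simp only: mult_ac)
  finally show ?thesis using pair_eq_H [OF \<psi> k t] by simp
qed

end

section \<open>Norms of the solution\<close>

lemma is_L2_zero: "is_L2 (\<lambda>x. 0)"
  by (simp add: is_L2_def)

lemma is_L2_sum: "(\<And>i. i \<in> I \<Longrightarrow> is_L2 (f i)) \<Longrightarrow> is_L2 (\<lambda>x. \<Sum>i\<in>I. f i x)"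
  by (induction I rule: infinite_finite_induct) (auto simp: is_L2_zero intro!: is_L2_add)

lemma L2_norm_sum_le:
  "(\<And>i. i \<in> I \<Longrightarrow> is_L2 (f i)) \<Longrightarrow> L2_norm (\<lambda>x. \<Sum>i\<in>I. f i x) \<le> (\<Sum>i\<in>I. L2_norm (f i))"
proof (induction I rule: infinite_finite_induct)
  case (insert i I)
  have "L2_norm (\<lambda>x. \<Sum>i\<in>insert i I. f i x) = L2_norm (\<lambda>x. f i x + (\<Sum>i\<in>I. f i x))"
    using insert by simp
  also have "\<dots> \<le> L2_norm (f i) + L2_norm (\<lambda>x. \<Sum>i\<in>I. f i x)"
    using insert.prems by (intro L2_norm_triangle is_L2_sum) auto
  also have "\<dots> \<le> L2_norm (f i) + (\<Sum>i\<in>I. L2_norm (f i))"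
    using insert by (intro add_left_mono) auto
  finally show ?case using insert by simp
qed (simp_all add: L2_norm_def)

lemma is_L2_indicator_box:
  fixes a b :: "real ^ 'n::finite"
  shows "is_L2 (\<lambda>\<xi>. complex_of_real (indicator (box a b) \<xi>))"
proof -
  have "(\<lambda>\<xi>. (cmod (complex_of_real (indicator (box a b) \<xi>)))\<^sup>2) = indicator (box a b)"
    by (auto simp: indicator_def)
  moreover have "integrable lborel (indicator (box a b) :: real ^ 'n \<Rightarrow> real)"
    by (rule integrable_real_indicator) (use emeasure_lborel_box_finite in auto)
  ultimately show ?thesis by (simp add: is_L2_def)
qed

lemma has_fourier_AE_cong:
  assumes f: "has_fourier f g" and h: "is_L2 h" and ae: "AE x in lborel. h x = f x"
  shows "has_fourier h g"
proof -
  have [measurable]: "f \<in> borel_measurable lborel" "h \<in> borel_measurable lborel"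
    using f h by (auto simp: has_fourier_def is_L2_def)
  have "fourier_integral (\<lambda>x. indicator (cball 0 R) x * h x) \<xi> = fourier_integral (\<lambda>x. indicator (cball 0 R) x * f x) \<xi>"
    for R \<xi>
    unfolding fourier_integral_def
  proof (rule integral_cong_AE)
    have fi: "integrable lborel (\<lambda>x. indicator (cball 0 R) x * f x)" "integrable lborel (\<lambda>x. indicator (cball 0 R) x * h x)"
      using f h by (auto intro!: truncation_integrable simp: has_fourier_def)
    show "(\<lambda>x. exp (- \<i> * complex_of_real (x \<bullet> \<xi>)) * (indicator (cball 0 R) x * h x)) \<in> borel_measurable lborel"
      "(\<lambda>x. exp (- \<i> * complex_of_real (x \<bullet> \<xi>)) * (indicator (cball 0 R) x * f x)) \<in> borel_measurable lborel"
      using fourier_kernel_integrable [OF fi(1), of \<xi>] fourier_kernel_integrable [OF fi(2), of \<xi>] by (simp_all only: borel_measurable_integrable)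
    show "AE x in lborel. exp (- \<i> * complex_of_real (x \<bullet> \<xi>)) * (indicator (cball 0 R) x * h x)
        = exp (- \<i> * complex_of_real (x \<bullet> \<xi>)) * (indicator (cball 0 R) x * f x)"
      using ae by eventually_elim simp
  qed
  then show ?thesis using f h by (simp add: has_fourier_def)
qed

context cauchy_problem
begin

lemma cauchy_solution_local_L2:
  assumes t: "0 \<le> t" and K: "compact K"
  shows "is_L2 (\<lambda>\<xi>. indicator K \<xi> * cauchy_solution_at (\<lambda>j. A j \<xi>) m (\<lambda>j. u_hat j 0 \<xi>) k t)"
proof -
  obtain M where M: "0 < M" "\<And>\<xi>. \<xi> \<in> K \<Longrightarrow> 1 + (\<Sum>i<m. cmod (A i \<xi>)) \<le> M"
    by (rule A_bound_on_compact [OF K]) (rule that)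
  have [measurable]: "K \<in> sets borel" using K by (simp add: borel_compact)
  have "is_L2 (\<lambda>\<xi>. indicator K \<xi> * (fundamental_solution (\<lambda>i. A i \<xi>) m k j t * u_hat j 0 \<xi>))" if j: "j < m" for j
  proof -
    have js: "real j \<le> s0" using j s0 by auto
    have [measurable]: "u_hat j 0 \<in> borel_measurable borel" by (rule u_hat_facts(3) [OF js]) simp
    show ?thesis
    proof (rule is_L2_dominated [OF u_hat_facts(2) [OF js order_refl]])
      show "(\<lambda>\<xi>. indicator K \<xi> * (fundamental_solution (\<lambda>i. A i \<xi>) m k j t * u_hat j 0 \<xi>)) \<in> borel_measurable lborel"
        by measurable
      show "AE \<xi> in lborel. cmod (indicator K \<xi> * (fundamental_solution (\<lambda>i. A i \<xi>) m k j t * u_hat j 0 \<xi>))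
          \<le> M ^ k * exp (M * t) * cmod (u_hat j 0 \<xi>)"
      proof (rule AE_I2)
        fix \<xi>
        show "cmod (indicator K \<xi> * (fundamental_solution (\<lambda>i. A i \<xi>) m k j t * u_hat j 0 \<xi>))
          \<le> M ^ k * exp (M * t) * cmod (u_hat j 0 \<xi>)"
        proof (cases "\<xi> \<in> K")
          case True
          then show ?thesis
            using mult_right_mono [OF fundamental_solution_bound [OF j t M(2) [OF True]], of "cmod (u_hat j 0 \<xi>)"]
            by (simp add: norm_mult)
        qed (use M(1) in simp)
      qed
    qed
  qed
  then have "is_L2 (\<lambda>\<xi>. \<Sum>j\<in>{..<m}. indicator K \<xi> * (fundamental_solution (\<lambda>i. A i \<xi>) m k j t * u_hat j 0 \<xi>))"
    by (intro is_L2_sum) simp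
  then show ?thesis by (simp add: cauchy_solution_at_def sum_distrib_left)
qed

text \<open>
  Both sides have the same integrals against all products of bumps.
\<close>

lemma u_hat_eq_cauchy_solution:
  assumes k: "real k \<le> s0" and t: "0 \<le> t"
  shows "AE \<xi> in lborel. u_hat k t \<xi> = cauchy_solution_at (\<lambda>j. A j \<xi>) m (\<lambda>j. u_hat j 0 \<xi>) k t"
proof -
  define cs where "cs \<xi> = cauchy_solution_at (\<lambda>j. A j \<xi>) m (\<lambda>j. u_hat j 0 \<xi>) k t" for \<xi>
  have csK: "is_L2 (\<lambda>\<xi>. indicator (cbox a b) \<xi> * cs \<xi>)" for a b
    unfolding cs_def by (rule cauchy_solution_local_L2 [OF t compact_cbox])
  have cs\<psi>: "integrable lborel (\<lambda>\<xi>. cs \<xi> * \<psi> \<xi>)"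
    if "is_L2 \<psi>" "\<And>\<xi>. \<xi> \<notin> cbox a b \<Longrightarrow> \<psi> \<xi> = 0" for \<psi> a b
  proof -
    have "integrable lborel (\<lambda>\<xi>. indicator (cbox a b) \<xi> * cs \<xi> * \<psi> \<xi>)" by (rule is_L2_mult(1) [OF csK that(1)])
    moreover have "(\<lambda>\<xi>. indicator (cbox a b) \<xi> * cs \<xi> * \<psi> \<xi>) = (\<lambda>\<xi>. cs \<xi> * \<psi> \<xi>)"
      using that(2) by (auto simp: fun_eq_iff indicator_def)
    ultimately show ?thesis by simp
  qed
  have "AE \<xi> in lborel. u_hat k t \<xi> - cs \<xi> = 0"
  proof (rule tensor_bumps_separate)
    fix a b :: "real ^ 'n"
    have "integrable lborel (\<lambda>\<xi>. u_hat k t \<xi> * complex_of_real (indicator (box a b) \<xi>)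
        - cs \<xi> * complex_of_real (indicator (box a b) \<xi>))"
      by (intro Bochner_Integration.integrable_diff is_L2_mult(1) u_hat_facts(2) k t is_L2_indicator_box cs\<psi> [of _ a b])
        (use box_subset_cbox in \<open>auto simp: indicator_def\<close>)
    then show "integrable lborel (\<lambda>\<xi>. indicator (box a b) \<xi> *\<^sub>R (u_hat k t \<xi> - cs \<xi>))"
      by (simp add: scaleR_conv_of_real algebra_simps)
  next
    fix \<epsilon> :: real and a b :: "'n \<Rightarrow> real"
    assume e: "0 < \<epsilon>" and ab: "\<And>i. a i < b i"
    interpret cauchy_problem_tests m Pm Pm1 Pm2 s0 u0 u U \<epsilon> a b
      by unfold_locales (use e ab in auto)
    let ?\<psi> = "tensor (\<lambda>i. bump \<epsilon> (a i) (b i) 1 0)"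
    have \<psi>: "?\<psi> \<in> tests" by (rule tests.tensor) (simp add: bump_family_def bump_in_bumps)
    have out: "?\<psi> \<xi> = 0" if "\<xi> \<notin> cbox (\<chi> i. a i) (\<chi> i. b i)" for \<xi>
      using tests_outside [OF \<psi>] that unfolding test_box_def by blast
    have "(LINT \<xi>|lborel. (u_hat k t \<xi> - cs \<xi>) * ?\<psi> \<xi>) = (LINT \<xi>|lborel. u_hat k t \<xi> * ?\<psi> \<xi>) - (LINT \<xi>|lborel. cs \<xi> * ?\<psi> \<xi>)"
      unfolding left_diff_distrib
      by (intro Bochner_Integration.integral_diff is_L2_mult(1) u_hat_facts(2) k t tests_L2 \<psi> cs\<psi> out)
    then show "(LINT \<xi>|lborel. (u_hat k t \<xi> - cs \<xi>) * ?\<psi> \<xi>) = 0"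
      using pair_cauchy_solution [OF \<psi> k t] by (simp add: pair_def cs_def)
  qed
  then show ?thesis by eventually_elim (simp add: cs_def)
qed

lemma initial_fourier:
  assumes adm: "admissible_data m s0 N u0" and j: "j < m"
  shows "AE \<xi> in lborel. u_hat j 0 \<xi> = fourier (u0 j) \<xi>"
proof -
  have js: "real j \<le> s0" using j s0 by auto
  have "has_fourier (u0 j) (fourier (u0 j))"
    using adm j by (simp add: admissible_data_def sobolev_space_def)
  moreover have "is_L2 (U j 0)" using u_hat_facts(1) [OF js order_refl] by (simp add: has_fourier_def)
  moreover have "AE x in lborel. U j 0 x = u0 j x" using sol j by (simp add: cauchy_solution_def)
  ultimately have "has_fourier (U j 0) (fourier (u0 j))" by (rule has_fourier_AE_cong)
  then show ?thesis unfolding u_hat_def by (rule has_fourier_fourier(2))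
qed

text \<open>
  Frequencies below \<open>\<delta>\<close> contribute nothing because the data, and with them the
  solution, vanish there. The estimate for the other frequencies is integrated as it stands.
\<close>

lemma hom_norm_estimate:
  assumes adm: "admissible_data m s0 N u0" and N: "ball 0 \<delta> \<subseteq> N"
    and s: "0 \<le> s" and \<nu>: "0 \<le> \<nu>" "real k + s + \<nu> \<le> s0" and t: "0 \<le> t" and D: "0 \<le> D"
    and pointwise: "\<And>\<xi> d. \<delta> \<le> norm \<xi> \<Longrightarrow> norm \<xi> powr s * cmod (cauchy_solution_at (\<lambda>j. A j \<xi>) m d k t)
      \<le> D * (\<Sum>j<m. bessel_weight (real k + s + \<nu> - real j) \<xi> * cmod (d j))"
  shows "U k t \<in> hom_sobolev_space s \<and>
    hom_sobolev_norm s (U k t) \<le> D * (\<Sum>j<m. sobolev_norm (real k + s + \<nu> - real j) (u0 j))"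
proof -
  have k: "real k \<le> s0" using s \<nu> by linarith
  have [measurable]: "fourier (U k t) \<in> borel_measurable borel"
    using u_hat_facts(3) [OF k t] by (simp add: u_hat_def)
  have wm: "hom_sobolev_weighted s (U k t) \<in> borel_measurable lborel"
    unfolding hom_sobolev_weighted_def [abs_def] by measurable
  let ?\<sigma> = "\<lambda>j. real k + s + \<nu> - real j"
  define f where "f j \<xi> = complex_of_real (cmod (sobolev_weighted (?\<sigma> j) (u0 j) \<xi>))" for j \<xi>
  have f: "is_L2 (f j)" and fn: "L2_norm (f j) = sobolev_norm (?\<sigma> j) (u0 j)" if "j < m" for j
  proof -
    have "u0 j \<in> sobolev_space (s0 - real j)" using adm that by (simp add: admissible_data_def)
    from sobolev_spaceD(4) [OF this, of "?\<sigma> j"] \<nu>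
    have "is_L2 (sobolev_weighted (?\<sigma> j) (u0 j))"
      by (simp add: sobolev_weighted_def [abs_def] bessel_weight_def)
    note w = this
    then have [measurable]: "sobolev_weighted (?\<sigma> j) (u0 j) \<in> borel_measurable borel" by (simp add: is_L2_def)
    have "f j \<in> borel_measurable lborel" unfolding f_def [abs_def] by measurable
    then show "is_L2 (f j)" using w by (simp add: is_L2_def f_def)
    show "L2_norm (f j) = sobolev_norm (?\<sigma> j) (u0 j)" by (simp add: L2_norm_def f_def sobolev_norm_def)
  qed
  define F where "F \<xi> = (\<Sum>j<m. f j \<xi>)" for \<xi>
  have FL2: "is_L2 F" unfolding F_def [abs_def] using f by (intro is_L2_sum) auto
  have "AE \<xi> in lborel. \<forall>j\<in>{..<m}. u_hat j 0 \<xi> = fourier (u0 j) \<xi>"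
    by (intro AE_finite_allI) (use initial_fourier [OF adm] in auto)
  moreover have "AE \<xi> in lborel. \<forall>j\<in>{..<m}. \<xi> \<in> N \<longrightarrow> fourier (u0 j) \<xi> = 0"
    by (intro AE_finite_allI) (use adm in \<open>auto simp: admissible_data_def\<close>)
  ultimately have le: "AE \<xi> in lborel. cmod (hom_sobolev_weighted s (U k t) \<xi>) \<le> D * cmod (F \<xi>)"
    using u_hat_eq_cauchy_solution [OF k t]
  proof eventually_elim
    case (elim \<xi>)
    have w: "cmod (hom_sobolev_weighted s (U k t) \<xi>)
        = norm \<xi> powr s * cmod (cauchy_solution_at (\<lambda>j. A j \<xi>) m (\<lambda>j. u_hat j 0 \<xi>) k t)"
      using elim(3) by (simp add: hom_sobolev_weighted_def u_hat_def norm_mult)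
    show ?case
    proof (cases "\<delta> \<le> norm \<xi>")
      case True
      have "F \<xi> = complex_of_real (\<Sum>j<m. bessel_weight (?\<sigma> j) \<xi> * cmod (u_hat j 0 \<xi>))"
        unfolding F_def f_def of_real_sum
        using elim(1) by (intro sum.cong) (auto simp: sobolev_weighted_def norm_mult bessel_weight_def)
      moreover have "0 \<le> (\<Sum>j<m. bessel_weight (?\<sigma> j) \<xi> * cmod (u_hat j 0 \<xi>))"
        by (intro sum_nonneg mult_nonneg_nonneg less_imp_le [OF bessel_weight_pos]) auto
      ultimately have "cmod (F \<xi>) = (\<Sum>j<m. bessel_weight (?\<sigma> j) \<xi> * cmod (u_hat j 0 \<xi>))"
        by (simp only: norm_of_real abs_of_nonneg)
      then show ?thesis unfolding w using pointwise [OF True, of "\<lambda>j. u_hat j 0 \<xi>"] by simp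
    next
      case False
      then have "\<xi> \<in> N" using N by auto
      then have "u_hat j 0 \<xi> = 0" if "j < m" for j using elim(1,2) that by auto
      then have "cauchy_solution_at (\<lambda>j. A j \<xi>) m (\<lambda>j. u_hat j 0 \<xi>) k t = 0"
        by (simp add: cauchy_solution_at_def)
      then show ?thesis unfolding w using D by simp
    qed
  qed
  have "is_L2 (hom_sobolev_weighted s (U k t))" by (rule is_L2_dominated [OF FL2 wm le])
  then have mem: "U k t \<in> hom_sobolev_space s"
    using u_hat_facts(1) [OF k t] by (simp add: hom_sobolev_space_def u_hat_def)
  have "hom_sobolev_norm s (U k t) \<le> D * L2_norm F"
    unfolding hom_sobolev_norm_def by (rule L2_norm_dominated [OF FL2 wm D le])
  also have "\<dots> \<le> D * (\<Sum>j\<in>{..<m}. L2_norm (f j))"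
    unfolding F_def [abs_def] using f by (intro mult_left_mono L2_norm_sum_le D) auto
  also have "\<dots> = D * (\<Sum>j<m. sobolev_norm (?\<sigma> j) (u0 j))"
    by (simp add: fn)
  finally show ?thesis using mem by simp
qed

end

section \<open>From pointwise decay to norms\<close>

lemma exp_polynomial_decay:
  fixes a c :: real
  assumes "0 < c" "0 \<le> a"
  obtains C where "0 < C" "\<And>x. 0 \<le> x \<Longrightarrow> (1 + x) powr a * exp (- c * x) \<le> C"
proof -
  define n where "n = nat \<lceil>a\<rceil>"
  have an: "a \<le> real n" unfolding n_def by (simp add: real_nat_ceiling_ge)
  show thesis
  proof (rule that [of "fact n * exp c / c ^ n"])
    show "0 < fact n * exp c / c ^ n" using assms by simp
    fix x :: real assume x: "0 \<le> x"
    have "(1 + x) powr a \<le> (1 + x) powr real n" using an x by (intro powr_mono) auto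
    also have "\<dots> = (1 + x) ^ n" using x by (simp add: powr_realpow)
    finally have 1: "(1 + x) powr a * exp (- c * x) \<le> (1 + x) ^ n * exp (- c * x)" by (intro mult_right_mono) auto
    have "(c * (1 + x)) ^ n / fact n \<le> exp (c * (1 + x))" using assms x by (intro power_le_fact_exp) auto
    then have "(1 + x) ^ n * c ^ n \<le> fact n * (exp c * exp (c * x))"
      unfolding power_mult_distrib by (simp add: divide_le_eq mult.commute distrib_left exp_add)
    then have "(1 + x) ^ n * c ^ n * exp (- c * x) \<le> fact n * (exp c * exp (c * x)) * exp (- c * x)"
      by (intro mult_right_mono) auto
    also have "\<dots> = fact n * exp c" by (simp add: exp_minus)
    finally have "(1 + x) ^ n * exp (- c * x) \<le> fact n * exp c / c ^ n"
      using assms by (simp add: pos_le_divide_eq mult_ac)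
    then show "(1 + x) powr a * exp (- c * x) \<le> fact n * exp c / c ^ n" using 1 by linarith
  qed
qed

text \<open>
  For \<open>e < 0\<close> the left-hand side is unbounded near the origin; away from it \<open>1 +
  |\<xi>|\<^sup>2\<close> is at most a multiple of \<open>|\<xi>|\<^sup>2\<close>.
\<close>

lemma powr_le_bessel_weight:
  fixes e \<delta> :: real
  assumes "0 < \<delta>"
  shows "\<exists>C>0. \<forall>\<xi> :: real ^ 'n::finite. \<delta> \<le> norm \<xi> \<longrightarrow> norm \<xi> powr e \<le> C * bessel_weight e \<xi>"
proof -
  let ?c = "1 + 1 / \<delta>\<^sup>2"
  let ?C = "?c powr (\<bar>e\<bar> / 2)"
  have c1: "1 \<le> ?c" by simp
  have C1: "1 \<le> ?C" using c1 by (intro ge_one_powr_ge_zero) auto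
  have "norm \<xi> powr e \<le> ?C * bessel_weight e \<xi>" if \<xi>: "\<delta> \<le> norm \<xi>" for \<xi> :: "real ^ 'n"
  proof -
    let ?r = "norm \<xi>"
    have r: "0 < ?r" using \<xi> assms by linarith
    have re: "?r powr e = (?r\<^sup>2) powr (e / 2)"
      using r powr_powr [of ?r 2 "e / 2"] by simp
    show ?thesis
    proof (cases "0 \<le> e")
      case True
      have "?r powr e \<le> bessel_weight e \<xi>"
        unfolding re bessel_weight_def using True by (intro powr_mono2) auto
      also have "\<dots> \<le> ?C * bessel_weight e \<xi>"
        using C1 less_imp_le [OF bessel_weight_pos [of e \<xi>]] by (simp add: mult_le_cancel_right1)
      finally show ?thesis .
    next
      case False
      have "1 + ?r\<^sup>2 \<le> ?r\<^sup>2 * ?c"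
      proof -
        have "\<delta>\<^sup>2 \<le> ?r\<^sup>2" using \<xi> assms by (intro power_mono) auto
        then have "1 \<le> ?r\<^sup>2 / \<delta>\<^sup>2" using assms by simp
        then show ?thesis by (simp add: distrib_left)
      qed
      then have "(?r\<^sup>2 * ?c) powr (e / 2) \<le> (1 + ?r\<^sup>2) powr (e / 2)"
        using False by (intro powr_mono2') (auto simp: add_pos_nonneg)
      moreover have "(?r\<^sup>2 * ?c) powr (e / 2) = ?r powr e * ?c powr (e / 2)"
        unfolding re by (subst powr_mult) (auto simp: add_nonneg_nonneg)
      moreover have "?c powr (e / 2) * ?C = 1"
      proof -
        have "0 < ?c" using c1 by linarith
        then show ?thesis using False by (subst powr_add [symmetric]) simp
      qed
      ultimately have "?r powr e * (?c powr (e / 2) * ?C) \<le> bessel_weight e \<xi> * ?C"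
        using C1 unfolding bessel_weight_def mult.assoc [symmetric] by (intro mult_right_mono) auto
      then show ?thesis using \<open>?c powr (e / 2) * ?C = 1\<close> by (simp add: mult.commute)
    qed
  qed
  then show ?thesis using C1 by (intro exI [of _ ?C]) auto
qed

section \<open>Symbols of homogeneous operators\<close>

lemma coeff_op_symbol:
  "coeff (op_symbol r c \<xi>) k
    = (\<Sum>x\<in>op_indices r. if fst x = k then c (fst x) (snd x) * mi_power \<xi> (snd x) else 0)"
  by (simp add: op_symbol_def coeff_sum case_prod_beta)

text \<open>
  Order \<open>r\<close> in \<open>\<lambda>\<close> leaves only the multi-index 0.
\<close>

lemma coeff_op_symbol_top:
  fixes c :: "nat \<Rightarrow> ('n::finite \<Rightarrow> nat) \<Rightarrow> real"
  shows "coeff (op_symbol r c \<xi>) r = c r (\<lambda>_. 0)"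
proof -
  have "coeff (op_symbol r c \<xi>) r = (\<Sum>x\<in>(op_indices r :: (nat \<times> ('n \<Rightarrow> nat)) set). if x = (r, \<lambda>_. 0) then c r (\<lambda>_. 0) else 0)"
    unfolding coeff_op_symbol
    by (rule sum.cong [OF refl]) (auto simp: op_indices_def mi_size_def mi_power_def)
  also have "\<dots> = c r (\<lambda>_. 0)"
    by (subst sum.delta [OF finite_op_indices]) (simp add: op_indices_def mi_size_def)
  finally show ?thesis .
qed

lemma coeff_op_symbol_above: "r < k \<Longrightarrow> coeff (op_symbol r c \<xi>) k = 0"
  unfolding coeff_op_symbol by (intro sum.neutral) (auto simp: op_indices_def)

lemma degree_op_symbol:
  assumes "c r (\<lambda>_. 0) \<noteq> 0"
  shows "degree (op_symbol r c \<xi>) = r" "lead_coeff (op_symbol r c \<xi>) = c r (\<lambda>_. 0)"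
proof -
  show d: "degree (op_symbol r c \<xi>) = r"
    by (intro antisym degree_le le_degree) (use assms in \<open>simp_all add: coeff_op_symbol_top coeff_op_symbol_above\<close>)
  show "lead_coeff (op_symbol r c \<xi>) = c r (\<lambda>_. 0)" unfolding d by (rule coeff_op_symbol_top)
qed

lemma coeff_op_symbol_continuous: "continuous_on X (\<lambda>\<xi>. coeff (op_symbol r c \<xi>) k)"
  unfolding coeff_op_symbol
proof (intro continuous_on_sum)
  fix x :: "nat \<times> ('a \<Rightarrow> nat)"
  show "continuous_on X (\<lambda>\<xi>. if fst x = k then c (fst x) (snd x) * mi_power \<xi> (snd x) else 0)"
    by (cases "fst x = k") (auto simp: mi_power_def intro!: continuous_intros)
qed

lemma mi_power_scaleR: "mi_power (r *\<^sub>R \<xi>) \<alpha> = r ^ mi_size \<alpha> * mi_power \<xi> \<alpha>"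
  by (simp add: mi_power_def mi_size_def power_mult_distrib prod.distrib power_sum)

lemma symbol_coeff_scaleR:
  "symbol_coeff n c k (r *\<^sub>R \<xi>) = (\<i> * of_real r) ^ (n - k) * of_real (coeff (op_symbol n c \<xi>) k)"
  unfolding symbol_coeff_def coeff_op_symbol of_real_sum sum_distrib_left
proof (rule sum.cong [OF refl])
  fix x :: "nat \<times> ('a \<Rightarrow> nat)"
  assume "x \<in> op_indices n"
  then have "mi_size (snd x) = n - k" if "fst x = k" using that by (auto simp: op_indices_def)
  then show "(if fst x = k then complex_of_real (c (fst x) (snd x) * mi_power (r *\<^sub>R \<xi>) (snd x)) * \<i> ^ mi_size (snd x) else 0)
      = (\<i> * of_real r) ^ (n - k) * complex_of_real (if fst x = k then c (fst x) (snd x) * mi_power \<xi> (snd x) else 0)"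
    by (simp add: mi_power_scaleR power_mult_distrib)
qed

text \<open>
  By homogeneity a symbol of order \<open>n\<close> contributes the factor \<open>(\<i> r) ^ (n -
  j)\<close>; relative to \<open>(\<i> r) ^ (m - j)\<close> the symbols of order \<open>m - 1\<close>
  and \<open>m - 2\<close> receive \<open>- \<i> / r\<close> and \<open>- 1 / r\<^sup>2\<close>.
\<close>

lemma full_symbol_rescaled:
  assumes r: "0 < r" and j: "j < m" and m: "2 \<le> m"
  shows "symbol_coeff m Pm j (r *\<^sub>R \<xi>) + symbol_coeff (m - 1) Pm1 j (r *\<^sub>R \<xi>) + symbol_coeff (m - 2) Pm2 j (r *\<^sub>R \<xi>)
    = (\<i> * of_real r) ^ (m - j) * coeff (qpoly (1 / r) (op_symbol m Pm \<xi>) (op_symbol (m - 1) Pm1 \<xi>) (op_symbol (m - 2) Pm2 \<xi>)) j"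
proof -
  let ?a = "\<i> * complex_of_real r"
  let ?c1 = "complex_of_real (coeff (op_symbol (m - 1) Pm1 \<xi>) j)"
  let ?c2 = "complex_of_real (coeff (op_symbol (m - 2) Pm2 \<xi>) j)"
  have "m - j = Suc (m - 1 - j)" using j by simp
  then have "?a ^ (m - j) = ?a * ?a ^ (m - 1 - j)" by simp
  then have 1: "?a ^ (m - 1 - j) * ?c1 = ?a ^ (m - j) * (- (\<i> * of_real (1 / r) * ?c1))"
    using r by (simp add: field_simps)
  have 2: "?a ^ (m - 2 - j) * ?c2 = ?a ^ (m - j) * (- (of_real ((1 / r)\<^sup>2) * ?c2))"
  proof (cases "j \<le> m - 2")
    case True
    then have "m - j = Suc (Suc (m - 2 - j))" using m by simp
    then have "?a ^ (m - j) = ?a * ?a * ?a ^ (m - 2 - j)" by simp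
    then show ?thesis using r by (simp add: field_simps power2_eq_square)
  next
    case False
    then show ?thesis by (simp add: coeff_op_symbol_above)
  qed
  show ?thesis
    unfolding symbol_coeff_scaleR coeff_qpoly 1 2 by (simp add: algebra_simps)
qed

section \<open>Decay of the solution\<close>

locale interlacing_symbols =
  fixes m :: nat and Pm Pm1 Pm2 :: "nat \<Rightarrow> ('n::finite \<Rightarrow> nat) \<Rightarrow> real"
  assumes m: "3 \<le> m"
    and lead: "Pm m (\<lambda>_. 0) = 1" "0 < Pm1 (m - 1) (\<lambda>_. 0)" "0 < Pm2 (m - 2) (\<lambda>_. 0)"
    and strict: "strictly_hyperbolic m Pm" "strictly_hyperbolic (m - 1) Pm1"
    and il: "\<And>\<xi> :: real ^ 'n. norm \<xi> = 1 \<Longrightarrow> interlace (op_symbol (m - 1) Pm1 \<xi>) (op_symbol m Pm \<xi>)"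
      "\<And>\<xi> :: real ^ 'n. norm \<xi> = 1 \<Longrightarrow> interlace (op_symbol (m - 2) Pm2 \<xi>) (op_symbol (m - 1) Pm1 \<xi>)"
    and no_common_zero: "\<And>l (\<xi> :: real ^ 'n). norm \<xi> = 1 \<Longrightarrow> poly (op_symbol m Pm \<xi>) l = 0 \<Longrightarrow>
      poly (op_symbol (m - 1) Pm1 \<xi>) l = 0 \<Longrightarrow> poly (op_symbol (m - 2) Pm2 \<xi>) l \<noteq> 0"
begin

sublocale interlacing_family "sphere 0 1 :: (real ^ 'n) set" m "op_symbol m Pm" "op_symbol (m - 1) Pm1" "op_symbol (m - 2) Pm2"
proof (rule interlacing_family.intro)
  show "compact (sphere 0 1 :: (real ^ 'n) set)" by simp
  show "poly_family (sphere 0 1) m (op_symbol m Pm)" "poly_family (sphere 0 1) m (op_symbol (m - 1) Pm1)"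
    "poly_family (sphere 0 1) m (op_symbol (m - 2) Pm2)"
    using lead by (auto simp: poly_family_def degree_op_symbol coeff_op_symbol_continuous)
  fix \<xi> :: "real ^ 'n" assume "\<xi> \<in> sphere 0 1"
  then have \<xi>: "norm \<xi> = 1" by simp
  show "interlacing_triple (op_symbol m Pm \<xi>) (op_symbol (m - 1) Pm1 \<xi>) (op_symbol (m - 2) Pm2 \<xi>)"
  proof
    show "interlace (op_symbol (m - 1) Pm1 \<xi>) (op_symbol m Pm \<xi>)" "interlace (op_symbol (m - 2) Pm2 \<xi>) (op_symbol (m - 1) Pm1 \<xi>)"
      by (rule il [OF \<xi>])+
    show "0 < lead_coeff (op_symbol m Pm \<xi>)" "0 < lead_coeff (op_symbol (m - 1) Pm1 \<xi>)" "0 < lead_coeff (op_symbol (m - 2) Pm2 \<xi>)"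
      using lead by (simp_all add: degree_op_symbol coeff_op_symbol_top)
    show "distinct (root_list (op_symbol (m - 1) Pm1 \<xi>))" using strict(2) \<xi> by (simp add: strictly_hyperbolic_def)
  qed (rule no_common_zero [OF \<xi>])
  show "degree (op_symbol m Pm \<xi>) = m" "lead_coeff (op_symbol m Pm \<xi>) = 1"
    using lead(1) degree_op_symbol [of Pm m \<xi>] by simp_all
qed

abbreviation Q :: "nat \<Rightarrow> real ^ 'n \<Rightarrow> complex" where
  "Q j \<xi> \<equiv> symbol_coeff m Pm j \<xi> + symbol_coeff (m - 1) Pm1 j \<xi> + symbol_coeff (m - 2) Pm2 j \<xi>"

text \<open>
  Polar coordinates \<open>\<xi> = r \<omega>\<close>. Only \<open>e = 1 / r \<le> 1 / \<delta>\<close>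
  occurs, so that a gap for bounded \<open>e\<close> is all that is required.
\<close>

lemma weighted_solution_decay:
  assumes \<delta>: "0 < \<delta>"
    and gap: "\<exists>c>0. \<forall>\<xi>\<in>sphere 0 1. \<forall>e. 0 < e \<and> e \<le> 1 / \<delta> \<longrightarrow> (\<forall>z. poly (q e \<xi>) z = 0 \<longrightarrow> c * e ^ \<kappa> \<le> Im z)"
  shows "\<exists>c>0. \<forall>k s. \<exists>C>0. \<forall>\<xi> d t. \<delta> \<le> norm \<xi> \<and> 0 \<le> t \<longrightarrow>
      norm \<xi> powr s * cmod (cauchy_solution_at (\<lambda>j. Q j \<xi>) m d k t)
        \<le> C * exp (- (c * (1 / norm \<xi>) ^ \<kappa>) * (norm \<xi> * t)) * (\<Sum>j<m. bessel_weight (real k + s - real j) \<xi> * cmod (d j))"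
proof -
  have "0 < 1 / \<delta>" "0 < m" using \<delta> m by auto
  moreover have "distinct (root_list (op_symbol m Pm \<xi>))" if "\<xi> \<in> sphere 0 1" for \<xi>
    using strict(1) that by (simp add: strictly_hyperbolic_def)
  ultimately obtain c where c: "0 < c" and decay: "\<forall>k. \<exists>C>0. \<forall>\<xi>\<in>sphere 0 1. \<forall>r A d t. 0 < r \<and> 1 / r \<le> 1 / \<delta> \<and> 0 \<le> t \<and>
      (\<forall>j<m. A j = (\<i> * of_real r) ^ (m - j) * coeff (q (1 / r) \<xi>) j) \<longrightarrow>
      cmod (cauchy_solution_at A m d k t)
        \<le> C * exp (- (c * (1 / r) ^ \<kappa>) * (r * t)) * (\<Sum>j<m. r ^ k / r ^ j * cmod (d j))"
    using cauchy_solution_decay [OF _ _ _ gap] by blast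
  have "\<exists>C>0. \<forall>\<xi> d t. \<delta> \<le> norm \<xi> \<and> 0 \<le> t \<longrightarrow>
      norm \<xi> powr s * cmod (cauchy_solution_at (\<lambda>j. Q j \<xi>) m d k t)
        \<le> C * exp (- (c * (1 / norm \<xi>) ^ \<kappa>) * (norm \<xi> * t)) * (\<Sum>j<m. bessel_weight (real k + s - real j) \<xi> * cmod (d j))"
    for k s
  proof -
    obtain C1 where C1: "0 < C1" and est: "\<And>\<xi> r A d t. \<xi> \<in> sphere 0 1 \<Longrightarrow> 0 < r \<Longrightarrow> 1 / r \<le> 1 / \<delta> \<Longrightarrow> 0 \<le> t \<Longrightarrow>
      (\<And>j. j < m \<Longrightarrow> A j = (\<i> * of_real r) ^ (m - j) * coeff (q (1 / r) \<xi>) j) \<Longrightarrow>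
      cmod (cauchy_solution_at A m d k t)
        \<le> C1 * exp (- (c * (1 / r) ^ \<kappa>) * (r * t)) * (\<Sum>j<m. r ^ k / r ^ j * cmod (d j))"
      using decay [rule_format, of k] by auto
    have "\<forall>j. \<exists>C>0. \<forall>\<xi> :: real ^ 'n. \<delta> \<le> norm \<xi> \<longrightarrow> norm \<xi> powr (real k + s - real j) \<le> C * bessel_weight (real k + s - real j) \<xi>"
      using powr_le_bessel_weight [OF \<delta>] by blast
    then obtain B where B: "\<And>j. 0 < B j" and Bw: "\<And>j (\<xi> :: real ^ 'n). \<delta> \<le> norm \<xi> \<Longrightarrow>
        norm \<xi> powr (real k + s - real j) \<le> B j * bessel_weight (real k + s - real j) \<xi>"
      by metis
    define B0 where "B0 = (\<Sum>j<m. B j)"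
    have Bj: "B j \<le> B0" if "j < m" for j
      unfolding B0_def using that less_imp_le [OF B] by (intro member_le_sum) auto
    have B0: "0 < B0" using Bj [of 0] B [of 0] m by linarith
    have "norm \<xi> powr s * cmod (cauchy_solution_at (\<lambda>j. Q j \<xi>) m d k t)
        \<le> (C1 * B0) * exp (- (c * (1 / norm \<xi>) ^ \<kappa>) * (norm \<xi> * t)) * (\<Sum>j<m. bessel_weight (real k + s - real j) \<xi> * cmod (d j))"
      if \<xi>: "\<delta> \<le> norm \<xi>" and t: "0 \<le> t" for \<xi> d t
    proof -
      let ?r = "norm \<xi>" and ?\<omega> = "(1 / norm \<xi>) *\<^sub>R \<xi>"
      let ?E = "exp (- (c * (1 / ?r) ^ \<kappa>) * (?r * t))"
      have r: "0 < ?r" using \<xi> \<delta> by linarith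
      have polar: "?r *\<^sub>R ?\<omega> = \<xi>" using r by simp
      have "cmod (cauchy_solution_at (\<lambda>j. Q j \<xi>) m d k t) \<le> C1 * ?E * (\<Sum>j<m. ?r ^ k / ?r ^ j * cmod (d j))"
      proof (rule est [OF _ r _ t])
        show "?\<omega> \<in> sphere 0 1" using r by simp
        show "1 / ?r \<le> 1 / \<delta>" using \<xi> \<delta> by (simp add: frac_le)
        fix j assume "j < m"
        from full_symbol_rescaled [OF r this, of Pm ?\<omega> Pm1 Pm2]
        show "Q j \<xi> = (\<i> * of_real ?r) ^ (m - j) * coeff (q (1 / ?r) ?\<omega>) j" using m unfolding polar by simp
      qed
      then have "?r powr s * cmod (cauchy_solution_at (\<lambda>j. Q j \<xi>) m d k t)
          \<le> ?r powr s * (C1 * ?E * (\<Sum>j<m. ?r ^ k / ?r ^ j * cmod (d j)))"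
        by (intro mult_left_mono) auto
      also have "\<dots> = C1 * ?E * (\<Sum>j<m. ?r powr (real k + s - real j) * cmod (d j))"
        unfolding sum_distrib_left using r
        by (intro sum.cong) (simp_all add: powr_add powr_diff powr_realpow)
      also have "\<dots> \<le> C1 * ?E * (\<Sum>j<m. B0 * (bessel_weight (real k + s - real j) \<xi> * cmod (d j)))"
      proof (intro mult_left_mono sum_mono)
        fix j assume "j \<in> {..<m}"
        then have "B j * bessel_weight (real k + s - real j) \<xi> \<le> B0 * bessel_weight (real k + s - real j) \<xi>"
          using Bj by (intro mult_right_mono less_imp_le [OF bessel_weight_pos]) auto
        with Bw [OF \<xi>, of j] have "?r powr (real k + s - real j) \<le> B0 * bessel_weight (real k + s - real j) \<xi>" by linarith
        then show "?r powr (real k + s - real j) * cmod (d j) \<le> B0 * (bessel_weight (real k + s - real j) \<xi> * cmod (d j))"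
          unfolding mult.assoc [symmetric] by (intro mult_right_mono) auto
      qed (use C1 in auto)
      also have "\<dots> = (C1 * B0) * ?E * (\<Sum>j<m. bessel_weight (real k + s - real j) \<xi> * cmod (d j))"
        unfolding sum_distrib_left [symmetric] by (simp only: mult_ac)
      finally show ?thesis .
    qed
    then show ?thesis using C1 B0 by (intro exI [of _ "C1 * B0"]) auto
  qed
  then show ?thesis using c by blast
qed

end

text \<open>
  The exponent is \<open>- c t / |\<xi>|\<^sup>2\<close>. With \<open>x = t / (1 +
  |\<xi>|\<^sup>2)\<close> the exponential is at most \<open>exp (- c x)\<close>, hence dominated by
  \<open>(1 + x) powr (- \<nu> / 2)\<close>, and \<open>1 + t \<le> (1 + |\<xi>|\<^sup>2) (1 +
  x)\<close> converts decay in \<open>x\<close> into decay in \<open>t\<close> at the price of the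
  weight.
\<close>

lemma loss_of_regularity:
  fixes c \<nu> :: real
  assumes c: "0 < c" and \<nu>: "0 \<le> \<nu>"
  shows "\<exists>C>0. \<forall>(\<xi> :: real ^ 'n::finite) t. \<xi> \<noteq> 0 \<and> 0 \<le> t \<longrightarrow>
    exp (- (c * (1 / norm \<xi>) ^ 3) * (norm \<xi> * t)) \<le> C * (1 + t) powr (- \<nu> / 2) * bessel_weight \<nu> \<xi>"
proof -
  obtain C where C: "0 < C" and decay: "\<And>x. 0 \<le> x \<Longrightarrow> (1 + x) powr (\<nu> / 2) * exp (- c * x) \<le> C"
    by (rule exp_polynomial_decay [of c "\<nu> / 2"]) (use c \<nu> in auto)
  have "exp (- (c * (1 / norm \<xi>) ^ 3) * (norm \<xi> * t)) \<le> C * (1 + t) powr (- \<nu> / 2) * bessel_weight \<nu> \<xi>"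
    if \<xi>: "\<xi> \<noteq> 0" and t: "0 \<le> t" for \<xi> :: "real ^ 'n" and t
  proof -
    let ?r = "norm \<xi>"
    let ?x = "t / (1 + ?r\<^sup>2)"
    have r: "0 < ?r" using \<xi> by simp
    have r1: "0 < 1 + ?r\<^sup>2" by (simp add: add_pos_nonneg)
    have x: "0 \<le> ?x" using t r1 by simp
    have "(1 / ?r) ^ 3 * (?r * t) = t / ?r\<^sup>2" using r by (simp add: field_simps power3_eq_cube power2_eq_square)
    moreover have "?x \<le> t / ?r\<^sup>2" using t r r1 by (intro divide_left_mono mult_pos_pos) auto
    ultimately have "c * ?x \<le> c * ((1 / ?r) ^ 3 * (?r * t))" using c by (intro mult_left_mono) auto
    then have 1: "exp (- (c * (1 / ?r) ^ 3) * (?r * t)) \<le> exp (- c * ?x)" by (simp add: mult.assoc)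
    have "1 + t \<le> (1 + ?r\<^sup>2) * (1 + ?x)" using r1 by (simp add: distrib_left)
    then have "(1 + t) powr (\<nu> / 2) \<le> ((1 + ?r\<^sup>2) * (1 + ?x)) powr (\<nu> / 2)" using \<nu> t by (intro powr_mono2) auto
    also have "\<dots> = bessel_weight \<nu> \<xi> * (1 + ?x) powr (\<nu> / 2)"
      unfolding bessel_weight_def by (rule powr_mult)
    finally have "(1 + t) powr (\<nu> / 2) * exp (- c * ?x) \<le> bessel_weight \<nu> \<xi> * (1 + ?x) powr (\<nu> / 2) * exp (- c * ?x)"
      by (intro mult_right_mono) auto
    also have "\<dots> \<le> bessel_weight \<nu> \<xi> * C"
      unfolding mult.assoc by (intro mult_left_mono decay x less_imp_le [OF bessel_weight_pos])
    finally have "(1 + t) powr (- \<nu> / 2) * ((1 + t) powr (\<nu> / 2) * exp (- c * ?x)) \<le> (1 + t) powr (- \<nu> / 2) * (bessel_weight \<nu> \<xi> * C)"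
      by (intro mult_left_mono) auto
    moreover have "(1 + t) powr (- \<nu> / 2) * (1 + t) powr (\<nu> / 2) = 1" using t by (simp add: powr_add [symmetric])
    ultimately have "exp (- c * ?x) \<le> C * (1 + t) powr (- \<nu> / 2) * bessel_weight \<nu> \<xi>"
      by (simp add: mult.assoc [symmetric]) (simp add: mult_ac)
    with 1 show ?thesis by linarith
  qed
  then show ?thesis using C by blast
qed

lemma bessel_weight_add: "bessel_weight (\<sigma> + \<tau>) \<xi> = bessel_weight \<sigma> \<xi> * bessel_weight \<tau> \<xi>"
  by (simp add: bessel_weight_def add_divide_distrib powr_add)

theorem proposition5p1:
  fixes m :: nat
    and Pm Pm1 Pm2 :: "nat \<Rightarrow> ('n::finite \<Rightarrow> nat) \<Rightarrow> real"
    and s0 :: real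
    and N :: "(real ^ 'n) set"
  assumes "m \<ge> 3"
    and "Pm m (\<lambda>_. 0) = 1" and "Pm1 (m - 1) (\<lambda>_. 0) > 0" and "Pm2 (m - 2) (\<lambda>_. 0) > 0"
    and "hyperbolic m Pm" and "hyperbolic (m - 2) Pm2"
    and "strictly_hyperbolic (m - 1) Pm1"
    and "\<And>\<xi> :: real ^ 'n. norm \<xi> = 1 \<Longrightarrow> interlace (op_symbol (m - 1) Pm1 \<xi>) (op_symbol m Pm \<xi>)"
    and "\<And>\<xi> :: real ^ 'n. norm \<xi> = 1 \<Longrightarrow>
           interlace (op_symbol (m - 2) Pm2 \<xi>) (op_symbol (m - 1) Pm1 \<xi>)"
    and "\<not> (\<exists>(l :: real) (\<xi> :: real ^ 'n). norm \<xi> = 1 \<and> poly (op_symbol m Pm \<xi>) l = 0 \<and>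
           poly (op_symbol (m - 1) Pm1 \<xi>) l = 0 \<and> poly (op_symbol (m - 2) Pm2 \<xi>) l = 0)"
    and "strictly_hyperbolic m Pm"
    and "s0 \<ge> real m - 1"
    and "open N" and "0 \<in> N"
  shows
    "(\<forall>(k :: nat) (s :: real) (\<nu> :: real). 0 \<le> s \<and> 0 \<le> \<nu> \<and> real k + s + \<nu> \<le> s0 \<longrightarrow>
        (\<exists>C>0. \<forall>u0 u U. admissible_data m s0 N u0 \<and> cauchy_solution m Pm Pm1 Pm2 s0 u0 u U \<longrightarrow>
           (\<forall>t\<ge>0. U k t \<in> hom_sobolev_space s \<and>
              hom_sobolev_norm s (U k t)
                \<le> C * (1 + t) powr (- \<nu> / 2) *
                   (\<Sum>j<m. sobolev_norm (real k + s + \<nu> - real j) (u0 j)))))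
     \<and> ((\<forall>\<xi> :: real ^ 'n. norm \<xi> = 1 \<longrightarrow>
            strictly_interlace (op_symbol (m - 1) Pm1 \<xi>) (op_symbol m Pm \<xi>)) \<longrightarrow>
        (\<exists>c>0. \<forall>(k :: nat) (s :: real). 0 \<le> s \<and> real k + s \<le> s0 \<longrightarrow>
          (\<exists>C>0. \<forall>u0 u U. admissible_data m s0 N u0 \<and> cauchy_solution m Pm Pm1 Pm2 s0 u0 u U \<longrightarrow>
             (\<forall>t\<ge>0. U k t \<in> hom_sobolev_space s \<and>
                hom_sobolev_norm s (U k t)
                  \<le> C * exp (- c * t) *
                     (\<Sum>j<m. sobolev_norm (real k + s - real j) (u0 j))))))"
proof -
  interpret interlacing_symbols m Pm Pm1 Pm2
    by unfold_locales (use assms in auto)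
  obtain \<delta> where \<delta>: "0 < \<delta>" and ball: "ball 0 \<delta> \<subseteq> N"
    using \<open>open N\<close> \<open>0 \<in> N\<close> open_contains_ball by blast
  \<comment> \<open>Only frequencies of size at least \<open>\<delta>\<close> carry data.\<close>
  have K: "0 < 1 / \<delta>" using \<delta> by simp
  have problem: "cauchy_problem m Pm Pm1 Pm2 s0 u0 u U" if "cauchy_solution m Pm Pm1 Pm2 s0 u0 u U" for u0 u U
    using that assms by unfold_locales auto
  show ?thesis
  proof (intro conjI allI impI)
    fix k :: nat and s \<nu> :: real
    assume asm: "0 \<le> s \<and> 0 \<le> \<nu> \<and> real k + s + \<nu> \<le> s0"
    obtain c where c: "0 < c" and "\<forall>k s. \<exists>C>0. \<forall>\<xi> d t. \<delta> \<le> norm \<xi> \<and> 0 \<le> t \<longrightarrow>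
      norm \<xi> powr s * cmod (cauchy_solution_at (\<lambda>j. Q j \<xi>) m d k t)
        \<le> C * exp (- (c * (1 / norm \<xi>) ^ 3) * (norm \<xi> * t)) * (\<Sum>j<m. bessel_weight (real k + s - real j) \<xi> * cmod (d j))"
      using weighted_solution_decay [OF \<delta> spectral_gap [OF K]] by blast
    then obtain C where C: "0 < C" and decay: "\<And>\<xi> d t. \<delta> \<le> norm \<xi> \<Longrightarrow> 0 \<le> t \<Longrightarrow>
      norm \<xi> powr s * cmod (cauchy_solution_at (\<lambda>j. Q j \<xi>) m d k t)
        \<le> C * exp (- (c * (1 / norm \<xi>) ^ 3) * (norm \<xi> * t)) * (\<Sum>j<m. bessel_weight (real k + s - real j) \<xi> * cmod (d j))"
      by meson
    obtain C' where C': "0 < C'" and loss: "\<And>(\<xi> :: real ^ 'n) t. \<xi> \<noteq> 0 \<Longrightarrow> 0 \<le> t \<Longrightarrow>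
      exp (- (c * (1 / norm \<xi>) ^ 3) * (norm \<xi> * t)) \<le> C' * (1 + t) powr (- \<nu> / 2) * bessel_weight \<nu> \<xi>"
      using loss_of_regularity [of c \<nu>] c asm by meson
    have "U k t \<in> hom_sobolev_space s \<and> hom_sobolev_norm s (U k t)
        \<le> C * C' * (1 + t) powr (- \<nu> / 2) * (\<Sum>j<m. sobolev_norm (real k + s + \<nu> - real j) (u0 j))"
      if adm: "admissible_data m s0 N u0" and sol: "cauchy_solution m Pm Pm1 Pm2 s0 u0 u U" and t: "0 \<le> t" for u0 u U t
    proof -
      interpret cauchy_problem m Pm Pm1 Pm2 s0 u0 u U by (rule problem [OF sol])
      show ?thesis
      proof (rule hom_norm_estimate [OF adm ball _ _ _ t])
        show "0 \<le> C * C' * (1 + t) powr (- \<nu> / 2)" using C C' by simp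
        fix \<xi> :: "real ^ 'n" and d :: "nat \<Rightarrow> complex" assume \<xi>: "\<delta> \<le> norm \<xi>"
        let ?S = "\<Sum>j<m. bessel_weight (real k + s - real j) \<xi> * cmod (d j)"
        have S: "0 \<le> ?S" by (intro sum_nonneg mult_nonneg_nonneg less_imp_le [OF bessel_weight_pos]) auto
        have "norm \<xi> powr s * cmod (cauchy_solution_at (\<lambda>j. A j \<xi>) m d k t)
            \<le> C * exp (- (c * (1 / norm \<xi>) ^ 3) * (norm \<xi> * t)) * ?S"
          using decay [OF \<xi> t] by (simp add: A_def)
        also have "\<dots> \<le> C * (C' * (1 + t) powr (- \<nu> / 2) * bessel_weight \<nu> \<xi>) * ?S"
          using \<xi> \<delta> C by (intro mult_right_mono mult_left_mono loss t S) auto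
        also have "\<dots> = C * C' * (1 + t) powr (- \<nu> / 2) * (bessel_weight \<nu> \<xi> * ?S)" by (simp only: mult_ac)
        also have "bessel_weight \<nu> \<xi> * ?S = (\<Sum>j<m. bessel_weight (real k + s + \<nu> - real j) \<xi> * cmod (d j))"
          unfolding sum_distrib_left
          by (intro sum.cong refl) (simp add: bessel_weight_add [symmetric] mult.assoc [symmetric] add_ac add_diff_eq)
        finally show "norm \<xi> powr s * cmod (cauchy_solution_at (\<lambda>j. A j \<xi>) m d k t)
            \<le> C * C' * (1 + t) powr (- \<nu> / 2) * (\<Sum>j<m. bessel_weight (real k + s + \<nu> - real j) \<xi> * cmod (d j))" .
      qed (use asm in auto)
    qed
    then show "\<exists>C>0. \<forall>u0 u U. admissible_data m s0 N u0 \<and> cauchy_solution m Pm Pm1 Pm2 s0 u0 u U \<longrightarrow>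
           (\<forall>t\<ge>0. U k t \<in> hom_sobolev_space s \<and>
              hom_sobolev_norm s (U k t)
                \<le> C * (1 + t) powr (- \<nu> / 2) *
                   (\<Sum>j<m. sobolev_norm (real k + s + \<nu> - real j) (u0 j)))"
      using C C' by (intro exI [of _ "C * C'"]) auto
  next
    assume "\<forall>\<xi> :: real ^ 'n. norm \<xi> = 1 \<longrightarrow> strictly_interlace (op_symbol (m - 1) Pm1 \<xi>) (op_symbol m Pm \<xi>)"
    then have "strictly_interlace (op_symbol (m - 1) Pm1 \<xi>) (op_symbol m Pm \<xi>)" if "\<xi> \<in> sphere 0 1" for \<xi> :: "real ^ 'n"
      using that by simp
    from strict_spectral_gap [OF K this]
    have "\<exists>c>0. \<forall>\<xi>\<in>sphere 0 1. \<forall>e. 0 < e \<and> e \<le> 1 / \<delta> \<longrightarrow> (\<forall>z. poly (q e \<xi>) z = 0 \<longrightarrow> c * e ^ 1 \<le> Im z)" by simp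
    from weighted_solution_decay [OF \<delta> this]
    obtain c where c: "0 < c" and decay: "\<forall>k s. \<exists>C>0. \<forall>\<xi> d t. \<delta> \<le> norm \<xi> \<and> 0 \<le> t \<longrightarrow>
      norm \<xi> powr s * cmod (cauchy_solution_at (\<lambda>j. Q j \<xi>) m d k t)
        \<le> C * exp (- (c * (1 / norm \<xi>) ^ 1) * (norm \<xi> * t)) * (\<Sum>j<m. bessel_weight (real k + s - real j) \<xi> * cmod (d j))"
      by blast
    have "\<exists>C>0. \<forall>u0 u U. admissible_data m s0 N u0 \<and> cauchy_solution m Pm Pm1 Pm2 s0 u0 u U \<longrightarrow>
        (\<forall>t\<ge>0. U k t \<in> hom_sobolev_space s \<and> hom_sobolev_norm s (U k t)
          \<le> C * exp (- c * t) * (\<Sum>j<m. sobolev_norm (real k + s - real j) (u0 j)))"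
      if s: "0 \<le> s" "real k + s \<le> s0" for k :: nat and s :: real
    proof -
      obtain C where C: "0 < C" and est: "\<And>\<xi> d t. \<delta> \<le> norm \<xi> \<Longrightarrow> 0 \<le> t \<Longrightarrow>
        norm \<xi> powr s * cmod (cauchy_solution_at (\<lambda>j. Q j \<xi>) m d k t)
          \<le> C * exp (- (c * (1 / norm \<xi>) ^ 1) * (norm \<xi> * t)) * (\<Sum>j<m. bessel_weight (real k + s - real j) \<xi> * cmod (d j))"
        using decay by meson
      have "U k t \<in> hom_sobolev_space s \<and> hom_sobolev_norm s (U k t)
          \<le> C * exp (- c * t) * (\<Sum>j<m. sobolev_norm (real k + s - real j) (u0 j))"
        if adm: "admissible_data m s0 N u0" and sol: "cauchy_solution m Pm Pm1 Pm2 s0 u0 u U" and t: "0 \<le> t" for u0 u U t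
      proof -
        interpret cauchy_problem m Pm Pm1 Pm2 s0 u0 u U by (rule problem [OF sol])
        have "U k t \<in> hom_sobolev_space s \<and> hom_sobolev_norm s (U k t)
          \<le> C * exp (- c * t) * (\<Sum>j<m. sobolev_norm (real k + s + 0 - real j) (u0 j))"
        proof (rule hom_norm_estimate [OF adm ball _ _ _ t])
          show "0 \<le> C * exp (- c * t)" using C by simp
          fix \<xi> :: "real ^ 'n" and d :: "nat \<Rightarrow> complex" assume \<xi>: "\<delta> \<le> norm \<xi>"
          then have "- (c * (1 / norm \<xi>) ^ 1) * (norm \<xi> * t) = - c * t" using \<delta> by (cases "\<xi> = 0") auto
          then show "norm \<xi> powr s * cmod (cauchy_solution_at (\<lambda>j. A j \<xi>) m d k t)
              \<le> C * exp (- c * t) * (\<Sum>j<m. bessel_weight (real k + s + 0 - real j) \<xi> * cmod (d j))"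
            using est [OF \<xi> t, of d] by (simp add: A_def)
        qed (use s in auto)
        then show ?thesis by simp
      qed
      then show ?thesis using C by blast
    qed
    then show "\<exists>c>0. \<forall>(k :: nat) (s :: real). 0 \<le> s \<and> real k + s \<le> s0 \<longrightarrow>
          (\<exists>C>0. \<forall>u0 u U. admissible_data m s0 N u0 \<and> cauchy_solution m Pm Pm1 Pm2 s0 u0 u U \<longrightarrow>
             (\<forall>t\<ge>0. U k t \<in> hom_sobolev_space s \<and>
                hom_sobolev_norm s (U k t)
                  \<le> C * exp (- c * t) *
                     (\<Sum>j<m. sobolev_norm (real k + s - real j) (u0 j))))"
      using c by blast
  qed
qed

end
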